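(* Let $g$ be monotone increasing and satisfy hypothesis (H), let $h\ge0$, and assume that $u=\phi(x+c_*t)$, $c_*>c_\#$, is a pushed traveling front of $u_t=u_{xx}-u+g(u(t-h,x))$. Let $\mu>\lambda_1(c_* )$, $A>0$, and fix $\lambda\in(\lambda_1(c_* ),\lambda_2(c_* ))$ with $\lambda<\mu$. Suppose that the functions $w_0(s,x)$ and $w_0(s,-x)$ are not identically zero and both satisfy (IC1): values in $[0,\kappa]$ for all $x\in\mathbb{R}$, $s\in[-h,0]$, and (IC2): bounded by $Ae^{\mu x}$ for all $x\in\mathbb{R}$, $s\in[-h,0]$. Then the solution $u(t,x)$ of $u_t(t,x)=u_{xx}(t,x)-u(t,x)+g(u(t-h,x))$ ($t>0$), $u(s,x)=w_0(s,x)$ ($s\in[-h,0]$), satisfies, for some $s_1,s_2\in\mathbb{R}$, $$\lim_{t\to\infty}\sup_{x\le0}\frac{|u(t,x)-\phi(x+c_*t+s_1)|}{\eta(x+c_*t)}=0,\qquad \lim_{t\to\infty}\sup_{x\ge0}\frac{|u(t,x)-\phi(-x+c_*t+s_2)|}{\eta(-x+c_*t)}=0.$$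
   Context: Hypothesis (H) on $g:\mathbb{R}_+\to\mathbb{R}_+$: $g(x)=x$ has exactly two nonnegative solutions $0$ and $\kappa>0$; $g$ is $C^1$ in a $\delta_0$-neighbourhood of $0$ and of $\kappa$, with $g'(0)>1$, $g'(\kappa)<1$; $|g(u)-g(v)|\le L_g|u-v|$ for $u,v\in[0,\kappa]$; there are $C>0,\theta\in(0,1]$ with $|g'(u)-g'(0)|+|g'(\kappa)-g'(\kappa-u)|\le Cu^\theta$ for $u\in(0,\delta_0]$; $g$ is extended linearly and $C^1$-smoothly to $(-\infty,0]$ and $[\kappa,\infty)$. Characteristic function $\chi(z,c)=z^2-cz-1+g'(0)e^{-zch}$; $c_\#$ is the unique real $c$ for which $\chi(\cdot,c)$ has a positive double zero; for $c>c_\#$ its two positive simple zeros are $\lambda_1(c)<\lambda_2(c)$. A wavefront is a solution $u=\phi(x+ct)$ with $\phi>0$, $\phi(-\infty)=0$, $\phi(+\infty)=\kappa$; $c_*$ is the minimal wavefront speed; the minimal wavefront is pushed if $c_*>c_\#$. $w_0:[-h,0]\times\mathbb{R}\to\mathbb{R}$ is continuous and locally Hölder continuous in $x$ uniformly in $s$. $\eta(x)=\min\{e^{\lambda x},1\}$. *)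

theory Defs
  imports "HOL-Analysis.Analysis"
begin

text \<open>Hypothesis (H) on g (g already extended to the whole real line), with positive equilibrium kappa.\<close>
definition hyp_H :: "(real \<Rightarrow> real) \<Rightarrow> real \<Rightarrow> bool" where
  "hyp_H g \<kappa> \<longleftrightarrow>
     \<kappa> > 0 \<and>
     (\<forall>x\<ge>0. g x \<ge> 0) \<and>
     {x. x \<ge> 0 \<and> g x = x} = {0, \<kappa>} \<and>
     (\<exists>\<delta>0 > 0.
        (\<forall>x \<in> {-\<delta>0<..<\<delta>0}. g differentiable at x) \<and>
        continuous_on {-\<delta>0<..<\<delta>0} (deriv g) \<and>
        (\<forall>x \<in> {\<kappa>-\<delta>0<..<\<kappa>+\<delta>0}. g differentiable at x) \<and>
        continuous_on {\<kappa>-\<delta>0<..<\<kappa>+\<delta>0} (deriv g) \<and>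
        deriv g 0 > 1 \<and> deriv g \<kappa> < 1 \<and>
        (\<exists>Lg. \<forall>u\<in>{0..\<kappa>}. \<forall>v\<in>{0..\<kappa>}. \<bar>g u - g v\<bar> \<le> Lg * \<bar>u - v\<bar>) \<and>
        (\<exists>C \<theta>. C > 0 \<and> 0 < \<theta> \<and> \<theta> \<le> 1 \<and>
           (\<forall>u\<in>{0<..\<delta>0}. \<bar>deriv g u - deriv g 0\<bar> + \<bar>deriv g \<kappa> - deriv g (\<kappa> - u)\<bar>
                              \<le> C * u powr \<theta>)) \<and>
        (\<forall>x\<le>0. g x = deriv g 0 * x) \<and>
        (\<forall>x\<ge>\<kappa>. g x = \<kappa> + deriv g \<kappa> * (x - \<kappa>)))"

definition chi :: "(real \<Rightarrow> real) \<Rightarrow> real \<Rightarrow> real \<Rightarrow> real \<Rightarrow> real" where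
  "chi g h z c = z^2 - c * z - 1 + deriv g 0 * exp (- z * c * h)"

definition c_sharp :: "(real \<Rightarrow> real) \<Rightarrow> real \<Rightarrow> real" where
  "c_sharp g h = (THE c. \<exists>z>0. chi g h z c = 0 \<and> deriv (\<lambda>y. chi g h y c) z = 0)"

text \<open>For c > c_sharp: the two positive zeros lambda1 < lambda2 of chi(.,c).\<close>
definition lambda1 :: "(real \<Rightarrow> real) \<Rightarrow> real \<Rightarrow> real \<Rightarrow> real" where
  "lambda1 g h c = Inf {z. z > 0 \<and> chi g h z c = 0}"

definition lambda2 :: "(real \<Rightarrow> real) \<Rightarrow> real \<Rightarrow> real \<Rightarrow> real" where
  "lambda2 g h c = Sup {z. z > 0 \<and> chi g h z c = 0}"

text \<open>Wavefront u = phi(x + c t) of u_t = u_xx - u + g(u(t-h,x)):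
  phi'' - c phi' - phi + g(phi(xi - c h)) = 0, phi > 0, phi(-inf)=0, phi(+inf)=kappa.\<close>
definition is_wavefront :: "(real \<Rightarrow> real) \<Rightarrow> real \<Rightarrow> real \<Rightarrow> real \<Rightarrow> (real \<Rightarrow> real) \<Rightarrow> bool" where
  "is_wavefront g h \<kappa> c \<phi> \<longleftrightarrow>
     (\<forall>\<xi>. \<phi> \<xi> > 0) \<and> (\<phi> \<longlongrightarrow> 0) at_bot \<and> (\<phi> \<longlongrightarrow> \<kappa>) at_top \<and>
     (\<forall>\<xi>. \<phi> differentiable at \<xi>) \<and>
     (\<forall>\<xi>. \<exists>d2. (deriv \<phi> has_real_derivative d2) (at \<xi>) \<and>
                c * deriv \<phi> \<xi> = d2 - \<phi> \<xi> + g (\<phi> (\<xi> - c * h)))"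

definition eta :: "real \<Rightarrow> real \<Rightarrow> real" where
  "eta l x = min (exp (l * x)) 1"

definition admissible_initial :: "real \<Rightarrow> (real \<Rightarrow> real \<Rightarrow> real) \<Rightarrow> bool" where
  "admissible_initial h w0 \<longleftrightarrow>
     continuous_on ({-h..0} \<times> UNIV) (\<lambda>(s, x). w0 s x) \<and>
     (\<forall>a b. \<exists>L \<alpha>. 0 < \<alpha> \<and> \<alpha> \<le> 1 \<and>
        (\<forall>s\<in>{-h..0}. \<forall>x\<in>{a..b}. \<forall>y\<in>{a..b}. \<bar>w0 s x - w0 s y\<bar> \<le> L * \<bar>x - y\<bar> powr \<alpha>))"

definition is_solution :: "(real \<Rightarrow> real) \<Rightarrow> real \<Rightarrow> (real \<Rightarrow> real \<Rightarrow> real) \<Rightarrow> (real \<Rightarrow> real \<Rightarrow> real) \<Rightarrow> bool" where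
  "is_solution g h w0 u \<longleftrightarrow>
     (\<forall>s\<in>{-h..0}. \<forall>x. u s x = w0 s x) \<and>
     continuous_on ({-h..} \<times> UNIV) (\<lambda>(t, x). u t x) \<and>
     (\<exists>M. \<forall>t\<ge>-h. \<forall>x. \<bar>u t x\<bar> \<le> M) \<and>
     (\<forall>t>0. \<forall>x. (\<lambda>y. u t y) differentiable at x) \<and>
     (\<forall>t>0. \<forall>x. \<exists>ut uxx.
        ((\<lambda>\<tau>. u \<tau> x) has_real_derivative ut) (at t) \<and>
        ((\<lambda>y. deriv (\<lambda>z. u t z) y) has_real_derivative uxx) (at x) \<and>
        ut = uxx - u t x + g (u (t - h) x))"

end

theory Submission
  imports Defs "HOL-Library.Diagonal_Subsequence"
begin

text \<open>
  Solutions are trapped between shifted and perturbed copies of an increasing front \<open>V\<close> in the frame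
  moving with speed \<open>c\<close>, in the manner of Fife and McLeod, with perturbations weighted by a logistic
  function \<open>\<simeq> min (exp (\<lambda> z)) 1\<close>. Since \<open>\<chi> (\<lambda>, c) < 0\<close>, this weight is contracted near the unstable
  state; near \<open>\<kappa>\<close> contraction comes from \<open>g'(\<kappa>) < 1\<close>, and in between \<open>V' > 0\<close> allows a shift to absorb
  the error. The largest lower and smallest upper asymptotic shifts then coincide by a Harnack
  argument.

  This requires \<open>V\<close> to decay faster than \<open>exp (\<lambda> z)\<close> at \<open>-\<infinity>\<close>, and here minimality of the speed enters.
  Fronts are fixed points of \<open>N c \<psi> z = (green c * g (\<psi>)) (z - c h)\<close>. If \<open>V\<close> decayed slowly, then the iterates
  of \<open>N c\<close> from \<open>min (V + q) (B exp (l z))\<close> would tend to \<open>0\<close>, which produces a supersolution, stable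
  under a slight decrease of \<open>c\<close>, and hence a front slower than the minimal one. Applying
  the stability result to the given front \<open>\<phi>\<close> as a solution shows that it is a translate of \<open>V\<close>.
\<close>

text \<open>A solution spreading in both directions resembles an increasing front only to the left,
  so all front estimates live on \<open>x \<le> 0\<close>. Upper barriers still work on the whole
  line, since on the right they start above \<kappa>; a lower barrier needs \<open>u t 0\<close>
  exponentially close to \<kappa>, which is why spreading comes before any front. Translating
  \<open>V\<close> by \<theta> changes it by about \<open>\<theta> * V'\<close>. This error must be
  negligible against the weight in both tails, otherwise moving a barrier costs more shift than it
  gains: this is the use of fast decay. Parabolic compactness is replaced by explicit means: a
  heat-kernel barrier and a modulus of continuity turn a gap at one point into a gap on a whole
  delay interval, with constants independent of time. Iterates tending to \<open>0\<close> give a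
  slower front because finitely many of them suffice: their minimum is a supersolution once the last
  lies below the first, and finitely many strict inequalities that secure this survive a slight
  decrease of the speed.\<close>

section \<open>Maximum principle for delayed parabolic inequalities\<close>

lemma second_deriv_at_max:
  fixes f :: "real \<Rightarrow> real"
  assumes r: "0 < r"
    and f': "\<And>s. \<bar>s - a\<bar> < r \<Longrightarrow> (f has_real_derivative f' s) (at s)"
    and f'': "(f' has_real_derivative D) (at a)"
    and max: "\<And>s. \<bar>s - a\<bar> < r \<Longrightarrow> f s \<le> f a"
  shows "f' a = 0" "D \<le> 0"
proof -
  show z: "f' a = 0"
    by (rule DERIV_local_max[OF f' r]) (use r max in \<open>auto simp: abs_minus_commute\<close>)
  show "D \<le> 0"
  proof (rule ccontr)
    assume "\<not> D \<le> 0"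
    then obtain d where d: "d > 0" "\<And>k. 0 < k \<Longrightarrow> k < d \<Longrightarrow> f' a < f' (a + k)"
      using DERIV_pos_inc_right[OF f''] by force
    define s where "s = min r d / 2"
    have s: "0 < s" "s < r" "s < d" using r d by (auto simp: s_def)
    have "f a < f (a + s)"
    proof (rule DERIV_pos_imp_increasing_open[of a "a + s"])
      show "a < a + s" using s by simp
      fix x assume x: "a < x" "x < a + s"
      have "f' x > 0" using d(2)[of "x - a"] x s z by auto
      moreover have "(f has_real_derivative f' x) (at x)" using f'[of x] x s by auto
      ultimately show "\<exists>y. (f has_real_derivative y) (at x) \<and> 0 < y" by blast
    next
      show "continuous_on {a..a + s} f"
        using s by (intro continuous_at_imp_continuous_on ballI) (auto intro!: DERIV_isCont[OF f'])
    qed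
    then show False using max[of "a + s"] s by auto
  qed
qed

lemma left_deriv_nonneg:
  fixes f :: "real \<Rightarrow> real"
  assumes "(f has_real_derivative D) (at t)" "a < t" "\<And>s. a < s \<Longrightarrow> s < t \<Longrightarrow> f s \<le> f t"
  shows "0 \<le> D"
proof (rule ccontr)
  assume "\<not> 0 \<le> D"
  then obtain d where d: "d > 0" "\<And>k. 0 < k \<Longrightarrow> k < d \<Longrightarrow> f t < f (t - k)"
    using DERIV_neg_dec_left[OF assms(1)] by force
  define k where "k = min d (t - a) / 2"
  have "0 < k" "k < d" "k < t - a" using d assms(2) by (auto simp: k_def)
  then show False using d(2)[of k] assms(3)[of "t - k"] by auto
qed

text \<open>The barrier \<open>\<epsilon> * P\<close> grows quadratically in space, so a bounded
  \<open>d\<close> can reach it only in a compact set and there is a first time of contact. The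
  exponential factor of \<open>P\<close> then contradicts the inequality at that point, and
  \<epsilon> tends to 0. Only second derivatives along one vector \<open>e\<close> enter: this
  covers the line, and also functions of two points differentiated along
  \<open>(1, -1)\<close>.\<close>

lemma max_principle:
  fixes d :: "real \<Rightarrow> 'a::euclidean_space \<Rightarrow> real" and e :: 'a
  assumes h: "0 \<le> h" and L: "0 \<le> L"
    and cont: "continuous_on ({t0-h..T} \<times> UNIV) (\<lambda>(t,p). d t p)"
    and bdd: "\<And>t p. t0 - h \<le> t \<Longrightarrow> t \<le> T \<Longrightarrow> d t p \<le> M"
    and init: "\<And>t p. t0 - h \<le> t \<Longrightarrow> t \<le> t0 \<Longrightarrow> d t p \<le> 0"
    and ineq: "\<And>t p. t0 < t \<Longrightarrow> t \<le> T \<Longrightarrow> d t p > 0 \<Longrightarrow>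
        \<exists>dt dx dxx r. r > 0 \<and> ((\<lambda>\<tau>. d \<tau> p) has_real_derivative dt) (at t) \<and>
          (\<forall>s. \<bar>s\<bar> < r \<longrightarrow> ((\<lambda>s. d t (p + s *\<^sub>R e)) has_real_derivative dx s) (at s)) \<and>
          (dx has_real_derivative dxx) (at 0) \<and>
          dt \<le> dxx + L * (d t p + max 0 (d (t - h) p))"
    and t: "t0 - h \<le> t" "t \<le> T"
  shows "d t p \<le> 0"
proof -
  \<comment> \<open>\<open>2 * L\<close> absorbs the present and the delayed zero-order term,
    \<open>2 * (e \<bullet> e)\<close> the second derivative of \<open>p \<bullet> p\<close> along
    \<open>e\<close>, and the final 1 makes the contradiction strict.\<close>
  define K where "K = 2 * L + 2 * (e \<bullet> e) + 1"
  define P where "P = (\<lambda>t (p::'a). exp (K * (t - t0)) * (1 + p \<bullet> p))"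
  have K0: "K > 0" using L by (simp add: K_def add_nonneg_pos)
  have Ppos: "P t p > 0" for t p
    by (simp add: P_def add_pos_nonneg)
  have main: "d t p < \<epsilon> * P t p" if eps: "\<epsilon> > 0" and t: "t0 - h \<le> t" "t \<le> T" for \<epsilon> t p
  proof (rule ccontr)
    assume "\<not> ?thesis"
    define F where "F = (\<lambda>z. d (fst z) (snd z) - \<epsilon> * P (fst z) (snd z))"
    define Bad where "Bad = {z \<in> {t0-h..T} \<times> UNIV. F z \<ge> 0}"
    have contF: "continuous_on ({t0-h..T} \<times> UNIV) F"
      using cont unfolding F_def P_def case_prod_unfold
      by (intro continuous_intros) auto
    have "closed Bad"
    proof -
      have "closed (({t0-h..T} \<times> UNIV) \<inter> F -` {0..})"
        by (intro continuous_closed_preimage[OF contF] closed_Times closed_UNIV closed_atLeastAtMost closed_atLeast)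
      moreover have "Bad = ({t0-h..T} \<times> UNIV) \<inter> F -` {0..}" by (auto simp: Bad_def)
      ultimately show ?thesis by simp
    qed
    moreover have "bounded Bad"
    proof -
      define c where "c = \<epsilon> * exp (- K * h)"
      have c: "c > 0" using eps by (simp add: c_def)
      have "norm p \<le> \<bar>M\<bar> / c + 1" if z: "(t, p) \<in> Bad" for t p
      proof -
        have tt: "t0 - h \<le> t" "t \<le> T" "\<epsilon> * P t p \<le> d t p" using z by (auto simp: Bad_def F_def)
        have "- K * h \<le> K * (t - t0)"
          using tt K0 mult_left_mono[of "-h" "t - t0" K] by (simp add: algebra_simps)
        then have "c * (1 + p \<bullet> p) \<le> \<epsilon> * P t p"
          unfolding c_def P_def mult.assoc using eps
          by (intro mult_left_mono mult_right_mono) auto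
        also have "\<dots> \<le> \<bar>M\<bar>" using tt bdd[of t p] by linarith
        finally have "1 + p \<bullet> p \<le> \<bar>M\<bar> / c" using c by (simp add: field_simps)
        moreover have "norm p \<le> 1 + p \<bullet> p"
        proof -
          have "0 \<le> (norm p - 1)^2" by simp
          then have "2 * norm p \<le> 1 + p \<bullet> p"
            by (simp add: power2_diff power2_norm_eq_inner)
          then show ?thesis using norm_ge_zero[of p] by linarith
        qed
        ultimately show ?thesis by linarith
      qed
      then have "Bad \<subseteq> {t0-h..T} \<times> cball 0 (\<bar>M\<bar> / c + 1)"
        by (auto simp: Bad_def)
      moreover have "bounded ({t0-h..T} \<times> cball (0::'a) (\<bar>M\<bar> / c + 1))"
        by (intro bounded_Times bounded_closed_interval bounded_cball)
      ultimately show ?thesis using bounded_subset by blast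
    qed
    ultimately have "compact Bad" by (simp add: compact_eq_bounded_closed)
    moreover have "(t, p) \<in> Bad" using \<open>\<not> _\<close> t by (simp add: Bad_def F_def)
    ultimately obtain z1 where z1: "z1 \<in> Bad" "\<And>z. z \<in> Bad \<Longrightarrow> fst z1 \<le> fst z"
      using continuous_attains_inf[of Bad fst] continuous_on_fst[OF continuous_on_id] by blast
    obtain t1 p1 where z1eq: "z1 = (t1, p1)" by (cases z1)
    have t1: "t0 - h \<le> t1" "t1 \<le> T" "\<epsilon> * P t1 p1 \<le> d t1 p1"
      using z1 by (auto simp: z1eq Bad_def F_def)
    have lt: "d s q < \<epsilon> * P s q" if "t0 - h \<le> s" "s < t1" for s q
      using z1(2)[of "(s, q)"] that t1 by (force simp: z1eq Bad_def F_def)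
    have dpos: "d t1 p1 > 0" using t1(3) eps Ppos[of t1 p1] by (metis less_le_trans mult_pos_pos)
    then have t1gt: "t0 < t1" using init[of t1 p1] t1 by force
    \<comment> \<open>Minimality of \<open>t1\<close> gives strict inequality at earlier times only;
      at \<open>t1\<close> itself the weak inequality follows by continuity from the left,
      separately at each point.\<close>
    have le: "d t1 q \<le> \<epsilon> * P t1 q" for q
    proof -
      have c: "continuous_on {t0-h..t1} (\<lambda>s. F (s, q))"
        by (rule continuous_on_compose2[OF contF]) (use t1 in \<open>auto intro!: continuous_intros\<close>)
      have ev: "eventually (\<lambda>s. F (s, q) \<le> 0) (at_left t1)"
        unfolding eventually_at_left[OF t1gt]
      proof (intro exI conjI allI impI)
        show "t0 < t1" by fact
        fix y assume "t0 < y" "y < t1" then show "F (y,q) \<le> 0"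
          using lt[of y q] h by (auto simp: F_def)
      qed
      have "((\<lambda>s. F (s, q)) \<longlongrightarrow> F (t1, q)) (at t1 within {t0-h..t1})"
        using c h t1gt by (auto simp: continuous_on_def)
      then have "((\<lambda>s. F (s, q)) \<longlongrightarrow> F (t1, q)) (at_left t1)"
        using at_within_Icc_at_left[of "t0 - h" t1] h t1gt by simp
      then have "F (t1, q) \<le> 0"
        using tendsto_upperbound[OF _ ev] by simp
      then show ?thesis by (simp add: F_def)
    qed
    have eq: "d t1 p1 = \<epsilon> * P t1 p1" using le[of p1] t1 by simp
    obtain dt dx dxx r where D: "r > 0" "((\<lambda>\<tau>. d \<tau> p1) has_real_derivative dt) (at t1)"
      "\<And>s. \<bar>s\<bar> < r \<Longrightarrow> ((\<lambda>s. d t1 (p1 + s *\<^sub>R e)) has_real_derivative dx s) (at s)"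
      "(dx has_real_derivative dxx) (at 0)"
      "dt \<le> dxx + L * (d t1 p1 + max 0 (d (t1 - h) p1))"
      using ineq[OF t1gt t1(2) dpos] by blast
    define E where "E = \<epsilon> * exp (K * (t1 - t0))"
    have E: "E > 0" using eps by (simp add: E_def)
    have "((\<lambda>\<tau>. \<epsilon> * P \<tau> p1) has_real_derivative \<epsilon> * (K * P t1 p1)) (at t1)"
      unfolding P_def by (auto intro!: derivative_eq_intros)
    from DERIV_diff[OF D(2) this]
    have "0 \<le> dt - \<epsilon> * (K * P t1 p1)"
      by (rule left_deriv_nonneg[of _ _ _ t0]) (use t1gt lt h eq in \<open>auto simp: less_eq_real_def\<close>)
    moreover have "dxx - 2 * E * (e \<bullet> e) \<le> 0"
    proof -
      have Pd: "((\<lambda>s. \<epsilon> * P t1 (p1 + s *\<^sub>R e)) has_real_derivative (E * (2 * (p1 \<bullet> e) + 2 * s * (e \<bullet> e)))) (at s)" for s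
        unfolding P_def E_def
        by (auto intro!: derivative_eq_intros simp: inner_add_left inner_add_right inner_commute algebra_simps)
      show ?thesis
      proof (rule second_deriv_at_max(2)[where f="\<lambda>s. d t1 (p1 + s *\<^sub>R e) - \<epsilon> * P t1 (p1 + s *\<^sub>R e)"
            and f'="\<lambda>s. dx s - E * (2 * (p1 \<bullet> e) + 2 * s * (e \<bullet> e))" and a=0 and r=r])
        show "0 < r" by fact
        show "((\<lambda>s. d t1 (p1 + s *\<^sub>R e) - \<epsilon> * P t1 (p1 + s *\<^sub>R e)) has_real_derivative
          dx s - E * (2 * (p1 \<bullet> e) + 2 * s * (e \<bullet> e))) (at s)" if "\<bar>s - 0\<bar> < r" for s
          using DERIV_diff[OF D(3) Pd] that by auto
        show "((\<lambda>s. dx s - E * (2 * (p1 \<bullet> e) + 2 * s * (e \<bullet> e))) has_real_derivative dxx - 2 * E * (e \<bullet> e)) (at 0)"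
          by (auto intro!: derivative_eq_intros D(4))
        show "d t1 (p1 + s *\<^sub>R e) - \<epsilon> * P t1 (p1 + s *\<^sub>R e) \<le> d t1 (p1 + 0 *\<^sub>R e) - \<epsilon> * P t1 (p1 + 0 *\<^sub>R e)" for s
          using le[of "p1 + s *\<^sub>R e"] eq by simp
      qed
    qed
    \<comment> \<open>For \<open>h > 0\<close> the delayed time precedes contact and
      \<open>P\<close> increases in time; for \<open>h = 0\<close> the delayed value is the contact
      value.\<close>
    moreover have "max 0 (d (t1 - h) p1) \<le> \<epsilon> * P t1 p1"
    proof -
      have "d (t1 - h) p1 \<le> \<epsilon> * P (t1 - h) p1"
        using lt[of "t1 - h" p1] eq h t1gt by (cases "h = 0") auto
      also have "\<dots> \<le> \<epsilon> * P t1 p1"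
        unfolding P_def using eps K0 h
        by (intro mult_left_mono mult_right_mono) (auto simp: mult_left_mono)
      finally show ?thesis using eps Ppos[of t1 p1] by simp
    qed
    then have "L * (d t1 p1 + max 0 (d (t1 - h) p1)) \<le> L * (2 * (\<epsilon> * P t1 p1))"
      using L eq by (intro mult_left_mono) auto
    ultimately have "\<epsilon> * (K * P t1 p1) \<le> 2 * E * (e \<bullet> e) + L * (2 * (\<epsilon> * P t1 p1))"
      using D(5) by linarith
    moreover have "\<epsilon> * P t1 p1 = E * (1 + p1 \<bullet> p1)" by (simp add: E_def P_def)
    ultimately have "E * (K * (1 + p1 \<bullet> p1)) \<le> E * (2 * (e \<bullet> e) + L * (2 * (1 + p1 \<bullet> p1)))"
      by (simp add: algebra_simps)
    then have "K * (1 + p1 \<bullet> p1) \<le> 2 * (e \<bullet> e) + L * (2 * (1 + p1 \<bullet> p1))"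
      using E by simp
    moreover have "K * (1 + p1 \<bullet> p1) = 2 * L * (1 + p1 \<bullet> p1) + 2 * (e \<bullet> e) * (1 + p1 \<bullet> p1) + (1 + p1 \<bullet> p1)"
      by (simp add: K_def algebra_simps)
    moreover have "2 * (e \<bullet> e) * (1 + p1 \<bullet> p1) \<ge> 2 * (e \<bullet> e)"
      using mult_left_mono[of 1 "1 + p1 \<bullet> p1" "2 * (e \<bullet> e)"] by simp
    moreover have "0 < 1 + p1 \<bullet> p1" by (simp add: add_pos_nonneg)
    ultimately show False by (simp only: mult.assoc mult.left_commute[of L 2])
  qed
  show ?thesis
  proof (rule ccontr)
    assume "\<not> ?thesis"
    then have "d t p / P t p > 0" using Ppos by simp
    from main[OF this t, of p] show False using Ppos[of t p] by simp
  qed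
qed

lemma max_principle_real:
  fixes d :: "real \<Rightarrow> real \<Rightarrow> real"
  assumes h: "0 \<le> h" and L: "0 \<le> L"
    and cont: "continuous_on ({t0-h..T} \<times> UNIV) (\<lambda>(t,x). d t x)"
    and bdd: "\<And>t x. t0 - h \<le> t \<Longrightarrow> t \<le> T \<Longrightarrow> d t x \<le> M"
    and init: "\<And>t x. t0 - h \<le> t \<Longrightarrow> t \<le> t0 \<Longrightarrow> d t x \<le> 0"
    and ineq: "\<And>t x. t0 < t \<Longrightarrow> t \<le> T \<Longrightarrow> d t x > 0 \<Longrightarrow>
        \<exists>dt dx dxx r. r > 0 \<and> ((\<lambda>\<tau>. d \<tau> x) has_real_derivative dt) (at t) \<and>
          (\<forall>y. \<bar>y - x\<bar> < r \<longrightarrow> (d t has_real_derivative dx y) (at y)) \<and>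
          (dx has_real_derivative dxx) (at x) \<and>
          dt \<le> dxx + L * (d t x + max 0 (d (t - h) x))"
    and t: "t0 - h \<le> t" "t \<le> T"
  shows "d t x \<le> 0"
proof (rule max_principle[where e="1::real", OF h L cont bdd init _ t])
  fix t p :: real assume "t0 < t" "t \<le> T" "d t p > 0"
  then obtain dt dx dxx r where D: "((\<lambda>\<tau>. d \<tau> p) has_real_derivative dt) (at t)"
    "\<And>y. \<bar>y - p\<bar> < r \<Longrightarrow> (d t has_real_derivative dx y) (at y)"
    "(dx has_real_derivative dxx) (at p)"
    "dt \<le> dxx + L * (d t p + max 0 (d (t - h) p))" "r > 0"
    using ineq[of t p] by blast
  have "((\<lambda>s. d t (p + s * 1)) has_real_derivative dx (p + s)) (at s)" if "\<bar>s\<bar> < r" for s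
    using D(2)[of "s + p", unfolded DERIV_shift] that by (simp add: add.commute)
  moreover have "((\<lambda>s. dx (p + s)) has_real_derivative dxx) (at 0)"
    using D(3) DERIV_shift[of dx dxx 0 p] by (simp add: add.commute)
  ultimately show "\<exists>dt dx dxx r. r > 0 \<and> ((\<lambda>\<tau>. d \<tau> p) has_real_derivative dt) (at t) \<and>
          (\<forall>s. \<bar>s\<bar> < r \<longrightarrow> ((\<lambda>s. d t (p + s *\<^sub>R 1)) has_real_derivative dx s) (at s)) \<and>
          (dx has_real_derivative dxx) (at 0) \<and>
          dt \<le> dxx + L * (d t p + max 0 (d (t - h) p))"
    using D(1,4,5) by (intro exI[of _ dt] exI[of _ "\<lambda>s. dx (p + s)"] exI[of _ dxx] exI[of _ r]) auto
qed

section \<open>Gaussian spreading of positivity\<close>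

text \<open>The fundamental solution of the heat equation up to the constant factor 1 / sqrt (4
  pi).\<close>

definition heat_kernel :: "real \<Rightarrow> real \<Rightarrow> real" where
  "heat_kernel t x = exp (- x\<^sup>2 / (4 * t)) / sqrt t"

lemma heat_kernel_deriv_t:
  assumes "0 < t"
  shows "((\<lambda>t. heat_kernel t x) has_real_derivative (x\<^sup>2 / (4 * t\<^sup>2) - 1 / (2 * t)) * heat_kernel t x) (at t)"
proof -
  have "sqrt t * sqrt t = t" using assms by simp
  then show ?thesis unfolding heat_kernel_def using assms
    by (auto intro!: derivative_eq_intros simp: field_simps power2_eq_square)
qed

lemma heat_kernel_deriv_x:
  assumes "0 < t"
  shows "(heat_kernel t has_real_derivative - x / (2 * t) * heat_kernel t x) (at x)"
  unfolding heat_kernel_def using assms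
  by (auto intro!: derivative_eq_intros simp: field_simps)

lemma heat_kernel_deriv_xx:
  assumes "0 < t"
  shows "((\<lambda>x. - x / (2 * t) * heat_kernel t x) has_real_derivative (x\<^sup>2 / (4 * t\<^sup>2) - 1 / (2 * t)) * heat_kernel t x) (at x)"
  by (rule derivative_eq_intros heat_kernel_deriv_x assms refl | use assms in \<open>simp add: field_simps power2_eq_square\<close>)+

lemma heat_kernel_pos: "0 < t \<Longrightarrow> 0 < heat_kernel t x"
  by (simp add: heat_kernel_def)

lemma continuous_on_heat_kernel:
  assumes "continuous_on S f" "continuous_on S k" "\<And>p. p \<in> S \<Longrightarrow> 0 < f p"
  shows "continuous_on S (\<lambda>p. heat_kernel (f p) (k p))"
  unfolding heat_kernel_def using assms
  by (intro continuous_intros) (auto dest!: assms(3))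

text \<open>The barrier is a heat kernel minus a constant, started at a time \<open>s\<close> so small that the
  constant is negligible compared with the kernel on the target region.\<close>
lemma gaussian_spread:
  assumes m: "0 < m" and r: "0 < r" and \<tau>1: "0 < \<tau>1" and \<tau>2: "\<tau>1 \<le> \<tau>2"
  obtains \<eta> R :: real where "0 < \<eta>" "0 < R"
    "\<And>w t0 x0 E t x.
       \<lbrakk>continuous_on ({t0..t0+\<tau>2} \<times> UNIV) (\<lambda>(t,x). w t x); 0 \<le> E;
        \<And>t x. t0 \<le> t \<Longrightarrow> t \<le> t0 + \<tau>2 \<Longrightarrow> - E \<le> w t x;
        \<And>x. \<bar>x - x0\<bar> \<le> r \<Longrightarrow> m \<le> w t0 x;
        \<And>t x. t0 < t \<Longrightarrow> t \<le> t0 + \<tau>2 \<Longrightarrow> \<bar>x - x0\<bar> < R \<Longrightarrow>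
          \<exists>wt wx wxx r. r > 0 \<and> ((\<lambda>\<tau>. w \<tau> x) has_real_derivative wt) (at t) \<and>
            (\<forall>y. \<bar>y - x\<bar> < r \<longrightarrow> (w t has_real_derivative wx y) (at y)) \<and>
            (wx has_real_derivative wxx) (at x) \<and> wxx - w t x - E \<le> wt;
        t0 + \<tau>1 \<le> t; t \<le> t0 + \<tau>2; \<bar>x - x0\<bar> \<le> R1\<rbrakk> \<Longrightarrow> \<eta> - E \<le> w t x"
proof -
  \<comment> \<open>A lower bound of the kernel, started at a time \<open>s \<le> 1\<close>, on the
    target \<open>\<bar>x - x0\<bar> \<le> R1\<close> during the window from \<tau>1 to
    \<tau>2.\<close>
  define q where "q = exp (- R1\<^sup>2 / (4 * \<tau>1)) / sqrt (\<tau>2 + 1)"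
  have t2p: "0 < \<tau>2" using \<tau>1 \<tau>2 by simp
  have q: "0 < q" using t2p by (simp add: q_def)
  define s where "s = min 1 ((q * r\<^sup>2 / 8)\<^sup>2)"
  have s: "0 < s" "s \<le> 1" using q r by (auto simp: s_def)
  have "sqrt s \<le> sqrt ((q * r\<^sup>2 / 8)\<^sup>2)" by (intro real_sqrt_le_mono) (simp add: s_def)
  then have sq: "sqrt s \<le> q * r\<^sup>2 / 8" using q r by simp
  have sqs: "sqrt s > 0" "sqrt s * sqrt s = s" using s by auto
  define G0 where "G0 = heat_kernel s r"
  have "G0 < q"
  proof -
    have "r\<^sup>2 / (4 * s) \<le> exp (r\<^sup>2 / (4 * s))" using exp_ge_add_one_self[of "r\<^sup>2 / (4 * s)"] by linarith
    then have "exp (- r\<^sup>2 / (4 * s)) \<le> 4 * s / r\<^sup>2"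
      using s r by (simp add: exp_minus field_simps)
    then have "G0 \<le> 4 * s / r\<^sup>2 / sqrt s"
      unfolding G0_def heat_kernel_def using sqs by (intro divide_right_mono) auto
    also have "\<dots> = 4 * sqrt s / r\<^sup>2" using sqs s r by (simp add: field_simps)
    also have "\<dots> \<le> q / 2" using sq r by (simp add: field_simps)
    finally show ?thesis using q by simp
  qed
  have G0: "0 < G0" using s by (simp add: G0_def heat_kernel_pos)
  define a where "a = m * sqrt s"
  have a: "0 < a" using m sqs by (simp add: a_def)
  define \<eta> where "\<eta> = exp (- \<tau>2) * (a * (q - G0))"
  have \<eta>: "0 < \<eta>" using a \<open>G0 < q\<close> by (simp add: \<eta>_def)
  \<comment> \<open>Outside this radius the kernel is below the subtracted constant
    \<open>G0\<close> at all times considered, so the barrier is nonpositive there and the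
    differential inequality for \<open>w\<close> matters only inside.\<close>
  define R where "R = sqrt (r\<^sup>2 * (\<tau>2 + s) / s)"
  have R: "0 < R" using r s t2p by (simp add: R_def)
  show thesis
  proof (rule that[OF \<eta> R])
    fix w :: "real \<Rightarrow> real \<Rightarrow> real" and t0 x0 E t x
    assume cont: "continuous_on ({t0..t0+\<tau>2} \<times> UNIV) (\<lambda>(t,x). w t x)" and E: "0 \<le> E"
      and lower: "\<And>t x. t0 \<le> t \<Longrightarrow> t \<le> t0 + \<tau>2 \<Longrightarrow> - E \<le> w t x"
      and init: "\<And>x. \<bar>x - x0\<bar> \<le> r \<Longrightarrow> m \<le> w t0 x"
      and ineq: "\<And>t x. t0 < t \<Longrightarrow> t \<le> t0 + \<tau>2 \<Longrightarrow> \<bar>x - x0\<bar> < R \<Longrightarrow>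
          \<exists>wt wx wxx r. r > 0 \<and> ((\<lambda>\<tau>. w \<tau> x) has_real_derivative wt) (at t) \<and>
            (\<forall>y. \<bar>y - x\<bar> < r \<longrightarrow> (w t has_real_derivative wx y) (at y)) \<and>
            (wx has_real_derivative wxx) (at x) \<and> wxx - w t x - E \<le> wt"
      and t: "t0 + \<tau>1 \<le> t" "t \<le> t0 + \<tau>2" and x: "\<bar>x - x0\<bar> \<le> R1"
    \<comment> \<open>The decaying exponential accounts for the term \<open>- w\<close>. The error
      is handled by comparing \<open>b\<close> with \<open>w + E\<close>, which satisfies the same
      inequality with zero error and is nonnegative.\<close>
    define b where "b = (\<lambda>t x. exp (- (t - t0)) * (a * (heat_kernel (t - t0 + s) (x - x0) - G0)))"
    have hk_le: "heat_kernel \<tau> y \<le> 1 / sqrt s" if "s \<le> \<tau>" for \<tau> y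
      unfolding heat_kernel_def using that s by (intro frac_le) auto
    have Gtime: "t - t0 + s > 0" if "t0 \<le> t" for t using that s by simp
    have "b t x - w t x - E \<le> 0"
    proof (rule max_principle_real[where d="\<lambda>t x. b t x - w t x - E" and h=0 and L=0 and ?t0.0=t0 and T="t0+\<tau>2"
          and M="a / sqrt s"])
      show "continuous_on ({t0 - 0..t0 + \<tau>2} \<times> UNIV) (\<lambda>(t, x). b t x - w t x - E)"
        unfolding b_def case_prod_unfold
        by (intro continuous_intros continuous_on_heat_kernel cont[unfolded case_prod_unfold, simplified])
           (use s in \<open>auto intro: cont[unfolded case_prod_unfold]\<close>)
      show "b t x - w t x - E \<le> a / sqrt s" if "t0 - 0 \<le> t" "t \<le> t0 + \<tau>2" for t x
      proof -
        have "b t x \<le> exp (- (t - t0)) * (a * (1 / sqrt s))"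
          unfolding b_def using a G0 hk_le[of "t - t0 + s" "x - x0"] that
          by (intro mult_left_mono) auto
        also have "\<dots> \<le> 1 * (a * (1 / sqrt s))"
          using that a sqs by (intro mult_right_mono) auto
        finally show ?thesis using lower[of t x] that by simp
      qed
      show "b t x - w t x - E \<le> 0" if "t0 - 0 \<le> t" "t \<le> t0" for t x
      proof -
        have tt: "t = t0" using that by simp
        show ?thesis
        proof (cases "\<bar>x - x0\<bar> \<le> r")
          case True
          have "b t x \<le> a * (1 / sqrt s)"
            unfolding b_def tt using a G0 hk_le[of s "x - x0"]
              mult_left_mono[of "heat_kernel s (x - x0) - G0" "1 / sqrt s" a] by simp
          also have "\<dots> = m" using sqs by (simp add: a_def)
          finally show ?thesis using init[OF True] E tt by simp
        next
          case False
          then have "\<bar>r\<bar> \<le> \<bar>x - x0\<bar>" using r by simp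
          then have "r\<^sup>2 \<le> (x - x0)\<^sup>2" by (simp only: abs_le_square_iff)
          then have "heat_kernel s (x - x0) \<le> G0"
            unfolding G0_def heat_kernel_def using s
            by (intro divide_right_mono) (auto simp: divide_right_mono)
          then have "b t x \<le> 0" unfolding b_def tt using a by (simp add: mult_nonneg_nonpos)
          then show ?thesis using lower[of t x] tt t2p by simp
        qed
      qed
      fix t x assume t: "t0 < t" "t \<le> t0 + \<tau>2" and pos: "0 < b t x - w t x - E"
      have quarter_less: "- (A / 4) < - (B / 4) \<Longrightarrow> B < A" for A B :: real by simp
      have "b t x > 0" using pos lower[of t x] t by simp
      then have "heat_kernel (t - t0 + s) (x - x0) > G0"
        using a by (simp add: b_def zero_less_mult_iff)
      also have "G0 = exp (- r\<^sup>2 / (4 * s)) / sqrt s" by (simp add: G0_def heat_kernel_def)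
      finally have "exp (- r\<^sup>2 / (4 * s)) / sqrt s < exp (- (x-x0)\<^sup>2 / (4 * (t - t0 + s))) / sqrt (t - t0 + s)"
        by (simp add: heat_kernel_def)
      also have "\<dots> \<le> exp (- (x-x0)\<^sup>2 / (4 * (t - t0 + s))) / sqrt s"
        using t s by (intro divide_left_mono) auto
      finally have "- r\<^sup>2 / (4 * s) < - (x-x0)\<^sup>2 / (4 * (t - t0 + s))"
        using sqs by (simp add: divide_less_cancel)
      then have "(x-x0)\<^sup>2 / (t - t0 + s) < r\<^sup>2 / s"
        unfolding mult.commute[of 4] minus_divide_left[symmetric] divide_divide_eq_left[symmetric]
        by (rule quarter_less)
      then have "(x-x0)\<^sup>2 < r\<^sup>2 * (t - t0 + s) / s" using t s by (simp add: field_simps)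
      also have "\<dots> \<le> r\<^sup>2 * (\<tau>2 + s) / s"
        using t s by (intro divide_right_mono mult_left_mono) auto
      finally have "\<bar>x - x0\<bar> < R" unfolding R_def by (simp add: real_less_rsqrt)
      then obtain wt wx wxx rr where W: "((\<lambda>\<tau>. w \<tau> x) has_real_derivative wt) (at t)"
        "\<And>y. \<bar>y - x\<bar> < rr \<Longrightarrow> (w t has_real_derivative wx y) (at y)"
        "(wx has_real_derivative wxx) (at x)" "wxx - w t x - E \<le> wt" "rr > 0" using ineq[OF t] by blast
      have tp: "t - t0 + s > 0" using t s by simp
      let ?T = "t - t0 + s"
      let ?e = "exp (- (t - t0)) * a"
      let ?H = "((x - x0)\<^sup>2 / (4 * ?T\<^sup>2) - 1 / (2 * ?T)) * heat_kernel ?T (x - x0)"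
      have bt: "((\<lambda>\<tau>. b \<tau> x) has_real_derivative - b t x + ?e * ?H) (at t)"
        unfolding b_def
        by (rule derivative_eq_intros DERIV_chain2[OF heat_kernel_deriv_t] tp refl | simp add: algebra_simps)+
      have bx: "(b t has_real_derivative ?e * (- (y - x0) / (2 * ?T) * heat_kernel ?T (y - x0))) (at y)" for y
        unfolding b_def
        by (rule derivative_eq_intros DERIV_chain2[OF heat_kernel_deriv_x] tp refl | simp)+
      have bxx: "((\<lambda>y. ?e * (- (y - x0) / (2 * ?T) * heat_kernel ?T (y - x0))) has_real_derivative ?e * ?H) (at x)"
      proof -
        have "((\<lambda>y. - (y - x0) / (2 * ?T) * heat_kernel ?T (y - x0)) has_real_derivative ?H * 1) (at x)"
          by (rule DERIV_chain2[OF heat_kernel_deriv_xx[OF tp]]) (auto intro!: derivative_eq_intros)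
        from DERIV_cmult[OF this, of ?e] show ?thesis by simp
      qed
      show "\<exists>dt dx dxx r. r > 0 \<and> ((\<lambda>\<tau>. b \<tau> x - w \<tau> x - E) has_real_derivative dt) (at t) \<and>
          (\<forall>y. \<bar>y - x\<bar> < r \<longrightarrow> ((\<lambda>x. b t x - w t x - E) has_real_derivative dx y) (at y)) \<and>
          (dx has_real_derivative dxx) (at x) \<and>
          dt \<le> dxx + 0 * (b t x - w t x - E + max 0 (b (t - 0) x - w (t - 0) x - E))"
      proof (intro exI conjI allI impI)
        show "0 < rr" by fact
        show "((\<lambda>\<tau>. b \<tau> x - w \<tau> x - E) has_real_derivative (- b t x + ?e * ?H - wt)) (at t)"
          by (auto intro!: derivative_eq_intros bt W(1))
        show "((\<lambda>x. b t x - w t x - E) has_real_derivative (?e * (- (y - x0) / (2 * ?T) * heat_kernel ?T (y - x0)) - wx y)) (at y)" if "\<bar>y - x\<bar> < rr" for y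
          using DERIV_diff[OF DERIV_diff[OF bx W(2)[OF that]] DERIV_const] by simp
        show "((\<lambda>y. ?e * (- (y - x0) / (2 * ?T) * heat_kernel ?T (y - x0)) - wx y) has_real_derivative (?e * ?H - wxx)) (at x)"
          by (rule DERIV_diff[OF bxx W(3)])
        show "- b t x + ?e * ?H - wt \<le> ?e * ?H - wxx + 0 * (b t x - w t x - E + max 0 (b (t - 0) x - w (t - 0) x - E))"
          using W(4) pos by simp
      qed
    qed (use t \<tau>1 in auto)
    moreover have "\<eta> \<le> b t x"
    proof -
      have tp: "\<tau>1 \<le> t - t0" "t - t0 \<le> \<tau>2" using t by auto
      have "R1\<^sup>2 \<ge> (x - x0)\<^sup>2" using x by (metis abs_le_square_iff abs_ge_self order_trans)
      then have "(x - x0)\<^sup>2 / (4 * (t - t0 + s)) \<le> R1\<^sup>2 / (4 * \<tau>1)"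
        using tp \<tau>1 s by (intro frac_le) auto
      then have "q \<le> heat_kernel (t - t0 + s) (x - x0)"
        unfolding q_def heat_kernel_def using tp \<tau>1 s
        by (intro frac_le) auto
      then show ?thesis unfolding \<eta>_def b_def using a tp \<open>G0 < q\<close>
        by (intro mult_mono mult_left_mono) auto
    qed
    ultimately show "\<eta> - E \<le> w t x" by simp
  qed
qed

section \<open>The nonlinearity\<close>

text \<open>Hypothesis (H) in the form in which comparison arguments consume it: \<open>G\<close>
  stands for the derivative at 0, and smoothness near 0 and \<kappa> appears as bounds on
  increments. Thanks to the linear extension, monotonicity and the Lipschitz bound are global and
  the slope bound \<rho> holds on the whole ray above \<open>\<kappa> - \<delta>\<close>.\<close>

locale monostable =
  fixes g :: "real \<Rightarrow> real" and \<kappa> G L \<rho> \<delta> :: real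
  assumes kappa_pos: "0 < \<kappa>"
    and g_mono: "x \<le> y \<Longrightarrow> g x \<le> g y"
    and g_lip: "\<bar>g x - g y\<bar> \<le> L * \<bar>x - y\<bar>"
    and g_0: "g 0 = 0" and g_kappa: "g \<kappa> = \<kappa>"
    and g_above: "0 < x \<Longrightarrow> x < \<kappa> \<Longrightarrow> x < g x"
    and G_gt_1: "1 < G"
    and g_near_0: "0 < e \<Longrightarrow> \<exists>d>0. \<forall>a b. - d \<le> a \<and> a \<le> b \<and> b \<le> d \<longrightarrow>
          (G - e) * (b - a) \<le> g b - g a \<and> g b - g a \<le> (G + e) * (b - a)"
    and delta: "0 < \<delta>" "\<delta> < \<kappa>" and rho: "0 \<le> \<rho>" "\<rho> < 1"
    and g_near_kappa: "\<kappa> - \<delta> \<le> a \<Longrightarrow> a \<le> b \<Longrightarrow> g b - g a \<le> \<rho> * (b - a)"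
begin

lemma L_ge_1: "1 \<le> L"
  using g_lip[of \<kappa> 0] kappa_pos by (simp add: g_0 g_kappa)

lemma g_diff_le: "g a - g b \<le> L * max 0 (a - b)"
proof (cases "a \<le> b")
  case True
  then show ?thesis using g_mono[OF True] L_ge_1 by simp
next
  case False
  then show ?thesis using g_lip[of a b] by simp
qed

lemma g_nonneg: "0 \<le> x \<Longrightarrow> 0 \<le> g x"
  using g_mono[of 0 x] by (simp add: g_0)

lemma isCont_g: "isCont g x"
proof -
  have "L-lipschitz_on UNIV g"
    using g_lip L_ge_1 by (intro lipschitz_onI) (auto simp: dist_real_def)
  then show ?thesis
    using lipschitz_on_continuous_on continuous_on_eq_continuous_at open_UNIV by blast
qed

lemma continuous_on_g: "continuous_on S f \<Longrightarrow> continuous_on S (\<lambda>x. g (f x))"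
  using isCont_g continuous_on_compose2[of UNIV g S f]
  by (auto simp: continuous_at_imp_continuous_on)

lemma g_linear_lower:
  obtains \<epsilon> \<eta>0 where "0 < \<epsilon>" "0 < \<eta>0" "\<And>v. 0 \<le> v \<Longrightarrow> v \<le> \<epsilon> \<Longrightarrow> (1 + \<eta>0) * v \<le> g v"
proof -
  obtain d where d: "d > 0" "\<And>a b. - d \<le> a \<and> a \<le> b \<and> b \<le> d \<Longrightarrow> (G - (G - 1) / 2) * (b - a) \<le> g b - g a"
    using g_near_0[of "(G - 1) / 2"] G_gt_1 by auto
  have *: "G - (G - 1) / 2 = 1 + (G - 1) / 2" by (simp add: field_simps)
  show thesis
    by (rule that[of d "(G - 1) / 2"])
       (use d(1) d(2)[of 0] G_gt_1 in \<open>auto simp: g_0 *[symmetric]\<close>)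
qed

end

section \<open>Comparison of solutions with barriers\<close>

locale solution = monostable +
  fixes h M :: real and u ut ux uxx :: "real \<Rightarrow> real \<Rightarrow> real"
  assumes h_nonneg: "0 \<le> h"
    and u_cont: "continuous_on ({-h..} \<times> UNIV) (\<lambda>(t,x). u t x)"
    and u_bdd: "- h \<le> t \<Longrightarrow> \<bar>u t x\<bar> \<le> M"
    and u_init: "- h \<le> t \<Longrightarrow> t \<le> 0 \<Longrightarrow> 0 \<le> u t x \<and> u t x \<le> \<kappa>"
    and u_t: "0 < t \<Longrightarrow> ((\<lambda>\<tau>. u \<tau> x) has_real_derivative ut t x) (at t)"
    and u_x: "0 < t \<Longrightarrow> (u t has_real_derivative ux t x) (at x)"
    and u_xx: "0 < t \<Longrightarrow> (ux t has_real_derivative uxx t x) (at x)"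
    and u_eq: "0 < t \<Longrightarrow> ut t x = uxx t x - u t x + g (u (t - h) x)"
begin

lemma u_cont_sub: "continuous_on S f \<Longrightarrow> continuous_on S k \<Longrightarrow> (\<And>p. p \<in> S \<Longrightarrow> - h \<le> f p) \<Longrightarrow>
    continuous_on S (\<lambda>p. u (f p) (k p))"
  using continuous_on_compose2[OF u_cont, of S "\<lambda>p. (f p, k p)"] by (auto intro: continuous_on_Pair)

text \<open>The reaction is evaluated at \<open>u\<close> rather than at \<open>b\<close>, with the
  \<open>L\<close>-term as compensation. By \<open>g_diff_le\<close> this is weaker than demanding a
  subsolution, and it leaves room for extra knowledge about the delayed values of \<open>u\<close>,
  such as their being near \<kappa>. The inequality is demanded only where \<open>b\<close> exceeds
  \<open>u\<close>.\<close>

lemma lower_barrier: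
  assumes t0: "0 \<le> t0"
    and cont: "continuous_on ({t0-h..T} \<times> UNIV) (\<lambda>(t,x). b t x)"
    and bdd: "\<And>t x. t0 - h \<le> t \<Longrightarrow> t \<le> T \<Longrightarrow> b t x \<le> B"
    and init: "\<And>t x. t0 - h \<le> t \<Longrightarrow> t \<le> t0 \<Longrightarrow> b t x \<le> u t x"
    and ineq: "\<And>t x. t0 < t \<Longrightarrow> t \<le> T \<Longrightarrow> u t x < b t x \<Longrightarrow>
       \<exists>bt bx bxx. ((\<lambda>\<tau>. b \<tau> x) has_real_derivative bt) (at t) \<and>
          (\<forall>y. (b t has_real_derivative bx y) (at y)) \<and> (bx has_real_derivative bxx) (at x) \<and>
          bt \<le> bxx - b t x + g (u (t - h) x) + L * max 0 (b (t - h) x - u (t - h) x)"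
    and t: "t0 - h \<le> t" "t \<le> T"
  shows "b t x \<le> u t x"
proof -
  have "b t x - u t x \<le> 0"
  proof (rule max_principle_real[where d="\<lambda>t x. b t x - u t x" and L=L and h=h and ?t0.0=t0 and T=T and M="B+M"])
    show "continuous_on ({t0 - h..T} \<times> UNIV) (\<lambda>(t, x). b t x - u t x)"
      using t0 cont unfolding case_prod_unfold
      by (intro continuous_intros u_cont_sub) auto
    show "b t x - u t x \<le> B + M" if "t0 - h \<le> t" "t \<le> T" for t x
      using bdd[OF that, of x] u_bdd[of t x] that t0 by linarith
    fix t x assume t: "t0 < t" "t \<le> T" "0 < b t x - u t x"
    then obtain bt bx bxx where D: "((\<lambda>\<tau>. b \<tau> x) has_real_derivative bt) (at t)"
          "\<And>y. (b t has_real_derivative bx y) (at y)" "(bx has_real_derivative bxx) (at x)"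
          "bt \<le> bxx - b t x + g (u (t - h) x) + L * max 0 (b (t - h) x - u (t - h) x)"
      using ineq[of t x] by force
    have tp: "0 < t" using t t0 by simp
    show "\<exists>dt dx dxx r. r > 0 \<and> ((\<lambda>\<tau>. b \<tau> x - u \<tau> x) has_real_derivative dt) (at t) \<and>
       (\<forall>y. \<bar>y - x\<bar> < r \<longrightarrow> ((\<lambda>x. b t x - u t x) has_real_derivative dx y) (at y)) \<and>
       (dx has_real_derivative dxx) (at x) \<and>
       dt \<le> dxx + L * (b t x - u t x + max 0 (b (t - h) x - u (t - h) x))"
    proof (intro exI conjI allI impI)
      show "0 < (1::real)" by simp
      show "((\<lambda>\<tau>. b \<tau> x - u \<tau> x) has_real_derivative bt - ut t x) (at t)"
        by (intro DERIV_diff D(1) u_t tp)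
      show "((\<lambda>x. b t x - u t x) has_real_derivative bx y - ux t y) (at y)" for y
        by (intro DERIV_diff D(2) u_x tp)
      show "((\<lambda>y. bx y - ux t y) has_real_derivative bxx - uxx t x) (at x)"
        by (intro DERIV_diff D(3) u_xx tp)
      have "0 \<le> L * (b t x - u t x)" using L_ge_1 t by simp
      then show "bt - ut t x \<le> bxx - uxx t x + L * (b t x - u t x + max 0 (b (t - h) x - u (t - h) x))"
        using D(4) u_eq[OF tp, of x] t by (simp add: distrib_left)
    qed
  qed (use assms h_nonneg L_ge_1 in auto)
  then show ?thesis by simp
qed

text \<open>Composing with \<open>min x 0\<close> continues the difference constantly to the right,
  so the principle on the whole line applies: where the difference is positive, the boundary
  condition forces \<open>x < 0\<close>, and derivatives exist in the neighbourhood of radius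
  \<open>- x\<close>.\<close>

lemma half_line_lower_barrier:
  assumes t0: "0 \<le> t0"
    and cont: "continuous_on ({t0-h..T} \<times> UNIV) (\<lambda>(t,x). b t x)"
    and bdd: "\<And>t x. t0 - h \<le> t \<Longrightarrow> t \<le> T \<Longrightarrow> b t x \<le> B"
    and init: "\<And>t x. t0 - h \<le> t \<Longrightarrow> t \<le> t0 \<Longrightarrow> x \<le> 0 \<Longrightarrow> b t x \<le> u t x"
    and boundary: "\<And>t. t0 \<le> t \<Longrightarrow> t \<le> T \<Longrightarrow> b t 0 \<le> u t 0"
    and ineq: "\<And>t x. t0 < t \<Longrightarrow> t \<le> T \<Longrightarrow> x < 0 \<Longrightarrow> u t x < b t x \<Longrightarrow>
       \<exists>bt bx bxx. ((\<lambda>\<tau>. b \<tau> x) has_real_derivative bt) (at t) \<and>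
          (\<forall>y. (b t has_real_derivative bx y) (at y)) \<and> (bx has_real_derivative bxx) (at x) \<and>
          bt \<le> bxx - b t x + g (u (t - h) x) + L * max 0 (b (t - h) x - u (t - h) x)"
    and t: "t0 - h \<le> t" "t \<le> T" and x: "x \<le> 0"
  shows "b t x \<le> u t x"
proof -
  define d where "d = (\<lambda>t x. b t (min x 0) - u t (min x 0))"
  have "d t x \<le> 0"
  proof (rule max_principle_real[where d=d and L=L and h=h and ?t0.0=t0 and T=T and M="B+M"])
    have "continuous_on ({t0 - h..T} \<times> UNIV) (\<lambda>p. case (fst p, min (snd p) 0) of (t, x) \<Rightarrow> b t x)"
      by (rule continuous_on_compose2[OF cont]) (auto intro!: continuous_intros)
    then have "continuous_on ({t0 - h..T} \<times> UNIV) (\<lambda>p. b (fst p) (min (snd p) 0))" by simp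
    then show "continuous_on ({t0 - h..T} \<times> UNIV) (\<lambda>(t, x). d t x)"
      using t0 unfolding d_def case_prod_unfold
      by (intro continuous_intros u_cont_sub) auto
    show "d t x \<le> B + M" if "t0 - h \<le> t" "t \<le> T" for t x
      using bdd[OF that, of "min x 0"] u_bdd[of t "min x 0"] that t0 unfolding d_def by linarith
    show "d t x \<le> 0" if "t0 - h \<le> t" "t \<le> t0" for t x
      using init[OF that, of "min x 0"] by (simp add: d_def)
    fix t x assume t: "t0 < t" "t \<le> T" "0 < d t x"
    have x0: "x < 0"
    proof (rule ccontr)
      assume "\<not> x < 0"
      then have "min x 0 = 0" by simp
      then show False using boundary[of t] t by (simp add: d_def)
    qed
    then obtain bt bx bxx where D: "((\<lambda>\<tau>. b \<tau> x) has_real_derivative bt) (at t)"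
          "\<And>y. (b t has_real_derivative bx y) (at y)" "(bx has_real_derivative bxx) (at x)"
          "bt \<le> bxx - b t x + g (u (t - h) x) + L * max 0 (b (t - h) x - u (t - h) x)"
      using ineq[of t x] t by (force simp: d_def)
    have tp: "0 < t" using t t0 by simp
    have dx: "d s x = b s x - u s x" for s using x0 by (simp add: d_def)
    show "\<exists>dt dx dxx r. r > 0 \<and> ((\<lambda>\<tau>. d \<tau> x) has_real_derivative dt) (at t) \<and>
       (\<forall>y. \<bar>y - x\<bar> < r \<longrightarrow> (d t has_real_derivative dx y) (at y)) \<and>
       (dx has_real_derivative dxx) (at x) \<and>
       dt \<le> dxx + L * (d t x + max 0 (d (t - h) x))"
    proof (intro exI conjI allI impI)
      show "0 < - x" using x0 by simp
      show "((\<lambda>\<tau>. d \<tau> x) has_real_derivative bt - ut t x) (at t)"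
        unfolding dx by (intro DERIV_diff D(1) u_t tp)
      show "(d t has_real_derivative bx y - ux t y) (at y)" if "\<bar>y - x\<bar> < - x" for y
      proof (rule has_field_derivative_transform_within_open[where S="{..<0}"])
        show "((\<lambda>x. b t x - u t x) has_real_derivative bx y - ux t y) (at y)"
          by (intro DERIV_diff D(2) u_x tp)
      qed (use that in \<open>auto simp: d_def\<close>)
      show "((\<lambda>y. bx y - ux t y) has_real_derivative bxx - uxx t x) (at x)"
        by (intro DERIV_diff D(3) u_xx tp)
      have "0 \<le> L * d t x" using L_ge_1 t by simp
      then show "bt - ut t x \<le> bxx - uxx t x + L * (d t x + max 0 (d (t - h) x))"
        using D(4) u_eq[OF tp, of x] t(3) by (simp add: distrib_left dx)
    qed
  qed (use assms h_nonneg L_ge_1 in auto)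
  then show ?thesis using x by (simp add: d_def)
qed

lemma upper_barrier:
  assumes t0: "0 \<le> t0"
    and cont: "continuous_on ({t0-h..T} \<times> UNIV) (\<lambda>(t,x). b t x)"
    and bdd: "\<And>t x. t0 - h \<le> t \<Longrightarrow> t \<le> T \<Longrightarrow> B \<le> b t x"
    and init: "\<And>t x. t0 - h \<le> t \<Longrightarrow> t \<le> t0 \<Longrightarrow> u t x \<le> b t x"
    and ineq: "\<And>t x. t0 < t \<Longrightarrow> t \<le> T \<Longrightarrow> b t x < u t x \<Longrightarrow>
       \<exists>bt bx bxx. ((\<lambda>\<tau>. b \<tau> x) has_real_derivative bt) (at t) \<and>
          (\<forall>y. (b t has_real_derivative bx y) (at y)) \<and> (bx has_real_derivative bxx) (at x) \<and>
          bxx - b t x + g (u (t - h) x) - L * max 0 (u (t - h) x - b (t - h) x) \<le> bt"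
    and t: "t0 - h \<le> t" "t \<le> T"
  shows "u t x \<le> b t x"
proof -
  have "u t x - b t x \<le> 0"
  proof (rule max_principle_real[where d="\<lambda>t x. u t x - b t x" and L=L and h=h and ?t0.0=t0 and T=T and M="M-B"])
    show "continuous_on ({t0 - h..T} \<times> UNIV) (\<lambda>(t, x). u t x - b t x)"
      using t0 cont unfolding case_prod_unfold
      by (intro continuous_intros u_cont_sub) auto
    show "u t x - b t x \<le> M - B" if "t0 - h \<le> t" "t \<le> T" for t x
      using bdd[OF that, of x] u_bdd[of t x] that t0 by linarith
    fix t x assume t: "t0 < t" "t \<le> T" "0 < u t x - b t x"
    then obtain bt bx bxx where D: "((\<lambda>\<tau>. b \<tau> x) has_real_derivative bt) (at t)"
          "\<And>y. (b t has_real_derivative bx y) (at y)" "(bx has_real_derivative bxx) (at x)"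
          "bxx - b t x + g (u (t - h) x) - L * max 0 (u (t - h) x - b (t - h) x) \<le> bt"
      using ineq[of t x] by force
    have tp: "0 < t" using t t0 by simp
    show "\<exists>dt dx dxx r. r > 0 \<and> ((\<lambda>\<tau>. u \<tau> x - b \<tau> x) has_real_derivative dt) (at t) \<and>
       (\<forall>y. \<bar>y - x\<bar> < r \<longrightarrow> ((\<lambda>x. u t x - b t x) has_real_derivative dx y) (at y)) \<and>
       (dx has_real_derivative dxx) (at x) \<and>
       dt \<le> dxx + L * (u t x - b t x + max 0 (u (t - h) x - b (t - h) x))"
    proof (intro exI conjI allI impI)
      show "0 < (1::real)" by simp
      show "((\<lambda>\<tau>. u \<tau> x - b \<tau> x) has_real_derivative ut t x - bt) (at t)"
        by (intro DERIV_diff D(1) u_t tp)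
      show "((\<lambda>x. u t x - b t x) has_real_derivative ux t y - bx y) (at y)" for y
        by (intro DERIV_diff D(2) u_x tp)
      show "((\<lambda>y. ux t y - bx y) has_real_derivative uxx t x - bxx) (at x)"
        by (intro DERIV_diff D(3) u_xx tp)
      have "0 \<le> L * (u t x - b t x)" using L_ge_1 t by simp
      then show "ut t x - bt \<le> uxx t x - bxx + L * (u t x - b t x + max 0 (u (t - h) x - b (t - h) x))"
        using D(4) u_eq[OF tp, of x] t by (simp add: distrib_left)
    qed
  qed (use assms h_nonneg L_ge_1 in auto)
  then show ?thesis by simp
qed

lemma u_nonneg: assumes "- h \<le> t" shows "0 \<le> u t x"
proof -
  have "(\<lambda>t x. 0) t x \<le> u t x"
  proof (rule lower_barrier[where ?t0.0=0 and B=0 and T="max t 0"])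
    fix t x assume "0 < t" "u t x < 0"
    show "\<exists>bt bx bxx. ((\<lambda>\<tau>. 0) has_real_derivative bt) (at t) \<and>
          (\<forall>y. ((\<lambda>x. 0) has_real_derivative bx y) (at y)) \<and> (bx has_real_derivative bxx) (at x) \<and>
          bt \<le> bxx - 0 + g (u (t - h) x) + L * max 0 (0 - u (t - h) x)"
      using g_diff_le[of 0 "u (t-h) x"]
      by (intro exI[of _ 0] exI[of _ "\<lambda>_. 0"]) (auto simp: g_0)
  qed (use assms u_init in auto)
  then show ?thesis by simp
qed

lemma u_le_kappa: assumes "- h \<le> t" shows "u t x \<le> \<kappa>"
proof -
  have "u t x \<le> (\<lambda>t x. \<kappa>) t x"
  proof (rule upper_barrier[where ?t0.0=0 and B=0 and T="max t 0"])
    fix t x assume "0 < t" "\<kappa> < u t x"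
    show "\<exists>bt bx bxx. ((\<lambda>\<tau>. \<kappa>) has_real_derivative bt) (at t) \<and>
          (\<forall>y. ((\<lambda>x. \<kappa>) has_real_derivative bx y) (at y)) \<and> (bx has_real_derivative bxx) (at x) \<and>
          bxx - \<kappa> + g (u (t - h) x) - L * max 0 (u (t - h) x - \<kappa>) \<le> bt"
      using g_diff_le[of "u (t-h) x" \<kappa>]
      by (intro exI[of _ 0] exI[of _ "\<lambda>_. 0"]) (auto simp: g_kappa)
  qed (use assms u_init kappa_pos in auto)
  then show ?thesis by simp
qed

text \<open>Since \<open>u\<close> and \<open>g\<close> of its delayed values are nonnegative,
  \<open>gaussian_spread\<close> applies with error zero. The bound depends neither on
  \<open>t0\<close> nor on \<open>x0\<close>, and the window of times can be made to cover a full
  delay.\<close>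

lemma spread_u:
  assumes "0 < m" "0 < r" "0 < \<tau>1" "\<tau>1 \<le> \<tau>2"
  obtains \<eta> where "0 < \<eta>" "\<And>t0 x0 t x. \<lbrakk>0 \<le> t0; \<And>x. \<bar>x - x0\<bar> \<le> r \<Longrightarrow> m \<le> u t0 x;
    t0 + \<tau>1 \<le> t; t \<le> t0 + \<tau>2; \<bar>x - x0\<bar> \<le> R1\<rbrakk> \<Longrightarrow> \<eta> \<le> u t x"
proof -
  obtain \<eta> R where \<eta>: "0 < \<eta>" "0 < R"
    and sp: "\<And>w t0 x0 E t x.
       \<lbrakk>continuous_on ({t0..t0+\<tau>2} \<times> UNIV) (\<lambda>(t,x). w t x); 0 \<le> E;
        \<And>t x. t0 \<le> t \<Longrightarrow> t \<le> t0 + \<tau>2 \<Longrightarrow> - E \<le> w t x;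
        \<And>x. \<bar>x - x0\<bar> \<le> r \<Longrightarrow> m \<le> w t0 x;
        \<And>t x. t0 < t \<Longrightarrow> t \<le> t0 + \<tau>2 \<Longrightarrow> \<bar>x - x0\<bar> < R \<Longrightarrow>
          \<exists>wt wx wxx r. r > 0 \<and> ((\<lambda>\<tau>. w \<tau> x) has_real_derivative wt) (at t) \<and>
            (\<forall>y. \<bar>y - x\<bar> < r \<longrightarrow> (w t has_real_derivative wx y) (at y)) \<and>
            (wx has_real_derivative wxx) (at x) \<and> wxx - w t x - E \<le> wt;
        t0 + \<tau>1 \<le> t; t \<le> t0 + \<tau>2; \<bar>x - x0\<bar> \<le> R1\<rbrakk> \<Longrightarrow> \<eta> - E \<le> w t x"
    using gaussian_spread[OF assms, of R1] by blast
  show thesis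
  proof (rule that[OF \<eta>(1)])
    fix t0 x0 t x assume A: "0 \<le> t0" "\<And>x. \<bar>x - x0\<bar> \<le> r \<Longrightarrow> m \<le> u t0 x"
      "t0 + \<tau>1 \<le> t" "t \<le> t0 + \<tau>2" "\<bar>x - x0\<bar> \<le> R1"
    have "\<eta> - 0 \<le> u t x"
    proof (rule sp[where w=u and ?t0.0=t0 and ?x0.0=x0])
      show "continuous_on ({t0..t0 + \<tau>2} \<times> UNIV) (\<lambda>(t, x). u t x)"
        using A(1) h_nonneg unfolding case_prod_unfold by (intro u_cont_sub continuous_intros) auto
      show "- 0 \<le> u t x" if "t0 \<le> t" for t x using u_nonneg[of t x] that A(1) h_nonneg by simp
      fix t x assume "t0 < t" "t \<le> t0 + \<tau>2"
      then have tp: "0 < t" using A by simp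
      have "0 \<le> g (u (t - h) x)" using tp by (intro g_nonneg u_nonneg) auto
      then show "\<exists>wt wx wxx r. r > 0 \<and> ((\<lambda>\<tau>. u \<tau> x) has_real_derivative wt) (at t) \<and>
            (\<forall>y. \<bar>y - x\<bar> < r \<longrightarrow> (u t has_real_derivative wx y) (at y)) \<and>
            (wx has_real_derivative wxx) (at x) \<and> wxx - u t x - 0 \<le> wt"
        using u_t[OF tp, of x] u_x[OF tp] u_xx[OF tp, of x] u_eq[OF tp, of x]
        by (intro exI[of _ "ut t x"] exI[of _ "ux t"] exI[of _ "uxx t x"] exI[of _ 1]) auto
    qed (use A in auto)
    then show "\<eta> \<le> u t x" by simp
  qed
qed

text \<open>Off the initial strip, a zero of \<open>u\<close> is a minimum, where the equation forces the delayed
  reaction term to vanish.\<close>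
lemma positive_somewhere:
  assumes nz: "\<exists>s\<in>{-h..0}. \<exists>x. u s x \<noteq> 0"
  shows "\<exists>t1\<ge>0. \<exists>x0. 0 < u t1 x0"
proof (rule ccontr)
  assume "\<not> ?thesis"
  then have "\<not> 0 < u t x" if "0 \<le> t" for t x
    using that by blast
  from not_less[THEN iffD1, OF this] have z: "u t x = 0" if "0 \<le> t" for t x
    using that u_nonneg[of t x] h_nonneg by (simp add: antisym)
  obtain s x where s: "- h \<le> s" "s \<le> 0" "0 < u s x"
    using nz u_init by (metis atLeastAtMost_iff less_eq_real_def)
  have s0: "s < 0" using s z[of s x] by (cases "s < 0") auto
  have "g (u \<sigma> x) = 0" if "- h < \<sigma>" "\<sigma> \<le> 0" for \<sigma>
  proof -
    have tp: "0 < \<sigma> + h" using that by simp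
    have "((\<lambda>\<tau>. u \<tau> x) has_real_derivative 0) (at (\<sigma> + h))"
      by (rule has_field_derivative_transform_within_open[where f="\<lambda>_. 0" and S="{0<..}"])
         (use tp z in auto)
    then have "ut (\<sigma> + h) x = 0" using u_t[OF tp, of x] DERIV_unique by blast
    moreover have "u (\<sigma> + h) = (\<lambda>_. 0)" using z tp by auto
    then have "ux (\<sigma> + h) y = 0" for y using u_x[OF tp, of y] DERIV_unique[OF _ DERIV_const] by metis
    then have "ux (\<sigma> + h) = (\<lambda>_. 0)" by auto
    then have "uxx (\<sigma> + h) x = 0" using u_xx[OF tp, of x] DERIV_unique[OF _ DERIV_const] by metis
    ultimately show ?thesis using u_eq[OF tp, of x] z[of "\<sigma> + h" x] tp by simp
  qed
  then have z2: "u \<sigma> x = 0" if "- h < \<sigma>" "\<sigma> \<le> 0" for \<sigma>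
    using that g_above[of "u \<sigma> x"] u_init[of \<sigma> x] g_kappa kappa_pos
    by (metis less_eq_real_def less_irrefl less_trans)
  \<comment> \<open>The equation at the positive time \<open>\<sigma> + h\<close> reaches every
    \<sigma> above \<open>- h\<close>; the remaining left end of the strip is excluded by continuity
    in time.\<close>
  have "s = - h" using z2[of s] s by force
  have "isCont (\<lambda>t. u (max t (-h)) x) s"
  proof -
    have "continuous_on UNIV (\<lambda>t. u (max t (-h)) x)"
      by (intro u_cont_sub continuous_intros) auto
    then show ?thesis by (simp add: continuous_on_eq_continuous_at)
  qed
  moreover have "u (max s (-h)) x > 0" using s by simp
  ultimately have "eventually (\<lambda>t. u (max t (-h)) x > 0) (at s)"
    by (metis isCont_def order_tendstoD(1))
  then have "eventually (\<lambda>t. u (max t (-h)) x > 0) (at_right s)"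
    by (simp add: eventually_at_split)
  then obtain b where b: "b > s" "\<And>y. s < y \<Longrightarrow> y < b \<Longrightarrow> u (max y (-h)) x > 0"
    using eventually_at_right[of s 0] s0 by auto
  define y where "y = min ((s + b) / 2) (s / 2)"
  have "s < y" "y < b" "y \<le> 0" using b s0 by (auto simp: y_def min_def field_simps)
  then show False using b(2)[of y] z2[of y] \<open>s = - h\<close> by simp
qed

end

section \<open>Spreading at a positive linear speed\<close>

text \<open>A Gaussian lowered so as to vanish at distance \<open>R\<close>: an explicit substitute
  for the first Dirichlet eigenfunction of the interval, negative outside and therefore
  automatically below a nonnegative solution there.\<close>

definition bump :: "real \<Rightarrow> real \<Rightarrow> real" where
  "bump R x = exp (- (x / R)\<^sup>2) - exp (- 1)"

lemma bump_le_1: "bump R x \<le> 1"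
proof -
  have "exp (- (x / R)\<^sup>2) \<le> 1" "0 < exp (- 1 :: real)" by auto
  then show ?thesis unfolding bump_def by linarith
qed

lemma bump_deriv:
  assumes "0 < R"
  shows "(bump R has_real_derivative - 2 * x / R\<^sup>2 * exp (- (x / R)\<^sup>2)) (at x)"
  unfolding bump_def using assms
  by (auto intro!: derivative_eq_intros simp: power2_eq_square)

lemma bump_deriv2:
  assumes "0 < R"
  shows "((\<lambda>x. - 2 * x / R\<^sup>2 * exp (- (x / R)\<^sup>2)) has_real_derivative (4 * (x / R)\<^sup>2 - 2) / R\<^sup>2 * exp (- (x / R)\<^sup>2)) (at x)"
  using assms by (auto intro!: derivative_eq_intros simp: power2_eq_square field_simps)

lemma bump_pos_imp: "0 < R \<Longrightarrow> 0 < bump R x \<Longrightarrow> \<bar>x\<bar> < R"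
proof (rule ccontr)
  assume R: "0 < R" and pos: "0 < bump R x" and "\<not> \<bar>x\<bar> < R"
  then have "\<bar>1\<bar> \<le> \<bar>x / R\<bar>" by simp
  then have "1\<^sup>2 \<le> (x / R)\<^sup>2" by (simp only: abs_le_square_iff)
  then show False using pos by (simp add: bump_def)
qed

lemma bump_nonpos: "0 < R \<Longrightarrow> R \<le> \<bar>x\<bar> \<Longrightarrow> bump R x \<le> 0"
  using bump_pos_imp[of R x] by linarith

text \<open>Where \<open>(x / R)\<^sup>2 \<ge> 1 / 2\<close> the Gaussian is convex. Nearer the
  centre its second derivative is at least \<open>- 2 / R\<^sup>2\<close> while the bump is at least
  \<open>exp (- 1) / 2\<close>, so a large radius suffices.\<close>

lemma bump_convex:
  assumes "0 < \<eta>" "0 < R" "4 * exp 1 / \<eta> \<le> R\<^sup>2" "0 < bump R x"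
  shows "0 \<le> (4 * (x / R)\<^sup>2 - 2) / R\<^sup>2 * exp (- (x / R)\<^sup>2) + \<eta> * bump R x"
proof (cases "1 / 2 \<le> (x / R)\<^sup>2")
  case True
  then show ?thesis using assms by (intro add_nonneg_nonneg mult_nonneg_nonneg divide_nonneg_nonneg) auto
next
  case False
  have "exp (- 1) * (1 / 2 :: real) \<le> exp (- 1) * (exp (1 / 2) - 1)"
    using exp_ge_add_one_self[of "1/2"] by (intro mult_left_mono) auto
  also have "\<dots> = exp (- (1 / 2)) - exp (- 1)" by (simp add: right_diff_distrib flip: exp_add)
  also have "\<dots> \<le> bump R x" using False by (simp add: bump_def)
  finally have "\<eta> * (exp (- 1) * (1 / 2)) \<le> \<eta> * bump R x" using assms by simp
  moreover have "2 / R\<^sup>2 \<le> \<eta> * (exp (- 1) * (1 / 2))"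
    using assms by (simp add: exp_minus field_simps)
  moreover have "- 2 / R\<^sup>2 \<le> (4 * (x / R)\<^sup>2 - 2) / R\<^sup>2 * exp (- (x / R)\<^sup>2)"
  proof -
    have "- 2 \<le> (4 * (x / R)\<^sup>2 - 2) * 1" by simp
    also have "\<dots> \<le> (4 * (x / R)\<^sup>2 - 2) * exp (- (x / R)\<^sup>2)"
      using False by (intro mult_left_mono_neg) auto
    finally have "- 2 / R\<^sup>2 \<le> (4 * (x / R)\<^sup>2 - 2) * exp (- (x / R)\<^sup>2) / R\<^sup>2"
      by (rule divide_right_mono) simp
    then show ?thesis by simp
  qed
  ultimately show ?thesis by simp
qed

context solution
begin

lemma bump_phase:
  assumes g_lin: "\<And>v. 0 \<le> v \<Longrightarrow> v \<le> \<epsilon> \<Longrightarrow> (1 + \<eta>0) * v \<le> g v"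
    and r: "0 \<le> r" and \<eta>: "0 < \<eta>" "\<eta> \<le> (1 + \<eta>0) * exp (- r * h) - 1 - r"
    and R: "0 < R" "4 * exp 1 / \<eta> \<le> R\<^sup>2"
    and t0: "0 \<le> t0" and p0: "0 < p0" "p0 * exp (r * (T - t0)) \<le> \<epsilon>"
    and init: "\<And>t x. t0 - h \<le> t \<Longrightarrow> t \<le> t0 \<Longrightarrow> p0 * exp (r * (t - t0)) * bump R (x - y) \<le> u t x"
    and t: "t0 - h \<le> t" "t \<le> T"
  shows "p0 * exp (r * (t - t0)) * bump R (x - y) \<le> u t x"
proof -
  define b where "b = (\<lambda>t x. p0 * exp (r * (t - t0)) * bump R (x - y))"
  have p_le: "p0 * exp (r * (t - t0)) \<le> \<epsilon>" if "t \<le> T" for t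
  proof -
    have "p0 * exp (r * (t - t0)) \<le> p0 * exp (r * (T - t0))"
      using p0 r that by (intro mult_left_mono) (auto intro!: mult_left_mono)
    then show ?thesis using p0 by linarith
  qed
  have b_le: "b t x \<le> \<epsilon>" if "t \<le> T" for t x
  proof -
    have "b t x \<le> p0 * exp (r * (t - t0)) * 1"
      unfolding b_def using p0 bump_le_1 by (intro mult_left_mono) auto
    then show ?thesis using p_le[OF that] by simp
  qed
  have "b t x \<le> u t x"
  proof (rule lower_barrier[OF t0 _ b_le _ _ t])
    show "continuous_on ({t0 - h..T} \<times> UNIV) (\<lambda>(t, x). b t x)"
      unfolding b_def bump_def case_prod_unfold power2_eq_square using R by (intro continuous_intros) auto
    show "b t x \<le> u t x" if "t0 - h \<le> t" "t \<le> t0" for t x using init[OF that] by (simp add: b_def)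
    fix t x assume t: "t0 < t" "t \<le> T" and lt: "u t x < b t x"
    have "0 < b t x" using lt u_nonneg[of t x] t t0 h_nonneg by force
    then have bp: "0 < bump R (x - y)" 
      using zero_less_mult_pos[of "p0 * exp (r * (t - t0))" "bump R (x - y)"] p0(1) unfolding b_def by simp
    let ?p = "p0 * exp (r * (t - t0))"
    let ?B = "(4 * ((x - y) / R)\<^sup>2 - 2) / R\<^sup>2 * exp (- ((x - y) / R)\<^sup>2)"
    show "\<exists>bt bx bxx. ((\<lambda>\<tau>. b \<tau> x) has_real_derivative bt) (at t) \<and>
          (\<forall>y. (b t has_real_derivative bx y) (at y)) \<and> (bx has_real_derivative bxx) (at x) \<and>
          bt \<le> bxx - b t x + g (u (t - h) x) + L * max 0 (b (t - h) x - u (t - h) x)"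
    proof (intro exI conjI allI)
      show "((\<lambda>\<tau>. b \<tau> x) has_real_derivative r * b t x) (at t)"
        unfolding b_def by (auto intro!: derivative_eq_intros)
      show "(b t has_real_derivative ?p * (- 2 * (z - y) / R\<^sup>2 * exp (- ((z - y) / R)\<^sup>2))) (at z)" for z
      proof -
        have "((\<lambda>z. bump R (z - y)) has_real_derivative (- 2 * (z - y) / R\<^sup>2 * exp (- ((z - y) / R)\<^sup>2)) * 1) (at z)"
          by (rule DERIV_chain2[OF bump_deriv[OF R(1)]]) (auto intro!: derivative_eq_intros)
        from DERIV_cmult[OF this, of ?p] show ?thesis by (simp add: b_def)
      qed
      have "((\<lambda>z. - 2 * (z - y) / R\<^sup>2 * exp (- ((z - y) / R)\<^sup>2)) has_real_derivative ?B * 1) (at x)"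
        by (rule DERIV_chain2[OF bump_deriv2[OF R(1)]]) (auto intro!: derivative_eq_intros)
      then show "((\<lambda>z. ?p * (- 2 * (z - y) / R\<^sup>2 * exp (- ((z - y) / R)\<^sup>2))) has_real_derivative ?p * ?B) (at x)"
        using DERIV_cmult by fastforce
      have "b (t - h) x = exp (- r * h) * b t x"
        by (simp add: b_def algebra_simps flip: exp_add)
      then have "(1 + \<eta>0) * (exp (- r * h) * b t x) \<le> g (b (t - h) x)"
        using g_lin[of "b (t - h) x"] b_le[of "t - h" x] t h_nonneg \<open>0 < b t x\<close> by simp
      moreover have "g (b (t - h) x) - g (u (t - h) x) \<le> L * max 0 (b (t - h) x - u (t - h) x)"
        by (rule g_diff_le)
      moreover have "0 \<le> ?p * (?B + \<eta> * bump R (x - y))"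
        using p0 bump_convex[OF \<eta>(1) R bp] by simp
      then have "- (\<eta> * b t x) \<le> ?p * ?B" by (simp add: b_def algebra_simps)
      moreover have "\<eta> * b t x \<le> ((1 + \<eta>0) * exp (- r * h) - 1 - r) * b t x"
        using \<eta> \<open>0 < b t x\<close> by (intro mult_right_mono) auto
      ultimately show "r * b t x \<le> ?p * ?B - b t x + g (u (t - h) x) + L * max 0 (b (t - h) x - u (t - h) x)"
        by (simp add: algebra_simps)
    qed
  qed
  then show ?thesis by (simp add: b_def)
qed

text \<open>Any positive lower bound on an interval during one delay is raised, after a waiting time
  depending on the bound, to a height \<epsilon>1 that does not depend on it. A growing phase
  reaches height \<epsilon>, then a stationary phase takes over; \<epsilon>1 is the height of the
  growing bump one delay earlier, so that it lies below \<open>u\<close> on the whole initial strip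
  of the second phase.\<close>

lemma bump_persistence:
  obtains R \<epsilon>1 where "0 < R" "0 < \<epsilon>1"
    "\<And>\<delta>'. 0 < \<delta>' \<Longrightarrow> \<exists>\<tau>\<ge>0. \<forall>t0\<ge>0. \<forall>y. (\<forall>s. t0 - h \<le> s \<and> s \<le> t0 \<longrightarrow> (\<forall>x. \<bar>x - y\<bar> \<le> R \<longrightarrow> \<delta>' \<le> u s x)) \<longrightarrow>
       (\<forall>t\<ge>t0+\<tau>. \<forall>x. \<epsilon>1 * bump R (x - y) \<le> u t x)"
proof -
  obtain \<epsilon> \<eta>0 where \<epsilon>: "0 < \<epsilon>" "0 < \<eta>0" "\<And>v. 0 \<le> v \<Longrightarrow> v \<le> \<epsilon> \<Longrightarrow> (1 + \<eta>0) * v \<le> g v"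
    using g_linear_lower by blast
  \<comment> \<open>With \<open>exp (- r * h) \<ge> 1 - r * h\<close> the margin is at least
    \<open>\<eta>0 - r * ((1 + \<eta>0) * h + 1)\<close>, and this choice makes it equal to
    \<open>\<eta>0 / 2\<close>.\<close>
  define r where "r = \<eta>0 / (2 * ((1 + \<eta>0) * h + 1))"
  define \<eta> where "\<eta> = \<eta>0 / 2"
  have pos: "(1 + \<eta>0) * h + 1 > 0" using \<epsilon> h_nonneg by (simp add: add_nonneg_pos)
  have r: "0 < r" using \<epsilon> pos by (simp add: r_def)
  have "\<eta>0 / (2 * X) * X = \<eta>0 / 2" if "0 < X" for X :: real using that by simp
  from this[OF pos] have "r * ((1 + \<eta>0) * h + 1) = \<eta>0 / 2" unfolding r_def .
  moreover have "(1 + \<eta>0) * (1 - r * h) \<le> (1 + \<eta>0) * exp (- r * h)"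
    using exp_ge_add_one_self[of "- r * h"] \<epsilon> by (intro mult_left_mono) auto
  ultimately have \<eta>r: "0 < \<eta>" "\<eta> \<le> (1 + \<eta>0) * exp (- r * h) - 1 - r"
    using \<epsilon> by (auto simp: \<eta>_def algebra_simps)
  have \<eta>0: "\<eta> \<le> (1 + \<eta>0) * exp (- 0 * h) - 1 - 0" using \<epsilon> by (simp add: \<eta>_def)
  define R where "R = sqrt (4 * exp 1 / \<eta>)"
  have R: "0 < R" "4 * exp 1 / \<eta> \<le> R\<^sup>2" using \<eta>r by (auto simp: R_def)
  define \<epsilon>1 where "\<epsilon>1 = \<epsilon> * exp (- r * h)"
  have \<epsilon>1: "0 < \<epsilon>1" "\<epsilon>1 \<le> \<epsilon>" using \<epsilon> r h_nonneg by (auto simp: \<epsilon>1_def mult_le_cancel_left1)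
  show thesis
  proof (rule that[OF R(1) \<epsilon>1(1)])
    fix \<delta>' :: real assume \<delta>': "0 < \<delta>'"
    define p0 where "p0 = min \<delta>' \<epsilon>"
    have p0: "0 < p0" "p0 \<le> \<delta>'" "p0 \<le> \<epsilon>" using \<delta>' \<epsilon> by (auto simp: p0_def)
    define \<tau> where "\<tau> = ln (\<epsilon> / p0) / r"
    have \<tau>: "0 \<le> \<tau>" using p0 r by (simp add: \<tau>_def)
    have p\<tau>: "p0 * exp (r * \<tau>) = \<epsilon>" using r p0 \<epsilon> by (simp add: \<tau>_def)
    show "\<exists>\<tau>\<ge>0. \<forall>t0\<ge>0. \<forall>y. (\<forall>s. t0 - h \<le> s \<and> s \<le> t0 \<longrightarrow> (\<forall>x. \<bar>x - y\<bar> \<le> R \<longrightarrow> \<delta>' \<le> u s x)) \<longrightarrow>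
       (\<forall>t\<ge>t0+\<tau>. \<forall>x. \<epsilon>1 * bump R (x - y) \<le> u t x)"
    proof (intro exI[of _ \<tau>] conjI \<tau> allI impI)
      fix t0 y t x assume t0: "0 \<le> t0" and t: "t0 + \<tau> \<le> t"
        and init: "\<forall>s. t0 - h \<le> s \<and> s \<le> t0 \<longrightarrow> (\<forall>x. \<bar>x - y\<bar> \<le> R \<longrightarrow> \<delta>' \<le> u s x)"
      have phase1: "p0 * exp (r * (s - t0)) * bump R (x - y) \<le> u s x" if s: "t0 - h \<le> s" "s \<le> t0 + \<tau>" for s x
      proof (rule bump_phase[OF \<epsilon>(3) _ \<eta>r R t0 p0(1) _ _ s])
        show "p0 * exp (r * (t0 + \<tau> - t0)) \<le> \<epsilon>" using p\<tau> by simp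
        fix t x assume t: "t0 - h \<le> t" "t \<le> t0"
        have ut: "0 \<le> u t x" using t t0 by (intro u_nonneg) auto
        show "p0 * exp (r * (t - t0)) * bump R (x - y) \<le> u t x"
        proof (cases "\<bar>x - y\<bar> \<le> R")
          case True
          have "p0 * exp (r * (t - t0)) * bump R (x - y) \<le> p0 * exp (r * (t - t0)) * 1"
            using p0 bump_le_1 by (intro mult_left_mono) auto
          also have "\<dots> \<le> p0 * 1 * 1"
            using p0 r t by (intro mult_right_mono mult_left_mono) (auto simp: mult_nonneg_nonpos)
          finally have "p0 * exp (r * (t - t0)) * bump R (x - y) \<le> \<delta>'" using p0 by linarith
          moreover have "\<delta>' \<le> u t x" using init t True by blast
          ultimately show ?thesis by simp
        next
          case False
          then have "p0 * exp (r * (t - t0)) * bump R (x - y) \<le> 0"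
            using p0 bump_nonpos[OF R(1), of "x - y"] by (simp add: mult_nonneg_nonpos)
          then show ?thesis using ut by simp
        qed
      qed (use r in auto)
      have t0\<tau>: "0 \<le> t0 + \<tau>" using t0 \<tau> by simp
      have "\<epsilon>1 * exp (0 * (t - (t0 + \<tau>))) * bump R (x - y) \<le> u t x"
      proof (rule bump_phase[OF \<epsilon>(3) _ \<eta>r(1) \<eta>0 R t0\<tau> \<epsilon>1(1), where T=t])
        fix s x assume s: "t0 + \<tau> - h \<le> s" "s \<le> t0 + \<tau>"
        have us: "0 \<le> u s x" using s t0\<tau> by (intro u_nonneg) auto
        show "\<epsilon>1 * exp (0 * (s - (t0 + \<tau>))) * bump R (x - y) \<le> u s x"
        proof (cases "0 < bump R (x - y)")
          case True
          have "\<epsilon>1 = p0 * exp (r * (\<tau> - h))"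
            unfolding \<epsilon>1_def p\<tau>[symmetric] by (simp add: algebra_simps flip: exp_add)
          also have "\<dots> \<le> p0 * exp (r * (s - t0))"
            using p0 r s by (intro mult_left_mono) auto
          finally have "\<epsilon>1 * bump R (x - y) \<le> p0 * exp (r * (s - t0)) * bump R (x - y)"
            using True by (intro mult_right_mono) auto
          also have "\<dots> \<le> u s x" using s \<tau> by (intro phase1) auto
          finally show ?thesis by simp
        next
          case False
          then have "\<epsilon>1 * bump R (x - y) \<le> 0" using \<epsilon>1 by (simp add: mult_nonneg_nonpos)
          then show ?thesis using us by simp
        qed
      qed (use \<epsilon>1 t h_nonneg in auto)
      then show "\<epsilon>1 * bump R (x - y) \<le> u t x" by simp
    qed
  qed
qed

text \<open>After a fixed time a bump of universal height reproduces itself around every centre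
  within distance \<open>R\<close>. Repeating this \<open>n\<close> times covers the distance
  \<open>n * R\<close> in a time linear in \<open>n\<close>, which is spreading with positive
  speed.\<close>

lemma linear_spreading:
  assumes nz: "\<exists>s\<in>{-h..0}. \<exists>x. u s x \<noteq> 0"
  shows "\<exists>m>0. \<exists>c>0. \<exists>T. \<forall>t\<ge>T. \<forall>x. \<bar>x\<bar> \<le> c * t \<longrightarrow> m \<le> u t x"
proof -
  obtain R \<epsilon>1 where R: "0 < R" and \<epsilon>1: "0 < \<epsilon>1"
    and grow: "\<And>\<delta>'. 0 < \<delta>' \<Longrightarrow> \<exists>\<tau>\<ge>0. \<forall>t0\<ge>0. \<forall>y. (\<forall>s. t0 - h \<le> s \<and> s \<le> t0 \<longrightarrow> (\<forall>x. \<bar>x - y\<bar> \<le> R \<longrightarrow> \<delta>' \<le> u s x)) \<longrightarrow>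
       (\<forall>t\<ge>t0+\<tau>. \<forall>x. \<epsilon>1 * bump R (x - y) \<le> u t x)"
    using bump_persistence by blast
  \<comment> \<open>Gaussian spreading gives a positive bound on radius \<open>2 * R\<close>
    throughout one delay. It thus contains the ball of radius \<open>R\<close> around each centre
    \<open>y'\<close> within distance \<open>R\<close>, where \<open>bump_persistence\<close> then
    applies.\<close>
  have transfer: "\<exists>\<tau>>0. \<forall>t0\<ge>0. \<forall>y. (\<forall>x. \<bar>x - y\<bar> \<le> r \<longrightarrow> m \<le> u t0 x) \<longrightarrow>
      (\<forall>y'. \<bar>y' - y\<bar> \<le> R \<longrightarrow> (\<forall>t\<ge>t0+\<tau>. \<forall>x. \<epsilon>1 * bump R (x - y') \<le> u t x))"
    if mr: "0 < m" "0 < r" for m r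
  proof -
    obtain \<eta> where \<eta>: "0 < \<eta>" "\<And>t0 x0 t x. \<lbrakk>0 \<le> t0; \<And>x. \<bar>x - x0\<bar> \<le> r \<Longrightarrow> m \<le> u t0 x;
      t0 + 1 \<le> t; t \<le> t0 + (1 + h); \<bar>x - x0\<bar> \<le> 2 * R\<rbrakk> \<Longrightarrow> \<eta> \<le> u t x"
      using spread_u[OF mr, of 1 "1 + h" "2 * R"] h_nonneg by auto
    obtain \<tau> where \<tau>: "0 \<le> \<tau>" "\<And>t0 y t x. 0 \<le> t0 \<Longrightarrow> (\<forall>s. t0 - h \<le> s \<and> s \<le> t0 \<longrightarrow> (\<forall>x. \<bar>x - y\<bar> \<le> R \<longrightarrow> \<eta> \<le> u s x)) \<Longrightarrow>
       t0 + \<tau> \<le> t \<Longrightarrow> \<epsilon>1 * bump R (x - y) \<le> u t x"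
      using grow[OF \<eta>(1)] by blast
    show ?thesis
    proof (intro exI[of _ "1 + h + \<tau>"] conjI allI impI)
      show "0 < 1 + h + \<tau>" using \<tau> h_nonneg by simp
      fix t0 y y' t x assume A: "0 \<le> t0" "\<forall>x. \<bar>x - y\<bar> \<le> r \<longrightarrow> m \<le> u t0 x" "\<bar>y' - y\<bar> \<le> R" "t0 + (1 + h + \<tau>) \<le> t"
      show "\<epsilon>1 * bump R (x - y') \<le> u t x"
      proof (rule \<tau>(2)[of "t0 + 1 + h"])
        show "\<forall>s. t0 + 1 + h - h \<le> s \<and> s \<le> t0 + 1 + h \<longrightarrow> (\<forall>x. \<bar>x - y'\<bar> \<le> R \<longrightarrow> \<eta> \<le> u s x)"
        proof (intro allI impI)
          fix s x assume "t0 + 1 + h - h \<le> s \<and> s \<le> t0 + 1 + h" "\<bar>x - y'\<bar> \<le> R"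
          then show "\<eta> \<le> u s x" using A by (intro \<eta>(2)[of t0 y]) auto
        qed
      qed (use A h_nonneg in auto)
    qed
  qed
  obtain t1 x0 where t1: "0 \<le> t1" "0 < u t1 x0" using positive_somewhere[OF nz] by blast
  have "isCont (u t1) x0"
  proof -
    have "continuous_on UNIV (u t1)" using t1 h_nonneg by (intro u_cont_sub[where f="\<lambda>_. t1"] continuous_intros) auto
    then show ?thesis by (simp add: continuous_on_eq_continuous_at)
  qed
  then have "eventually (\<lambda>x. u t1 x0 / 2 < u t1 x) (nhds x0)"
    using t1 order_tendstoD(1)[of "u t1" "u t1 x0" "nhds x0" "u t1 x0 / 2"] by (simp add: isCont_def tendsto_nhds_iff)
  then obtain r where r: "r > 0" "\<And>x. dist x x0 < r \<Longrightarrow> u t1 x0 / 2 < u t1 x"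
    by (auto simp: eventually_nhds_metric)
  obtain \<tau>0 where "\<forall>t0\<ge>0. \<forall>y. (\<forall>x. \<bar>x - y\<bar> \<le> r / 2 \<longrightarrow> u t1 x0 / 2 \<le> u t0 x) \<longrightarrow>
      (\<forall>y'. \<bar>y' - y\<bar> \<le> R \<longrightarrow> (\<forall>t\<ge>t0+\<tau>0. \<forall>x. \<epsilon>1 * bump R (x - y') \<le> u t x))" (is ?\<tau>0) and \<tau>0: "0 < \<tau>0"
    using transfer[of "u t1 x0 / 2" "r / 2"] t1 r by auto
  note \<tau>0' = \<open>?\<tau>0\<close>[rule_format]
  have start: "\<epsilon>1 * bump R (x - x0) \<le> u t x" if "t1 + \<tau>0 \<le> t" for t x
  proof -
    have "\<forall>x. \<bar>x - x0\<bar> \<le> r / 2 \<longrightarrow> u t1 x0 / 2 \<le> u t1 x"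
      using r by (auto simp: dist_real_def intro!: less_imp_le)
    then show ?thesis
      using \<tau>0'[of t1 x0 x0 t x] t1(1) that R by simp
  qed
  \<comment> \<open>The value of the universal bump at half its radius: each bump in the chain feeds
    the next one with the bound \<open>m\<close> on radius \<open>R / 2\<close>.\<close>
  define m where "m = \<epsilon>1 * (exp (- (1/4)) - exp (- 1))"
  have m: "0 < m" using \<epsilon>1 by (simp add: m_def)
  have bump_half: "m \<le> \<epsilon>1 * bump R x" if "\<bar>x\<bar> \<le> R / 2" for x
  proof -
    have "\<bar>x / R\<bar> \<le> \<bar>1 / 2\<bar>" using that R by (simp add: field_simps)
    then have "(x / R)\<^sup>2 \<le> (1/2)\<^sup>2" by (simp only: abs_le_square_iff)
    then show ?thesis using \<epsilon>1 by (simp add: m_def bump_def power2_eq_square)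
  qed
  obtain \<tau> where \<tau>: "0 < \<tau>" "\<And>t0 y y' t x. 0 \<le> t0 \<Longrightarrow> (\<forall>x. \<bar>x - y\<bar> \<le> R / 2 \<longrightarrow> m \<le> u t0 x) \<Longrightarrow>
      \<bar>y' - y\<bar> \<le> R \<Longrightarrow> t0 + \<tau> \<le> t \<Longrightarrow> \<epsilon>1 * bump R (x - y') \<le> u t x"
    using transfer[OF m, of "R / 2"] R by auto
  have chain: "\<epsilon>1 * bump R (x - y) \<le> u t x" if "\<bar>y - x0\<bar> \<le> real n * R" "t1 + \<tau>0 + real n * \<tau> \<le> t" for n y t x
    using that
  proof (induction n arbitrary: y t x)
    case 0
    then show ?case using start by simp
  next
    case (Suc n)
    \<comment> \<open>The last but one of \<open>Suc n\<close> equal steps on the segment from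
      \<open>x0\<close> to \<open>y\<close>, so that each step has length at most
      \<open>R\<close>.\<close>
    define y1 where "y1 = x0 + (y - x0) * (real n / real (Suc n))"
    have y1: "\<bar>y1 - x0\<bar> \<le> real n * R"
    proof -
      have "\<bar>y1 - x0\<bar> = \<bar>y - x0\<bar> * (real n / real (Suc n))" by (simp add: y1_def abs_mult)
      also have "\<dots> \<le> (real (Suc n) * R) * (real n / real (Suc n))"
        using Suc.prems by (intro mult_right_mono) auto
      also have "\<dots> = real n * R" by (simp del: of_nat_Suc)
      finally show ?thesis .
    qed
    have yy1: "\<bar>y - y1\<bar> \<le> R"
    proof -
      have "y - y1 = (y - x0) * (1 / real (Suc n))" by (simp add: y1_def field_simps)
      then have "\<bar>y - y1\<bar> = \<bar>y - x0\<bar> * (1 / real (Suc n))" by (simp add: abs_mult)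
      also have "\<dots> \<le> (real (Suc n) * R) * (1 / real (Suc n))"
        using Suc.prems by (intro mult_right_mono) auto
      finally show ?thesis by simp
    qed
    show ?case
    proof (rule \<tau>(2)[of "t1 + \<tau>0 + real n * \<tau>" y1 y])
      show "\<forall>x. \<bar>x - y1\<bar> \<le> R / 2 \<longrightarrow> m \<le> u (t1 + \<tau>0 + real n * \<tau>) x"
      proof (intro allI impI)
        fix x assume "\<bar>x - y1\<bar> \<le> R / 2"
        from bump_half[OF this] Suc.IH[OF y1 order_refl, of x] show "m \<le> u (t1 + \<tau>0 + real n * \<tau>) x" by simp
      qed
    qed (use yy1 Suc.prems t1 \<tau>0 \<tau> in \<open>auto simp: algebra_simps\<close>)
  qed
  define Y where "Y = (\<bar>x0\<bar> / R + 1) * \<tau>"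
  define T where "T = 2 * (t1 + \<tau>0 + Y)"
  have "\<epsilon>1 * (1 - exp (- 1)) \<le> u t x" if t: "T \<le> t" and x: "\<bar>x\<bar> \<le> R / (2 * \<tau>) * t" for t x
  proof -
    define n where "n = nat \<lceil>\<bar>x - x0\<bar> / R\<rceil>"
    have n1: "\<bar>x - x0\<bar> / R \<le> real n" by (simp add: n_def real_nat_ceiling_ge)
    have "real n \<le> \<bar>x - x0\<bar> / R + 1" using R by (simp add: n_def)
    also have "\<dots> \<le> \<bar>x\<bar> / R + \<bar>x0\<bar> / R + 1"
      using R divide_right_mono[OF abs_triangle_ineq4[of x x0], of R] by (simp add: add_divide_distrib)
    also have "\<bar>x\<bar> / R \<le> t / (2 * \<tau>)" using x R by (simp add: field_simps)
    finally have "real n * \<tau> \<le> (t / (2 * \<tau>) + \<bar>x0\<bar> / R + 1) * \<tau>"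
      using \<tau> by (intro mult_right_mono) auto
    also have "\<dots> = t / 2 + Y" using \<tau> by (simp add: Y_def field_simps)
    finally have "t1 + \<tau>0 + real n * \<tau> \<le> t" using t unfolding T_def
      by (simp add: field_simps)
    moreover have "\<bar>x - x0\<bar> \<le> real n * R" using n1 R by (simp add: field_simps)
    ultimately have "\<epsilon>1 * bump R (x - x) \<le> u t x" by (intro chain)
    then show ?thesis by (simp add: bump_def)
  qed
  moreover have "0 < \<epsilon>1 * (1 - exp (- 1))" "0 < R / (2 * \<tau>)" using \<epsilon>1 R \<tau> by auto
  ultimately show ?thesis by blast
qed

end

section \<open>Convergence to the upper state inside a cone\<close>

lemma exists_small_pos:
  fixes f :: "real \<Rightarrow> real"
  assumes "continuous_on UNIV f" "0 < f 0" "0 < b"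
  shows "\<exists>\<beta>>0. \<beta> \<le> b \<and> 0 < f \<beta>"
proof -
  have "(f \<longlongrightarrow> f 0) (at 0)" using assms(1) by (simp add: continuous_on_def)
  then have "eventually (\<lambda>x. 0 < f x) (at 0)" using assms(2) by (rule order_tendstoD)
  then have "eventually (\<lambda>x. 0 < f x) (at_right 0)" by (simp add: eventually_at_split)
  then obtain d where d: "0 < d" "\<And>y. 0 < y \<Longrightarrow> y < d \<Longrightarrow> 0 < f y"
    unfolding eventually_at_right[OF zero_less_one] by blast
  then have "0 < f (min (d / 2) b)" using assms(3) by (intro d) auto
  then show ?thesis using d assms(3) by (intro exI[of _ "min (d / 2) b"]) auto
qed

text \<open>The two-sided exponential pays for the unknown boundary values on \<open>\<bar>x\<bar> = c t\<close>.\<close>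
definition wedge :: "real \<Rightarrow> real \<Rightarrow> real \<Rightarrow> real \<Rightarrow> real" where
  "wedge \<beta> c t x = exp (\<beta> * (x - c * t)) + exp (\<beta> * (- x - c * t))"

lemma wedge_pos: "0 < wedge \<beta> c t x"
  by (simp add: wedge_def add_pos_pos)

lemma wedge_ge_1: "0 < \<beta> \<Longrightarrow> c * t \<le> \<bar>x\<bar> \<Longrightarrow> 1 \<le> wedge \<beta> c t x"
proof -
  assume "0 < \<beta>" "c * t \<le> \<bar>x\<bar>"
  then have "1 \<le> exp (\<beta> * (x - c * t)) \<or> 1 \<le> exp (\<beta> * (- x - c * t))"
    by (cases "0 \<le> x") auto
  moreover have "0 < exp (\<beta> * (x - c * t))" "0 < exp (\<beta> * (- x - c * t))" by auto
  ultimately show ?thesis unfolding wedge_def by linarith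
qed

lemma wedge_le:
  assumes "0 < \<beta>" "\<bar>x\<bar> \<le> c / 2 * t" shows "wedge \<beta> c t x \<le> 2 * exp (- (\<beta> * c / 2 * t))"
proof -
  have "\<beta> * (x - c * t) \<le> \<beta> * (- (c / 2 * t))" "\<beta> * (- x - c * t) \<le> \<beta> * (- (c / 2 * t))"
    using assms by (intro mult_left_mono; simp; linarith)+
  then have "exp (\<beta> * (x - c * t)) \<le> exp (\<beta> * (- (c / 2 * t)))" "exp (\<beta> * (- x - c * t)) \<le> exp (\<beta> * (- (c / 2 * t)))"
    by simp_all
  moreover have "\<beta> * (- (c / 2 * t)) = - (\<beta> * c / 2 * t)" by simp
  ultimately show ?thesis unfolding wedge_def by (simp only:)
qed

lemma wedge_deriv_t: "((\<lambda>t. wedge \<beta> c t x) has_real_derivative - (\<beta> * c * wedge \<beta> c t x)) (at t)"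
  unfolding wedge_def by (auto intro!: derivative_eq_intros simp: algebra_simps)

lemma wedge_deriv_x:
  "(wedge \<beta> c t has_real_derivative \<beta> * (exp (\<beta> * (x - c * t)) - exp (\<beta> * (- x - c * t)))) (at x)"
  unfolding wedge_def by (auto intro!: derivative_eq_intros simp: algebra_simps)

lemma wedge_deriv_xx:
  "((\<lambda>x. \<beta> * (exp (\<beta> * (x - c * t)) - exp (\<beta> * (- x - c * t)))) has_real_derivative \<beta>\<^sup>2 * wedge \<beta> c t x) (at x)"
  unfolding wedge_def by (auto intro!: derivative_eq_intros simp: algebra_simps power2_eq_square)

lemma wedge_shift: "wedge \<beta> c (t - h) x = exp (\<beta> * c * h) * wedge \<beta> c t x"
  by (simp add: wedge_def distrib_left algebra_simps flip: exp_add)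

lemma continuous_on_wedge:
  "continuous_on S f \<Longrightarrow> continuous_on S k \<Longrightarrow> continuous_on S (\<lambda>p. wedge \<beta> c (f p) (k p))"
  unfolding wedge_def by (intro continuous_intros)

context solution
begin

definition spreads_to :: "real \<Rightarrow> bool" where
  "spreads_to m \<longleftrightarrow> (\<exists>c>0. \<exists>T. \<forall>t\<ge>T. \<forall>x. \<bar>x\<bar> \<le> c * t \<longrightarrow> m \<le> u t x)"

text \<open>A common form of the two barriers used on the cone: they lie below \<open>u\<close> as soon as the
  differential inequality holds in the interior of the cone.\<close>
lemma cone_barrier:
  assumes c: "0 < c" and A: "0 \<le> A" and \<gamma>: "0 < \<gamma>" and \<beta>: "0 < \<beta>" and T': "0 \<le> T'"
    and ineq: "\<And>t x. T' < t \<Longrightarrow> \<bar>x\<bar> \<le> c * t \<Longrightarrow>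
      \<gamma> * A * exp (- \<gamma> * (t - T')) + A * \<beta> * c * wedge \<beta> c t x \<le>
        - A * \<beta>\<^sup>2 * wedge \<beta> c t x - (A - A * exp (- \<gamma> * (t - T')) - A * wedge \<beta> c t x) + g (u (t - h) x)
        + L * max 0 (A - A * exp (- \<gamma> * (t - h - T')) - A * wedge \<beta> c (t - h) x - u (t - h) x)"
    and t: "T' - h \<le> t"
  shows "A - A * exp (- \<gamma> * (t - T')) - A * wedge \<beta> c t x \<le> u t x"
proof -
  define b where "b = (\<lambda>t x. A - A * exp (- \<gamma> * (t - T')) - A * wedge \<beta> c t x)"
  define Te where "Te = max t T'"
  have "b t x \<le> u t x"
  proof (rule lower_barrier[OF T' _ _ _ _ t, where T=Te and B=A])
    show "continuous_on ({T' - h..Te} \<times> UNIV) (\<lambda>(t, x). b t x)"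
      unfolding b_def case_prod_unfold by (intro continuous_intros continuous_on_wedge)
    show "b t x \<le> A" for t x
    proof -
      have "0 \<le> A * wedge \<beta> c t x" "0 \<le> A * exp (- \<gamma> * (t - T'))" using A wedge_pos[of \<beta> c t x] by auto
      then show ?thesis unfolding b_def by linarith
    qed
    show "b t x \<le> u t x" if "T' - h \<le> t" "t \<le> T'" for t x
    proof -
      have "1 \<le> exp (- \<gamma> * (t - T'))" using that \<gamma> by (simp add: mult_nonneg_nonpos)
      then have "A * 1 \<le> A * exp (- \<gamma> * (t - T'))" using A by (intro mult_left_mono) auto
      moreover have "0 \<le> A * wedge \<beta> c t x" using A wedge_pos[of \<beta> c t x] by simp
      ultimately have "b t x \<le> 0" unfolding b_def by linarith
      then show ?thesis using u_nonneg[of t x] that T' by simp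
    qed
    fix t x assume t: "T' < t" "t \<le> Te" and lt: "u t x < b t x"
    have bp: "0 < b t x" using lt u_nonneg[of t x] t T' h_nonneg by force
    have "\<bar>x\<bar> \<le> c * t"
    proof (rule ccontr)
      assume "\<not> ?thesis"
      then have "A * 1 \<le> A * wedge \<beta> c t x" using A wedge_ge_1[OF \<beta>, of c t x] by (intro mult_left_mono) auto
      moreover have "0 \<le> A * exp (- \<gamma> * (t - T'))" using A by simp
      ultimately show False using bp unfolding b_def by linarith
    qed
    show "\<exists>bt bx bxx. ((\<lambda>\<tau>. b \<tau> x) has_real_derivative bt) (at t) \<and>
          (\<forall>y. (b t has_real_derivative bx y) (at y)) \<and> (bx has_real_derivative bxx) (at x) \<and>
          bt \<le> bxx - b t x + g (u (t - h) x) + L * max 0 (b (t - h) x - u (t - h) x)"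
    proof (intro exI conjI allI)
      show "((\<lambda>\<tau>. b \<tau> x) has_real_derivative (\<gamma> * A * exp (- \<gamma> * (t - T')) + A * \<beta> * c * wedge \<beta> c t x)) (at t)"
        unfolding b_def by (auto intro!: derivative_eq_intros wedge_deriv_t simp: algebra_simps)
      show "(b t has_real_derivative - A * (\<beta> * (exp (\<beta> * (y - c * t)) - exp (\<beta> * (- y - c * t))))) (at y)" for y
        unfolding b_def by (rule derivative_eq_intros wedge_deriv_x refl | simp)+
      show "((\<lambda>y. - A * (\<beta> * (exp (\<beta> * (y - c * t)) - exp (\<beta> * (- y - c * t))))) has_real_derivative - A * (\<beta>\<^sup>2 * wedge \<beta> c t x)) (at x)"
        by (intro DERIV_cmult wedge_deriv_xx)
      show "\<gamma> * A * exp (- \<gamma> * (t - T')) + A * \<beta> * c * wedge \<beta> c t x \<le> - A * (\<beta>\<^sup>2 * wedge \<beta> c t x) - b t x + g (u (t - h) x)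
          + L * max 0 (b (t - h) x - u (t - h) x)"
        using ineq[OF t(1) \<open>\<bar>x\<bar> \<le> c * t\<close>] unfolding b_def by (simp add: mult.assoc)
    qed
  qed (auto simp: Te_def)
  then show ?thesis by (simp add: b_def)
qed

text \<open>Halving the opening speed pays for the delay: from time \<open>2 * h\<close> on, a point
  of the narrow cone lay in the wide one already one delay earlier.\<close>

lemma cone_time:
  assumes "0 < c" "\<And>t x. T \<le> t \<Longrightarrow> \<bar>x\<bar> \<le> c * t \<Longrightarrow> P t x"
    and "max (T + h) (2 * h) < t" "\<bar>x\<bar> \<le> c / 2 * t"
  shows "P (t - h) x"
proof (rule assms(2))
  show "T \<le> t - h" using assms by simp
  have "c / 2 * t \<le> c * (t - h)"
    using assms mult_left_mono[of "2 * h" t "c / 2"] by (simp add: field_simps)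
  then show "\<bar>x\<bar> \<le> c * (t - h)" using assms(4) by linarith
qed

text \<open>Where the delayed values are at least \<open>m\<close>, the reaction is at least
  \<open>g m\<close>, and the linear equation relaxes to that level at rate 1. The cone barrier with
  \<open>A = g m\<close> follows this relaxation. The opening speed shrinks to a quarter, which is
  harmless because only some positive speed is claimed.\<close>

lemma spreads_to_step:
  assumes m: "0 \<le> m" "spreads_to m" and m': "m' < g m"
  shows "spreads_to m'"
proof -
  obtain c T where c: "0 < c" and T: "\<And>t x. T \<le> t \<Longrightarrow> \<bar>x\<bar> \<le> c * t \<Longrightarrow> m \<le> u t x"
    using m(2) by (auto simp: spreads_to_def)
  define c' where "c' = c / 2"
  have c': "0 < c'" using c by (simp add: c'_def)
  define T' where "T' = max 0 (max (T + h) (2 * h))"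
  \<comment> \<open>This sign makes \<open>wedge\<close> a supersolution of the linear equation with
    decay rate 1, so that subtracting it preserves the lower barrier.\<close>
  have "\<exists>\<beta>>0. \<beta> \<le> 1 \<and> 0 < 1 - \<beta> * c' - \<beta>\<^sup>2"
    by (intro exists_small_pos continuous_intros) auto
  then obtain \<beta> where \<beta>: "0 < \<beta>" "0 < 1 - \<beta> * c' - \<beta>\<^sup>2" by blast
  define A where "A = g m"
  have A: "0 \<le> A" using g_nonneg m(1) by (simp add: A_def)
  have low: "A - A * exp (- 1 * (t - T')) - A * wedge \<beta> c' t x \<le> u t x" if t: "T' - h \<le> t" for t x
  proof (rule cone_barrier[OF c' A _ \<beta>(1) _ _ t])
    fix t x assume t: "T' < t" and x: "\<bar>x\<bar> \<le> c' * t"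
    have "m \<le> u (t - h) x" using cone_time[OF c T, where t=t and x=x] t x by (auto simp: T'_def c'_def)
    then have "A \<le> g (u (t - h) x)" unfolding A_def by (rule g_mono)
    moreover have "0 \<le> A * wedge \<beta> c' t x * (1 - \<beta> * c' - \<beta>\<^sup>2)" using A \<beta> wedge_pos[of \<beta> c' t x] by simp
    moreover have "0 \<le> L * max 0 (A - A * exp (- 1 * (t - h - T')) - A * wedge \<beta> c' (t - h) x - u (t - h) x)"
      using L_ge_1 by simp
    ultimately show "1 * A * exp (- 1 * (t - T')) + A * \<beta> * c' * wedge \<beta> c' t x
           \<le> - A * \<beta>\<^sup>2 * wedge \<beta> c' t x - (A - A * exp (- 1 * (t - T')) - A * wedge \<beta> c' t x) + g (u (t - h) x)
              + L * max 0 (A - A * exp (- 1 * (t - h - T')) - A * wedge \<beta> c' (t - h) x - u (t - h) x)"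
      by (simp add: algebra_simps)
  qed (auto simp: T'_def)
  have "((\<lambda>t. A - A * exp (- 1 * (t - T')) - A * (2 * exp (- (\<beta> * c' / 2 * t)))) \<longlongrightarrow> A - A * 0 - A * (2 * 0)) at_top"
  proof (intro tendsto_intros filterlim_compose[OF exp_at_bot])
    show "LIM t at_top. - 1 * (t - T') :> at_bot"
      by (simp add: filterlim_uminus_at_bot) (rule filterlim_tendsto_add_at_top[OF tendsto_const filterlim_ident, of "-T'", simplified])
    show "LIM t at_top. - (\<beta> * c' / 2 * t) :> at_bot"
      unfolding filterlim_uminus_at_bot minus_minus using \<beta> c'
      by (intro filterlim_tendsto_pos_mult_at_top[OF tendsto_const _ filterlim_ident]) auto
  qed
  then have "eventually (\<lambda>t. m' < A - A * exp (- 1 * (t - T')) - A * (2 * exp (- (\<beta> * c' / 2 * t)))) at_top"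
    using m' by (intro order_tendstoD(1)[of _ A]) (auto simp: A_def)
  then obtain T2 where T2: "\<And>t. T2 \<le> t \<Longrightarrow> m' < A - A * exp (- 1 * (t - T')) - A * (2 * exp (- (\<beta> * c' / 2 * t)))"
    unfolding eventually_at_top_linorder by blast
  have "m' \<le> u t x" if t: "max T2 T' \<le> t" and x: "\<bar>x\<bar> \<le> c' / 2 * t" for t x
  proof -
    have "A * wedge \<beta> c' t x \<le> A * (2 * exp (- (\<beta> * c' / 2 * t)))"
      using A wedge_le[OF \<beta>(1) x] by (intro mult_left_mono)
    then show ?thesis using T2[of t] low[of t x] t h_nonneg by simp
  qed
  then show ?thesis unfolding spreads_to_def using c' by (intro exI[of _ "c' / 2"] exI[of _ "max T2 T'"] conjI) auto
qed

text \<open>The supremum of the levels to which \<open>u\<close> spreads cannot be below \<kappa>: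
  by continuity \<open>g\<close> maps levels slightly below it to levels above it, and
  \<open>spreads_to_step\<close> would exceed the supremum.\<close>

lemma spreads_to_below_kappa:
  assumes nz: "\<exists>s\<in>{-h..0}. \<exists>x. u s x \<noteq> 0" and m: "m < \<kappa>"
  shows "spreads_to m"
proof -
  obtain m0 where m0: "0 < m0" "spreads_to m0"
    using linear_spreading[OF nz] unfolding spreads_to_def by blast
  have le: "m \<le> \<kappa>" if "spreads_to m" for m
  proof -
    obtain c T where c: "0 < c" and T: "\<And>t x. T \<le> t \<Longrightarrow> \<bar>x\<bar> \<le> c * t \<Longrightarrow> m \<le> u t x"
      using \<open>spreads_to m\<close> by (auto simp: spreads_to_def)
    have "m \<le> u (max T 0) 0" using c by (intro T) auto
    also have "\<dots> \<le> \<kappa>" using h_nonneg by (intro u_le_kappa) auto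
    finally show ?thesis .
  qed
  have anti: "spreads_to m2" if "spreads_to m1" "m2 \<le> m1" for m1 m2
    using that unfolding spreads_to_def by (meson order_trans)
  define mm where "mm = Sup {m. spreads_to m}"
  have bdd: "bdd_above {m. spreads_to m}" using le by (auto intro: bdd_aboveI[of _ \<kappa>])
  have mm0: "m0 \<le> mm" unfolding mm_def using m0 bdd by (intro cSup_upper) auto
  have mmk: "mm \<le> \<kappa>" unfolding mm_def using m0 le by (intro cSup_least) auto
  have "mm = \<kappa>"
  proof (rule ccontr)
    assume "mm \<noteq> \<kappa>"
    then have "mm < g mm" using mm0 mmk m0 by (intro g_above) auto
    moreover have "(g \<longlongrightarrow> g mm) (at_left mm)" using isCont_g[of mm] by (simp add: isCont_def filterlim_at_split)
    ultimately have "eventually (\<lambda>x. mm < g x) (at_left mm)" by (metis order_tendstoD(1))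
    then obtain b where b: "b < mm" "\<And>y. b < y \<Longrightarrow> y < mm \<Longrightarrow> mm < g y"
      unfolding eventually_at_left[of 0 mm, OF order.strict_trans2[OF m0(1) mm0]] by blast
    have "max b 0 < mm" using b mm0 m0 by simp
    then obtain m1 where m1: "spreads_to m1" "max b 0 < m1"
      using less_cSup_iff[of "{m. spreads_to m}" "max b 0"] m0 bdd unfolding mm_def by blast
    \<comment> \<open>A level below the attained \<open>m1\<close>, hence attained, and close enough
      to the supremum that \<open>g\<close> carries it beyond.\<close>
    define m2 where "m2 = (max b 0 + min m1 mm) / 2"
    have m2: "b < m2" "0 \<le> m2" "m2 < mm" "m2 \<le> m1" using m1 \<open>max b 0 < mm\<close> by (auto simp: m2_def)
    have "spreads_to ((mm + g m2) / 2)"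
      using b(2)[of m2] m2 by (intro spreads_to_step[OF m2(2) anti[OF m1(1) m2(4)]]) auto
    then have "(mm + g m2) / 2 \<le> mm" unfolding mm_def using bdd by (intro cSup_upper) auto
    then show False using b(2)[of m2] m2 by simp
  qed
  then show ?thesis using less_cSup_iff[of "{m. spreads_to m}" m] m m0 bdd anti unfolding mm_def
    by (metis (mono_tags, lifting) empty_iff mem_Collect_eq less_imp_le)
qed

text \<open>Once \<open>u\<close> exceeds \<open>\<kappa> - \<delta>\<close> on a cone, the slope
  \<rho> < 1 contracts the distance to \<kappa>, while on the axis the unknown values outside the
  cone are damped exponentially by the wedge. The result supplies the boundary values at
  \<open>x = 0\<close> for lower barriers on the half-line.\<close>

lemma kappa_exponentially:
  assumes nz: "\<exists>s\<in>{-h..0}. \<exists>x. u s x \<noteq> 0"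
  obtains C \<gamma> T where "0 < C" "0 < \<gamma>" "\<And>t. T \<le> t \<Longrightarrow> \<kappa> - C * exp (- \<gamma> * t) \<le> u t 0"
proof -
  obtain c T where c: "0 < c" and T: "\<And>t x. T \<le> t \<Longrightarrow> \<bar>x\<bar> \<le> c * t \<Longrightarrow> \<kappa> - \<delta> \<le> u t x"
    using spreads_to_below_kappa[OF nz, of "\<kappa> - \<delta>"] delta by (auto simp: spreads_to_def)
  define c' where "c' = c / 2"
  have c': "0 < c'" using c by (simp add: c'_def)
  define T' where "T' = max 0 (max (T + h) (2 * h))"
  \<comment> \<open>One delay magnifies the wedge by \<open>exp (\<beta> * c' * h)\<close> and the
    time factor by \<open>exp (\<gamma> * h)\<close>; small exponents keep the contraction by \<rho>
    effective.\<close>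
  have "\<exists>\<beta>>0. \<beta> \<le> 1 \<and> 0 < 1 - \<beta> * c' - \<beta>\<^sup>2 - \<rho> * exp (\<beta> * c' * h)"
    by (intro exists_small_pos continuous_intros) (use rho in auto)
  then obtain \<beta> where \<beta>: "0 < \<beta>" "0 < 1 - \<beta> * c' - \<beta>\<^sup>2 - \<rho> * exp (\<beta> * c' * h)" by blast
  have "\<exists>\<gamma>>0. \<gamma> \<le> 1 \<and> 0 < 1 - \<gamma> - \<rho> * exp (\<gamma> * h)"
    by (intro exists_small_pos continuous_intros) (use rho in auto)
  then obtain \<gamma> where \<gamma>: "0 < \<gamma>" "0 < 1 - \<gamma> - \<rho> * exp (\<gamma> * h)" by blast
  have low: "\<kappa> - \<kappa> * exp (- \<gamma> * (t - T')) - \<kappa> * wedge \<beta> c' t x \<le> u t x" if t: "T' - h \<le> t" for t x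
  proof (rule cone_barrier[OF c' less_imp_le[OF kappa_pos] \<gamma>(1) \<beta>(1) _ _ t])
    fix t x assume t: "T' < t" and x: "\<bar>x\<bar> \<le> c' * t"
    let ?E = "exp (- \<gamma> * (t - T'))" and ?W = "wedge \<beta> c' t x"
    let ?b = "\<kappa> - \<kappa> * exp (- \<gamma> * (t - h - T')) - \<kappa> * wedge \<beta> c' (t - h) x"
    have "\<kappa> - \<delta> \<le> u (t - h) x" using cone_time[OF c T, where t=t and x=x] t x by (auto simp: T'_def c'_def)
    moreover have "u (t - h) x \<le> \<kappa>" using t by (intro u_le_kappa) (auto simp: T'_def)
    ultimately have "g \<kappa> - g (u (t - h) x) \<le> \<rho> * (\<kappa> - u (t - h) x)" by (intro g_near_kappa)
    then have 1: "\<kappa> - \<rho> * (\<kappa> - ?b) - \<rho> * (?b - u (t - h) x) \<le> g (u (t - h) x)"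
      by (simp add: g_kappa algebra_simps)
    have "\<rho> * (?b - u (t - h) x) \<le> \<rho> * max 0 (?b - u (t - h) x)"
      using rho by (intro mult_left_mono) auto
    also have "\<dots> \<le> L * max 0 (?b - u (t - h) x)"
      using rho L_ge_1 by (intro mult_right_mono) auto
    finally have 2: "\<rho> * (?b - u (t - h) x) \<le> L * max 0 (?b - u (t - h) x)" .
    have "\<kappa> - ?b = \<kappa> * (exp (\<gamma> * h) * ?E) + \<kappa> * (exp (\<beta> * c' * h) * ?W)"
      unfolding wedge_shift by (simp add: algebra_simps flip: exp_add)
    then have 3: "\<rho> * (\<kappa> - ?b) = \<kappa> * ?E * (\<rho> * exp (\<gamma> * h)) + \<kappa> * ?W * (\<rho> * exp (\<beta> * c' * h))"
      by (simp add: algebra_simps)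
    have 4: "0 \<le> \<kappa> * ?E * (1 - \<gamma> - \<rho> * exp (\<gamma> * h))" using \<gamma> kappa_pos by simp
    have 5: "0 \<le> \<kappa> * ?W * (1 - \<beta> * c' - \<beta>\<^sup>2 - \<rho> * exp (\<beta> * c' * h))"
      using \<beta> kappa_pos wedge_pos[of \<beta> c' t x] by simp
    have "\<gamma> * \<kappa> * ?E + \<kappa> * \<beta> * c' * ?W \<le> - \<kappa> * \<beta>\<^sup>2 * ?W - (\<kappa> - \<kappa> * ?E - \<kappa> * ?W) + (\<kappa> - \<rho> * (\<kappa> - ?b))"
      using 4 5 unfolding 3 by (simp add: algebra_simps)
    then show "\<gamma> * \<kappa> * ?E + \<kappa> * \<beta> * c' * ?W \<le> - \<kappa> * \<beta>\<^sup>2 * ?W - (\<kappa> - \<kappa> * ?E - \<kappa> * ?W) + g (u (t - h) x)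
          + L * max 0 (?b - u (t - h) x)"
      using 1 2 by linarith
  qed (auto simp: T'_def)
  define \<gamma>' where "\<gamma>' = min \<gamma> (\<beta> * c')"
  have \<gamma>': "0 < \<gamma>'" "\<gamma>' \<le> \<gamma>" "\<gamma>' \<le> \<beta> * c'" using \<gamma> \<beta> c' by (auto simp: \<gamma>'_def)
  show thesis
  proof (rule that[of "\<kappa> * (exp (\<gamma> * T') + 2)" \<gamma>' T'])
    show "0 < \<kappa> * (exp (\<gamma> * T') + 2)" using kappa_pos by (simp add: add_pos_pos)
    fix t assume t: "T' \<le> t"
    then have t0: "0 \<le> t" by (simp add: T'_def)
    have "exp (- \<gamma> * (t - T')) = exp (\<gamma> * T') * exp (- \<gamma> * t)"
      by (simp add: algebra_simps flip: exp_add)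
    also have "\<dots> \<le> exp (\<gamma> * T') * exp (- \<gamma>' * t)"
      using \<gamma>' t0 by (intro mult_left_mono) (auto intro: mult_right_mono)
    finally have 1: "\<kappa> * exp (- \<gamma> * (t - T')) \<le> \<kappa> * (exp (\<gamma> * T') * exp (- \<gamma>' * t))"
      using kappa_pos by (intro mult_left_mono) auto
    have "wedge \<beta> c' t 0 = 2 * exp (- (\<beta> * c') * t)" by (simp add: wedge_def)
    also have "\<dots> \<le> 2 * exp (- \<gamma>' * t)" using \<gamma>' t0 by (auto intro: mult_right_mono)
    finally have 2: "\<kappa> * wedge \<beta> c' t 0 \<le> \<kappa> * (2 * exp (- \<gamma>' * t))"
      using kappa_pos by (intro mult_left_mono) auto
    show "\<kappa> - \<kappa> * (exp (\<gamma> * T') + 2) * exp (- \<gamma>' * t) \<le> u t 0"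
      using 1 2 low[of t 0] t h_nonneg by (simp add: algebra_simps)
  qed (use \<gamma>' in auto)
qed

end

section \<open>Modulus of continuity in space\<close>

context solution
begin

text \<open>Doubling of variables: \<open>u t x - u t y\<close> solves a heat equation along the direction \<open>(1, -1)\<close>,
  where a strictly concave function of \<open>\<bar>x - y\<bar>\<close> is a barrier.\<close>
lemma u_modulus:
  assumes t: "0 \<le> t"
  shows "u t x - u t y \<le> 2 * \<kappa> * \<bar>x - y\<bar> + 2 * \<kappa> * exp (- 2 * t)"
proof -
  \<comment> \<open>Along \<open>(1, -1)\<close> the distance \<open>r\<close> changes at rate 2.
    Concavity of the two summands therefore yields \<open>8 * \<kappa>\<close> and
    \<open>4 * \<kappa> * exp (- 2 * t)\<close>, against a source of at most
    \<open>2 * \<kappa>\<close> and a loss of the latter size from the decay in time. The second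
    summand dominates arbitrary initial data at time 0 and then dies out.\<close>
  define \<Psi> where "\<Psi> = (\<lambda>t r. \<kappa> * (2 * r - r\<^sup>2) + 2 * \<kappa> * exp (- 2 * t) * (1 - r\<^sup>2 / 4))"
  define d where "d = (\<lambda>t p. u t (fst p) - u t (snd p) - \<Psi> t (min \<bar>fst p - snd p\<bar> 1))"
  have ub: "0 \<le> u t x" "u t x \<le> \<kappa>" if "0 \<le> t" for t x
    using that h_nonneg by (auto intro!: u_nonneg u_le_kappa)
  have sq: "r\<^sup>2 \<le> r" if "0 \<le> r" "r \<le> 1" for r :: real
    using mult_left_mono[OF that(2,1)] by (simp add: power2_eq_square)
  have \<Psi>_nonneg: "0 \<le> \<Psi> t r" if "0 \<le> r" "r \<le> 1" for t r
    unfolding \<Psi>_def using kappa_pos sq[OF that] that by (intro add_nonneg_nonneg mult_nonneg_nonneg) auto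
  have "d t (x, y) \<le> 0"
  proof (rule max_principle[where d=d and e="(1, -1)" and h=0 and L=0 and ?t0.0=0 and T=t and M=\<kappa>])
    show "continuous_on ({0 - 0..t} \<times> UNIV) (\<lambda>(t, p). d t p)"
      unfolding d_def \<Psi>_def case_prod_unfold using h_nonneg
      by (intro continuous_intros u_cont_sub) auto
    show "d t p \<le> \<kappa>" if "0 - 0 \<le> t" for t p
      using ub[of t "fst p"] ub[of t "snd p"] that \<Psi>_nonneg[of "min \<bar>fst p - snd p\<bar> 1" t]
      unfolding d_def by simp
    show "d t p \<le> 0" if "0 - 0 \<le> t" "t \<le> 0" for t p
    proof -
      have t0: "t = 0" using that by simp
      define r where "r = min \<bar>fst p - snd p\<bar> 1"
      have r: "0 \<le> r" "r \<le> 1" by (auto simp: r_def)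
      have "\<kappa> * 1 \<le> \<kappa> * (2 * r - r\<^sup>2 + 2 * (1 - r\<^sup>2 / 4))"
        using kappa_pos sq[OF r] r by (intro mult_left_mono) auto
      also have "\<dots> = \<Psi> t r" by (simp add: \<Psi>_def t0 algebra_simps)
      finally show ?thesis using ub[of 0 "fst p"] ub[of 0 "snd p"] by (simp add: d_def t0 flip: r_def)
    qed
    fix t p assume t: "0 < t" and pos: "0 < d t p"
    obtain x y where p: "p = (x, y)" by (cases p)
    define \<rho>0 where "\<rho>0 = \<bar>x - y\<bar>"
    define \<sigma> where "\<sigma> = sgn (x - y)"
    define E where "E = \<kappa> * exp (- 2 * t)"
    have E: "0 < E" using kappa_pos by (simp add: E_def)
    \<comment> \<open>Both kinks of \<open>min \<bar>x - y\<bar> 1\<close> lie where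
      \<open>d\<close> is not positive: at distance at least 1 because \<Psi> exceeds \<kappa>
      there, and on the diagonal because the two values of \<open>u\<close> cancel.\<close>
    have "\<rho>0 < 1"
    proof (rule ccontr)
      assume "\<not> \<rho>0 < 1"
      then have "d t p = u t x - u t y - (\<kappa> + 2 * E * (1 - 1/4))" by (simp add: d_def p \<Psi>_def E_def flip: \<rho>0_def)
      then show False using pos ub[of t x] ub[of t y] t E by simp
    qed
    have "\<rho>0 \<noteq> 0"
    proof
      assume "\<rho>0 = 0"
      then have "d t p = - 2 * E" by (simp add: d_def p \<Psi>_def E_def \<rho>0_def)
      then show False using pos E by simp
    qed
    then have \<rho>0: "0 < \<rho>0" "\<rho>0 < 1" "\<sigma> * \<sigma> = 1" "\<rho>0 = \<sigma> * (x - y)" "\<bar>\<sigma>\<bar> = 1"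
      using \<open>\<rho>0 < 1\<close> by (auto simp: \<rho>0_def \<sigma>_def sgn_if)
    define r where "r = min \<rho>0 (1 - \<rho>0) / 2"
    have r: "0 < r" "2 * r \<le> \<rho>0" "2 * r \<le> 1 - \<rho>0" using \<rho>0 by (auto simp: r_def)
    have abs_eq: "\<bar>(x + s) - (y - s)\<bar> = \<rho>0 + 2 * \<sigma> * s" "\<rho>0 + 2 * \<sigma> * s \<le> 1" if "\<bar>s\<bar> < r" for s
    proof -
      have "\<bar>\<sigma> * s\<bar> < r" using that \<rho>0 by (simp add: abs_mult)
      then have s: "0 < \<rho>0 + 2 * \<sigma> * s" "\<rho>0 + 2 * \<sigma> * s < 1" using r by auto
      have "\<rho>0 + 2 * \<sigma> * s = \<sigma> * ((x + s) - (y - s))" using \<rho>0 by (simp add: algebra_simps)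
      then have "\<bar>\<rho>0 + 2 * \<sigma> * s\<bar> = \<bar>\<sigma>\<bar> * \<bar>(x + s) - (y - s)\<bar>" by (simp add: abs_mult)
      then show "\<bar>(x + s) - (y - s)\<bar> = \<rho>0 + 2 * \<sigma> * s" "\<rho>0 + 2 * \<sigma> * s \<le> 1" using s \<rho>0 by auto
    qed
    define dx where "dx = (\<lambda>s. ux t (x + s) + ux t (y - s) - 2 * \<sigma> * (\<kappa> * (2 - 2 * (\<rho>0 + 2 * \<sigma> * s)) - E * (\<rho>0 + 2 * \<sigma> * s)))"
    show "\<exists>dt dx dxx r. r > 0 \<and> ((\<lambda>\<tau>. d \<tau> p) has_real_derivative dt) (at t) \<and>
          (\<forall>s. \<bar>s\<bar> < r \<longrightarrow> ((\<lambda>s. d t (p + s *\<^sub>R (1, -1))) has_real_derivative dx s) (at s)) \<and>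
          (dx has_real_derivative dxx) (at 0) \<and>
          dt \<le> dxx + 0 * (d t p + max 0 (d (t - 0) p))"
    proof (intro exI conjI allI impI)
      show "0 < r" by fact
      show "((\<lambda>\<tau>. d \<tau> p) has_real_derivative (ut t x - ut t y + 4 * E * (1 - \<rho>0\<^sup>2 / 4))) (at t)"
      proof -
        have "(\<lambda>\<tau>. d \<tau> p) = (\<lambda>\<tau>. u \<tau> x - u \<tau> y - \<Psi> \<tau> \<rho>0)" using \<open>\<rho>0 < 1\<close> by (auto simp: d_def p \<rho>0_def)
        then show ?thesis unfolding \<Psi>_def E_def
          by (auto intro!: derivative_eq_intros u_t t)
      qed
      show "((\<lambda>s. d t (p + s *\<^sub>R (1, -1))) has_real_derivative dx s) (at s)" if s: "\<bar>s\<bar> < r" for s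
      proof (rule has_field_derivative_transform_within_open[where S="{-r<..<r}"])
        have 1: "((\<lambda>s. u t (x + s)) has_real_derivative ux t (x + s) * 1) (at s)"
          by (rule DERIV_chain2[OF u_x[OF t]]) (auto intro!: derivative_eq_intros)
        have 2: "((\<lambda>s. u t (y - s)) has_real_derivative ux t (y - s) * (- 1)) (at s)"
          by (rule DERIV_chain2[OF u_x[OF t]]) (auto intro!: derivative_eq_intros)
        have 3: "((\<lambda>s. \<Psi> t (\<rho>0 + 2 * \<sigma> * s)) has_real_derivative
          2 * \<sigma> * (\<kappa> * (2 - 2 * (\<rho>0 + 2 * \<sigma> * s)) - E * (\<rho>0 + 2 * \<sigma> * s))) (at s)"
          unfolding \<Psi>_def E_def
          by (auto intro!: derivative_eq_intros simp: algebra_simps power2_eq_square)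
        show "((\<lambda>s. u t (x + s) - u t (y - s) - \<Psi> t (\<rho>0 + 2 * \<sigma> * s)) has_real_derivative dx s) (at s)"
          using DERIV_diff[OF DERIV_diff[OF 1 2] 3] by (simp add: dx_def)
        show "u t (x + s) - u t (y - s) - \<Psi> t (\<rho>0 + 2 * \<sigma> * s) = d t (p + s *\<^sub>R (1, -1))" if "s \<in> {-r<..<r}" for s
        proof -
          have "min \<bar>(x + s) - (y - s)\<bar> 1 = \<rho>0 + 2 * \<sigma> * s" using abs_eq[of s] that by auto
          then show ?thesis by (simp add: d_def p)
        qed
      qed (use s in auto)
      show "(dx has_real_derivative (uxx t x - uxx t y + 8 * \<kappa> + 4 * E)) (at 0)"
      proof -
        have 1: "((\<lambda>s. ux t (x + s)) has_real_derivative uxx t x * 1) (at 0)"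
          by (rule DERIV_chain2[where f="ux t" and g="\<lambda>s. x + s"]) (use u_xx[OF t, of x] in \<open>auto intro!: derivative_eq_intros\<close>)
        have 2: "((\<lambda>s. ux t (y - s)) has_real_derivative uxx t y * (- 1)) (at 0)"
          by (rule DERIV_chain2[where f="ux t" and g="\<lambda>s. y - s"]) (use u_xx[OF t, of y] in \<open>auto intro!: derivative_eq_intros\<close>)
        have 3: "((\<lambda>s. 2 * \<sigma> * (\<kappa> * (2 - 2 * (\<rho>0 + 2 * \<sigma> * s)) - E * (\<rho>0 + 2 * \<sigma> * s))) has_real_derivative
           (\<sigma> * \<sigma>) * (- 8 * \<kappa> - 4 * E)) (at 0)"
          by (auto intro!: derivative_eq_intros simp: algebra_simps)
        show ?thesis unfolding dx_def
          by (rule DERIV_cong[OF DERIV_diff[OF DERIV_add[OF 1 2] 3]]) (simp add: \<rho>0(3))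
      qed
      have "g (u (t - h) x) \<le> \<kappa>" using g_mono[OF u_le_kappa, of "t - h" x] t by (simp add: g_kappa)
      moreover have "0 \<le> g (u (t - h) y)" using t by (intro g_nonneg u_nonneg) simp
      ultimately have "ut t x - ut t y \<le> uxx t x - uxx t y + 2 * \<kappa>"
        using u_eq[OF t, of x] u_eq[OF t, of y] ub[of t x] ub[of t y] t by simp
      moreover have "4 * E * (1 - \<rho>0\<^sup>2 / 4) \<le> 4 * E * 1" using E by (intro mult_left_mono) auto
      ultimately show "ut t x - ut t y + 4 * E * (1 - \<rho>0\<^sup>2 / 4) \<le> uxx t x - uxx t y + 8 * \<kappa> + 4 * E + 0 * (d t p + max 0 (d (t - 0) p))"
        using kappa_pos by simp
    qed
  qed (use t in auto)
  then have "u t x - u t y \<le> \<Psi> t (min \<bar>x - y\<bar> 1)" by (simp add: d_def)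
  also have "\<dots> \<le> \<kappa> * (2 * \<bar>x - y\<bar>) + 2 * \<kappa> * exp (- 2 * t) * 1"
    unfolding \<Psi>_def using kappa_pos by (intro add_mono mult_left_mono) (auto simp: min_def)
  finally show ?thesis by simp
qed

end

section \<open>The logistic weight\<close>

text \<open>The smooth substitute for \<open>min (exp (lam * z)) 1\<close>. Its derivatives are
  polynomials in the function itself, so differential inequalities near the two ends reduce to the
  continuity of one polynomial at 0 and at 1.\<close>

definition logistic :: "real \<Rightarrow> real \<Rightarrow> real" where
  "logistic lam z = 1 / (1 + exp (- lam * z))"

lemma logistic_pos: "0 < logistic lam z"
  by (simp add: logistic_def add_pos_pos)

lemma logistic_less_1: "logistic lam z < 1"
  by (simp add: logistic_def add_pos_pos)

lemma logistic_eq: "logistic lam z = exp (lam * z) * (1 - logistic lam z)"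
proof -
  have "1 + exp (- (lam * z)) > 0" by (simp add: add_pos_pos)
  then show ?thesis by (simp add: logistic_def field_simps flip: exp_add)
qed

lemma logistic_le_exp: "logistic lam z \<le> exp (lam * z)"
  using logistic_eq[of lam z] logistic_pos[of lam z]
    mult_left_mono[of "1 - logistic lam z" 1 "exp (lam * z)"] by simp

lemma logistic_mono: "0 \<le> lam \<Longrightarrow> x \<le> y \<Longrightarrow> logistic lam x \<le> logistic lam y"
  unfolding logistic_def by (intro divide_left_mono mult_pos_pos add_pos_pos) (auto intro: mult_left_mono)

lemma logistic_ge_half: "0 \<le> lam \<Longrightarrow> 0 \<le> z \<Longrightarrow> 1 / 2 \<le> logistic lam z"
  using logistic_mono[of lam 0 z] by (simp add: logistic_def)

lemma logistic_shift:
  assumes "0 \<le> lam"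
  shows "logistic lam (z + a) \<le> exp (lam * \<bar>a\<bar>) * logistic lam z"
proof (cases "0 \<le> a")
  case True
  let ?X = "exp (- (lam * z))"
  have p: "0 < 1 + ?X" "0 < 1 + ?X * exp (- (lam * a))" by (auto simp: add_pos_pos)
  have "1 + ?X \<le> exp (lam * a) * (1 + ?X * exp (- (lam * a)))"
    using True assms by (simp add: algebra_simps flip: exp_add)
  then have "1 / (1 + ?X * exp (- (lam * a))) \<le> exp (lam * a) * (1 / (1 + ?X))"
    using p by (simp add: field_simps)
  then show ?thesis using True by (simp add: logistic_def algebra_simps exp_diff exp_minus divide_inverse)
next
  case False
  then have "logistic lam (z + a) \<le> 1 * logistic lam z" using assms by (simp add: logistic_mono)
  also have "\<dots> \<le> exp (lam * \<bar>a\<bar>) * logistic lam z"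
    using assms logistic_pos[of lam z] by (intro mult_right_mono) auto
  finally show ?thesis .
qed

lemma logistic_deriv: "(logistic lam has_real_derivative lam * (logistic lam z * (1 - logistic lam z))) (at z)"
proof -
  have "1 + exp (- (lam * z)) \<noteq> 0" by (metis add_pos_pos exp_gt_zero less_irrefl zero_less_one)
  then show ?thesis unfolding logistic_def
    by (auto intro!: derivative_eq_intros simp: field_simps power2_eq_square)
qed

lemma logistic_deriv2:
  "((\<lambda>z. lam * (logistic lam z * (1 - logistic lam z))) has_real_derivative
     lam\<^sup>2 * (logistic lam z * (1 - logistic lam z) * (1 - 2 * logistic lam z))) (at z)"
  by (auto intro!: derivative_eq_intros logistic_deriv simp: algebra_simps power2_eq_square)

lemma logistic_at_bot: assumes "0 < lam" "0 < e" shows "\<exists>Z. \<forall>z\<le>Z. logistic lam z \<le> e"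
proof (intro exI[of _ "ln e / lam"] allI impI)
  fix z assume "z \<le> ln e / lam"
  then have "exp (lam * z) \<le> e" using assms by (simp add: field_simps) (metis exp_le_cancel_iff exp_ln)
  then show "logistic lam z \<le> e" using logistic_le_exp[of lam z] by simp
qed

lemma logistic_minus: "logistic lam (- z) = 1 - logistic lam z"
proof -
  have "1 + exp (- (lam * z)) > 0" "1 + exp (lam * z) > 0" by (simp_all add: add_pos_pos)
  then show ?thesis by (simp add: logistic_def field_simps flip: exp_add)
qed

section \<open>Fast fronts and their weighted perturbations\<close>

text \<open>The assumption \<open>chi_neg\<close> is negativity of the characteristic function at
  \<open>lam\<close>. The two smallness assumptions say that the front decays faster than the weight
  at the unstable end and that \<open>V'\<close> is negligible against the weight at both ends, so
  that the effect of a small shift can be hidden in the perturbation there.\<close>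

locale fast_front = monostable +
  fixes h c lam :: real and V V' V'' :: "real \<Rightarrow> real"
  assumes h_ge_0: "0 \<le> h" and c_pos: "0 < c" and lam_pos: "0 < lam"
    and chi_neg: "G * exp (- lam * c * h) < 1 + c * lam - lam\<^sup>2"
    and V_deriv: "(V has_real_derivative V' z) (at z)"
    and V'_deriv: "(V' has_real_derivative V'' z) (at z)"
    and V_eq: "c * V' z = V'' z - V z + g (V (z - c * h))"
    and V'_pos: "0 < V' z" and V_pos: "0 < V z" and V_less: "V z < \<kappa>"
    and V_bot: "(V \<longlongrightarrow> 0) at_bot" and V_top: "(V \<longlongrightarrow> \<kappa>) at_top"
    and V'_small: "0 < \<nu> \<Longrightarrow> \<exists>Z. \<forall>z. Z \<le> \<bar>z\<bar> \<longrightarrow> V' z \<le> \<nu> * logistic lam z"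
    and V_small: "0 < \<nu> \<Longrightarrow> \<exists>Z. \<forall>z\<le>Z. V z \<le> \<nu> * logistic lam z"
begin

lemma V_strict_mono: "x < y \<Longrightarrow> V x < V y"
  by (rule DERIV_pos_imp_increasing[of x y V]) (use V_deriv V'_pos in auto)

lemma V_mono: "x \<le> y \<Longrightarrow> V x \<le> V y"
  using V_strict_mono[of x y] by (cases "x = y") auto

lemma V_cont: "continuous_on S V"
  by (rule DERIV_continuous_on) (use V_deriv has_field_derivative_at_within in blast)

lemma V'_cont: "continuous_on S V'"
  by (rule DERIV_continuous_on) (use V'_deriv has_field_derivative_at_within in blast)

lemma V_near_kappa: assumes "0 < e" obtains Z where "0 \<le> Z" "\<And>z. Z \<le> z \<Longrightarrow> \<kappa> - e \<le> V z"
proof -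
  have "eventually (\<lambda>z. \<kappa> - e < V z) at_top" using assms by (intro order_tendstoD(1)[OF V_top]) simp
  then obtain Z where "\<And>z. Z \<le> z \<Longrightarrow> \<kappa> - e < V z" unfolding eventually_at_top_linorder by blast
  then show thesis by (intro that[of "max Z 0"]) (auto intro: less_imp_le)
qed

lemma V_near_0: assumes "0 < e" obtains Z where "\<And>z. z \<le> Z \<Longrightarrow> V z \<le> e"
proof -
  have "eventually (\<lambda>z. V z < e) at_bot" using assms by (intro order_tendstoD(2)[OF V_bot]) simp
  then obtain Z where "\<And>z. z \<le> Z \<Longrightarrow> V z < e" unfolding eventually_at_bot_linorder by blast
  then show thesis by (intro that[of Z]) (auto intro: less_imp_le)
qed

lemma V'_bounded: obtains K where "1 \<le> K" "\<And>z. V' z \<le> K * logistic lam z"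
proof -
  obtain Z where Z: "\<And>z. Z \<le> \<bar>z\<bar> \<Longrightarrow> V' z \<le> 1 * logistic lam z" using V'_small[of 1] by auto
  have "continuous_on {-\<bar>Z\<bar>..\<bar>Z\<bar>} (\<lambda>z. V' z / logistic lam z)"
    using logistic_pos[of lam] less_irrefl unfolding logistic_def
    by (intro continuous_intros V'_cont) (auto simp: add_pos_pos less_imp_neq[symmetric])
  then have "bdd_above ((\<lambda>z. V' z / logistic lam z) ` {-\<bar>Z\<bar>..\<bar>Z\<bar>})"
    by (intro bounded_imp_bdd_above compact_imp_bounded compact_continuous_image) auto
  then obtain B where "\<And>z. z \<in> {-\<bar>Z\<bar>..\<bar>Z\<bar>} \<Longrightarrow> V' z / logistic lam z \<le> B"
    unfolding bdd_above_def by blast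
  then have B: "V' z / logistic lam z \<le> B" if "\<bar>z\<bar> \<le> \<bar>Z\<bar>" for z
    using that by (simp add: abs_le_iff)
  show thesis
  proof (rule that[of "max 1 B"])
    fix z
    show "V' z \<le> max 1 B * logistic lam z"
    proof (cases "\<bar>z\<bar> \<le> \<bar>Z\<bar>")
      case True
      then have "V' z \<le> B * logistic lam z" using B[of z] logistic_pos[of lam z] by (simp add: field_simps)
      also have "\<dots> \<le> max 1 B * logistic lam z" using logistic_pos[of lam z] by (intro mult_right_mono) auto
      finally show ?thesis .
    next
      case False
      then have "V' z \<le> 1 * logistic lam z" by (intro Z) auto
      also have "\<dots> \<le> max 1 B * logistic lam z" using logistic_pos[of lam z] by (intro mult_right_mono) auto
      finally show ?thesis .
    qed
  qed simp
qed

lemma V_shift_le: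
  assumes "0 \<le> \<theta>" and "\<And>\<xi>. z \<le> \<xi> \<Longrightarrow> \<xi> \<le> z + \<theta> \<Longrightarrow> V' \<xi> \<le> B"
  shows "V (z + \<theta>) \<le> V z + \<theta> * B"
proof (cases "\<theta> = 0")
  case False
  then obtain \<xi> where \<xi>: "z < \<xi>" "\<xi> < z + \<theta>" "V (z + \<theta>) - V z = (z + \<theta> - z) * V' \<xi>"
    using assms MVT2[of z "z + \<theta>" V V'] V_deriv by auto
  then have "\<theta> * V' \<xi> \<le> \<theta> * B" using assms by (intro mult_left_mono) auto
  then show ?thesis using \<xi>(3) by (simp only: add_diff_cancel_left')
qed simp

text \<open>Near \<open>-\<infinity>\<close> the linearisation at \<open>0\<close> acts on \<open>logistic lam\<close> with the sign of \<open>chi\<close>, near \<open>+\<infinity>\<close>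
  the slope \<open>\<rho> < 1\<close> wins, and in between the drift term \<open>\<sigma> V'\<close> dominates.\<close>
lemma perturbation_inequality:
  assumes "0 < \<gamma>"
  obtains \<delta>1 \<Lambda> \<sigma> qb where "0 < \<delta>1" "\<delta>1 \<le> \<gamma>" "1 < \<Lambda>" "\<Lambda> \<le> 2" "exp (\<delta>1 * h) \<le> sqrt \<Lambda>" "0 < \<sigma>" "0 < qb"
    "exp (lam * (\<sigma> * qb * \<Lambda>)) \<le> sqrt \<Lambda>" "\<sigma> * qb * lam \<le> 1"
    "\<And>q z. 0 < q \<Longrightarrow> q \<le> qb \<Longrightarrow>
       max (g (V (z - c * h) + q * \<Lambda> * logistic lam (z - c * h)) - g (V (z - c * h)))
           (g (V (z - c * h)) - g (V (z - c * h) - q * \<Lambda> * logistic lam (z - c * h)))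
        \<le> \<sigma> * \<delta>1 * q * V' z + q * (logistic lam z - 2 * \<delta>1 * logistic lam z
            + c * (lam * (logistic lam z * (1 - logistic lam z)))
            - lam\<^sup>2 * (logistic lam z * (1 - logistic lam z) * (1 - 2 * logistic lam z)))"
proof -
  define e where "e = logistic lam"
  have e: "0 < e z" "e z < 1" for z by (auto simp: e_def logistic_pos logistic_less_1)
  \<comment> \<open>The margins at the unstable and at the stable end, with one slack
    \<open>b\<close> for the decay rate, the slope of \<open>g\<close> and the delayed amplitude
    \<open>\<Lambda> = 1 + b\<close>. At \<open>b = 0\<close> both are positive, by
    \<open>chi_neg\<close> and by \<open>\<rho> < 1\<close>.\<close>
  define f1 where "f1 = (\<lambda>b. 1 + c * lam - lam\<^sup>2 - 2 * b - (G + b) * (1 + b) * exp (- lam * c * h))"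
  define f2 where "f2 = (\<lambda>b. 1 - 2 * b - \<rho> * (1 + b))"
  have "\<exists>b>0. b \<le> 1 \<and> 0 < min (f1 b) (f2 b)"
    unfolding f1_def f2_def
    by (intro exists_small_pos continuous_intros) (use chi_neg rho in auto)
  then obtain b where b: "0 < b" "b \<le> 1" "0 < f1 b" "0 < f2 b" by auto
  define \<Lambda> where "\<Lambda> = 1 + b"
  have \<Lambda>: "1 < \<Lambda>" "\<Lambda> \<le> 2" using b by (auto simp: \<Lambda>_def)
  \<comment> \<open>The factor \<Lambda> is split into two square roots: one covers the decay of the
    amplitude over a delay, the other the change of the weight caused by the moving shift of a lower
    barrier.\<close>
  have "\<exists>d>0. d \<le> min b \<gamma> \<and> 0 < sqrt \<Lambda> - exp (d * h)"
    by (intro exists_small_pos continuous_intros) (use b assms \<Lambda> in auto)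
  then obtain \<delta>1 where \<delta>1: "0 < \<delta>1" "\<delta>1 \<le> b" "\<delta>1 \<le> \<gamma>" "exp (\<delta>1 * h) \<le> sqrt \<Lambda>" by auto
  have ch: "0 \<le> c * h" using c_pos h_ge_0 by simp
  define p where "p = (\<lambda>y. 1 - 2 * \<delta>1 + c * lam * (1 - y) - lam\<^sup>2 * ((1 - y) * (1 - 2 * y)))"
  define A where "A = (\<lambda>z. e z - 2 * \<delta>1 * e z + c * (lam * (e z * (1 - e z))) - lam\<^sup>2 * (e z * (1 - e z) * (1 - 2 * e z)))"
  have A_eq: "A z = e z * p (e z)" for z by (simp add: A_def p_def algebra_simps)
  \<comment> \<open>By \<open>logistic_eq\<close> the gain is
    \<open>exp (lam * z) * (1 - y) * p y\<close> with \<open>y = e z\<close>, which is directly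
    comparable to the bound \<open>exp (lam * (z - c * h))\<close> on the delayed weight.\<close>
  have cont_p1: "continuous_on UNIV (\<lambda>y. (1 - y) * p y - (G + b) * \<Lambda> * exp (- lam * c * h))"
    unfolding p_def by (intro continuous_intros)
  have p0: "0 < (1 - 0) * p 0 - (G + b) * \<Lambda> * exp (- lam * c * h)"
  proof -
    have "p 0 = f1 b + 2 * (b - \<delta>1) + (G + b) * \<Lambda> * exp (- lam * c * h)"
      by (simp add: p_def f1_def \<Lambda>_def)
    then show ?thesis using b \<delta>1 by simp
  qed
  have "eventually (\<lambda>y. 0 < (1 - y) * p y - (G + b) * \<Lambda> * exp (- lam * c * h)) (nhds 0)"
    using cont_p1 p0 by (intro order_tendstoD(1)) (auto simp: continuous_on_eq_continuous_at isCont_def tendsto_nhds_iff)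
  then obtain y0 where y0: "0 < y0" "\<And>y. \<bar>y\<bar> < y0 \<Longrightarrow> (G + b) * \<Lambda> * exp (- lam * c * h) \<le> (1 - y) * p y"
    unfolding eventually_nhds_metric dist_real_def by force
  have cont_p2: "continuous_on UNIV (\<lambda>y. y * p y - \<rho> * \<Lambda>)"
    unfolding p_def by (intro continuous_intros)
  have p1: "0 < 1 * p 1 - \<rho> * \<Lambda>"
    using b \<delta>1 by (simp add: p_def f2_def \<Lambda>_def)
  have "eventually (\<lambda>y. 0 < y * p y - \<rho> * \<Lambda>) (nhds 1)"
    using cont_p2 p1 by (intro order_tendstoD(1)) (auto simp: continuous_on_eq_continuous_at isCont_def tendsto_nhds_iff)
  then obtain y1 where y1: "0 < y1" "\<And>y. \<bar>y - 1\<bar> < y1 \<Longrightarrow> \<rho> * \<Lambda> \<le> y * p y"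
    unfolding eventually_nhds_metric dist_real_def by force
  obtain d where d: "0 < d" "\<And>x y. - d \<le> x \<Longrightarrow> x \<le> y \<Longrightarrow> y \<le> d \<Longrightarrow> g y - g x \<le> (G + b) * (y - x)"
    using g_near_0[OF b(1)] by blast
  obtain Z1 where Z1: "\<And>z. z \<le> Z1 \<Longrightarrow> V z \<le> d / 2" using V_near_0[of "d / 2"] d by auto
  obtain Z2 where Z2: "\<And>z. z \<le> Z2 \<Longrightarrow> e z \<le> y0 / 2" using logistic_at_bot[OF lam_pos, of "y0 / 2"] y0 by (auto simp: e_def)
  obtain Z3 where Z3: "\<And>z. Z3 \<le> z \<Longrightarrow> \<kappa> - \<delta> / 2 \<le> V z" using V_near_kappa[of "\<delta> / 2"] delta by auto
  obtain Z4 where Z4: "\<And>z. z \<le> Z4 \<Longrightarrow> e z \<le> y1 / 2" using logistic_at_bot[OF lam_pos, of "y1 / 2"] y1 by (auto simp: e_def)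
  define Z where "Z = \<bar>Z1\<bar> + \<bar>Z2\<bar> + \<bar>Z3\<bar> + c * h + \<bar>Z4\<bar>"
  have Z: "\<bar>Z1\<bar> \<le> Z" "\<bar>Z2\<bar> \<le> Z" "\<bar>Z3\<bar> + c * h \<le> Z" "\<bar>Z4\<bar> \<le> Z" using ch by (auto simp: Z_def)
  obtain m where m: "0 < m" "\<And>z. \<bar>z\<bar> \<le> Z \<Longrightarrow> m \<le> V' z"
  proof -
    obtain z0 where "z0 \<in> {-Z..Z}" "\<And>z. z \<in> {-Z..Z} \<Longrightarrow> V' z0 \<le> V' z"
      using continuous_attains_inf[of "{-Z..Z}" V'] V'_cont Z ch by fastforce
    then show thesis using V'_pos[of z0] by (intro that[of "V' z0"]) (auto simp: abs_le_iff)
  qed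
  \<comment> \<open>On the compact middle range \<open>V'\<close> is at least \<open>m\<close>; this
    \<sigma> lets the shift term outweigh the Lipschitz bound on the reaction together with the most
    negative value of the remaining terms.\<close>
  define \<sigma> where "\<sigma> = (L * \<Lambda> + lam\<^sup>2 + 2) / (\<delta>1 * m)"
  have num: "0 < L * \<Lambda> + lam\<^sup>2 + 2" using L_ge_1 \<Lambda> by (intro add_nonneg_pos) auto
  have \<sigma>: "0 < \<sigma>" using num \<delta>1 m by (simp add: \<sigma>_def)
  \<comment> \<open>The first two bounds keep the perturbed front within the linear ranges of
    \<open>g\<close>. The third and the last serve lower barriers: they limit the extra term and the
    change of weight produced by the shift.\<close>
  have "\<exists>q>0. q \<le> min (min (d / 4) (\<delta> / 4)) (1 / (\<sigma> * lam)) \<and> 0 < sqrt \<Lambda> - exp (lam * (\<sigma> * q * \<Lambda>))"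
    by (intro exists_small_pos continuous_intros) (use d delta \<sigma> lam_pos \<Lambda> in auto)
  then obtain qb where qb: "0 < qb" "qb \<le> d / 4" "qb \<le> \<delta> / 4" "qb \<le> 1 / (\<sigma> * lam)" "exp (lam * (\<sigma> * qb * \<Lambda>)) \<le> sqrt \<Lambda>"
    by auto
  have qb2: "\<sigma> * qb * lam \<le> 1" using qb(4) \<sigma> lam_pos by (simp add: field_simps)
  show thesis
  proof (rule that[OF \<delta>1(1,3) \<Lambda> \<delta>1(4) \<sigma> qb(1,5) qb2], unfold e_def[symmetric])
    fix q z assume q: "0 < q" "q \<le> qb"
    define v where "v = V (z - c * h)"
    define w where "w = q * \<Lambda> * e (z - c * h)"
    have q\<Lambda>: "0 < q * \<Lambda>" "q * \<Lambda> \<le> d / 2" "q * \<Lambda> \<le> \<delta> / 2"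
      using q qb \<Lambda> mult_mono[of q qb \<Lambda> 2] by auto
    have w: "0 < w" "w \<le> q * \<Lambda>"
      using q\<Lambda> e[of "z - c * h"] mult_left_mono[of "e (z - c * h)" 1 "q * \<Lambda>"] by (auto simp: w_def)
    have vp: "0 < v" "v < \<kappa>" by (auto simp: v_def V_pos V_less)
    have "max (g (v + w) - g v) (g v - g (v - w)) \<le> \<sigma> * \<delta>1 * q * V' z + q * A z"
    proof (cases "\<bar>z\<bar> \<le> Z")
      case True
      have "max (g (v + w) - g v) (g v - g (v - w)) \<le> L * w"
        using g_diff_le[of "v + w" v] g_diff_le[of v "v - w"] w by simp
      also have "\<dots> \<le> L * (q * \<Lambda>)" using w L_ge_1 by (intro mult_left_mono) auto
      also have "\<dots> = q * (L * \<Lambda> + lam\<^sup>2 + 2) + q * (- lam\<^sup>2 - 2)" by (simp add: algebra_simps)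
      also have "\<dots> \<le> \<sigma> * \<delta>1 * q * V' z + q * A z"
      proof (rule add_mono)
        have "q * (L * \<Lambda> + lam\<^sup>2 + 2) = \<sigma> * \<delta>1 * q * m" using \<delta>1 m by (simp add: \<sigma>_def)
        also have "\<dots> \<le> \<sigma> * \<delta>1 * q * V' z" using \<sigma> \<delta>1 q m True by (intro mult_left_mono) auto
        finally show "q * (L * \<Lambda> + lam\<^sup>2 + 2) \<le> \<sigma> * \<delta>1 * q * V' z" .
        have "2 * \<delta>1 * e z \<le> 2 * 1 * 1" using \<delta>1 b e[of z] by (intro mult_mono) auto
        moreover have "0 \<le> c * (lam * (e z * (1 - e z)))" using c_pos lam_pos e[of z] by auto
        moreover have "lam\<^sup>2 * (e z * (1 - e z) * (1 - 2 * e z)) \<le> lam\<^sup>2 * (1 * 1 * 1)"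
        proof (intro mult_left_mono)
          have "e z * (1 - e z) * (1 - 2 * e z) \<le> e z * (1 - e z) * 1"
            using e[of z] by (intro mult_left_mono) auto
          also have "\<dots> \<le> 1 * 1 * 1" using e[of z] by (intro mult_mono) auto
          finally show "e z * (1 - e z) * (1 - 2 * e z) \<le> 1 * 1 * 1" .
        qed simp
        ultimately have "- lam\<^sup>2 - 2 \<le> A z" using e[of z] unfolding A_def by linarith
        then show "q * (- lam\<^sup>2 - 2) \<le> q * A z" using q by (intro mult_left_mono) auto
      qed
      finally show ?thesis .
    next
      case False
      have "0 \<le> \<sigma> * \<delta>1 * q * V' z" using \<sigma> \<delta>1 q V'_pos[of z] by simp
      moreover have "max (g (v + w) - g v) (g v - g (v - w)) \<le> q * A z"
      proof (cases "z < 0")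
        case True
        then have z: "z \<le> Z1" "z \<le> Z2" "z - c * h \<le> Z1" using False Z ch by auto
        have "v \<le> d / 2" unfolding v_def by (rule Z1) fact
        then have "max (g (v + w) - g v) (g v - g (v - w)) \<le> (G + b) * w"
          using d(2)[of v "v + w"] d(2)[of "v - w" v] w vp q\<Lambda> by simp
        also have "\<dots> \<le> (G + b) * (q * \<Lambda> * exp (lam * (z - c * h)))"
          unfolding w_def e_def using G_gt_1 b q\<Lambda> logistic_le_exp by (intro mult_left_mono) auto
        also have "\<dots> = q * (exp (lam * z) * ((G + b) * \<Lambda> * exp (- lam * c * h)))"
          by (simp add: algebra_simps flip: exp_add)
        also have "\<dots> \<le> q * (exp (lam * z) * ((1 - e z) * p (e z)))"
          using q y0 Z2[OF z(2)] e[of z] by (intro mult_left_mono y0(2)) auto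
        also have "\<dots> = q * A z" unfolding A_eq by (subst (3) e_def, subst logistic_eq) (simp add: e_def)
        finally show ?thesis .
      next
        case False
        then have z: "Z3 \<le> z - c * h" "- z \<le> Z4" using \<open>\<not> \<bar>z\<bar> \<le> Z\<close> Z ch by auto
        have "\<kappa> - \<delta> / 2 \<le> v" unfolding v_def by (rule Z3) fact
        then have "max (g (v + w) - g v) (g v - g (v - w)) \<le> \<rho> * w"
          using g_near_kappa[of v "v + w"] g_near_kappa[of "v - w" v] w vp q\<Lambda> delta by simp
        also have "\<dots> \<le> \<rho> * (q * \<Lambda>)" using w rho by (intro mult_left_mono) auto
        also have "\<dots> = q * (\<rho> * \<Lambda>)" by simp
        also have "\<dots> \<le> q * (e z * p (e z))"
        proof (intro mult_left_mono y1(2))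
          have "1 - e z \<le> y1 / 2" using Z4[OF z(2)] by (simp add: e_def logistic_minus)
          then show "\<bar>e z - 1\<bar> < y1" using e[of z] y1 by simp
        qed (use q in auto)
        finally show ?thesis by (simp add: A_eq)
      qed
      ultimately show ?thesis by simp
    qed
    then show "max (g (V (z - c * h) + q * \<Lambda> * e (z - c * h)) - g (V (z - c * h)))
            (g (V (z - c * h)) - g (V (z - c * h) - q * \<Lambda> * e (z - c * h)))
           \<le> \<sigma> * \<delta>1 * q * V' z + q * (e z - 2 * \<delta>1 * e z + c * (lam * (e z * (1 - e z))) -
               lam\<^sup>2 * (e z * (1 - e z) * (1 - 2 * e z)))"
      by (simp add: v_def w_def A_def)
  qed
qed

end

section \<open>Moving barriers around a front\<close>

locale front_stability =
  solution g \<kappa> G L \<rho> \<delta> h M u ut ux uxx + fast_front g \<kappa> G L \<rho> \<delta> h c lam V V' V''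
  for g :: "real \<Rightarrow> real" and \<kappa> G L \<rho> \<delta> h M :: real and u ut ux uxx :: "real \<Rightarrow> real \<Rightarrow> real"
    and c lam :: real and V V' V'' :: "real \<Rightarrow> real" +
  fixes A :: real
  assumes nonzero: "\<exists>s\<in>{-h..0}. \<exists>x. u s x \<noteq> 0"
    and init_exp: "- h \<le> t \<Longrightarrow> t \<le> 0 \<Longrightarrow> u t x \<le> A * exp (lam * x)"
begin

abbreviation e :: "real \<Rightarrow> real" where "e \<equiv> logistic lam"
abbreviation e1 :: "real \<Rightarrow> real" where "e1 \<equiv> \<lambda>z. lam * (e z * (1 - e z))"
abbreviation e2 :: "real \<Rightarrow> real" where "e2 \<equiv> \<lambda>z. lam\<^sup>2 * (e z * (1 - e z) * (1 - 2 * e z))"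

definition asym_upper :: "real \<Rightarrow> bool" where
  "asym_upper b \<longleftrightarrow> (\<forall>\<epsilon>>0. \<exists>T. \<forall>t\<ge>T. \<forall>x\<le>0. u t x \<le> V (x + c * t + b) + \<epsilon> * e (x + c * t))"

definition asym_lower :: "real \<Rightarrow> bool" where
  "asym_lower a \<longleftrightarrow> (\<forall>\<epsilon>>0. \<exists>T. \<forall>t\<ge>T. \<forall>x\<le>0. V (x + c * t + a) - \<epsilon> * e (x + c * t) \<le> u t x)"

lemma e_mono: "x \<le> y \<Longrightarrow> e x \<le> e y"
  using lam_pos by (simp add: logistic_mono)

lemma e_shift: "e (z + a) \<le> exp (lam * \<bar>a\<bar>) * e z"
  using lam_pos by (simp add: logistic_shift)

lemma exp_decay:
  fixes K a \<epsilon> T0 :: real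
  assumes "0 < a" "0 < \<epsilon>" "0 \<le> K"
  shows "\<exists>T. \<forall>t\<ge>T. K * exp (- a * (t - T0)) \<le> \<epsilon>"
proof (cases "K = 0")
  case False
  show ?thesis
  proof (intro exI[of _ "T0 + ln (K / \<epsilon>) / a"] allI impI)
    fix t assume "T0 + ln (K / \<epsilon>) / a \<le> t"
    then have "ln (K / \<epsilon>) \<le> a * (t - T0)" using assms by (simp add: field_simps)
    then have "exp (ln (K / \<epsilon>)) \<le> exp (a * (t - T0))" by (simp only: exp_le_cancel_iff)
    then have "K / \<epsilon> \<le> exp (a * (t - T0))" using assms False by simp
    then have "K \<le> \<epsilon> * exp (a * (t - T0))" using assms by (simp add: field_simps)
    then have "K * exp (- a * (t - T0)) \<le> \<epsilon> * exp (a * (t - T0)) * exp (- a * (t - T0))"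
      by (intro mult_right_mono) auto
    also have "\<dots> = \<epsilon>" by (simp add: mult.assoc flip: exp_add)
    finally show "K * exp (- a * (t - T0)) \<le> \<epsilon>" .
  qed
qed (use assms in auto)

text \<open>The sign \<open>sg\<close> is 1 for the upper and -1 for the lower barrier. The shift
  moves monotonically, with speed \<open>\<sigma> * \<delta>1\<close> times the current amplitude,
  so that its product with \<open>V'\<close> is the middle-range term of
  \<open>perturbation_inequality\<close>; the total displacement stays proportional to
  \<open>q0\<close>.\<close>

lemma barrier_derivs:
  fixes sg q0 \<sigma> \<Lambda> \<delta>1 T0 s0 :: real
  assumes E_def: "E = (\<lambda>t. exp (- \<delta>1 * (t - T0)))"
    and s_def: "s = (\<lambda>t. s0 + sg * (\<sigma> * q0 * (\<Lambda> - E t)))"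
    and b_def: "b = (\<lambda>t x. V (x + c * t + s t) + sg * (q0 * E t * e (x + c * t + s t)))"
  shows "((\<lambda>\<tau>. b \<tau> x) has_real_derivative
      (c + sg * (\<sigma> * \<delta>1 * (q0 * E t))) * V' (x + c * t + s t)
      + sg * (q0 * E t * ((c + sg * (\<sigma> * \<delta>1 * (q0 * E t))) * e1 (x + c * t + s t)) - \<delta>1 * (q0 * E t * e (x + c * t + s t)))) (at t)"
    and "(b t has_real_derivative V' (x + c * t + s t) + sg * (q0 * E t * e1 (x + c * t + s t))) (at x)"
    and "((\<lambda>x. V' (x + c * t + s t) + sg * (q0 * E t * e1 (x + c * t + s t))) has_real_derivative
      V'' (x + c * t + s t) + sg * (q0 * E t * e2 (x + c * t + s t))) (at x)"
    and "continuous_on S (\<lambda>(t, x). b t x)"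
proof -
  have E': "(E has_real_derivative - \<delta>1 * E t) (at t)"
    unfolding E_def by (auto intro!: derivative_eq_intros)
  have s': "(s has_real_derivative sg * (\<sigma> * \<delta>1 * (q0 * E t))) (at t)"
    unfolding s_def by (auto intro!: derivative_eq_intros E' simp: algebra_simps)
  have z': "((\<lambda>t. x + c * t + s t) has_real_derivative (c + sg * (\<sigma> * \<delta>1 * (q0 * E t)))) (at t)"
    by (auto intro!: derivative_eq_intros s')
  show "((\<lambda>\<tau>. b \<tau> x) has_real_derivative
      (c + sg * (\<sigma> * \<delta>1 * (q0 * E t))) * V' (x + c * t + s t)
      + sg * (q0 * E t * ((c + sg * (\<sigma> * \<delta>1 * (q0 * E t))) * e1 (x + c * t + s t)) - \<delta>1 * (q0 * E t * e (x + c * t + s t)))) (at t)"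
    unfolding b_def
    by (rule DERIV_cong[OF DERIV_add[OF DERIV_chain2[OF V_deriv z']
        DERIV_cmult[OF DERIV_mult[OF DERIV_cmult[OF E'] DERIV_chain2[OF logistic_deriv z']]]]])
       (simp add: algebra_simps)
  have x': "((\<lambda>x. x + c * t + s t) has_real_derivative 1) (at x)"
    by (auto intro!: derivative_eq_intros)
  show "(b t has_real_derivative V' (x + c * t + s t) + sg * (q0 * E t * e1 (x + c * t + s t))) (at x)"
    unfolding b_def
    by (rule DERIV_cong[OF DERIV_add[OF DERIV_chain2[OF V_deriv x']
        DERIV_cmult[OF DERIV_cmult[OF DERIV_chain2[OF logistic_deriv x']]]]]) simp
  show "((\<lambda>x. V' (x + c * t + s t) + sg * (q0 * E t * e1 (x + c * t + s t))) has_real_derivative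
      V'' (x + c * t + s t) + sg * (q0 * E t * e2 (x + c * t + s t))) (at x)"
    by (rule DERIV_cong[OF DERIV_add[OF DERIV_chain2[OF V'_deriv x']
        DERIV_cmult[OF DERIV_cmult[OF DERIV_chain2[OF logistic_deriv2 x']]]]]) simp
  have lc: "continuous_on UNIV e"
    by (rule DERIV_continuous_on) (use logistic_deriv has_field_derivative_at_within in blast)
  show "continuous_on S (\<lambda>(t, x). b t x)"
    unfolding b_def s_def E_def case_prod_unfold
    by (intro continuous_intros continuous_on_compose2[OF V_cont[of UNIV]] continuous_on_compose2[OF lc]) auto
qed

text \<open>Closeness to a translate up to amplitude \<open>q0\<close> during one delay costs in the
  limit only the additional shift \<open>\<sigma>1 * q0\<close>. This proportionality is what later
  allows a net gain of shift. The lower barrier starts from \<open>q0 / 2\<close>, because during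
  the initial strip its shift may have changed the weight by a factor of up to 2, and it needs the
  values at \<open>x = 0\<close>.\<close>

lemma barriers:
  obtains \<sigma>1 qb C \<gamma> T1 where "0 < \<sigma>1" "0 < qb" "0 < C" "0 < \<gamma>"
    "\<And>q0 s0 T0. \<lbrakk>0 < q0; q0 \<le> qb; 0 \<le> T0;
       \<And>t x. T0 - h \<le> t \<Longrightarrow> t \<le> T0 \<Longrightarrow> u t x \<le> V (x + c * t + s0) + q0 * e (x + c * t + s0)\<rbrakk> \<Longrightarrow>
       asym_upper (s0 + \<sigma>1 * q0)"
    "\<And>q0 s0 T0. \<lbrakk>0 < q0; q0 \<le> qb; 0 \<le> T0; T1 \<le> T0; C * exp (- \<gamma> * T0) \<le> q0 * e (c * T0 + s0 - \<sigma>1 * q0);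
       \<And>t x. T0 - h \<le> t \<Longrightarrow> t \<le> T0 \<Longrightarrow> x \<le> 0 \<Longrightarrow> V (x + c * t + s0) - q0 / 2 * e (x + c * t + s0) \<le> u t x\<rbrakk> \<Longrightarrow>
       asym_lower (s0 - \<sigma>1 * q0)"
proof -
  obtain C \<gamma> T1 where C: "0 < C" "0 < \<gamma>" "\<And>t. T1 \<le> t \<Longrightarrow> \<kappa> - C * exp (- \<gamma> * t) \<le> u t 0"
    using kappa_exponentially[OF nonzero] by blast
  obtain \<delta>1 \<Lambda> \<sigma> qb where \<delta>1: "0 < \<delta>1" "\<delta>1 \<le> \<gamma>" and \<Lambda>: "1 < \<Lambda>" "\<Lambda> \<le> 2" "exp (\<delta>1 * h) \<le> sqrt \<Lambda>" and \<sigma>: "0 < \<sigma>" and qb: "0 < qb"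
    "exp (lam * (\<sigma> * qb * \<Lambda>)) \<le> sqrt \<Lambda>" "\<sigma> * qb * lam \<le> 1" and
    pert: "\<And>q z. 0 < q \<Longrightarrow> q \<le> qb \<Longrightarrow>
       max (g (V (z - c * h) + q * \<Lambda> * e (z - c * h)) - g (V (z - c * h)))
           (g (V (z - c * h)) - g (V (z - c * h) - q * \<Lambda> * e (z - c * h)))
        \<le> \<sigma> * \<delta>1 * q * V' z + q * (e z - 2 * \<delta>1 * e z + c * e1 z - e2 z)"
    by (rule perturbation_inequality[OF C(2)]) blast
  have sq: "sqrt \<Lambda> \<le> \<Lambda>" "sqrt \<Lambda> \<le> 2" "sqrt \<Lambda> * sqrt \<Lambda> = \<Lambda>"
  proof -
    have "sqrt \<Lambda> \<le> sqrt (\<Lambda>\<^sup>2)" using \<Lambda> by (intro real_sqrt_le_mono) (simp add: power2_eq_square)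
    then show "sqrt \<Lambda> \<le> \<Lambda>" using \<Lambda> by simp
    then show "sqrt \<Lambda> \<le> 2" using \<Lambda> by simp
    show "sqrt \<Lambda> * sqrt \<Lambda> = \<Lambda>" using \<Lambda> by simp
  qed
  show thesis
  proof (rule that[of "\<sigma> * \<Lambda>" qb C \<gamma> T1])
    show "0 < \<sigma> * \<Lambda>" using \<sigma> \<Lambda> by simp
    fix q0 s0 T0 :: real assume q0: "0 < q0" "q0 \<le> qb" and T0: "0 \<le> T0"
    define E where "E = (\<lambda>t. exp (- \<delta>1 * (t - T0)))"
    have E: "0 < E t" for t by (simp add: E_def)
    have E_le1: "E t \<le> 1" if "T0 \<le> t" for t using that \<delta>1 by (simp add: E_def)
    have E_init: "1 \<le> E t" "E t \<le> \<Lambda>" if "T0 - h \<le> t" "t \<le> T0" for t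
    proof -
      show "1 \<le> E t" using that \<delta>1 by (simp add: E_def mult_nonneg_nonpos)
      have "E t \<le> exp (\<delta>1 * h)" using that \<delta>1 mult_left_mono[of "T0 - t" h \<delta>1] by (simp add: E_def algebra_simps)
      then show "E t \<le> \<Lambda>" using \<Lambda> sq by linarith
    qed
    have E_h: "E (t - h) = exp (\<delta>1 * h) * E t" for t by (simp add: E_def algebra_simps flip: exp_add)
    have E_le: "E t \<le> E (t - h)" "E (t - h) \<le> sqrt \<Lambda> * E t" for t
      using E[of t] \<Lambda>(3) \<delta>1 h_ge_0 mult_right_mono[of 1 "exp (\<delta>1 * h)" "E t"] unfolding E_h
      by (auto intro!: mult_right_mono)
    {
      assume init: "\<And>t x. T0 - h \<le> t \<Longrightarrow> t \<le> T0 \<Longrightarrow> u t x \<le> V (x + c * t + s0) + q0 * e (x + c * t + s0)"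
      \<comment> \<open>On the initial strip \<open>1 \<le> E t \<le> \<Lambda>\<close>, so the
        offset \<Lambda> puts the barrier on the correct side of the translate by \<open>s0\<close>
        already there.\<close>
      define s where "s = (\<lambda>t. s0 + 1 * (\<sigma> * q0 * (\<Lambda> - E t)))"
      define b where "b = (\<lambda>t x. V (x + c * t + s t) + 1 * (q0 * E t * e (x + c * t + s t)))"
      note D = barrier_derivs[OF E_def s_def b_def]
      have ub: "u t x \<le> b t x" if t: "T0 \<le> t" for t x
      proof (rule upper_barrier[OF T0 D(4), where T=t and B=0])
        show "0 \<le> b t x" for t x unfolding b_def
          using V_pos[of "x + c * t + s t"] q0 E[of t] logistic_pos[of lam "x + c * t + s t"]
          by (intro add_nonneg_nonneg) auto
        show "u t x \<le> b t x" if t: "T0 - h \<le> t" "t \<le> T0" for t x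
        proof -
          have "s0 \<le> s t" using E_init[OF t] \<sigma> q0 by (simp add: s_def)
          then have 1: "V (x + c * t + s0) \<le> V (x + c * t + s t)" "e (x + c * t + s0) \<le> e (x + c * t + s t)"
            by (auto intro: V_mono e_mono)
          have "q0 * e (x + c * t + s0) \<le> q0 * E t * e (x + c * t + s t)"
            using 1 q0 E_init[OF t] logistic_pos[of lam] by (intro mult_mono) (auto intro: less_imp_le)
          then show ?thesis using 1 init[OF t, of x] by (simp add: b_def)
        qed
        fix t' x assume t': "T0 < t'" "t' \<le> t"
        define z where "z = x + c * t' + s t'"
        define q where "q = q0 * E t'"
        have "q0 * E t' \<le> q0 * 1" using q0 E_le1[of t'] t' by (intro mult_left_mono) auto
        then have q: "0 < q" "q \<le> qb" using q0 E[of t'] unfolding q_def by (simp, linarith)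
        show "\<exists>bt bx bxx. ((\<lambda>\<tau>. b \<tau> x) has_real_derivative bt) (at t') \<and>
          (\<forall>y. (b t' has_real_derivative bx y) (at y)) \<and> (bx has_real_derivative bxx) (at x) \<and>
          bxx - b t' x + g (u (t' - h) x) - L * max 0 (u (t' - h) x - b (t' - h) x) \<le> bt"
        proof (intro exI conjI allI)
          have "b (t' - h) x \<le> V (z - c * h) + q * \<Lambda> * e (z - c * h)"
          proof -
            have "s (t' - h) \<le> s t'" using E_le(1)[of t'] \<sigma> q0 by (simp add: s_def)
            then have 1: "x + c * (t' - h) + s (t' - h) \<le> z - c * h" by (simp add: z_def algebra_simps)
            have "E (t' - h) \<le> \<Lambda> * E t'" using E[of t'] by (intro order_trans[OF E_le(2)] mult_right_mono sq(1)) auto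
            then have "q0 * E (t' - h) \<le> q * \<Lambda>" using q0 by (simp add: q_def mult.commute)
            then have "q0 * E (t' - h) * e (x + c * (t' - h) + s (t' - h)) \<le> q * \<Lambda> * e (z - c * h)"
              by (rule mult_mono) (use e_mono[OF 1] q \<Lambda> logistic_pos[of lam] in \<open>auto intro: less_imp_le\<close>)
            then show ?thesis using V_mono[OF 1] by (simp add: b_def)
          qed
          then have "g (b (t' - h) x) \<le> g (V (z - c * h) + q * \<Lambda> * e (z - c * h))" by (rule g_mono)
          moreover have "g (u (t' - h) x) - g (b (t' - h) x) \<le> L * max 0 (u (t' - h) x - b (t' - h) x)"
            by (rule g_diff_le)
          moreover note pert[OF q, of z] V_eq[of z]
          moreover have "0 \<le> q * (\<sigma> * \<delta>1 * q * e1 z)"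
            using q \<sigma> \<delta>1 lam_pos logistic_pos[of lam z] logistic_less_1[of lam z] by simp
          moreover have "0 \<le> \<delta>1 * (q * e z)" using q \<delta>1 logistic_pos[of lam z] by simp
          ultimately show "V'' z + 1 * (q * e2 z) - b t' x + g (u (t' - h) x) - L * max 0 (u (t' - h) x - b (t' - h) x)
             \<le> (c + 1 * (\<sigma> * \<delta>1 * q)) * V' z + 1 * (q * ((c + 1 * (\<sigma> * \<delta>1 * q)) * e1 z) - \<delta>1 * (q * e z))"
            unfolding b_def z_def[symmetric] q_def[symmetric] by (simp add: algebra_simps)
        qed (unfold z_def q_def, (rule D)+)
      qed (use t h_ge_0 in auto)
      show "asym_upper (s0 + \<sigma> * \<Lambda> * q0)"
        unfolding asym_upper_def
      proof (intro allI impI)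
        fix \<epsilon> :: real assume \<epsilon>: "0 < \<epsilon>"
        let ?s = "s0 + \<sigma> * \<Lambda> * q0"
        obtain T where T: "\<And>t. T \<le> t \<Longrightarrow> q0 * exp (lam * \<bar>?s\<bar>) * exp (- \<delta>1 * (t - T0)) \<le> \<epsilon>"
          using exp_decay[OF \<delta>1(1) \<epsilon>, of "q0 * exp (lam * \<bar>?s\<bar>)"] q0 by auto
        show "\<exists>T. \<forall>t\<ge>T. \<forall>x\<le>0. u t x \<le> V (x + c * t + ?s) + \<epsilon> * e (x + c * t)"
        proof (intro exI[of _ "max T T0"] allI impI)
          fix t x :: real assume t: "max T T0 \<le> t" and "x \<le> 0"
          have "s t \<le> ?s" using E[of t] \<sigma> q0 by (simp add: s_def algebra_simps)
          then have 1: "x + c * t + s t \<le> x + c * t + ?s" by simp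
          have "q0 * E t * e (x + c * t + s t) \<le> q0 * E t * (exp (lam * \<bar>?s\<bar>) * e (x + c * t))"
            using q0 E[of t] e_mono[OF 1] e_shift[of "x + c * t" ?s] by (intro mult_left_mono) auto
          also have "\<dots> = q0 * exp (lam * \<bar>?s\<bar>) * exp (- \<delta>1 * (t - T0)) * e (x + c * t)"
            by (simp add: E_def)
          also have "\<dots> \<le> \<epsilon> * e (x + c * t)"
            using T[of t] t logistic_pos[of lam] by (intro mult_right_mono) (auto intro: less_imp_le)
          finally show "u t x \<le> V (x + c * t + ?s) + \<epsilon> * e (x + c * t)"
            using ub[of t x] t V_mono[OF 1] by (simp add: b_def)
        qed
      qed
    }
    {
      assume T1: "T1 \<le> T0" and bc: "C * exp (- \<gamma> * T0) \<le> q0 * e (c * T0 + s0 - \<sigma> * \<Lambda> * q0)"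
        and init: "\<And>t x. T0 - h \<le> t \<Longrightarrow> t \<le> T0 \<Longrightarrow> x \<le> 0 \<Longrightarrow> V (x + c * t + s0) - q0 / 2 * e (x + c * t + s0) \<le> u t x"
      define s where "s = (\<lambda>t. s0 + -1 * (\<sigma> * q0 * (\<Lambda> - E t)))"
      define b where "b = (\<lambda>t x. V (x + c * t + s t) + -1 * (q0 * E t * e (x + c * t + s t)))"
      note D = barrier_derivs[OF E_def s_def b_def]
      have s_ge: "s0 - \<sigma> * \<Lambda> * q0 \<le> s t" for t using E[of t] \<sigma> q0 by (simp add: s_def algebra_simps)
      have small_shift: "exp (lam * d) \<le> sqrt \<Lambda>" if "d \<le> \<sigma> * q0 * \<Lambda>" for d
      proof -
        have "\<sigma> * q0 * \<Lambda> \<le> \<sigma> * qb * \<Lambda>" using q0 \<sigma> \<Lambda> by (intro mult_right_mono mult_left_mono) auto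
        then have "d \<le> \<sigma> * qb * \<Lambda>" using that by linarith
        then have "exp (lam * d) \<le> exp (lam * (\<sigma> * qb * \<Lambda>))" using lam_pos by simp
        then show ?thesis using qb(2) by linarith
      qed
      have lb: "b t x \<le> u t x" if t: "T0 \<le> t" and x: "x \<le> 0" for t x
      proof (rule half_line_lower_barrier[OF T0 D(4), where T=t and B=\<kappa>])
        show "b t x \<le> \<kappa>" for t x
        proof -
          have "0 < q0 * E t * e (x + c * t + s t)" by (intro mult_pos_pos q0 E logistic_pos)
          then show ?thesis using V_less[of "x + c * t + s t"] unfolding b_def by linarith
        qed
        show "b t x \<le> u t x" if t: "T0 - h \<le> t" "t \<le> T0" and x: "x \<le> 0" for t x
        proof -
          have st: "s t \<le> s0" using E_init[OF t] \<sigma> q0 by (simp add: s_def)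
          have "e (x + c * t + s0) \<le> exp (lam * (s0 - s t)) * e (x + c * t + s t)"
            using e_shift[of "x + c * t + s t" "s0 - s t"] st by (simp add: add.assoc)
          also have "\<dots> \<le> 2 * e (x + c * t + s t)"
          proof (rule mult_right_mono)
            have "s0 - s t \<le> \<sigma> * q0 * \<Lambda>" using s_ge[of t] by (simp add: algebra_simps)
            from small_shift[OF this] show "exp (lam * (s0 - s t)) \<le> 2" using sq by linarith
          qed (simp add: logistic_pos less_imp_le)
          finally have "e (x + c * t + s0) / 2 \<le> 1 * e (x + c * t + s t)" by simp
          also have "\<dots> \<le> E t * e (x + c * t + s t)"
            using E_init[OF t] logistic_pos[of lam "x + c * t + s t"] by (intro mult_right_mono) auto
          finally have "q0 * (e (x + c * t + s0) / 2) \<le> q0 * (E t * e (x + c * t + s t))"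
            using q0 by (intro mult_left_mono) auto
          moreover have "V (x + c * t + s t) \<le> V (x + c * t + s0)" using st by (intro V_mono) simp
          ultimately show ?thesis using init[OF t x] by (simp add: b_def)
        qed
        \<comment> \<open>At \<open>x = 0\<close> the weight along the moving frame does not fall
          below its bound at \<open>T0\<close>, and the amplitude decays at the rate
          \<open>\<delta>1 \<le> \<gamma>\<close>; hence the inequality assumed at \<open>T0\<close>
          persists.\<close>
        show "b t' 0 \<le> u t' 0" if t': "T0 \<le> t'" "t' \<le> t" for t'
        proof -
          have "c * T0 \<le> c * t'" using t' c_pos by simp
          then have arg: "c * T0 + s0 - \<sigma> * \<Lambda> * q0 \<le> 0 + c * t' + s t'" using s_ge[of t'] by linarith
          have "C * exp (- \<gamma> * t') = C * exp (- \<gamma> * T0) * exp (- \<gamma> * (t' - T0))"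
            by (simp add: algebra_simps flip: exp_add)
          also have "\<dots> \<le> C * exp (- \<gamma> * T0) * E t'"
            unfolding E_def using \<delta>1 t' C by (intro mult_left_mono) (auto intro: mult_right_mono)
          also have "\<dots> \<le> q0 * e (c * T0 + s0 - \<sigma> * \<Lambda> * q0) * E t'"
            using bc E[of t'] by (intro mult_right_mono) auto
          also have "\<dots> \<le> q0 * e (0 + c * t' + s t') * E t'"
            using q0 E[of t'] by (intro mult_right_mono mult_left_mono e_mono arg) auto
          finally show ?thesis using C(3)[of t'] V_less[of "0 + c * t' + s t'"] t' T1 by (simp add: b_def algebra_simps)
        qed
        fix t' x assume t': "T0 < t'" "t' \<le> t"
        define z where "z = x + c * t' + s t'"
        define q where "q = q0 * E t'"
        have "q0 * E t' \<le> q0 * 1" using q0 E_le1[of t'] t' by (intro mult_left_mono) auto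
        then have q: "0 < q" "q \<le> qb" "q \<le> q0" using q0 E[of t'] unfolding q_def by (simp, linarith, linarith)
        show "\<exists>bt bx bxx. ((\<lambda>\<tau>. b \<tau> x) has_real_derivative bt) (at t') \<and>
          (\<forall>y. (b t' has_real_derivative bx y) (at y)) \<and> (bx has_real_derivative bxx) (at x) \<and>
          bt \<le> bxx - b t' x + g (u (t' - h) x) + L * max 0 (b (t' - h) x - u (t' - h) x)"
        proof (intro exI conjI allI)
          have "V (z - c * h) - q * \<Lambda> * e (z - c * h) \<le> b (t' - h) x"
          proof -
            define d where "d = \<sigma> * q0 * (E (t' - h) - E t')"
            have zd: "x + c * (t' - h) + s (t' - h) = z - c * h + d" by (simp add: z_def d_def s_def algebra_simps)
            have d0: "0 \<le> d" using E_le(1)[of t'] \<sigma> q0 by (simp add: d_def)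
            have "E (t' - h) - E t' \<le> \<Lambda> * 1"
            proof -
              have "E (t' - h) \<le> \<Lambda> * 1"
                using E[of t'] E_le1[of t'] t' \<Lambda> by (intro order_trans[OF E_le(2)] mult_mono sq(1)) auto
              then show ?thesis using E[of t'] by linarith
            qed
            then have "d \<le> \<sigma> * q0 * \<Lambda>" unfolding d_def using \<sigma> q0 by (intro mult_left_mono) auto
            then have "exp (lam * d) \<le> sqrt \<Lambda>" by (rule small_shift)
            then have 1: "e (z - c * h + d) \<le> sqrt \<Lambda> * e (z - c * h)"
              using d0 logistic_pos[of lam "z - c * h"]
              by (intro order_trans[OF e_shift] mult_right_mono) auto
            have "q0 * E (t' - h) * e (z - c * h + d) \<le> q0 * (sqrt \<Lambda> * E t') * (sqrt \<Lambda> * e (z - c * h))"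
              using 1 q0 E_le(2)[of t'] E[of "t' - h"] E[of t'] \<Lambda> logistic_pos[of lam "z - c * h + d"]
              by (intro mult_mono mult_left_mono) auto
            also have "\<dots> = q * (sqrt \<Lambda> * sqrt \<Lambda>) * e (z - c * h)" by (simp only: q_def mult_ac)
            finally have "q0 * E (t' - h) * e (z - c * h + d) \<le> q * \<Lambda> * e (z - c * h)" by (simp only: sq(3))
            moreover have "V (z - c * h) \<le> V (z - c * h + d)" using d0 by (intro V_mono) simp
            ultimately show ?thesis by (simp add: b_def zd)
          qed
          then have "g (V (z - c * h) - q * \<Lambda> * e (z - c * h)) \<le> g (b (t' - h) x)" by (rule g_mono)
          moreover have "g (b (t' - h) x) - g (u (t' - h) x) \<le> L * max 0 (b (t' - h) x - u (t' - h) x)"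
            by (rule g_diff_le)
          moreover note pert[OF q(1,2), of z] V_eq[of z]
          \<comment> \<open>The moving shift also acts on the perturbation, here with the
            unfavourable sign. Of the reserve \<open>2 * \<delta>1\<close> in
            \<open>perturbation_inequality\<close> one half is the decay of the amplitude and the
            other half pays for this term.\<close>
          moreover have "q * (\<sigma> * \<delta>1 * q * e1 z) \<le> \<delta>1 * (q * e z)"
          proof -
            have "\<sigma> * q * lam \<le> 1" 
              using q \<sigma> lam_pos by (intro order_trans[OF _ qb(3)] mult_right_mono mult_left_mono) auto
            then have "(\<sigma> * q * lam) * (e z * (1 - e z)) \<le> 1 * (e z * 1)"
              using logistic_pos[of lam z] logistic_less_1[of lam z] \<sigma> q lam_pos by (intro mult_mono) auto
            then have "\<delta>1 * q * ((\<sigma> * q * lam) * (e z * (1 - e z))) \<le> \<delta>1 * q * (1 * (e z * 1))"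
              using \<delta>1 q by (intro mult_left_mono) auto
            then show ?thesis by (simp add: mult_ac)
          qed
          ultimately show "(c + -1 * (\<sigma> * \<delta>1 * q)) * V' z + -1 * (q * ((c + -1 * (\<sigma> * \<delta>1 * q)) * e1 z) - \<delta>1 * (q * e z))
              \<le> V'' z + -1 * (q * e2 z) - b t' x + g (u (t' - h) x) + L * max 0 (b (t' - h) x - u (t' - h) x)"
            unfolding b_def z_def[symmetric] q_def[symmetric] by (simp add: algebra_simps)
        qed (unfold z_def q_def, (rule D)+)
      qed (use t h_ge_0 x in auto)
      show "asym_lower (s0 - \<sigma> * \<Lambda> * q0)"
        unfolding asym_lower_def
      proof (intro allI impI)
        fix \<epsilon> :: real assume \<epsilon>: "0 < \<epsilon>"
        let ?s = "s0 - \<sigma> * \<Lambda> * q0"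
        obtain T where T: "\<And>t. T \<le> t \<Longrightarrow> q0 * exp (lam * \<bar>s0\<bar>) * exp (- \<delta>1 * (t - T0)) \<le> \<epsilon>"
          using exp_decay[OF \<delta>1(1) \<epsilon>, of "q0 * exp (lam * \<bar>s0\<bar>)"] q0 by auto
        show "\<exists>T. \<forall>t\<ge>T. \<forall>x\<le>0. V (x + c * t + ?s) - \<epsilon> * e (x + c * t) \<le> u t x"
        proof (intro exI[of _ "max T T0"] allI impI)
          fix t x :: real assume t: "max T T0 \<le> t" and x: "x \<le> 0"
          have "s t \<le> s0" using E_le1[of t] \<sigma> q0 t \<Lambda> by (simp add: s_def)
          then have 1: "x + c * t + s t \<le> x + c * t + s0" by simp
          have 2: "x + c * t + ?s \<le> x + c * t + s t" using s_ge[of t] by simp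
          have "q0 * E t * e (x + c * t + s t) \<le> q0 * E t * (exp (lam * \<bar>s0\<bar>) * e (x + c * t))"
            using q0 E[of t] e_mono[OF 1] e_shift[of "x + c * t" s0] by (intro mult_left_mono) auto
          also have "\<dots> = q0 * exp (lam * \<bar>s0\<bar>) * exp (- \<delta>1 * (t - T0)) * e (x + c * t)"
            by (simp add: E_def)
          also have "\<dots> \<le> \<epsilon> * e (x + c * t)"
            using T[of t] t logistic_pos[of lam] by (intro mult_right_mono) (auto intro: less_imp_le)
          finally show "V (x + c * t + ?s) - \<epsilon> * e (x + c * t) \<le> u t x"
            using lb[of t x] t x V_mono[OF 2] by (simp add: b_def)
        qed
      qed
    }
  qed (use qb C in auto)
qed

end

section \<open>Asymptotic shifts and the spreading of a gap\<close>

context front_stability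
begin

lemma V_shift_both:
  assumes "\<bar>\<theta>\<bar> \<le> 1" and B: "\<And>\<xi>. \<bar>\<xi> - z\<bar> \<le> 1 \<Longrightarrow> V' \<xi> \<le> B"
  shows "\<bar>V (z + \<theta>) - V z\<bar> \<le> \<bar>\<theta>\<bar> * B"
proof (cases "0 \<le> \<theta>")
  case True
  then have "V (z + \<theta>) \<le> V z + \<theta> * B" using assms by (intro V_shift_le B) auto
  then show ?thesis using True V_mono[of z "z + \<theta>"] by simp
next
  case False
  then have "V ((z + \<theta>) + (- \<theta>)) \<le> V (z + \<theta>) + (- \<theta>) * B" using assms by (intro V_shift_le B) auto
  then show ?thesis using False V_mono[of "z + \<theta>" z] by simp
qed

lemma e_near: "\<bar>\<xi> - (z + a)\<bar> \<le> 1 \<Longrightarrow> e \<xi> \<le> exp (lam * (\<bar>a\<bar> + 1)) * e z"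
proof -
  assume "\<bar>\<xi> - (z + a)\<bar> \<le> 1"
  then have "exp (lam * \<bar>\<xi> - z\<bar>) \<le> exp (lam * (\<bar>a\<bar> + 1))" using lam_pos by simp
  then have "exp (lam * \<bar>\<xi> - z\<bar>) * e z \<le> exp (lam * (\<bar>a\<bar> + 1)) * e z"
    using logistic_pos[of lam z] by (intro mult_right_mono) auto
  then show ?thesis using e_shift[of z "\<xi> - z"] by simp
qed

lemma e_near': "\<bar>\<theta>\<bar> \<le> 1 \<Longrightarrow> e z \<le> exp (lam * (\<bar>a\<bar> + 1)) * e (z + a + \<theta>)"
proof -
  assume "\<bar>\<theta>\<bar> \<le> 1"
  then have "exp (lam * \<bar>- (a + \<theta>)\<bar>) \<le> exp (lam * (\<bar>a\<bar> + 1))" using lam_pos by simp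
  then have "exp (lam * \<bar>- (a + \<theta>)\<bar>) * e (z + a + \<theta>) \<le> exp (lam * (\<bar>a\<bar> + 1)) * e (z + a + \<theta>)"
    using logistic_pos[of lam "z + a + \<theta>"] by (intro mult_right_mono) auto
  then show ?thesis using e_shift[of "z + a + \<theta>" "- (a + \<theta>)"] by (simp add: add.assoc)
qed

lemma V_shift_bound:
  obtains K where "0 < K"
    "\<And>a \<theta> z. \<bar>\<theta>\<bar> \<le> 1 \<Longrightarrow> \<bar>V (z + a + \<theta>) - V (z + a)\<bar> \<le> \<bar>\<theta>\<bar> * (K * exp (lam * (\<bar>a\<bar> + 1)) * e z)"
proof -
  obtain K where K: "1 \<le> K" "\<And>z. V' z \<le> K * e z" using V'_bounded by blast
  show thesis
  proof (rule that[of K], goal_cases)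
    case (2 a \<theta> z)
    show ?case
    proof (rule V_shift_both[OF 2])
      fix \<xi> assume "\<bar>\<xi> - (z + a)\<bar> \<le> 1"
      from e_near[OF this] K(1) have "K * e \<xi> \<le> K * (exp (lam * (\<bar>a\<bar> + 1)) * e z)" by (intro mult_left_mono) auto
      then show "V' \<xi> \<le> K * exp (lam * (\<bar>a\<bar> + 1)) * e z" using K(2)[of \<xi>] by simp
    qed
  qed (use K in auto)
qed

text \<open>Here \<open>V'_small\<close> enters: far out in either direction, a translation by
  \<theta> costs an arbitrarily small multiple of \<theta> times the weight.\<close>

lemma V_shift_tail:
  assumes "0 < \<nu>"
  obtains Z where "\<And>z \<theta>. Z \<le> \<bar>z\<bar> \<Longrightarrow> \<bar>\<theta>\<bar> \<le> 1 \<Longrightarrow> \<bar>V (z + a + \<theta>) - V (z + a)\<bar> \<le> \<bar>\<theta>\<bar> * (\<nu> * e z)"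
proof -
  let ?K = "exp (lam * (\<bar>a\<bar> + 1))"
  obtain Z where Z: "\<And>z. Z \<le> \<bar>z\<bar> \<Longrightarrow> V' z \<le> \<nu> / ?K * e z" using V'_small[of "\<nu> / ?K"] assms by auto
  show thesis
  proof (rule that[of "Z + \<bar>a\<bar> + 1"], rule V_shift_both)
    fix z \<theta> \<xi> assume z: "Z + \<bar>a\<bar> + 1 \<le> \<bar>z\<bar>" and \<xi>: "\<bar>\<xi> - (z + a)\<bar> \<le> 1"
    have "V' \<xi> \<le> \<nu> / ?K * e \<xi>" using z \<xi> by (intro Z) auto
    also have "\<dots> \<le> \<nu> / ?K * (?K * e z)" using e_near[OF \<xi>] assms by (intro mult_left_mono) auto
    finally show "V' \<xi> \<le> \<nu> * e z" by simp
  qed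
qed

lemma asym_lower_mono: "asym_lower a \<Longrightarrow> a' \<le> a \<Longrightarrow> asym_lower a'"
  unfolding asym_lower_def
proof (intro allI impI)
  fix \<epsilon> :: real assume A: "\<forall>\<epsilon>>0. \<exists>T. \<forall>t\<ge>T. \<forall>x\<le>0. V (x + c * t + a) - \<epsilon> * e (x + c * t) \<le> u t x" "a' \<le> a" "0 < \<epsilon>"
  then obtain T where T: "\<And>t x. T \<le> t \<Longrightarrow> x \<le> 0 \<Longrightarrow> V (x + c * t + a) - \<epsilon> * e (x + c * t) \<le> u t x" by blast
  have "V (x + c * t + a') - \<epsilon> * e (x + c * t) \<le> u t x" if "T \<le> t" "x \<le> 0" for t x
    using T[OF that] V_mono[of "x + c * t + a'" "x + c * t + a"] A(2) by simp
  then show "\<exists>T. \<forall>t\<ge>T. \<forall>x\<le>0. V (x + c * t + a') - \<epsilon> * e (x + c * t) \<le> u t x" by blast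
qed

lemma asym_upper_mono: "asym_upper b \<Longrightarrow> b \<le> b' \<Longrightarrow> asym_upper b'"
  unfolding asym_upper_def
proof (intro allI impI)
  fix \<epsilon> :: real assume A: "\<forall>\<epsilon>>0. \<exists>T. \<forall>t\<ge>T. \<forall>x\<le>0. u t x \<le> V (x + c * t + b) + \<epsilon> * e (x + c * t)" "b \<le> b'" "0 < \<epsilon>"
  then obtain T where T: "\<And>t x. T \<le> t \<Longrightarrow> x \<le> 0 \<Longrightarrow> u t x \<le> V (x + c * t + b) + \<epsilon> * e (x + c * t)" by blast
  have "u t x \<le> V (x + c * t + b') + \<epsilon> * e (x + c * t)" if "T \<le> t" "x \<le> 0" for t x
    using T[OF that] V_mono[of "x + c * t + b" "x + c * t + b'"] A(2) by simp
  then show "\<exists>T. \<forall>t\<ge>T. \<forall>x\<le>0. u t x \<le> V (x + c * t + b') + \<epsilon> * e (x + c * t)" by blast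
qed

text \<open>Since \<open>V'\<close> is dominated by the weight, a translation by \<theta> changes
  \<open>V\<close> by at most a constant times \<theta> times the weight. Hence the extremal
  asymptotic shifts are attained.\<close>

lemma asym_closed:
  "(\<And>\<eta>. 0 < \<eta> \<Longrightarrow> asym_lower (a - \<eta>)) \<Longrightarrow> asym_lower a"
  "(\<And>\<eta>. 0 < \<eta> \<Longrightarrow> asym_upper (a + \<eta>)) \<Longrightarrow> asym_upper a"
proof -
  obtain K where K: "0 < K"
    "\<And>a \<theta> z. \<bar>\<theta>\<bar> \<le> 1 \<Longrightarrow> \<bar>V (z + a + \<theta>) - V (z + a)\<bar> \<le> \<bar>\<theta>\<bar> * (K * exp (lam * (\<bar>a\<bar> + 1)) * e z)"
    using V_shift_bound by blast
  define K1 where "K1 = K * exp (lam * (\<bar>a\<bar> + 1))"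
  have K1: "0 < K1" using K by (simp add: K1_def)
  have small: "\<exists>\<theta>>0. \<forall>z. \<bar>V (z + a + \<theta>) - V (z + a)\<bar> \<le> \<epsilon> / 2 * e z \<and> \<bar>V (z + a + (- \<theta>)) - V (z + a)\<bar> \<le> \<epsilon> / 2 * e z"
    if "0 < \<epsilon>" for \<epsilon>
  proof -
    define \<theta> where "\<theta> = min 1 (\<epsilon> / (2 * K1))"
    have \<theta>: "0 < \<theta>" "\<theta> \<le> 1" "\<theta> * K1 \<le> \<epsilon> / 2"
    proof -
      have "\<theta> * K1 \<le> \<epsilon> / (2 * K1) * K1" unfolding \<theta>_def using K1 by (intro mult_right_mono) auto
      then show "\<theta> * K1 \<le> \<epsilon> / 2" using K1 by simp
    qed (use that K1 in \<open>auto simp: \<theta>_def\<close>)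
    have "\<theta> * (K1 * e z) \<le> \<epsilon> / 2 * e z" for z
      using \<theta>(3) logistic_pos[of lam z] mult_right_mono[of "\<theta> * K1" "\<epsilon> / 2" "e z"] by (simp add: mult.assoc)
    moreover have "\<bar>V (z + a + \<theta>) - V (z + a)\<bar> \<le> \<theta> * (K1 * e z)" "\<bar>V (z + a + (- \<theta>)) - V (z + a)\<bar> \<le> \<theta> * (K1 * e z)" for z
      using K(2)[of \<theta> z a] K(2)[of "- \<theta>" z a] \<theta> unfolding K1_def by simp_all
    ultimately show ?thesis using \<theta>(1) by (intro exI[of _ \<theta>]) (blast intro: order_trans)
  qed
  show "asym_lower a" if A: "\<And>\<eta>. 0 < \<eta> \<Longrightarrow> asym_lower (a - \<eta>)"
    unfolding asym_lower_def
  proof (intro allI impI)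
    fix \<epsilon> :: real assume \<epsilon>: "0 < \<epsilon>"
    obtain \<theta> where \<theta>: "0 < \<theta>" "\<And>z. \<bar>V (z + a + (- \<theta>)) - V (z + a)\<bar> \<le> \<epsilon> / 2 * e z" using small[OF \<epsilon>] by blast
    obtain T where T: "\<And>t x. T \<le> t \<Longrightarrow> x \<le> 0 \<Longrightarrow> V (x + c * t + (a - \<theta>)) - \<epsilon> / 2 * e (x + c * t) \<le> u t x"
      using A[OF \<theta>(1)] \<epsilon> unfolding asym_lower_def by (meson half_gt_zero)
    have "V (x + c * t + a) - \<epsilon> * e (x + c * t) \<le> u t x" if "T \<le> t" "x \<le> 0" for t x
    proof -
      have eq: "x + c * t + a + (- \<theta>) = x + c * t + (a - \<theta>)" by simp
      note \<theta>(2)[of "x + c * t", unfolded eq]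
      moreover have "\<epsilon> / 2 * e (x + c * t) + \<epsilon> / 2 * e (x + c * t) = \<epsilon> * e (x + c * t)" by simp
      ultimately show ?thesis using T[OF that] by linarith
    qed
    then show "\<exists>T. \<forall>t\<ge>T. \<forall>x\<le>0. V (x + c * t + a) - \<epsilon> * e (x + c * t) \<le> u t x" by blast
  qed
  show "asym_upper a" if A: "\<And>\<eta>. 0 < \<eta> \<Longrightarrow> asym_upper (a + \<eta>)"
    unfolding asym_upper_def
  proof (intro allI impI)
    fix \<epsilon> :: real assume \<epsilon>: "0 < \<epsilon>"
    obtain \<theta> where \<theta>: "0 < \<theta>" "\<And>z. \<bar>V (z + a + \<theta>) - V (z + a)\<bar> \<le> \<epsilon> / 2 * e z" using small[OF \<epsilon>] by blast
    obtain T where T: "\<And>t x. T \<le> t \<Longrightarrow> x \<le> 0 \<Longrightarrow> u t x \<le> V (x + c * t + (a + \<theta>)) + \<epsilon> / 2 * e (x + c * t)"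
      using A[OF \<theta>(1)] \<epsilon> unfolding asym_upper_def by (meson half_gt_zero)
    have "u t x \<le> V (x + c * t + a) + \<epsilon> * e (x + c * t)" if "T \<le> t" "x \<le> 0" for t x
    proof -
      have eq: "x + c * t + a + \<theta> = x + c * t + (a + \<theta>)" by simp
      note \<theta>(2)[of "x + c * t", unfolded eq]
      moreover have "\<epsilon> / 2 * e (x + c * t) + \<epsilon> / 2 * e (x + c * t) = \<epsilon> * e (x + c * t)" by simp
      ultimately show ?thesis using T[OF that] by linarith
    qed
    then show "\<exists>T. \<forall>t\<ge>T. \<forall>x\<le>0. u t x \<le> V (x + c * t + a) + \<epsilon> * e (x + c * t)" by blast
  qed
qed

text \<open>At the moving point \<open>x = - c * t\<close> the two bounds compare \<open>V a\<close>
  with \<open>V b\<close> up to an arbitrarily small error.\<close>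

lemma asym_lower_le_upper:
  assumes "asym_lower a" "asym_upper b" shows "a \<le> b"
proof (rule ccontr)
  assume "\<not> a \<le> b"
  then have "V b < V a" using V_strict_mono by simp
  define D where "D = (V a - V b) / 4"
  have D: "0 < D" "V a - V b = 4 * D" using \<open>V b < V a\<close> by (auto simp: D_def)
  obtain T1 where T1: "\<And>t x. T1 \<le> t \<Longrightarrow> x \<le> 0 \<Longrightarrow> V (x + c * t + a) - D * e (x + c * t) \<le> u t x"
    using assms(1) D(1) unfolding asym_lower_def by blast
  obtain T2 where T2: "\<And>t x. T2 \<le> t \<Longrightarrow> x \<le> 0 \<Longrightarrow> u t x \<le> V (x + c * t + b) + D * e (x + c * t)"
    using assms(2) D(1) unfolding asym_upper_def by blast
  define t where "t = max 0 (max T1 T2)"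
  have t: "T1 \<le> t" "T2 \<le> t" "- c * t \<le> 0" using c_pos by (auto simp: t_def mult_nonneg_nonneg)
  have "V a - D * e 0 \<le> V b + D * e 0"
    using order_trans[OF T1[OF t(1,3)] T2[OF t(2,3)]] by simp
  moreover have "D * e 0 \<le> D * 1"
    using D logistic_less_1[of lam 0] by (intro mult_left_mono) auto
  ultimately show False using D by linarith
qed

text \<open>A large shift turns the exponential bound on the initial data into a bound by the weight
  with amplitude \<open>qb\<close>. Where the shifted argument exceeds \<open>Y\<close>, front and
  perturbation together are already above \<kappa>.\<close>

lemma asym_upper_exists: "\<exists>b. asym_upper b"
proof -
  obtain \<sigma>1 qb C \<gamma> T1 where B: "0 < \<sigma>1" "0 < qb" "0 < C" "0 < \<gamma>"
    "\<And>q0 s0 T0. \<lbrakk>0 < q0; q0 \<le> qb; 0 \<le> T0;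
       \<And>t x. T0 - h \<le> t \<Longrightarrow> t \<le> T0 \<Longrightarrow> u t x \<le> V (x + c * t + s0) + q0 * e (x + c * t + s0)\<rbrakk> \<Longrightarrow>
       asym_upper (s0 + \<sigma>1 * q0)"
    "\<And>q0 s0 T0. \<lbrakk>0 < q0; q0 \<le> qb; 0 \<le> T0; T1 \<le> T0; C * exp (- \<gamma> * T0) \<le> q0 * e (c * T0 + s0 - \<sigma>1 * q0);
       \<And>t x. T0 - h \<le> t \<Longrightarrow> t \<le> T0 \<Longrightarrow> x \<le> 0 \<Longrightarrow> V (x + c * t + s0) - q0 / 2 * e (x + c * t + s0) \<le> u t x\<rbrakk> \<Longrightarrow>
       asym_lower (s0 - \<sigma>1 * q0)" by (rule barriers) blast
  obtain Y where Y: "0 \<le> Y" "\<And>z. Y \<le> z \<Longrightarrow> \<kappa> - qb / 2 \<le> V z" using V_near_kappa[of "qb / 2"] B by auto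
  \<comment> \<open>To the left of \<open>Y\<close> the weight is at least
    \<open>exp (lam * z) / (1 + exp (lam * Y))\<close>; \<open>P\<close> is the factor still
    missing. The extra \<open>c * h\<close> in the shift compensates for negative times on the
    initial strip.\<close>
  define P where "P = (\<bar>A\<bar> + 1) / (qb / (1 + exp (lam * Y)))"
  have den: "0 < 1 + exp (lam * Y)" by (simp add: add_pos_pos)
  have P: "0 < P" unfolding P_def using B den by (intro divide_pos_pos) auto
  define s0 where "s0 = c * h + ln P / lam"
  have s0: "exp (lam * (s0 - c * h)) = P" using lam_pos P by (simp add: s0_def)
  have "asym_upper (s0 + \<sigma>1 * qb)"
  proof (rule B(5)[OF B(2) order_refl order_refl])
    fix t x assume t: "0 - h \<le> t" "t \<le> 0"
    define z where "z = x + c * t + s0"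
    have "u t x \<le> V z + qb * e z"
    proof (cases "Y \<le> z")
      case True
      then have "qb * (1 / 2) \<le> qb * e z"
        using logistic_ge_half[of lam z] Y lam_pos B by (intro mult_left_mono) auto
      then show ?thesis using Y(2)[OF True] u_le_kappa[of t x] t by simp
    next
      case False
      have "(\<bar>A\<bar> + 1) * exp (lam * x) = qb * (1 / (1 + exp (lam * Y))) * P * exp (lam * x)"
        unfolding P_def using B den by simp
      also have "\<dots> = qb * (exp (lam * (x + s0 - c * h)) * (1 / (1 + exp (lam * Y))))"
        unfolding s0[symmetric] by (simp add: algebra_simps flip: exp_add)
      also have "\<dots> \<le> qb * e z"
      proof (rule mult_left_mono)
        have "- (c * h) \<le> c * t" using t c_pos mult_left_mono[of "- h" t c] by simp
        then have "exp (lam * (x + s0 - c * h)) \<le> exp (lam * z)" using lam_pos by (simp add: z_def)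
        moreover have "1 / (1 + exp (lam * Y)) \<le> 1 / (1 + exp (lam * z))"
          using False lam_pos den by (intro divide_left_mono add_mono mult_pos_pos) (auto simp: add_pos_pos)
        ultimately have "exp (lam * (x + s0 - c * h)) * (1 / (1 + exp (lam * Y))) \<le> exp (lam * z) * (1 / (1 + exp (lam * z)))"
          using den by (intro mult_mono) auto
        also have "1 / (1 + exp (lam * z)) = 1 - e z" using logistic_minus[of lam z] by (simp add: logistic_def)
        finally show "exp (lam * (x + s0 - c * h)) * (1 / (1 + exp (lam * Y))) \<le> e z" using logistic_eq[of lam z] by simp
      qed (use B in auto)
      finally have "(\<bar>A\<bar> + 1) * exp (lam * x) \<le> qb * e z" .
      moreover have "A * exp (lam * x) \<le> (\<bar>A\<bar> + 1) * exp (lam * x)" by (intro mult_right_mono) auto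
      ultimately show ?thesis using init_exp[of t x] t V_pos[of z] by linarith
    qed
    then show "u t x \<le> V (x + c * t + s0) + qb * e (x + c * t + s0)" by (simp add: z_def)
  qed
  then show ?thesis by blast
qed

text \<open>Far to the left the front is smaller than half the perturbation, so a barrier shifted to
  the right by \<open>c * T0\<close> starts below zero on the half-line. The time \<open>T0\<close>
  is taken late enough for the condition at \<open>x = 0\<close>.\<close>

lemma asym_lower_exists: "\<exists>a. asym_lower a"
proof -
  obtain \<sigma>1 qb C \<gamma> T1 where B: "0 < \<sigma>1" "0 < qb" "0 < C" "0 < \<gamma>"
    "\<And>q0 s0 T0. \<lbrakk>0 < q0; q0 \<le> qb; 0 \<le> T0;
       \<And>t x. T0 - h \<le> t \<Longrightarrow> t \<le> T0 \<Longrightarrow> u t x \<le> V (x + c * t + s0) + q0 * e (x + c * t + s0)\<rbrakk> \<Longrightarrow>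
       asym_upper (s0 + \<sigma>1 * q0)"
    "\<And>q0 s0 T0. \<lbrakk>0 < q0; q0 \<le> qb; 0 \<le> T0; T1 \<le> T0; C * exp (- \<gamma> * T0) \<le> q0 * e (c * T0 + s0 - \<sigma>1 * q0);
       \<And>t x. T0 - h \<le> t \<Longrightarrow> t \<le> T0 \<Longrightarrow> x \<le> 0 \<Longrightarrow> V (x + c * t + s0) - q0 / 2 * e (x + c * t + s0) \<le> u t x\<rbrakk> \<Longrightarrow>
       asym_lower (s0 - \<sigma>1 * q0)" by (rule barriers) blast
  obtain Y where Y: "\<And>z. z \<le> Y \<Longrightarrow> V z \<le> qb / 2 * e z" using V_small[of "qb / 2"] B by auto
  obtain T where T: "\<And>t. T \<le> t \<Longrightarrow> C * exp (- \<gamma> * (t - 0)) \<le> qb * e (Y - \<sigma>1 * qb)"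
    using exp_decay[OF B(4), of "qb * e (Y - \<sigma>1 * qb)" C 0] B logistic_pos[of lam "Y - \<sigma>1 * qb"] by auto
  define T0 where "T0 = max 0 (max T T1)"
  have "asym_lower (Y - c * T0 - \<sigma>1 * qb)"
  proof (rule B(6)[OF B(2) order_refl, of T0])
    show "C * exp (- \<gamma> * T0) \<le> qb * e (c * T0 + (Y - c * T0) - \<sigma>1 * qb)" using T[of T0] by (simp add: T0_def)
    fix t x assume t: "T0 - h \<le> t" "t \<le> T0" and x: "x \<le> (0::real)"
    have "c * t \<le> c * T0" using t c_pos by simp
    then have "x + c * t + (Y - c * T0) \<le> Y" using x by simp
    moreover have "0 \<le> u t x" using t by (intro u_nonneg) (simp add: T0_def)
    ultimately show "V (x + c * t + (Y - c * T0)) - qb / 2 * e (x + c * t + (Y - c * T0)) \<le> u t x"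
      using Y[of "x + c * t + (Y - c * T0)"] by linarith
  qed (auto simp: T0_def)
  then show ?thesis by blast
qed

text \<open>A quantitative strong maximum principle. A gap \<open>m\<close> at the moving point
  persists on an interval by the moduli of \<open>u\<close> and \<open>V\<close>, and the Gaussian
  barrier carries it to all \<open>\<bar>z\<bar> \<le> Z\<close> during a whole delay. The
  difference may be as low as \<open>- \<epsilon>\<close>, which enters the linear inequality as the
  error \<open>(L + 1) * \<epsilon>\<close>; \<eta> depends neither on \<epsilon> nor on the
  time.\<close>

lemma spread_gap:
  assumes sg: "sg = 1 \<or> sg = -1" and m: "0 < m"
  obtains \<eta> where "0 < \<eta>"
    "\<And>\<epsilon> T. \<lbrakk>0 \<le> \<epsilon>; \<And>t x. T \<le> t \<Longrightarrow> x \<le> 0 \<Longrightarrow> - (\<epsilon> * e (x + c * t)) \<le> sg * (u t x - V (x + c * t + a))\<rbrakk> \<Longrightarrow>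
       \<exists>T1. \<forall>t0\<ge>T1. m \<le> sg * (u t0 (- c * t0) - V a) \<longrightarrow>
         (\<forall>t x. t0 + 1 \<le> t \<longrightarrow> t \<le> t0 + 1 + h \<longrightarrow> \<bar>x + c * t\<bar> \<le> Z \<longrightarrow> x \<le> 0 \<longrightarrow>
            \<eta> - (L + 1) * \<epsilon> \<le> sg * (u t x - V (x + c * t + a)))"
proof -
  obtain K where K: "1 \<le> K" "\<And>z. V' z \<le> K * e z" using V'_bounded by blast
  have VK: "V' z \<le> K" for z
    using K(2)[of z] K(1) logistic_less_1[of lam z] mult_left_mono[of "e z" 1 K] by linarith
  \<comment> \<open>The Lipschitz parts of the moduli of \<open>u\<close> and \<open>V\<close> then
    consume at most \<open>m / 4\<close>. The exponentially decaying remainder of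
    \<open>u_modulus\<close> takes another \<open>m / 4\<close>, leaving half of the gap.\<close>
  define r where "r = min 1 (m / (4 * (2 * \<kappa> + K)))"
  have den: "0 < 2 * \<kappa> + K" using kappa_pos K by simp
  have r: "0 < r" "r \<le> 1" using m den by (auto simp: r_def)
  have "(2 * \<kappa> + K) * r \<le> (2 * \<kappa> + K) * (m / (4 * (2 * \<kappa> + K)))"
    using den by (intro mult_left_mono) (auto simp: r_def)
  also have "\<dots> = m / 4" using nonzero_mult_divide_mult_cancel_left[of "2 * \<kappa> + K" m 4] den by (simp add: mult.commute)
  finally have rm: "(2 * \<kappa> + K) * r \<le> m / 4" .
  \<comment> \<open>During the time \<open>1 + h\<close> the frame moves by up to
    \<open>c * (1 + h)\<close> relative to the fixed centre \<open>- c * t0\<close>.\<close>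
  define R1 where "R1 = \<bar>Z\<bar> + c * (1 + h)"
  have m2: "0 < m / 2" and h1: "(1::real) \<le> 1 + h" using m h_ge_0 by auto
  obtain \<eta> R where \<eta>: "0 < \<eta>" "0 < R"
    and sp: "\<And>w t0 x0 E t x.
       \<lbrakk>continuous_on ({t0..t0+(1+h)} \<times> UNIV) (\<lambda>(t,x). w t x); 0 \<le> E;
        \<And>t x. t0 \<le> t \<Longrightarrow> t \<le> t0 + (1+h) \<Longrightarrow> - E \<le> w t x;
        \<And>x. \<bar>x - x0\<bar> \<le> r \<Longrightarrow> m / 2 \<le> w t0 x;
        \<And>t x. t0 < t \<Longrightarrow> t \<le> t0 + (1+h) \<Longrightarrow> \<bar>x - x0\<bar> < R \<Longrightarrow>
          \<exists>wt wx wxx r. r > 0 \<and> ((\<lambda>\<tau>. w \<tau> x) has_real_derivative wt) (at t) \<and>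
            (\<forall>y. \<bar>y - x\<bar> < r \<longrightarrow> (w t has_real_derivative wx y) (at y)) \<and>
            (wx has_real_derivative wxx) (at x) \<and> wxx - w t x - E \<le> wt;
        t0 + 1 \<le> t; t \<le> t0 + (1+h); \<bar>x - x0\<bar> \<le> R1\<rbrakk> \<Longrightarrow> \<eta> - E \<le> w t x"
    using gaussian_spread[OF m2 r(1) zero_less_one h1, of R1] by blast
  obtain T2 where T2: "\<And>t. T2 \<le> t \<Longrightarrow> 2 * \<kappa> * exp (- 2 * (t - 0)) \<le> m / 4"
    using exp_decay[of 2 "m / 4" "2 * \<kappa>" 0] m kappa_pos by auto
  show thesis
  proof (rule that[OF \<eta>(1)])
    fix \<epsilon> T assume \<epsilon>: "0 \<le> \<epsilon>"
      and low: "\<And>t x. T \<le> t \<Longrightarrow> x \<le> 0 \<Longrightarrow> - (\<epsilon> * e (x + c * t)) \<le> sg * (u t x - V (x + c * t + a))"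
    have low': "- \<epsilon> \<le> sg * (u t x - V (x + c * t + a))" if "T \<le> t" "x \<le> 0" for t x
      using low[OF that] mult_left_mono[of "e (x + c * t)" 1 \<epsilon>] \<epsilon> logistic_less_1[of lam "x + c * t"] by simp
    define T1 where "T1 = Max {0, T + h, T2, r / c, R / c, R1 / c}"
    have T1: "0 \<le> T1" "T + h \<le> T1" "T2 \<le> T1" "r / c \<le> T1" "R / c \<le> T1"
      unfolding T1_def by (rule Max_ge; simp)+
    show "\<exists>T1. \<forall>t0\<ge>T1. m \<le> sg * (u t0 (- c * t0) - V a) \<longrightarrow>
         (\<forall>t x. t0 + 1 \<le> t \<longrightarrow> t \<le> t0 + 1 + h \<longrightarrow> \<bar>x + c * t\<bar> \<le> Z \<longrightarrow> x \<le> 0 \<longrightarrow>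
            \<eta> - (L + 1) * \<epsilon> \<le> sg * (u t x - V (x + c * t + a)))"
    proof (intro exI[of _ T1] allI impI)
      fix t0 t x assume t0: "T1 \<le> t0" and gap: "m \<le> sg * (u t0 (- c * t0) - V a)"
        and t: "t0 + 1 \<le> t" "t \<le> t0 + 1 + h" and x: "\<bar>x + c * t\<bar> \<le> Z" "x \<le> 0"
      have rc: "r \<le> c * t0" "R \<le> c * t0"
      proof -
        have "r \<le> T1 * c" "R \<le> T1 * c" using T1(4,5) c_pos by (simp_all add: field_simps)
        moreover have "T1 * c \<le> t0 * c" using t0 c_pos by (intro mult_right_mono) auto
        ultimately show "r \<le> c * t0" "R \<le> c * t0" by (simp_all add: mult.commute)
      qed
      \<comment> \<open>The truncation keeps the lower bound valid for \<open>x > 0\<close>. The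
        differential inequality is asked only within distance \<open>R\<close> of
        \<open>- c * t0\<close>, which for late \<open>t0\<close> lies in
        \<open>x < 0\<close>.\<close>
      define w where "w = (\<lambda>t x. sg * (u t (min x 0) - V (min x 0 + c * t + a)))"
      have "\<eta> - (L + 1) * \<epsilon> \<le> w t x"
      proof (rule sp[where w=w and E="(L + 1) * \<epsilon>" and ?t0.0=t0 and ?x0.0="- c * t0"])
        show "continuous_on ({t0..t0 + (1 + h)} \<times> UNIV) (\<lambda>(t, x). w t x)"
          unfolding w_def case_prod_unfold using T1 t0 h_ge_0
          by (intro continuous_intros u_cont_sub continuous_on_compose2[OF V_cont[of UNIV]]) auto
        show "0 \<le> (L + 1) * \<epsilon>" using \<epsilon> L_ge_1 by simp
        show "- ((L + 1) * \<epsilon>) \<le> w t x" if "t0 \<le> t" for t x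
        proof -
          have "- \<epsilon> \<le> w t x" unfolding w_def using that T1 t0 h_ge_0 by (intro low') auto
          moreover have "1 * \<epsilon> \<le> (L + 1) * \<epsilon>" using \<epsilon> L_ge_1 by (intro mult_right_mono) auto
          ultimately show ?thesis by linarith
        qed
        show "m / 2 \<le> w t0 y" if y: "\<bar>y - - c * t0\<bar> \<le> r" for y
        proof -
          have y0: "min y 0 = y" using y rc by auto
          have "\<bar>u t0 y - u t0 (- c * t0)\<bar> \<le> 2 * \<kappa> * \<bar>y - - c * t0\<bar> + 2 * \<kappa> * exp (- 2 * t0)"
            using u_modulus[of t0 y "- c * t0"] u_modulus[of t0 "- c * t0" y] T1 t0 by (simp add: abs_le_iff abs_minus_commute)
          also have "\<dots> \<le> 2 * \<kappa> * r + m / 4"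
            using y kappa_pos T2[of t0] T1 t0 by (intro add_mono mult_left_mono) auto
          finally have 1: "\<bar>u t0 y - u t0 (- c * t0)\<bar> \<le> 2 * \<kappa> * r + m / 4" .
          have "\<bar>V (a + (y + c * t0)) - V a\<bar> \<le> \<bar>y + c * t0\<bar> * K"
            using y r VK by (intro V_shift_both) auto
          also have "\<dots> \<le> r * K" using y K by (intro mult_right_mono) auto
          finally have 2: "\<bar>V (y + c * t0 + a) - V a\<bar> \<le> r * K" by (simp add: add_ac)
          show ?thesis using 1 2 gap rm sg unfolding w_def y0 by (auto simp: algebra_simps)
        qed
        show "\<exists>wt wx wxx r. r > 0 \<and> ((\<lambda>\<tau>. w \<tau> x) has_real_derivative wt) (at t) \<and>
            (\<forall>y. \<bar>y - x\<bar> < r \<longrightarrow> (w t has_real_derivative wx y) (at y)) \<and>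
            (wx has_real_derivative wxx) (at x) \<and> wxx - w t x - (L + 1) * \<epsilon> \<le> wt"
          if t: "t0 < t" and x: "\<bar>x - - c * t0\<bar> < R" for t x
        proof (intro exI conjI allI impI)
          have x0: "x < 0" using x rc by auto
          have tp: "0 < t" using t T1 t0 by simp
          show "0 < - x" using x0 by simp
          show "((\<lambda>\<tau>. w \<tau> x) has_real_derivative (sg * (ut t x - V' (x + c * t + a) * c))) (at t)"
          proof -
            have "((\<lambda>\<tau>. V (x + c * \<tau> + a)) has_real_derivative V' (x + c * t + a) * c) (at t)"
              by (rule DERIV_chain2[OF V_deriv]) (auto intro!: derivative_eq_intros)
            from DERIV_cmult[OF DERIV_diff[OF u_t[OF tp, of x] this], of sg] show ?thesis using x0 by (simp add: w_def)
          qed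
          show "(w t has_real_derivative (sg * (ux t y - V' (y + c * t + a)))) (at y)" if "\<bar>y - x\<bar> < - x" for y
          proof (rule has_field_derivative_transform_within_open[where S="{..<0}"])
            have "((\<lambda>x. V (x + c * t + a)) has_real_derivative V' (y + c * t + a) * 1) (at y)"
              by (rule DERIV_chain2[OF V_deriv]) (auto intro!: derivative_eq_intros)
            from DERIV_cmult[OF DERIV_diff[OF u_x[OF tp, of y] this], of sg]
            show "((\<lambda>x. sg * (u t x - V (x + c * t + a))) has_real_derivative (sg * (ux t y - V' (y + c * t + a)))) (at y)" by simp
          qed (use that in \<open>auto simp: w_def\<close>)
          show "((\<lambda>y. sg * (ux t y - V' (y + c * t + a))) has_real_derivative (sg * (uxx t x - V'' (x + c * t + a)))) (at x)"
          proof -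
            have "((\<lambda>x. V' (x + c * t + a)) has_real_derivative V'' (x + c * t + a) * 1) (at x)"
              by (rule DERIV_chain2[OF V'_deriv]) (auto intro!: derivative_eq_intros)
            from DERIV_cmult[OF DERIV_diff[OF u_xx[OF tp, of x] this], of sg] show ?thesis by simp
          qed
          have z: "x + c * (t - h) + a = x + c * t + a - c * h" by (simp add: algebra_simps)
          have "- \<epsilon> \<le> sg * (u (t - h) x - V (x + c * t + a - c * h))"
            using low'[of "t - h" x] T1 t0 t x0 unfolding z by simp
          then have "- (L * \<epsilon>) \<le> sg * (g (u (t - h) x) - g (V (x + c * t + a - c * h)))"
          proof -
            assume A: "- \<epsilon> \<le> sg * (u (t - h) x - V (x + c * t + a - c * h))"
            have "L * max 0 (V (x + c * t + a - c * h) - u (t - h) x) \<le> L * \<epsilon>" if "sg = 1"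
              using A that L_ge_1 \<epsilon> by (intro mult_left_mono) auto
            moreover have "L * max 0 (u (t - h) x - V (x + c * t + a - c * h)) \<le> L * \<epsilon>" if "sg = -1"
              using A that L_ge_1 \<epsilon> by (intro mult_left_mono) auto
            ultimately show ?thesis
              using sg g_diff_le[of "V (x + c * t + a - c * h)" "u (t - h) x"] g_diff_le[of "u (t - h) x" "V (x + c * t + a - c * h)"]
              by fastforce
          qed
          moreover have "w t x = sg * (u t x - V (x + c * t + a))" using x0 by (simp add: w_def)
          ultimately show "sg * (uxx t x - V'' (x + c * t + a)) - w t x - (L + 1) * \<epsilon> \<le> sg * (ut t x - V' (x + c * t + a) * c)"
            using u_eq[OF tp, of x] V_eq[of "x + c * t + a"] \<epsilon> sg by (auto simp: algebra_simps)
        qed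
        show "\<bar>x - - c * t0\<bar> \<le> R1"
        proof -
          have "c * (t - t0) \<le> c * (1 + h)" "0 \<le> c * (t - t0)" using t c_pos by auto
          then show ?thesis using x unfolding R1_def by (simp add: algebra_simps)
        qed
      qed (use t in auto)
      then show "\<eta> - (L + 1) * \<epsilon> \<le> sg * (u t x - V (x + c * t + a))" using x by (simp add: w_def)
    qed
  qed
qed

end

section \<open>Coincidence of the extremal shifts\<close>

context front_stability
begin

text \<open>Raise the shift by a small \<theta>. On \<open>\<bar>z\<bar> \<le> Z\<close> the spread
  gap absorbs the change. In the tails \<open>V'\<close> is so small that a perturbation of
  amplitude \<open>q0\<close> does, and its cost in shift is only \<open>\<theta> / 2\<close>. The
  net gain is \<open>\<theta> / 2\<close>.\<close>

lemma improve_lower: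
  assumes low: "asym_lower a" and m: "0 < m"
    and often: "\<And>T. \<exists>t0\<ge>T. m \<le> u t0 (- c * t0) - V a"
  shows "\<exists>\<theta>>0. asym_lower (a + \<theta>)"
proof -
  obtain \<sigma>1 qb C \<gamma> T1 where B: "0 < \<sigma>1" "0 < qb" "0 < C" "0 < \<gamma>"
    "\<And>q0 s0 T0. \<lbrakk>0 < q0; q0 \<le> qb; 0 \<le> T0;
       \<And>t x. T0 - h \<le> t \<Longrightarrow> t \<le> T0 \<Longrightarrow> u t x \<le> V (x + c * t + s0) + q0 * e (x + c * t + s0)\<rbrakk> \<Longrightarrow>
       asym_upper (s0 + \<sigma>1 * q0)"
    "\<And>q0 s0 T0. \<lbrakk>0 < q0; q0 \<le> qb; 0 \<le> T0; T1 \<le> T0; C * exp (- \<gamma> * T0) \<le> q0 * e (c * T0 + s0 - \<sigma>1 * q0);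
       \<And>t x. T0 - h \<le> t \<Longrightarrow> t \<le> T0 \<Longrightarrow> x \<le> 0 \<Longrightarrow> V (x + c * t + s0) - q0 / 2 * e (x + c * t + s0) \<le> u t x\<rbrakk> \<Longrightarrow>
       asym_lower (s0 - \<sigma>1 * q0)" by (rule barriers) blast
  obtain K where K: "0 < K"
    "\<And>a \<theta> z. \<bar>\<theta>\<bar> \<le> 1 \<Longrightarrow> \<bar>V (z + a + \<theta>) - V (z + a)\<bar> \<le> \<bar>\<theta>\<bar> * (K * exp (lam * (\<bar>a\<bar> + 1)) * e z)"
    using V_shift_bound by blast
  define K1 where "K1 = exp (lam * (\<bar>a\<bar> + 1))"
  have K1: "0 < K1" by (simp add: K1_def)
  \<comment> \<open>Makes the shift cost of \<open>q0 = 4 * K1 * \<nu> * \<theta>\<close> equal to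
    \<open>\<theta> / 2\<close>. The 4 stems from two errors of size
    \<open>\<theta> * \<nu>\<close>, from the front and from \<epsilon>, and from the
    \<open>q0 / 2\<close> in \<open>barriers\<close>; \<open>K1\<close> moves the weight to the
    shifted argument.\<close>
  define \<nu> where "\<nu> = 1 / (8 * K1 * \<sigma>1)"
  have \<nu>: "0 < \<nu>" "\<sigma>1 * (4 * K1 * \<nu>) = 1 / 2" using K1 B by (auto simp: \<nu>_def)
  obtain Z where Z: "\<And>z \<theta>. Z \<le> \<bar>z\<bar> \<Longrightarrow> \<bar>\<theta>\<bar> \<le> 1 \<Longrightarrow> \<bar>V (z + a + \<theta>) - V (z + a)\<bar> \<le> \<bar>\<theta>\<bar> * (\<nu> * e z)"
    using V_shift_tail[OF \<nu>(1)] by blast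
  obtain \<eta> where \<eta>: "0 < \<eta>"
    "\<And>\<epsilon> T. \<lbrakk>0 \<le> \<epsilon>; \<And>t x. T \<le> t \<Longrightarrow> x \<le> 0 \<Longrightarrow> - (\<epsilon> * e (x + c * t)) \<le> 1 * (u t x - V (x + c * t + a))\<rbrakk> \<Longrightarrow>
       \<exists>T1. \<forall>t0\<ge>T1. m \<le> 1 * (u t0 (- c * t0) - V a) \<longrightarrow>
         (\<forall>t x. t0 + 1 \<le> t \<longrightarrow> t \<le> t0 + 1 + h \<longrightarrow> \<bar>x + c * t\<bar> \<le> Z \<longrightarrow> x \<le> 0 \<longrightarrow>
            \<eta> - (L + 1) * \<epsilon> \<le> 1 * (u t x - V (x + c * t + a)))"
    by (rule spread_gap[of 1 m a Z]) (use m in auto)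
  define Kb where "Kb = K * K1"
  have Kb: "0 < Kb" using K K1 by (simp add: Kb_def)
  define \<theta> where "\<theta> = min 1 (min (\<eta> / (2 * Kb)) (qb / (4 * K1 * \<nu>)))"
  have \<theta>: "0 < \<theta>" "\<theta> \<le> 1" "\<theta> \<le> \<eta> / (2 * Kb)" "\<theta> \<le> qb / (4 * K1 * \<nu>)"
    using \<eta> Kb B K1 \<nu> by (auto simp: \<theta>_def)
  have \<theta>K: "\<theta> * Kb \<le> \<eta> / 2" using \<theta>(3) Kb by (simp add: field_simps)
  define q0 where "q0 = 4 * K1 * \<nu> * \<theta>"
  have q0: "0 < q0" using K1 \<nu> \<theta> by (simp add: q0_def)
  have q0_le: "q0 \<le> qb" using \<theta>(4) K1 \<nu> by (simp add: q0_def field_simps)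
  have \<sigma>q0: "\<sigma>1 * q0 = \<theta> / 2" using \<nu>(2) by (simp add: q0_def mult.assoc[symmetric])
  define \<epsilon> where "\<epsilon> = min (\<theta> * \<nu>) (\<eta> / (2 * (L + 1)))"
  have \<epsilon>: "0 < \<epsilon>" "\<epsilon> \<le> \<theta> * \<nu>" "\<epsilon> \<le> \<eta> / (2 * (L + 1))" using \<theta> \<nu> \<eta> L_ge_1 by (auto simp: \<epsilon>_def)
  have L\<epsilon>: "(L + 1) * \<epsilon> \<le> \<eta> / 2"
  proof -
    have "(L + 1) * \<epsilon> \<le> (L + 1) * (\<eta> / (2 * (L + 1)))" using \<epsilon> L_ge_1 by (intro mult_left_mono) auto
    also have "\<dots> = \<eta> / 2" using L_ge_1 by (simp add: field_simps)
    finally show ?thesis .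
  qed
  obtain T2 where T2: "\<And>t x. T2 \<le> t \<Longrightarrow> x \<le> 0 \<Longrightarrow> V (x + c * t + a) - \<epsilon> * e (x + c * t) \<le> u t x"
    using low \<epsilon>(1) unfolding asym_lower_def by blast
  have "\<exists>T1. \<forall>t0\<ge>T1. m \<le> 1 * (u t0 (- c * t0) - V a) \<longrightarrow>
         (\<forall>t x. t0 + 1 \<le> t \<longrightarrow> t \<le> t0 + 1 + h \<longrightarrow> \<bar>x + c * t\<bar> \<le> Z \<longrightarrow> x \<le> 0 \<longrightarrow>
            \<eta> - (L + 1) * \<epsilon> \<le> 1 * (u t x - V (x + c * t + a)))"
  proof (rule \<eta>(2))
    show "- (\<epsilon> * e (x + c * t)) \<le> 1 * (u t x - V (x + c * t + a))" if "T2 \<le> t" "x \<le> 0" for t x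
      using T2[OF that] by simp
  qed (use \<epsilon> in auto)
  then obtain T3 where T3: "\<And>t0 t x. T3 \<le> t0 \<Longrightarrow> m \<le> u t0 (- c * t0) - V a \<Longrightarrow> t0 + 1 \<le> t \<Longrightarrow> t \<le> t0 + 1 + h \<Longrightarrow>
      \<bar>x + c * t\<bar> \<le> Z \<Longrightarrow> x \<le> 0 \<Longrightarrow> \<eta> - (L + 1) * \<epsilon> \<le> u t x - V (x + c * t + a)" by auto
  obtain T4 where T4: "\<And>t. T4 \<le> t \<Longrightarrow> C * exp (- \<gamma> * (t - 0)) \<le> q0 / 2"
    using exp_decay[OF B(4), of "q0 / 2" C 0] B q0 by auto
  obtain t0 where t0: "\<bar>T1\<bar> + \<bar>T2\<bar> + \<bar>T3\<bar> + \<bar>T4\<bar> + \<bar>a\<bar> / c \<le> t0" "m \<le> u t0 (- c * t0) - V a"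
    using often by blast
  have ac: "0 \<le> \<bar>a\<bar> / c" using c_pos by simp
  have t0': "T1 \<le> t0" "T2 \<le> t0" "T3 \<le> t0" "T4 \<le> t0" "\<bar>a\<bar> / c \<le> t0" "0 \<le> t0" using t0(1) ac by linarith+
  \<comment> \<open>The initial strip of the new barrier is exactly the window from
    \<open>t0 + 1\<close> to \<open>t0 + 1 + h\<close> provided by
    \<open>spread_gap\<close>.\<close>
  define T0 where "T0 = t0 + 1 + h"
  have T0: "0 \<le> T0" "T1 \<le> T0" "T4 \<le> T0" "t0 \<le> T0" using t0' h_ge_0 by (auto simp: T0_def)
  have "asym_lower (a + \<theta> - \<sigma>1 * q0)"
  proof (rule B(6)[OF q0 q0_le T0(1,2)])
    have "\<bar>a\<bar> \<le> c * t0" using t0'(5) c_pos by (simp add: field_simps)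
    also have "\<dots> \<le> c * T0" using T0 c_pos by simp
    finally have "0 \<le> c * T0 + (a + \<theta>) - \<sigma>1 * q0" using \<sigma>q0 \<theta> by simp
    then have "q0 * (1 / 2) \<le> q0 * e (c * T0 + (a + \<theta>) - \<sigma>1 * q0)"
      using q0 lam_pos by (intro mult_left_mono logistic_ge_half) auto
    then show "C * exp (- \<gamma> * T0) \<le> q0 * e (c * T0 + (a + \<theta>) - \<sigma>1 * q0)" using T4[OF T0(3)] by simp
    fix t x assume t: "T0 - h \<le> t" "t \<le> T0" and x: "x \<le> (0::real)"
    define z where "z = x + c * t"
    have zz: "x + c * t + (a + \<theta>) = z + a + \<theta>" by (simp add: z_def)
    have pos: "0 < q0 / 2 * e (z + a + \<theta>)" using q0 logistic_pos[of lam "z + a + \<theta>"] by simp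
    show "V (x + c * t + (a + \<theta>)) - q0 / 2 * e (x + c * t + (a + \<theta>)) \<le> u t x"
      unfolding zz
    proof (cases "\<bar>z\<bar> \<le> Z")
      case True
      have "\<eta> - (L + 1) * \<epsilon> \<le> u t x - V (z + a)"
        using T3[OF t0'(3) t0(2), of t x] t x True by (simp add: T0_def z_def)
      then have 1: "\<eta> / 2 \<le> u t x - V (z + a)" using L\<epsilon> by linarith
      have "\<bar>V (z + a + \<theta>) - V (z + a)\<bar> \<le> \<theta> * (Kb * e z)"
        using K(2)[of \<theta> z a] \<theta> by (simp add: Kb_def K1_def)
      also have "\<dots> \<le> \<theta> * (Kb * 1)"
        using \<theta> Kb logistic_less_1[of lam z] by (intro mult_left_mono) auto
      finally show "V (z + a + \<theta>) - q0 / 2 * e (z + a + \<theta>) \<le> u t x" using 1 \<theta>K pos by simp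
    next
      case False
      have "V (z + a + \<theta>) \<le> V (z + a) + \<theta> * (\<nu> * e z)" using Z[of z \<theta>] False \<theta> by simp
      moreover have "V (z + a) - \<epsilon> * e z \<le> u t x" using T2[of t x] t0' t x h_ge_0 by (simp add: T0_def z_def)
      moreover have "\<epsilon> * e z \<le> \<theta> * \<nu> * e z" using \<epsilon> logistic_pos[of lam z] by (intro mult_right_mono) auto
      moreover have "\<theta> * \<nu> * e z \<le> \<theta> * \<nu> * (K1 * e (z + a + \<theta>))"
        using e_near'[of \<theta> z a] \<theta> \<nu> by (intro mult_left_mono) (auto simp: K1_def)
      moreover have "q0 / 2 * e (z + a + \<theta>) = 2 * (\<theta> * \<nu> * (K1 * e (z + a + \<theta>)))" by (simp add: q0_def)
      ultimately show "V (z + a + \<theta>) - q0 / 2 * e (z + a + \<theta>) \<le> u t x" by (simp only: mult.assoc)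
    qed
  qed
  then show ?thesis using \<sigma>q0 \<theta> by (intro exI[of _ "\<theta> / 2"]) (simp add: algebra_simps)
qed

text \<open>The balance of \<theta> against its cost is that of \<open>improve_lower\<close>, with
  the gap on the other side of the front. The upper barrier lives on the whole line, so the
  half-line \<open>x > 0\<close> has to be covered as well.\<close>

lemma improve_upper:
  assumes upp: "asym_upper a" and m: "0 < m"
    and often: "\<And>T. \<exists>t0\<ge>T. m \<le> V a - u t0 (- c * t0)"
  shows "\<exists>\<theta>>0. asym_upper (a - \<theta>)"
proof -
  obtain \<sigma>1 qb C \<gamma> T1 where B: "0 < \<sigma>1" "0 < qb" "0 < C" "0 < \<gamma>"
    "\<And>q0 s0 T0. \<lbrakk>0 < q0; q0 \<le> qb; 0 \<le> T0;
       \<And>t x. T0 - h \<le> t \<Longrightarrow> t \<le> T0 \<Longrightarrow> u t x \<le> V (x + c * t + s0) + q0 * e (x + c * t + s0)\<rbrakk> \<Longrightarrow>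
       asym_upper (s0 + \<sigma>1 * q0)"
    "\<And>q0 s0 T0. \<lbrakk>0 < q0; q0 \<le> qb; 0 \<le> T0; T1 \<le> T0; C * exp (- \<gamma> * T0) \<le> q0 * e (c * T0 + s0 - \<sigma>1 * q0);
       \<And>t x. T0 - h \<le> t \<Longrightarrow> t \<le> T0 \<Longrightarrow> x \<le> 0 \<Longrightarrow> V (x + c * t + s0) - q0 / 2 * e (x + c * t + s0) \<le> u t x\<rbrakk> \<Longrightarrow>
       asym_lower (s0 - \<sigma>1 * q0)" by (rule barriers) blast
  obtain K where K: "0 < K"
    "\<And>a \<theta> z. \<bar>\<theta>\<bar> \<le> 1 \<Longrightarrow> \<bar>V (z + a + \<theta>) - V (z + a)\<bar> \<le> \<bar>\<theta>\<bar> * (K * exp (lam * (\<bar>a\<bar> + 1)) * e z)"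
    using V_shift_bound by blast
  define K1 where "K1 = exp (lam * (\<bar>a\<bar> + 1))"
  have K1: "0 < K1" by (simp add: K1_def)
  define \<nu> where "\<nu> = 1 / (8 * K1 * \<sigma>1)"
  have \<nu>: "0 < \<nu>" "\<sigma>1 * (4 * K1 * \<nu>) = 1 / 2" using K1 B by (auto simp: \<nu>_def)
  obtain Z where Z: "\<And>z \<theta>. Z \<le> \<bar>z\<bar> \<Longrightarrow> \<bar>\<theta>\<bar> \<le> 1 \<Longrightarrow> \<bar>V (z + a + \<theta>) - V (z + a)\<bar> \<le> \<bar>\<theta>\<bar> * (\<nu> * e z)"
    using V_shift_tail[OF \<nu>(1)] by blast
  obtain \<eta> where \<eta>: "0 < \<eta>"
    "\<And>\<epsilon> T. \<lbrakk>0 \<le> \<epsilon>; \<And>t x. T \<le> t \<Longrightarrow> x \<le> 0 \<Longrightarrow> - (\<epsilon> * e (x + c * t)) \<le> -1 * (u t x - V (x + c * t + a))\<rbrakk> \<Longrightarrow>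
       \<exists>T1. \<forall>t0\<ge>T1. m \<le> -1 * (u t0 (- c * t0) - V a) \<longrightarrow>
         (\<forall>t x. t0 + 1 \<le> t \<longrightarrow> t \<le> t0 + 1 + h \<longrightarrow> \<bar>x + c * t\<bar> \<le> Z \<longrightarrow> x \<le> 0 \<longrightarrow>
            \<eta> - (L + 1) * \<epsilon> \<le> -1 * (u t x - V (x + c * t + a)))"
    by (rule spread_gap[of "-1" m a Z]) (use m in auto)
  define Kb where "Kb = K * K1"
  have Kb: "0 < Kb" using K K1 by (simp add: Kb_def)
  define \<theta> where "\<theta> = min 1 (min (\<eta> / (2 * Kb)) (qb / (4 * K1 * \<nu>)))"
  have \<theta>: "0 < \<theta>" "\<theta> \<le> 1" "\<theta> \<le> \<eta> / (2 * Kb)" "\<theta> \<le> qb / (4 * K1 * \<nu>)"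
    using \<eta> Kb B K1 \<nu> by (auto simp: \<theta>_def)
  have \<theta>K: "\<theta> * Kb \<le> \<eta> / 2" using \<theta>(3) Kb by (simp add: field_simps)
  define q0 where "q0 = 4 * K1 * \<nu> * \<theta>"
  have q0: "0 < q0" using K1 \<nu> \<theta> by (simp add: q0_def)
  have q0_le: "q0 \<le> qb" using \<theta>(4) K1 \<nu> by (simp add: q0_def field_simps)
  have \<sigma>q0: "\<sigma>1 * q0 = \<theta> / 2" using \<nu>(2) by (simp add: q0_def mult.assoc[symmetric])
  define \<epsilon> where "\<epsilon> = min (\<theta> * \<nu>) (\<eta> / (2 * (L + 1)))"
  have \<epsilon>: "0 < \<epsilon>" "\<epsilon> \<le> \<theta> * \<nu>" "\<epsilon> \<le> \<eta> / (2 * (L + 1))" using \<theta> \<nu> \<eta> L_ge_1 by (auto simp: \<epsilon>_def)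
  have L\<epsilon>: "(L + 1) * \<epsilon> \<le> \<eta> / 2"
  proof -
    have "(L + 1) * \<epsilon> \<le> (L + 1) * (\<eta> / (2 * (L + 1)))" using \<epsilon> L_ge_1 by (intro mult_left_mono) auto
    also have "\<dots> = \<eta> / 2" using L_ge_1 by (simp add: field_simps)
    finally show ?thesis .
  qed
  obtain T2 where T2: "\<And>t x. T2 \<le> t \<Longrightarrow> x \<le> 0 \<Longrightarrow> u t x \<le> V (x + c * t + a) + \<epsilon> * e (x + c * t)"
    using upp \<epsilon>(1) unfolding asym_upper_def by blast
  have "\<exists>T1. \<forall>t0\<ge>T1. m \<le> -1 * (u t0 (- c * t0) - V a) \<longrightarrow>
         (\<forall>t x. t0 + 1 \<le> t \<longrightarrow> t \<le> t0 + 1 + h \<longrightarrow> \<bar>x + c * t\<bar> \<le> Z \<longrightarrow> x \<le> 0 \<longrightarrow>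
            \<eta> - (L + 1) * \<epsilon> \<le> -1 * (u t x - V (x + c * t + a)))"
  proof (rule \<eta>(2))
    show "- (\<epsilon> * e (x + c * t)) \<le> -1 * (u t x - V (x + c * t + a))" if "T2 \<le> t" "x \<le> 0" for t x
      using T2[OF that] by simp
  qed (use \<epsilon> in auto)
  then obtain T3 where T3: "\<And>t0 t x. T3 \<le> t0 \<Longrightarrow> m \<le> V a - u t0 (- c * t0) \<Longrightarrow> t0 + 1 \<le> t \<Longrightarrow> t \<le> t0 + 1 + h \<Longrightarrow>
      \<bar>x + c * t\<bar> \<le> Z \<Longrightarrow> x \<le> 0 \<Longrightarrow> \<eta> - (L + 1) * \<epsilon> \<le> V (x + c * t + a) - u t x" by auto
  obtain Y where Y: "0 \<le> Y" "\<And>z. Y \<le> z \<Longrightarrow> \<kappa> - q0 / 2 \<le> V z" using V_near_kappa[of "q0 / 2"] q0 by auto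
  obtain t0 where t0: "\<bar>T2\<bar> + \<bar>T3\<bar> + (\<bar>a\<bar> + 1 + Y) / c \<le> t0" "m \<le> V a - u t0 (- c * t0)"
    using often by blast
  have ac: "0 \<le> (\<bar>a\<bar> + 1 + Y) / c" using c_pos Y by simp
  have t0': "T2 \<le> t0" "T3 \<le> t0" "(\<bar>a\<bar> + 1 + Y) / c \<le> t0" "0 \<le> t0" using t0(1) ac by linarith+
  define T0 where "T0 = t0 + 1 + h"
  have T0: "0 \<le> T0" "t0 \<le> T0" using t0' h_ge_0 by (auto simp: T0_def)
  have "asym_upper (a - \<theta> + \<sigma>1 * q0)"
  proof (rule B(5)[OF q0 q0_le T0(1)])
    fix t x assume t: "T0 - h \<le> t" "t \<le> T0"
    define z where "z = x + c * t"
    have zz: "x + c * t + (a - \<theta>) = z + a + - \<theta>" by (simp add: z_def)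
    have pos: "0 < q0 * e (z + a + - \<theta>)" using q0 logistic_pos[of lam "z + a + - \<theta>"] by simp
    show "u t x \<le> V (x + c * t + (a - \<theta>)) + q0 * e (x + c * t + (a - \<theta>))"
      unfolding zz
    proof (cases "x \<le> 0")
      \<comment> \<open>For \<open>x > 0\<close> neither the asymptotic bound nor the gap is
        available, but at such late times front and perturbation together exceed \<kappa>.\<close>
      case False
      have "\<bar>a\<bar> + 1 + Y \<le> c * t0" using t0'(3) c_pos by (simp add: field_simps)
      also have "\<dots> \<le> c * t" using t c_pos by (simp add: T0_def)
      finally have z: "Y \<le> z + a + - \<theta>" using False \<theta> by (simp add: z_def)
      then have "q0 * (1 / 2) \<le> q0 * e (z + a + - \<theta>)"
        using q0 lam_pos Y by (intro mult_left_mono logistic_ge_half) auto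
      moreover have "u t x \<le> \<kappa>" using t t0' by (intro u_le_kappa) (simp add: T0_def)
      ultimately show "u t x \<le> V (z + a + - \<theta>) + q0 * e (z + a + - \<theta>)" using Y(2)[OF z] by simp
    next
      case x: True
      show "u t x \<le> V (z + a + - \<theta>) + q0 * e (z + a + - \<theta>)"
      proof (cases "\<bar>z\<bar> \<le> Z")
        case True
        have "\<eta> - (L + 1) * \<epsilon> \<le> V (z + a) - u t x"
          using T3[OF t0'(2) t0(2), of t x] t x True by (simp add: T0_def z_def)
        then have 1: "\<eta> / 2 \<le> V (z + a) - u t x" using L\<epsilon> by linarith
        have "\<bar>V (z + a + - \<theta>) - V (z + a)\<bar> \<le> \<theta> * (Kb * e z)"
          using K(2)[of "- \<theta>" z a] \<theta> by (simp add: Kb_def K1_def)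
        also have "\<dots> \<le> \<theta> * (Kb * 1)"
          using \<theta> Kb logistic_less_1[of lam z] by (intro mult_left_mono) auto
        finally show ?thesis using 1 \<theta>K pos by simp
      next
        case False
        have "V (z + a) \<le> V (z + a + - \<theta>) + \<theta> * (\<nu> * e z)" using Z[of z "- \<theta>"] False \<theta> by simp
        moreover have "u t x \<le> V (z + a) + \<epsilon> * e z" using T2[of t x] t0' t x h_ge_0 by (simp add: T0_def z_def)
        moreover have "\<epsilon> * e z \<le> \<theta> * \<nu> * e z" using \<epsilon> logistic_pos[of lam z] by (intro mult_right_mono) auto
        moreover have "\<theta> * \<nu> * e z \<le> \<theta> * \<nu> * (K1 * e (z + a + - \<theta>))"
          using e_near'[of "- \<theta>" z a] \<theta> \<nu> by (intro mult_left_mono) (auto simp: K1_def)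
        moreover have "q0 * e (z + a + - \<theta>) = 4 * (\<theta> * \<nu> * (K1 * e (z + a + - \<theta>)))" by (simp add: q0_def)
        ultimately show ?thesis using pos by (simp only: mult.assoc)
      qed
    qed
  qed
  then show ?thesis using \<sigma>q0 \<theta> by (intro exI[of _ "\<theta> / 2"]) (simp add: algebra_simps)
qed

text \<open>If the extremal shifts \<open>a < b\<close> differed, the value of \<open>u\<close> at
  the moving point would either exceed \<open>V\<close> at the midpoint at arbitrarily late times,
  improving \<open>a\<close>, or eventually stay below it, improving \<open>b\<close>.\<close>

theorem convergence_to_front: "\<exists>s. \<forall>\<epsilon>>0. \<exists>T. \<forall>t\<ge>T. \<forall>x\<le>0. \<bar>u t x - V (x + c * t + s)\<bar> \<le> \<epsilon> * e (x + c * t)"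
proof -
  obtain a0 b0 where ab0: "asym_lower a0" "asym_upper b0" using asym_lower_exists asym_upper_exists by blast
  define a where "a = Sup {a. asym_lower a}"
  define b where "b = Inf {b. asym_upper b}"
  have bdd: "bdd_above {a. asym_lower a}" "bdd_below {b. asym_upper b}"
    using ab0 asym_lower_le_upper by (auto intro!: bdd_aboveI[of _ b0] bdd_belowI[of _ a0])
  have a_max: "a' \<le> a" if "asym_lower a'" for a' unfolding a_def using bdd that by (intro cSup_upper) auto
  have b_min: "b \<le> b'" if "asym_upper b'" for b' unfolding b_def using bdd that by (intro cInf_lower) auto
  have la: "asym_lower a"
  proof (rule asym_closed(1))
    fix \<eta> :: real assume "0 < \<eta>"
    then have "a - \<eta> < Sup {a. asym_lower a}" by (simp add: a_def)
    then obtain a' where "asym_lower a'" "a - \<eta> < a'"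
      using less_cSup_iff[OF _ bdd(1)] ab0 by auto
    then show "asym_lower (a - \<eta>)" using asym_lower_mono by (meson less_imp_le)
  qed
  have ub: "asym_upper b"
  proof (rule asym_closed(2))
    fix \<eta> :: real assume "0 < \<eta>"
    then have "Inf {b. asym_upper b} < b + \<eta>" by (simp add: b_def)
    then obtain b' where "asym_upper b'" "b' < b + \<eta>"
      using cInf_less_iff[OF _ bdd(2)] ab0 by auto
    then show "asym_upper (b + \<eta>)" using asym_upper_mono by (meson less_imp_le)
  qed
  have "a = b"
  proof (rule ccontr)
    assume "a \<noteq> b"
    then have "a < b" using asym_lower_le_upper[OF la ub] by simp
    define mid where "mid = (a + b) / 2"
    have m: "0 < V mid - V a" "0 < V b - V mid" using \<open>a < b\<close> V_strict_mono by (auto simp: mid_def)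
    show False
    proof (cases "\<forall>T. \<exists>t0\<ge>T. V mid \<le> u t0 (- c * t0)")
      case True
      have "\<exists>t0\<ge>T. V mid - V a \<le> u t0 (- c * t0) - V a" for T using True by force
      from improve_lower[OF la m(1) this] show False using a_max by force
    next
      case False
      then obtain T where T: "\<And>t0. T \<le> t0 \<Longrightarrow> u t0 (- c * t0) < V mid" by (meson linorder_not_le)
      have "\<exists>t0\<ge>T'. V b - V mid \<le> V b - u t0 (- c * t0)" for T'
        using T[of "max T T'"] by (intro exI[of _ "max T T'"]) auto
      from improve_upper[OF ub m(2) this] show False using b_min by force
    qed
  qed
  show ?thesis
  proof (rule exI[of _ a], intro allI impI)
    fix \<epsilon> :: real assume \<epsilon>: "0 < \<epsilon>"
    obtain T1 where T1: "\<And>t x. T1 \<le> t \<Longrightarrow> x \<le> 0 \<Longrightarrow> V (x + c * t + a) - \<epsilon> * e (x + c * t) \<le> u t x"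
      using la \<epsilon> unfolding asym_lower_def by blast
    obtain T2 where T2: "\<And>t x. T2 \<le> t \<Longrightarrow> x \<le> 0 \<Longrightarrow> u t x \<le> V (x + c * t + a) + \<epsilon> * e (x + c * t)"
      using ub \<epsilon> unfolding asym_upper_def \<open>a = b\<close> by blast
    have "\<bar>u t x - V (x + c * t + a)\<bar> \<le> \<epsilon> * e (x + c * t)" if "max T1 T2 \<le> t" "x \<le> 0" for t x
      using T1[of t x] T2[of t x] that by (auto simp: abs_le_iff)
    then show "\<exists>T. \<forall>t\<ge>T. \<forall>x\<le>0. \<bar>u t x - V (x + c * t + a)\<bar> \<le> \<epsilon> * e (x + c * t)" by blast
  qed
qed

end

section \<open>The resolvent of the linear profile equation\<close>

text \<open>The distance between the negative and the positive root of
  \<open>r\<^sup>2 = c * r + 1\<close>. It also bounds both roots in absolute value and serves as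
  the Harnack exponent.\<close>

definition disc :: "real \<Rightarrow> real" where "disc c = sqrt (c\<^sup>2 + 4)"
definition root1 :: "real \<Rightarrow> real" where "root1 c = (c - disc c) / 2"
definition root2 :: "real \<Rightarrow> real" where "root2 c = (c + disc c) / 2"

lemma disc_pos: "0 < disc c"
  by (simp add: disc_def add_nonneg_pos)

lemma disc_gt: "\<bar>c\<bar> < disc c"
  unfolding disc_def by (rule real_less_rsqrt) simp

lemma roots: "root1 c < 0" "0 < root2 c" "root2 c - root1 c = disc c" "root1 c * root2 c = - 1" "root1 c + root2 c = c"
  "root1 c * root1 c = c * root1 c + 1" "root2 c * root2 c = c * root2 c + 1"
proof -
  have sq: "disc c * disc c = c * c + 4" by (simp add: disc_def power2_eq_square add_nonneg_nonneg)
  show "root1 c < 0" "0 < root2 c" "root2 c - root1 c = disc c" "root1 c + root2 c = c"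
    using disc_gt[of c] by (auto simp: root1_def root2_def field_simps)
  show "root1 c * root2 c = - 1" "root1 c * root1 c = c * root1 c + 1" "root2 c * root2 c = c * root2 c + 1"
    using sq by (simp_all add: root1_def root2_def field_simps)
qed

lemma roots_bounds: "- disc c \<le> root1 c" "root2 c \<le> disc c"
  using disc_gt[of c] by (auto simp: root1_def root2_def field_simps)

lemma between_roots: "0 < 1 + c * l - l\<^sup>2 \<Longrightarrow> root1 c < l \<and> l < root2 c"
proof -
  assume "0 < 1 + c * l - l\<^sup>2"
  also have "1 + c * l - l\<^sup>2 = (l - root1 c) * (root2 c - l)"
  proof -
    have "(l - root1 c) * (root2 c - l) = (root1 c + root2 c) * l - root1 c * root2 c - l\<^sup>2"
      by (simp add: algebra_simps power2_eq_square)
    then show ?thesis by (simp add: roots)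
  qed
  finally show ?thesis using roots(1,2)[of c] by (auto simp: zero_less_mult_iff)
qed

text \<open>Green's function of \<open>- y'' + c y' + y = f\<close> on the whole line.\<close>
definition green :: "real \<Rightarrow> real \<Rightarrow> real" where
  "green c y = exp (min (root1 c * y) (root2 c * y)) / disc c"

lemma green_pos: "0 < green c y"
  by (simp add: green_def disc_pos)

lemma green_cases: "0 \<le> y \<Longrightarrow> green c y = exp (root1 c * y) / disc c" "y \<le> 0 \<Longrightarrow> green c y = exp (root2 c * y) / disc c"
proof -
  have r: "root1 c \<le> root2 c" using roots(1,2)[of c] by simp
  show "0 \<le> y \<Longrightarrow> green c y = exp (root1 c * y) / disc c"
    using mult_right_mono[OF r, of y] by (simp add: green_def min_absorb1)
  show "y \<le> 0 \<Longrightarrow> green c y = exp (root2 c * y) / disc c"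
    using mult_right_mono_neg[OF r, of y] by (simp add: green_def min_absorb2)
qed

lemma green_measurable [measurable]: "green c \<in> borel_measurable borel"
  unfolding green_def by measurable

text \<open>The logarithm of the kernel is piecewise linear with slopes bounded by
  \<open>disc c\<close>. Every convolution with a nonnegative function inherits this as a Harnack
  inequality independent of the function.\<close>

lemma green_lipschitz: "green c x \<le> exp (disc c * \<bar>x - y\<bar>) * green c y"
proof -
  have "root1 c * (x - y) \<le> disc c * \<bar>x - y\<bar>" "root2 c * (x - y) \<le> disc c * \<bar>x - y\<bar>"
  proof -
    have "\<bar>root1 c\<bar> \<le> disc c" "\<bar>root2 c\<bar> \<le> disc c" using roots(1,2)[of c] roots_bounds[of c] by auto
    then have "\<bar>root1 c * (x - y)\<bar> \<le> disc c * \<bar>x - y\<bar>" "\<bar>root2 c * (x - y)\<bar> \<le> disc c * \<bar>x - y\<bar>"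
      by (auto simp: abs_mult intro: mult_right_mono)
    then show "root1 c * (x - y) \<le> disc c * \<bar>x - y\<bar>" "root2 c * (x - y) \<le> disc c * \<bar>x - y\<bar>" by auto
  qed
  then have "min (root1 c * x) (root2 c * x) \<le> disc c * \<bar>x - y\<bar> + min (root1 c * y) (root2 c * y)"
    by (auto simp: algebra_simps min_def)
  then show ?thesis using disc_pos[of c] by (simp add: green_def divide_right_mono flip: exp_add)
qed

lemma exp_half_line:
  assumes "0 < a"
  shows "has_bochner_integral lborel (\<lambda>y::real. indicator {0..} y * exp (- a * y)) (1 / a)"
proof (rule has_bochner_integral_nn_integral)
  have "((\<lambda>y. - exp (- a * y) / a) \<longlongrightarrow> - 0 / a) at_top"
  proof (intro tendsto_intros filterlim_compose[OF exp_at_bot])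
    show "LIM y at_top. - a * y :> at_bot"
      using filterlim_tendsto_neg_mult_at_bot[OF tendsto_const, of "- a"] assms filterlim_ident by force
  qed (use assms in auto)
  then have "(\<integral>\<^sup>+y. ennreal (exp (- a * y)) * indicator {0..} y \<partial>lborel) = ennreal (0 - (- exp (- a * 0) / a))"
    using assms by (intro nn_integral_FTC_atLeast) (auto intro!: derivative_eq_intros)
  moreover have "ennreal (indicator {0..} y * exp (- a * y)) = ennreal (exp (- a * y)) * indicator {0..} y" for y :: real
    by (simp split: split_indicator)
  ultimately show "(\<integral>\<^sup>+y. ennreal (indicator {0..} y * exp (- a * y)) \<partial>lborel) = ennreal (1 / a)" by simp
qed (use assms in auto)

text \<open>The two half-line integrals add up to
  \<open>(1 / (l - root1 c) + 1 / (root2 c - l)) / disc c\<close>, and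
  \<open>(l - root1 c) * (root2 c - l) = 1 + c * l - l\<^sup>2\<close>. For \<open>l = 0\<close>
  this is the total mass 1.\<close>

lemma green_moment:
  assumes "0 < 1 + c * l - l\<^sup>2"
  shows "has_bochner_integral lborel (\<lambda>y. green c y * exp (- l * y)) (1 / (1 + c * l - l\<^sup>2))"
proof -
  have l: "0 < l - root1 c" "0 < root2 c - l" using between_roots[OF assms] by auto
  define I where "I = (\<lambda>a y::real. indicator {0..} y * exp (- a * y) :: real)"
  have 1: "has_bochner_integral lborel (I (l - root1 c)) (1 / (l - root1 c))"
    unfolding I_def by (rule exp_half_line) fact
  have refl2: "has_bochner_integral lborel (I (root2 c - l)) (1 / (root2 c - l))"
    unfolding I_def by (rule exp_half_line) fact
  have 2: "has_bochner_integral lborel (\<lambda>y. I (root2 c - l) (0 + (-1) * y)) ((1 / (root2 c - l)) /\<^sub>R \<bar>-1\<bar>)"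
    by (subst lborel_has_bochner_integral_real_affine_iff[symmetric])
       (use refl2 in simp_all)
  have "has_bochner_integral lborel (\<lambda>y. (I (l - root1 c) y + I (root2 c - l) (0 + (-1) * y)) / disc c)
     ((1 / (l - root1 c) + (1 / (root2 c - l)) /\<^sub>R \<bar>-1\<bar>) / disc c)"
    by (intro has_bochner_integral_divide has_bochner_integral_add 1 2)
  moreover have "AE y in lborel. (I (l - root1 c) y + I (root2 c - l) (0 + (-1) * y)) / disc c = green c y * exp (- l * y)"
    using AE_lborel_singleton[of "0::real"]
  proof eventually_elim
    case (elim y)
    show ?case
    proof (cases "0 < y")
      case True
      then show ?thesis by (simp add: I_def green_cases algebra_simps flip: exp_add)
    next
      case False
      then have "y < 0" using elim by simp
      then show ?thesis by (simp add: I_def green_cases algebra_simps flip: exp_add)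
    qed
  qed
  moreover have "(1 / (l - root1 c) + (1 / (root2 c - l)) /\<^sub>R \<bar>-1\<bar>) / disc c = 1 / (1 + c * l - l\<^sup>2)"
  proof -
    have "(1 / (l - root1 c) + 1 / (root2 c - l)) = disc c / ((l - root1 c) * (root2 c - l))"
      using l by (simp add: field_simps flip: roots(3))
    also have "(l - root1 c) * (root2 c - l) = (root1 c + root2 c) * l - root1 c * root2 c - l\<^sup>2"
      by (simp add: algebra_simps power2_eq_square)
    finally show ?thesis using disc_pos[of c] by (simp add: roots add_ac)
  qed
  ultimately have A: "has_bochner_integral lborel (\<lambda>y. (I (l - root1 c) y + I (root2 c - l) (0 + (-1) * y)) / disc c)
     (1 / (1 + c * l - l\<^sup>2))"
    and ae: "AE y in lborel. (I (l - root1 c) y + I (root2 c - l) (0 + (-1) * y)) / disc c = green c y * exp (- l * y)"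
    by simp_all
  show ?thesis
    by (rule has_bochner_integral_cong_AE[THEN iffD1, OF borel_measurable_has_bochner_integral[OF A] _ ae A]) measurable
qed

definition bmeas :: "(real \<Rightarrow> real) \<Rightarrow> bool" where
  "bmeas f \<longleftrightarrow> f \<in> borel_measurable borel \<and> (\<exists>B. \<forall>x. \<bar>f x\<bar> \<le> B)"

text \<open>For continuous bounded \<open>f\<close> the only bounded solution of
  \<open>y'' = c * y' + y - f\<close>, by \<open>res_ode\<close> and \<open>ode_imp_res\<close>. The
  integral also makes sense for monotone functions with jumps.\<close>

definition res :: "real \<Rightarrow> (real \<Rightarrow> real) \<Rightarrow> real \<Rightarrow> real" where
  "res c f z = (\<integral>y. green c y * f (z - y) \<partial>lborel)"

lemma bmeas_intros:
  "bmeas (\<lambda>_. k)"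
  "bmeas f \<Longrightarrow> bmeas k1 \<Longrightarrow> bmeas (\<lambda>x. f x + k1 x)"
  "bmeas f \<Longrightarrow> bmeas k1 \<Longrightarrow> bmeas (\<lambda>x. f x - k1 x)"
  "bmeas f \<Longrightarrow> bmeas k1 \<Longrightarrow> bmeas (\<lambda>x. min (f x) (k1 x))"
  "bmeas f \<Longrightarrow> bmeas k1 \<Longrightarrow> bmeas (\<lambda>x. max (f x) (k1 x))"
  "bmeas f \<Longrightarrow> bmeas (\<lambda>x. a * f x)"
proof -
  show "bmeas (\<lambda>_. k)" by (auto simp: bmeas_def)
  show "bmeas (\<lambda>x. a * f x)" if "bmeas f"
  proof -
    from that obtain B where [measurable]: "f \<in> borel_measurable borel" and B: "\<And>x. \<bar>f x\<bar> \<le> B" by (auto simp: bmeas_def)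
    have "\<bar>a * f x\<bar> \<le> \<bar>a\<bar> * B" for x using B[of x] by (simp add: abs_mult mult_left_mono)
    then show ?thesis unfolding bmeas_def by auto
  qed
  show "bmeas (\<lambda>x. f x + k1 x)" "bmeas (\<lambda>x. f x - k1 x)" "bmeas (\<lambda>x. min (f x) (k1 x))" "bmeas (\<lambda>x. max (f x) (k1 x))"
    if "bmeas f" "bmeas k1"
  proof -
    from that obtain B C where [measurable]: "f \<in> borel_measurable borel" "k1 \<in> borel_measurable borel"
      and B: "\<And>x. \<bar>f x\<bar> \<le> B" "\<And>x. \<bar>k1 x\<bar> \<le> C" by (auto simp: bmeas_def)
    have "\<bar>f x + k1 x\<bar> \<le> B + C" "\<bar>f x - k1 x\<bar> \<le> B + C" "\<bar>min (f x) (k1 x)\<bar> \<le> B + C" "\<bar>max (f x) (k1 x)\<bar> \<le> B + C" for x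
      using B(1)[of x] B(2)[of x] by (auto simp: min_def max_def)
    then show "bmeas (\<lambda>x. f x + k1 x)" "bmeas (\<lambda>x. f x - k1 x)" "bmeas (\<lambda>x. min (f x) (k1 x))" "bmeas (\<lambda>x. max (f x) (k1 x))"
      unfolding bmeas_def by (auto intro!: exI[of _ "B + C"])
  qed
qed

lemma bmeas_shift: assumes "bmeas f" shows "bmeas (\<lambda>x. f (x + s))"
proof -
  from assms have [measurable]: "f \<in> borel_measurable borel" by (simp add: bmeas_def)
  show "bmeas (\<lambda>x. f (x + s))" using assms by (auto simp: bmeas_def)
qed

lemma bmeas_measurable: "bmeas f \<Longrightarrow> f \<in> borel_measurable borel"
  by (simp add: bmeas_def)

lemma bmeas_mono: "mono f \<Longrightarrow> (\<And>x. \<bar>f x\<bar> \<le> B) \<Longrightarrow> bmeas f" for f :: "real \<Rightarrow> real"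
  unfolding bmeas_def by (auto intro: borel_measurable_mono)

lemma bmeas_continuous: "continuous_on UNIV f \<Longrightarrow> (\<And>x. \<bar>f x\<bar> \<le> B) \<Longrightarrow> bmeas f" for f :: "real \<Rightarrow> real"
  unfolding bmeas_def by (auto intro: borel_measurable_continuous_onI)

lemma green_integrable: "integrable lborel (green c)" "(\<integral>y. green c y \<partial>lborel) = 1"
  using green_moment[of c 0] by (auto simp: has_bochner_integral_iff)

lemma res_integrable:
  assumes "bmeas f" shows "integrable lborel (\<lambda>y. green c y * f (z - y))"
proof -
  obtain B where B: "\<And>x. \<bar>f x\<bar> \<le> B" and [measurable]: "f \<in> borel_measurable borel" using assms by (auto simp: bmeas_def)
  have "0 \<le> B" using B[of 0] by simp
  show ?thesis
  proof (rule Bochner_Integration.integrable_bound[of lborel "\<lambda>y. B * green c y"])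
    have "norm (green c y * f (z - y)) \<le> norm (B * green c y)" for y
      using mult_left_mono[OF B[of "z - y"], of "green c y"] green_pos[of c y] \<open>0 \<le> B\<close>
      by (simp add: abs_mult mult.commute)
    then show "AE y in lborel. norm (green c y * f (z - y)) \<le> norm (B * green c y)" by (intro AE_I2)
  qed (use green_integrable in auto)
qed

lemma res_alt: "res c f z = (\<integral>x. green c (z - x) * f x \<partial>lborel)"
proof -
  have "(\<integral>x. green c (z - x) * f x \<partial>lborel) = \<bar>-1\<bar> *\<^sub>R (\<integral>y. green c (z - (z + (-1) * y)) * f (z + (-1) * y) \<partial>lborel)"
    by (rule lborel_integral_real_affine) simp
  then show ?thesis by (simp add: res_def)
qed

lemma res_integrable_alt: "bmeas f \<Longrightarrow> integrable lborel (\<lambda>x. green c (z - x) * f x)"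
  using lborel_integrable_real_affine[OF res_integrable[of f c z], of "-1" z] by simp

lemma res_mono: "bmeas f \<Longrightarrow> bmeas k \<Longrightarrow> (\<And>x. f x \<le> k x) \<Longrightarrow> res c f z \<le> res c k z"
  unfolding res_def using green_pos[of c]
  by (intro integral_mono res_integrable mult_left_mono) (auto intro: less_imp_le)

lemma res_const: "res c (\<lambda>_. k) z = k"
  by (simp add: res_def green_integrable)

lemma res_diff: "bmeas f \<Longrightarrow> bmeas k \<Longrightarrow> res c (\<lambda>x. f x - k x) z = res c f z - res c k z"
  unfolding res_def right_diff_distrib by (intro Bochner_Integration.integral_diff res_integrable)

lemma res_nonneg: "(\<And>x. 0 \<le> f x) \<Longrightarrow> 0 \<le> res c f z"
  unfolding res_def using green_pos[of c]
  by (intro Bochner_Integration.integral_nonneg mult_nonneg_nonneg) (auto intro: less_imp_le)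

lemma res_shift: "res c (\<lambda>x. f (x + s)) z = res c f (z + s)"
  unfolding res_def by (rule arg_cong[where f="integral\<^sup>L lborel"]) (auto simp: algebra_simps)

lemma res_exp:
  assumes "0 < 1 + c * l - l\<^sup>2"
  shows "integrable lborel (\<lambda>y. green c y * (K * exp (l * (z - y))))"
    "(\<integral>y. green c y * (K * exp (l * (z - y))) \<partial>lborel) = K * exp (l * z) / (1 + c * l - l\<^sup>2)"
proof -
  have eq: "green c y * (K * exp (l * (z - y))) = K * exp (l * z) * (green c y * exp (- l * y))" for y
    by (simp add: right_diff_distrib exp_diff exp_minus field_simps)
  have "has_bochner_integral lborel (\<lambda>y. green c y * (K * exp (l * (z - y)))) (K * exp (l * z) * (1 / (1 + c * l - l\<^sup>2)))"
    unfolding eq by (rule has_bochner_integral_mult_right, rule green_moment[OF assms])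
  then show "integrable lborel (\<lambda>y. green c y * (K * exp (l * (z - y))))"
    "(\<integral>y. green c y * (K * exp (l * (z - y))) \<partial>lborel) = K * exp (l * z) / (1 + c * l - l\<^sup>2)"
    by (auto simp: has_bochner_integral_iff)
qed

lemma res_le_exp2:
  assumes "bmeas f" "0 < 1 + c * l - l\<^sup>2" "0 < 1 + c * l' - l'\<^sup>2"
    and "\<And>x. f x \<le> K * exp (l * x) + K' * exp (l' * x)"
  shows "res c f z \<le> K * exp (l * z) / (1 + c * l - l\<^sup>2) + K' * exp (l' * z) / (1 + c * l' - l'\<^sup>2)"
proof -
  have "res c f z \<le> (\<integral>y. green c y * (K * exp (l * (z - y))) + green c y * (K' * exp (l' * (z - y))) \<partial>lborel)"
    unfolding res_def
  proof (rule integral_mono[OF res_integrable[OF assms(1)]])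
    show "integrable lborel (\<lambda>y. green c y * (K * exp (l * (z - y))) + green c y * (K' * exp (l' * (z - y))))"
      by (intro Bochner_Integration.integrable_add res_exp assms)
    show "green c y * f (z - y) \<le> green c y * (K * exp (l * (z - y))) + green c y * (K' * exp (l' * (z - y)))" for y
      using mult_left_mono[OF assms(4)[of "z - y"], of "green c y"] green_pos[of c y] by (simp add: algebra_simps)
  qed
  also have "\<dots> = K * exp (l * z) / (1 + c * l - l\<^sup>2) + K' * exp (l' * z) / (1 + c * l' - l'\<^sup>2)"
    unfolding Bochner_Integration.integral_add[OF res_exp(1)[OF assms(2)] res_exp(1)[OF assms(3)]]
      res_exp(2)[OF assms(2)] res_exp(2)[OF assms(3)] ..
  finally show ?thesis .
qed

lemma res_le_exp:
  assumes "bmeas f" "0 < 1 + c * l - l\<^sup>2" "\<And>x. f x \<le> K * exp (l * x)"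
  shows "res c f z \<le> K * exp (l * z) / (1 + c * l - l\<^sup>2)"
  using res_le_exp2[OF assms(1,2,2), of K 0] assms(3) by simp

lemma res_harnack:
  assumes "bmeas f" "\<And>x. 0 \<le> f x"
  shows "res c f z \<le> exp (disc c * \<bar>z - z'\<bar>) * res c f z'"
proof -
  have "res c f z \<le> (\<integral>x. exp (disc c * \<bar>z - z'\<bar>) * (green c (z' - x) * f x) \<partial>lborel)"
    unfolding res_alt
  proof (rule integral_mono)
    show "green c (z - x) * f x \<le> exp (disc c * \<bar>z - z'\<bar>) * (green c (z' - x) * f x)" for x
      using mult_right_mono[OF green_lipschitz[of c "z - x" "z' - x"] assms(2)[of x]] by (simp add: mult.assoc)
  qed (use assms in \<open>auto intro!: res_integrable_alt\<close>)
  then show ?thesis by (simp add: res_alt)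
qed

text \<open>Two opposite Harnack inequalities combine. The bound is relative to the value at
  \<open>z\<close>, hence uniform over all nonnegative \<open>f\<close> with a common bound: this is
  the source of equicontinuity.\<close>

lemma res_lipschitz:
  assumes "bmeas f" "\<And>x. 0 \<le> f x"
  shows "\<bar>res c f z - res c f z'\<bar> \<le> (exp (disc c * \<bar>z - z'\<bar>) - 1) * res c f z"
proof -
  let ?E = "exp (disc c * \<bar>z - z'\<bar>)"
  have E: "1 \<le> ?E" using disc_pos[of c] by simp
  have 1: "res c f z \<le> ?E * res c f z'" by (rule res_harnack[OF assms])
  have 2: "res c f z' \<le> ?E * res c f z" using res_harnack[OF assms, of c z' z] by (simp add: abs_minus_commute)
  have "res c f z - res c f z' \<le> (?E - 1) * res c f z"
  proof (cases "res c f z' \<le> res c f z")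
    case True
    have "(?E - 1) * res c f z' \<le> (?E - 1) * res c f z" using True E by (intro mult_left_mono) auto
    then show ?thesis using 1 by (simp add: algebra_simps)
  next
    case False
    moreover have "0 \<le> (?E - 1) * res c f z" using E by (intro mult_nonneg_nonneg res_nonneg assms(2)) auto
    ultimately show ?thesis by linarith
  qed
  then show ?thesis using 2 by (simp add: abs_le_iff algebra_simps)
qed

lemma isCont_res_nonneg:
  assumes "bmeas f" "\<And>x. 0 \<le> f x" shows "isCont (res c f) z"
proof -
  have "((\<lambda>z'. (exp (disc c * \<bar>z - z'\<bar>) - 1) * res c f z) \<longlongrightarrow> (exp (disc c * \<bar>z - z\<bar>) - 1) * res c f z) (at z)"
    by (intro tendsto_intros)
  then have A: "((\<lambda>z'. (exp (disc c * \<bar>z - z'\<bar>) - 1) * res c f z) \<longlongrightarrow> 0) (at z)" by simp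
  have B: "norm (res c f z' - res c f z) \<le> (exp (disc c * \<bar>z - z'\<bar>) - 1) * res c f z" for z'
    using res_lipschitz[OF assms, of c z z'] unfolding real_norm_def abs_minus_commute[of "res c f z'"] .
  have "((\<lambda>z'. res c f z' - res c f z) \<longlongrightarrow> 0) (at z)"
    by (rule Lim_null_comparison[OF always_eventually[OF allI[OF B]] A])
  then show ?thesis using LIM_zero_iff isCont_def by blast
qed

lemma res_tendsto:
  assumes "\<And>n. F n \<in> borel_measurable borel" "\<And>n x. \<bar>F n x\<bar> \<le> B" "\<And>x. (\<lambda>n. F n x) \<longlonglongrightarrow> f x"
  shows "(\<lambda>n. res c (F n) z) \<longlonglongrightarrow> res c f z"
  unfolding res_def
proof (rule integral_dominated_convergence[where w="\<lambda>y. B * green c y"])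
  have [measurable]: "\<And>n. F n \<in> borel_measurable borel" by fact
  have [measurable]: "f \<in> borel_measurable borel"
    using borel_measurable_LIMSEQ_real[of borel F f] assms(1,3) by blast
  have "0 \<le> B" using assms(2)[of 0 0] by simp
  show "(\<lambda>y. green c y * f (z - y)) \<in> borel_measurable lborel" by measurable
  show "(\<lambda>y. green c y * F n (z - y)) \<in> borel_measurable lborel" for n by measurable
  show "AE y in lborel. (\<lambda>n. green c y * F n (z - y)) \<longlonglongrightarrow> green c y * f (z - y)"
    using assms(3) by (auto intro!: tendsto_intros)
  have "norm (green c y * F n (z - y)) \<le> B * green c y" for n y
    using mult_left_mono[OF assms(2)[of n "z - y"], of "green c y"] green_pos[of c y]
    by (simp add: abs_mult mult.commute)
  then show "AE y in lborel. norm (green c y * F n (z - y)) \<le> B * green c y" for n by (intro AE_I2)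
  show "integrable lborel (\<lambda>y. B * green c y)" using green_integrable by auto
qed

lemma res_pos:
  assumes f: "bmeas f" "\<And>x. 0 \<le> f x" and m: "0 < m" "\<And>x. p \<le> x \<Longrightarrow> x \<le> q \<Longrightarrow> m \<le> f x" and pq: "p < q"
  shows "0 < res c f z"
proof -
  define k where "k = green c (z - p) * exp (- (disc c * (q - p)))"
  have k: "0 < k" using green_pos by (simp add: k_def)
  have "0 < k * m * (q - p)" using k m pq by simp
  also have "\<dots> = (\<integral>x. k * m * indicator {p..q} x \<partial>lborel)" using pq by simp
  also have "\<dots> \<le> res c f z"
    unfolding res_alt
  proof (rule integral_mono)
    show "integrable lborel (\<lambda>x. k * m * indicator {p..q} x :: real)"
      using integrable_real_indicator[of "{p..q}" lborel] pq by simp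
    fix x
    show "k * m * indicator {p..q} x \<le> green c (z - x) * f x"
    proof (cases "x \<in> {p..q}")
      case True
      have "green c (z - p) \<le> exp (disc c * \<bar>(z - p) - (z - x)\<bar>) * green c (z - x)" by (rule green_lipschitz)
      also have "\<dots> \<le> exp (disc c * (q - p)) * green c (z - x)"
        using True disc_pos[of c] green_pos[of c] by (intro mult_right_mono) (auto intro: less_imp_le)
      finally have "k \<le> exp (disc c * (q - p)) * green c (z - x) * exp (- (disc c * (q - p)))"
        unfolding k_def by (intro mult_right_mono) auto
      also have "\<dots> = green c (z - x)" by (simp add: mult.commute mult.left_commute flip: exp_add)
      finally have "k \<le> green c (z - x)" .
      then have "k * m \<le> green c (z - x) * f x" using m True k green_pos[of c "z - x"] by (intro mult_mono) auto
      then show ?thesis using True by simp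
    next
      case False
      then show ?thesis using f(2)[of x] green_pos[of c "z - x"] by simp
    qed
  qed (use f in \<open>auto intro!: res_integrable_alt\<close>)
  finally show ?thesis .
qed

lemma half_line_integral_deriv:
  fixes k :: "real \<Rightarrow> real"
  assumes k: "continuous_on UNIV k" and int: "\<And>z. integrable lborel (\<lambda>x. indicator {..z} x * k x)"
  shows "((\<lambda>z. \<integral>x. indicator {..z} x * k x \<partial>lborel) has_real_derivative k z) (at z)"
proof -
  define a where "a = z - 1"
  have ck: "continuous_on S k" for S using k continuous_on_subset by blast
  have eq: "(\<integral>x. indicator {..a} x * k x \<partial>lborel) + integral {a..y} k = (\<integral>x. indicator {..y} x * k x \<partial>lborel)"
    if "a \<le> y" for y
  proof -
    have si: "set_integrable lborel {a..y} k"
      unfolding set_integrable_def by (rule borel_integrable_compact) (use ck in auto)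
    have "(\<integral>x. indicator {..y} x * k x \<partial>lborel) = (\<integral>x. indicator {..a} x * k x + indicator {a..y} x * k x \<partial>lborel)"
    proof (rule integral_cong_AE)
      show "AE x in lborel. indicator {..y} x * k x = indicator {..a} x * k x + indicator {a..y} x * k x"
        using AE_lborel_singleton[of a] by eventually_elim (use that in \<open>auto split: split_indicator\<close>)
    qed (use borel_measurable_continuous_onI[OF k] in measurable)
    also have "\<dots> = (\<integral>x. indicator {..a} x * k x \<partial>lborel) + (\<integral>x. indicator {a..y} x * k x \<partial>lborel)"
      by (rule Bochner_Integration.integral_add[OF int]) (use si in \<open>simp add: set_integrable_def\<close>)
    also have "(\<integral>x. indicator {a..y} x * k x \<partial>lborel) = integral {a..y} k"
      using set_borel_integral_eq_integral(2)[OF si] by (simp add: set_lebesgue_integral_def)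
    finally show ?thesis by simp
  qed
  have "((\<lambda>y. integral {a..y} k) has_real_derivative k z) (at z within {a..z + 1})"
    by (rule integral_has_real_derivative) (use ck in \<open>auto simp: a_def\<close>)
  then have "((\<lambda>y. integral {a..y} k) has_real_derivative k z) (at z)"
    using at_within_interior[of z "{a..z+1}"] by (simp add: a_def)
  then have "((\<lambda>y. (\<integral>x. indicator {..a} x * k x \<partial>lborel) + integral {a..y} k) has_real_derivative k z) (at z)"
    by (auto intro!: derivative_eq_intros)
  then show ?thesis
    by (rule has_field_derivative_transform_within_open[where S="{a<..}"]) (auto simp: a_def eq[unfolded a_def])
qed

lemma half_line_integral_deriv':
  fixes k :: "real \<Rightarrow> real"
  assumes k: "continuous_on UNIV k" and int: "\<And>z. integrable lborel (\<lambda>x. indicator {z..} x * k x)"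
  shows "((\<lambda>z. \<integral>x. indicator {z..} x * k x \<partial>lborel) has_real_derivative - k z) (at z)"
proof -
  have ind: "indicator {z..} (0 + (-1) * x) = (indicator {..- z} x :: real)" for x z :: real
    by (auto split: split_indicator)
  have refl: "(\<integral>x. indicator {z..} x * k x \<partial>lborel) = (\<integral>x. indicator {..- z} x * k (- x) \<partial>lborel)" for z
    using lborel_integral_real_affine[of "-1" "\<lambda>x. indicator {z..} x * k x" 0] by (simp only: ind) simp
  have "integrable lborel (\<lambda>x. indicator {..y} x * k (- x))" for y
    using lborel_integrable_real_affine[OF int[of "- y"], of "-1" 0] by (simp only: ind) simp
  moreover have "continuous_on UNIV (\<lambda>x. k (- x))"
    by (rule continuous_on_compose2[OF k]) (auto intro!: continuous_intros)
  ultimately have "((\<lambda>z. \<integral>x. indicator {..z} x * k (- x) \<partial>lborel) has_real_derivative k (- (- z))) (at (- z))"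
    by (intro half_line_integral_deriv)
  then have "((\<lambda>z. \<integral>x. indicator {..- z} x * k (- x) \<partial>lborel) has_real_derivative k (- (- z)) * (- 1)) (at z)"
    by (rule DERIV_chain2[where g=uminus]) (auto intro!: derivative_eq_intros)
  then show ?thesis unfolding refl by simp
qed

text \<open>Variation of constants: on either side of \<open>x = z\<close> the kernel factors into
  exponentials of \<open>z\<close> and of \<open>x\<close>, so the convolution becomes a combination
  of half-line integrals, which are differentiable for merely continuous \<open>f\<close>.\<close>

lemma res_split:
  assumes f: "continuous_on UNIV f" "\<And>x. \<bar>f x\<bar> \<le> B"
    and P_def: "P = (\<lambda>z. \<integral>x. indicator {..z} x * (exp (- root1 c * x) * f x) \<partial>lborel)"
    and Q_def: "Q = (\<lambda>z. \<integral>x. indicator {z..} x * (exp (- root2 c * x) * f x) \<partial>lborel)"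
  shows "res c f z = (exp (root1 c * z) * P z + exp (root2 c * z) * Q z) / disc c"
    and "(P has_real_derivative exp (- root1 c * z) * f z) (at z)"
    and "(Q has_real_derivative - (exp (- root2 c * z) * f z)) (at z)"
proof -
  have bm: "bmeas f" by (rule bmeas_continuous[OF f])
  have intP: "integrable lborel (\<lambda>x. indicator {..z} x * (exp (- root1 c * x) * f x))" for z
  proof -
    have "integrable lborel (\<lambda>x. indicator {..z} x *\<^sub>R (green c (z - x) * f x))"
      by (rule integrable_mult_indicator) (use res_integrable_alt[OF bm] in auto)
    then have "integrable lborel (\<lambda>x. (disc c * exp (- root1 c * z)) * (indicator {..z} x *\<^sub>R (green c (z - x) * f x)))"
      by simp
    moreover have "(disc c * exp (- root1 c * z)) * (indicator {..z} x *\<^sub>R (green c (z - x) * f x))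
        = indicator {..z} x * (exp (- root1 c * x) * f x)" for x
      using disc_pos[of c] by (auto split: split_indicator simp: green_cases algebra_simps simp flip: exp_add)
    ultimately show ?thesis by (simp only:)
  qed
  have intQ: "integrable lborel (\<lambda>x. indicator {z..} x * (exp (- root2 c * x) * f x))" for z
  proof -
    have "integrable lborel (\<lambda>x. indicator {z..} x *\<^sub>R (green c (z - x) * f x))"
      by (rule integrable_mult_indicator) (use res_integrable_alt[OF bm] in auto)
    then have "integrable lborel (\<lambda>x. (disc c * exp (- root2 c * z)) * (indicator {z..} x *\<^sub>R (green c (z - x) * f x)))"
      by simp
    moreover have "(disc c * exp (- root2 c * z)) * (indicator {z..} x *\<^sub>R (green c (z - x) * f x))
        = indicator {z..} x * (exp (- root2 c * x) * f x)" for x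
      using disc_pos[of c] by (auto split: split_indicator simp: green_cases algebra_simps simp flip: exp_add)
    ultimately show ?thesis by (simp only:)
  qed
  show "(P has_real_derivative exp (- root1 c * z) * f z) (at z)"
    unfolding P_def by (rule half_line_integral_deriv) (intro continuous_intros f(1), rule intP)
  show "(Q has_real_derivative - (exp (- root2 c * z) * f z)) (at z)"
    unfolding Q_def by (rule half_line_integral_deriv') (intro continuous_intros f(1), rule intQ)
  have "res c f z = (\<integral>x. exp (root1 c * z) / disc c * (indicator {..z} x * (exp (- root1 c * x) * f x))
      + exp (root2 c * z) / disc c * (indicator {z..} x * (exp (- root2 c * x) * f x)) \<partial>lborel)"
    unfolding res_alt
  proof (rule integral_cong_AE)
    show "AE x in lborel. green c (z - x) * f x = exp (root1 c * z) / disc c * (indicator {..z} x * (exp (- root1 c * x) * f x))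
      + exp (root2 c * z) / disc c * (indicator {z..} x * (exp (- root2 c * x) * f x))"
      using AE_lborel_singleton[of z]
    proof eventually_elim
      case (elim x)
      then show ?case
        by (cases "x < z") (auto simp: green_cases algebra_simps simp flip: exp_add)
    qed
  qed (use borel_measurable_continuous_onI[OF f(1)] in measurable)
  also have "\<dots> = exp (root1 c * z) / disc c * P z + exp (root2 c * z) / disc c * Q z"
    unfolding P_def Q_def
    by (subst Bochner_Integration.integral_add[OF integrable_mult_right[OF intP] integrable_mult_right[OF intQ]])
       (simp only: Bochner_Integration.integral_mult_right_zero)
  finally show "res c f z = (exp (root1 c * z) * P z + exp (root2 c * z) * Q z) / disc c"
    by (simp add: add_divide_distrib)
qed

lemma res_ode:
  assumes f: "continuous_on UNIV f" "\<And>x. \<bar>f x\<bar> \<le> B"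
  obtains y' y'' where "\<And>z. (res c f has_real_derivative y' z) (at z)" "\<And>z. (y' has_real_derivative y'' z) (at z)"
    "\<And>z. y'' z = c * y' z + res c f z - f z"
proof -
  define P where "P = (\<lambda>z. \<integral>x. indicator {..z} x * (exp (- root1 c * x) * f x) \<partial>lborel)"
  define Q where "Q = (\<lambda>z. \<integral>x. indicator {z..} x * (exp (- root2 c * x) * f x) \<partial>lborel)"
  note S = res_split[OF f P_def Q_def]
  let ?r1 = "root1 c" and ?r2 = "root2 c" and ?D = "disc c"
  have eqf: "res c f = (\<lambda>z. (exp (?r1 * z) * P z + exp (?r2 * z) * Q z) / ?D)" using S(1) by auto
  have c1: "exp (?r1 * z) * (exp (- ?r1 * z) * f z) = f z" "exp (?r2 * z) * (exp (- ?r2 * z) * f z) = f z" for z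
  proof -
    have cancel: "exp (a * z) * (exp (- a * z) * y) = y" for a y :: real
    proof -
      have "exp (a * z) * exp (- a * z) = 1" by (simp flip: exp_add)
      then show ?thesis by (simp only: mult.assoc[symmetric])
    qed
    show "exp (?r1 * z) * (exp (- ?r1 * z) * f z) = f z" "exp (?r2 * z) * (exp (- ?r2 * z) * f z) = f z" by (rule cancel)+
  qed
  have c2: "exp (- ?r1 * z) * f z * exp (?r1 * z) = f z" "- (exp (- ?r2 * z) * f z) * exp (?r2 * z) = - f z" for z
    using c1[of z] by (simp_all only: mult.commute[of _ "exp (?r1 * z)"] mult.commute[of _ "exp (?r2 * z)"] mult_minus_right)
  define y' where "y' = (\<lambda>z. (?r1 * (exp (?r1 * z) * P z) + ?r2 * (exp (?r2 * z) * Q z)) / ?D)"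
  define y'' where "y'' = (\<lambda>z. (?r1 * ?r1 * (exp (?r1 * z) * P z) + ?r2 * ?r2 * (exp (?r2 * z) * Q z) + (?r1 - ?r2) * f z) / ?D)"
  have dP: "((\<lambda>z. exp (?r1 * z) * P z) has_real_derivative ?r1 * (exp (?r1 * z) * P z) + f z) (at z)" for z
    by (rule DERIV_cong[OF DERIV_mult[OF DERIV_fun_exp[OF DERIV_cmult[OF DERIV_ident]] S(2)]]) (simp only: c2; simp add: mult_ac)
  have dQ: "((\<lambda>z. exp (?r2 * z) * Q z) has_real_derivative ?r2 * (exp (?r2 * z) * Q z) - f z) (at z)" for z
    by (rule DERIV_cong[OF DERIV_mult[OF DERIV_fun_exp[OF DERIV_cmult[OF DERIV_ident]] S(3)]]) (simp only: c2; simp add: mult_ac)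
  show thesis
  proof (rule that[of y' y''])
    fix z
    show "(res c f has_real_derivative y' z) (at z)"
      unfolding eqf y'_def by (rule DERIV_cong[OF DERIV_cdivide[OF DERIV_add[OF dP dQ]]]) simp
    show "(y' has_real_derivative y'' z) (at z)"
      unfolding y'_def y''_def
      by (rule DERIV_cong[OF DERIV_cdivide[OF DERIV_add[OF DERIV_cmult[OF dP] DERIV_cmult[OF dQ]]]])
         (simp add: algebra_simps)
    have rD: "?r1 - ?r2 = - ?D" using roots(3)[of c] by simp
    have "y'' z = (c * (?r1 * (exp (?r1 * z) * P z) + ?r2 * (exp (?r2 * z) * Q z)) + (exp (?r1 * z) * P z + exp (?r2 * z) * Q z) - ?D * f z) / ?D"
      unfolding y''_def roots(6,7) rD by (simp add: algebra_simps)
    moreover have "(c * A + B - ?D * f z) / ?D = c * (A / ?D) + B / ?D - f z" for A B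
      using disc_pos[of c] by (simp add: add_divide_distrib diff_divide_distrib)
    ultimately show "y'' z = c * y' z + res c f z - f z"
      unfolding eqf y'_def by (simp only:)
  qed
qed

text \<open>Factoring the operator in both orders shows that \<open>w' - a * w\<close> is a multiple
  of \<open>exp (b * z)\<close> when \<open>a\<close>, \<open>b\<close> are the two roots. So
  \<open>w\<close> combines one growing and one decaying exponential, and boundedness at both ends
  removes both.\<close>

lemma bounded_homogeneous_zero:
  fixes w w' w'' :: "real \<Rightarrow> real"
  assumes d: "\<And>z. (w has_real_derivative w' z) (at z)" "\<And>z. (w' has_real_derivative w'' z) (at z)"
    and eq: "\<And>z. w'' z = c * w' z + w z" and bdd: "\<And>z. \<bar>w z\<bar> \<le> M"
  shows "w z = 0"
proof -
  let ?r1 = "root1 c" and ?r2 = "root2 c"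
  have const: "\<exists>K. \<forall>z. w' z - a * w z = K * exp (b * z)" if "a + b = c" "a * b = -1" for a b
  proof -
    have "((\<lambda>z. (w' z - a * w z) * exp (- b * z)) has_real_derivative 0) (at z)" for z
    proof -
      have "w'' z - a * w' z - b * (w' z - a * w z) = w'' z - (a + b) * w' z + (a * b) * w z"
        by (simp add: algebra_simps)
      also have "\<dots> = 0" using eq[of z] that by simp
      finally have "(w'' z - a * w' z) * exp (- b * z) = b * (w' z - a * w z) * exp (- b * z)" by simp
      then show ?thesis by (auto intro!: derivative_eq_intros d simp: algebra_simps)
    qed
    then have X: "(w' z - a * w z) * exp (- b * z) = (w' 0 - a * w 0) * exp (- b * 0)" for z
      using DERIV_isconst_all[of "\<lambda>z. (w' z - a * w z) * exp (- b * z)" z 0] by blast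
    have cancel: "y = y * exp (- b * z) * exp (b * z)" for y z :: real by (simp add: exp_minus)
    have "w' z - a * w z = (w' 0 - a * w 0) * exp (b * z)" for z
      using cancel[of "w' z - a * w z" z] unfolding X[of z] by simp
    then show ?thesis by blast
  qed
  obtain K where K: "\<And>z. w' z - ?r1 * w z = K * exp (?r2 * z)" using const[of ?r1 ?r2] roots[of c] by auto
  obtain K' where K': "\<And>z. w' z - ?r2 * w z = K' * exp (?r1 * z)"
    using const[of ?r2 ?r1] roots[of c] by (auto simp: add.commute mult.commute)
  have rep: "disc c * w z = K * exp (?r2 * z) - K' * exp (?r1 * z)" for z
    using K[of z] K'[of z] roots(3)[of c] by (simp add: algebra_simps flip: roots(3))
  have wb: "\<bar>disc c * w z\<bar> \<le> disc c * M" for z using bdd[of z] disc_pos[of c] by (simp add: abs_mult)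
  have unbounded: "k = 0" if "\<And>z. 0 \<le> z \<Longrightarrow> \<bar>k\<bar> * exp (r * z) \<le> C" "0 < r" for k r C :: real
  proof (rule ccontr)
    assume k: "k \<noteq> 0"
    define z where "z = (\<bar>C\<bar> / \<bar>k\<bar>) / r"
    have "\<bar>k\<bar> * (1 + \<bar>C\<bar> / \<bar>k\<bar>) \<le> \<bar>k\<bar> * exp (r * z)"
      using exp_ge_add_one_self[of "r * z"] that(2) by (intro mult_left_mono) (auto simp: z_def)
    also have "\<dots> \<le> C" using that by (intro that(1)) (simp add: z_def)
    finally have "\<bar>k\<bar> * (1 + \<bar>C\<bar> / \<bar>k\<bar>) \<le> C" .
    moreover have "\<bar>k\<bar> * (1 + \<bar>C\<bar> / \<bar>k\<bar>) = \<bar>k\<bar> + \<bar>C\<bar>" using k by (simp add: field_simps)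
    ultimately have "\<bar>k\<bar> + \<bar>C\<bar> \<le> C" by (simp only:)
    then show False using k by linarith
  qed
  have "K = 0"
  proof (rule unbounded[where r="?r2" and C="disc c * M + \<bar>K'\<bar>"])
    fix z :: real assume z: "0 \<le> z"
    have "exp (?r1 * z) \<le> 1" using z roots(1)[of c] by (simp add: mult_nonpos_nonneg)
    then have "\<bar>K'\<bar> * exp (?r1 * z) \<le> \<bar>K'\<bar> * 1" by (intro mult_left_mono) auto
    moreover have "\<bar>K * exp (?r2 * z)\<bar> \<le> disc c * M + \<bar>K' * exp (?r1 * z)\<bar>" using rep[of z] wb[of z] by linarith
    ultimately show "\<bar>K\<bar> * exp (?r2 * z) \<le> disc c * M + \<bar>K'\<bar>" by (simp add: abs_mult)
  qed (rule roots)
  moreover have "K' = 0"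
  proof (rule unbounded[where r="- ?r1" and C="disc c * M + \<bar>K\<bar>"])
    fix z :: real assume z: "0 \<le> z"
    have "exp (?r2 * (- z)) \<le> 1" using z roots(2)[of c] by simp
    then have "\<bar>K\<bar> * exp (?r2 * (- z)) \<le> \<bar>K\<bar> * 1" by (intro mult_left_mono) auto
    moreover have "\<bar>K' * exp (?r1 * (- z))\<bar> \<le> disc c * M + \<bar>K * exp (?r2 * (- z))\<bar>" using rep[of "- z"] wb[of "- z"] by linarith
    ultimately show "\<bar>K'\<bar> * exp (- ?r1 * z) \<le> disc c * M + \<bar>K\<bar>" by (simp add: abs_mult)
  qed (use roots[of c] in auto)
  ultimately show ?thesis using rep[of z] disc_pos[of c] by simp
qed

lemma ode_imp_res:
  assumes f: "continuous_on UNIV f" "\<And>x. \<bar>f x\<bar> \<le> B"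
    and d: "\<And>z. (y has_real_derivative y' z) (at z)" "\<And>z. (y' has_real_derivative y'' z) (at z)"
    and eq: "\<And>z. y'' z = c * y' z + y z - f z" and bdd: "\<And>z. \<bar>y z\<bar> \<le> M"
  shows "y z = res c f z"
proof -
  obtain v' v'' where v: "\<And>z. (res c f has_real_derivative v' z) (at z)" "\<And>z. (v' has_real_derivative v'' z) (at z)"
    "\<And>z. v'' z = c * v' z + res c f z - f z" using res_ode[OF f] by blast
  have bm: "bmeas f" by (rule bmeas_continuous[OF f])
  have fb: "f x \<le> B" "- B \<le> f x" for x using f(2)[of x] by linarith+
  have "\<bar>y z - res c f z\<bar> \<le> M + B" for z
    using res_mono[OF bm bmeas_intros(1)[of B] fb(1), of c z] res_mono[OF bmeas_intros(1)[of "- B"] bm fb(2), of c z]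
      bdd[of z] unfolding res_const by linarith
  then have "y z - res c f z = 0"
  proof (rule bounded_homogeneous_zero[rotated 3])
    show "((\<lambda>z. y z - res c f z) has_real_derivative y' z - v' z) (at z)" for z by (intro DERIV_diff d v)
    show "((\<lambda>z. y' z - v' z) has_real_derivative y'' z - v'' z) (at z)" for z by (intro DERIV_diff d v)
    show "y'' z - v'' z = c * (y' z - v' z) + (y z - res c f z)" for z by (simp add: eq v(3) algebra_simps)
  qed
  then show ?thesis by simp
qed

lemma bounded_of_limits:
  fixes f :: "real \<Rightarrow> real"
  assumes "continuous_on UNIV f" "(f \<longlongrightarrow> a) at_bot" "(f \<longlongrightarrow> b) at_top"
  obtains B where "\<And>x. \<bar>f x\<bar> \<le> B"
proof -
  have "eventually (\<lambda>x. \<bar>f x - a\<bar> < 1) at_bot" "eventually (\<lambda>x. \<bar>f x - b\<bar> < 1) at_top"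
    using tendstoD[OF assms(2), of 1] tendstoD[OF assms(3), of 1] by (auto simp: dist_real_def)
  then obtain p q where p: "\<And>x. x \<le> p \<Longrightarrow> \<bar>f x - a\<bar> < 1" and q: "\<And>x. q \<le> x \<Longrightarrow> \<bar>f x - b\<bar> < 1"
    unfolding eventually_at_bot_linorder eventually_at_top_linorder by blast
  have "compact (f ` {p..q})"
    using assms(1) continuous_on_subset by (intro compact_continuous_image) auto
  then obtain C where "\<forall>y\<in>f ` {p..q}. norm y \<le> C"
    using compact_imp_bounded bounded_iff[of "f ` {p..q}"] by blast
  then have C: "\<bar>f x\<bar> \<le> C" if "p \<le> x" "x \<le> q" for x using that by auto
  have "\<bar>f x\<bar> \<le> \<bar>a\<bar> + \<bar>b\<bar> + \<bar>C\<bar> + 1" for x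
    using p[of x] q[of x] C[of x] by (cases "x \<le> p"; cases "q \<le> x") (auto simp: not_le intro: order_trans)
  then show thesis by (rule that)
qed

lemma positive_min_on_interval:
  fixes f :: "real \<Rightarrow> real"
  assumes "continuous_on UNIV f" "\<And>x. p \<le> x \<Longrightarrow> x \<le> q \<Longrightarrow> 0 < f x"
  obtains m where "0 < m" "\<And>x. p \<le> x \<Longrightarrow> x \<le> q \<Longrightarrow> m \<le> f x"
proof (cases "p \<le> q")
  case True
  have "continuous_on {p..q} f" using assms(1) continuous_on_subset by blast
  then obtain x0 where "x0 \<in> {p..q}" "\<And>x. x \<in> {p..q} \<Longrightarrow> f x0 \<le> f x"
    using continuous_attains_inf[of "{p..q}" f] True by auto
  then show thesis using assms(2)[of x0] by (intro that[of "f x0"]) auto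
next
  case False
  then show thesis by (intro that[of 1]) auto
qed

section \<open>Fronts as fixed points and sliding\<close>

locale profile = monostable +
  fixes h :: real
  assumes h_nn: "0 \<le> h"
begin

definition N :: "real \<Rightarrow> (real \<Rightarrow> real) \<Rightarrow> real \<Rightarrow> real" where
  "N c \<psi> z = res c (\<lambda>x. g (\<psi> x)) (z - c * h)"

text \<open>The integral form passes to pointwise limits and compares monotonically;
  \<open>wavefront_iff_front\<close> relates it to the differential equation.\<close>

definition front :: "real \<Rightarrow> (real \<Rightarrow> real) \<Rightarrow> bool" where
  "front c \<phi> \<longleftrightarrow> continuous_on UNIV \<phi> \<and> (\<forall>z. 0 < \<phi> z) \<and> (\<phi> \<longlongrightarrow> 0) at_bot \<and> (\<phi> \<longlongrightarrow> \<kappa>) at_top \<and>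
     (\<forall>z. \<phi> z = N c \<phi> z)"

lemma g_measurable [measurable]: "g \<in> borel_measurable borel"
  by (rule borel_measurable_mono) (auto intro: monoI g_mono)

lemma bmeas_g: assumes "bmeas \<psi>" shows "bmeas (\<lambda>x. g (\<psi> x))"
proof -
  obtain B where [measurable]: "\<psi> \<in> borel_measurable borel" and B: "\<And>x. \<bar>\<psi> x\<bar> \<le> B" using assms by (auto simp: bmeas_def)
  have "\<bar>g (\<psi> x)\<bar> \<le> L * B" for x
  proof -
    have "\<bar>g (\<psi> x) - g 0\<bar> \<le> L * \<bar>\<psi> x - 0\<bar>" by (rule g_lip)
    also have "\<dots> \<le> L * B" using B[of x] L_ge_1 by (intro mult_left_mono) auto
    finally show ?thesis by (simp add: g_0)
  qed
  then show ?thesis unfolding bmeas_def by auto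
qed

lemma N_mono: "bmeas \<psi> \<Longrightarrow> bmeas \<omega> \<Longrightarrow> (\<And>x. \<psi> x \<le> \<omega> x) \<Longrightarrow> N c \<psi> z \<le> N c \<omega> z"
  unfolding N_def by (intro res_mono bmeas_g g_mono)

lemma N_shift: "N c (\<lambda>x. \<psi> (x + s)) z = N c \<psi> (z + s)"
  using res_shift[of c "\<lambda>x. g (\<psi> x)" s "z - c * h"] by (simp add: N_def algebra_simps)

lemma N_const: "N c (\<lambda>_. k) z = g k"
  by (simp add: N_def res_const)

lemma N_mono_fun:
  assumes "mono \<psi>" "bmeas \<psi>" shows "mono (N c \<psi>)"
proof (rule monoI)
  fix x y :: real assume xy: "x \<le> y"
  have "N c \<psi> x \<le> N c (\<lambda>z. \<psi> (z + (y - x))) x"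
    by (rule N_mono[OF assms(2) bmeas_shift[OF assms(2)]], rule monoD[OF assms(1)]) (use xy in simp)
  then show "N c \<psi> x \<le> N c \<psi> y" by (simp add: N_shift)
qed

lemma N_nonneg: "(\<And>x. 0 \<le> \<psi> x) \<Longrightarrow> 0 \<le> N c \<psi> z"
  unfolding N_def by (intro res_nonneg g_nonneg)

lemma N_le: "bmeas \<psi> \<Longrightarrow> (\<And>x. \<psi> x \<le> b) \<Longrightarrow> N c \<psi> z \<le> g b"
  using N_mono[of \<psi> "\<lambda>_. b" c z] by (simp add: N_const bmeas_intros)

lemma N_harnack: "bmeas \<psi> \<Longrightarrow> (\<And>x. 0 \<le> \<psi> x) \<Longrightarrow> N c \<psi> z \<le> exp (disc c * \<bar>z - z'\<bar>) * N c \<psi> z'"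
  using res_harnack[OF bmeas_g, of \<psi> c "z - c * h" "z' - c * h"] by (simp add: N_def g_nonneg)

lemma N_lipschitz: "bmeas \<psi> \<Longrightarrow> (\<And>x. 0 \<le> \<psi> x) \<Longrightarrow> \<bar>N c \<psi> z - N c \<psi> z'\<bar> \<le> (exp (disc c * \<bar>z - z'\<bar>) - 1) * N c \<psi> z"
  using res_lipschitz[OF bmeas_g, of \<psi> c "z - c * h" "z' - c * h"] by (simp add: N_def g_nonneg)

lemma N_continuous: assumes "bmeas \<psi>" "\<And>x. 0 \<le> \<psi> x" shows "continuous_on UNIV (N c \<psi>)"
proof -
  have "isCont (\<lambda>z. res c (\<lambda>x. g (\<psi> x)) (z - c * h)) z" for z
    by (rule isCont_o2[where f="\<lambda>z. z - c * h"]) (use isCont_res_nonneg[OF bmeas_g[OF assms(1)]] assms(2) g_nonneg in auto)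
  then show ?thesis by (simp add: N_def[abs_def] continuous_at_imp_continuous_on)
qed

lemma bmeas_N: assumes "bmeas \<psi>" "\<And>x. 0 \<le> \<psi> x" shows "bmeas (N c \<psi>)"
proof -
  obtain B where B: "\<And>x. \<bar>\<psi> x\<bar> \<le> B" using assms by (auto simp: bmeas_def)
  have "\<psi> x \<le> B" for x using B[of x] by simp
  then have "\<bar>N c \<psi> z\<bar> \<le> g B" for z using N_nonneg[of \<psi> c z] N_le[of \<psi> B c z] assms by simp
  then show ?thesis using N_continuous[OF assms] by (rule bmeas_continuous[rotated])
qed

lemma N_tendsto:
  assumes "\<And>n. F n \<in> borel_measurable borel" "\<And>n x. \<bar>F n x\<bar> \<le> B" "\<And>x. (\<lambda>n. F n x) \<longlonglongrightarrow> f x"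
  shows "(\<lambda>n. N c (F n) z) \<longlonglongrightarrow> N c f z"
  unfolding N_def
proof (rule res_tendsto[where B="L * B"])
  have [measurable]: "F n \<in> borel_measurable borel" for n by (rule assms)
  show "(\<lambda>x. g (F n x)) \<in> borel_measurable borel" for n by measurable
  show "\<bar>g (F n x)\<bar> \<le> L * B" for n x
  proof -
    have "\<bar>g (F n x) - g 0\<bar> \<le> L * \<bar>F n x - 0\<bar>" by (rule g_lip)
    also have "\<dots> \<le> L * B" using assms(2)[of n x] L_ge_1 by (intro mult_left_mono) auto
    finally show ?thesis by (simp add: g_0)
  qed
  show "(\<lambda>n. g (F n x)) \<longlonglongrightarrow> g (f x)" for x
    using isCont_tendsto_compose[OF isCont_g assms(3)] .
qed

lemma N_close:
  assumes "bmeas \<psi>" "bmeas \<omega>" "\<And>x. \<bar>\<psi> x - \<omega> x\<bar> \<le> \<epsilon>"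
  shows "\<bar>N c \<psi> z - N c \<omega> z\<bar> \<le> L * \<epsilon>"
proof -
  have *: "N c \<psi> z - N c \<omega> z \<le> L * \<epsilon>" if "bmeas \<psi>" "bmeas \<omega>" "\<And>x. \<bar>\<psi> x - \<omega> x\<bar> \<le> \<epsilon>" for \<psi> \<omega>
  proof -
    have "N c \<psi> z - N c \<omega> z = res c (\<lambda>x. g (\<psi> x) - g (\<omega> x)) (z - c * h)"
      unfolding N_def by (rule res_diff[symmetric]) (intro bmeas_g that)+
    also have "\<dots> \<le> res c (\<lambda>_. L * \<epsilon>) (z - c * h)"
    proof (rule res_mono)
      fix x
      have "\<bar>g (\<psi> x) - g (\<omega> x)\<bar> \<le> L * \<bar>\<psi> x - \<omega> x\<bar>" by (rule g_lip)
      also have "\<dots> \<le> L * \<epsilon>" using that(3)[of x] L_ge_1 by (intro mult_left_mono) auto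
      finally show "g (\<psi> x) - g (\<omega> x) \<le> L * \<epsilon>" by simp
    qed (intro bmeas_intros bmeas_g that)+
    finally show ?thesis by (simp add: res_const)
  qed
  show ?thesis using *[OF assms] *[OF assms(2,1)] assms(3) by (auto simp: abs_le_iff abs_minus_commute)
qed

text \<open>Where the supersolution is already close to \<open>\<kappa>\<close> the operator contracts, so an ordering that
  could only fail there cannot fail at all.\<close>
lemma contraction_comparison:
  assumes W: "bmeas W" "\<And>z. W z \<le> N c W z" and \<phi>: "bmeas \<phi>" "\<And>z. N c \<phi> z \<le> \<phi> z"
    and near: "\<And>z. \<phi> z < W z \<Longrightarrow> \<kappa> - \<delta> \<le> \<phi> z"
  shows "W z \<le> \<phi> z"
proof -
  define D where "D = (\<lambda>z. max 0 (W z - \<phi> z))"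
  have "bmeas D" unfolding D_def by (intro bmeas_intros W \<phi>)
  then obtain C where C: "\<And>z. \<bar>D z\<bar> \<le> C" by (auto simp: bmeas_def)
  have bdd: "bdd_above (range D)" by (rule bdd_aboveI[of _ C]) (use C in \<open>auto simp: abs_le_iff\<close>)
  define d where "d = (SUP z. D z)"
  have Dd: "D z \<le> d" for z unfolding d_def by (rule cSUP_upper[OF _ bdd]) simp
  have d0: "0 \<le> d" using Dd[of 0] by (simp add: D_def)
  have "D z \<le> \<rho> * d" for z
  proof -
    have "W z - \<phi> z \<le> N c W z - N c \<phi> z" using W(2)[of z] \<phi>(2)[of z] by simp
    also have "\<dots> = res c (\<lambda>x. g (W x) - g (\<phi> x)) (z - c * h)"
      unfolding N_def by (rule res_diff[symmetric]) (intro bmeas_g W \<phi>)+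
    also have "\<dots> \<le> res c (\<lambda>_. \<rho> * d) (z - c * h)"
    proof (rule res_mono)
      fix x
      show "g (W x) - g (\<phi> x) \<le> \<rho> * d"
      proof (cases "\<phi> x < W x")
        case True
        then have "g (W x) - g (\<phi> x) \<le> \<rho> * (W x - \<phi> x)" using near by (intro g_near_kappa) auto
        also have "\<dots> \<le> \<rho> * d" using Dd[of x] rho True by (intro mult_left_mono) (auto simp: D_def)
        finally show ?thesis .
      next
        case False
        then have "g (W x) \<le> g (\<phi> x)" by (intro g_mono) simp
        moreover have "0 \<le> \<rho> * d" using rho d0 by simp
        ultimately show ?thesis by linarith
      qed
    qed (intro bmeas_intros bmeas_g W \<phi>)+
    finally show ?thesis using rho d0 by (simp add: D_def res_const)
  qed
  then have "d \<le> \<rho> * d" unfolding d_def by (intro cSUP_least) auto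
  then have "d \<le> 0" using rho d0 by (metis mult_le_cancel_right1 not_le less_eq_real_def)
  then show ?thesis using Dd[of z] by (simp add: D_def)
qed

lemma front_bmeas: "front c \<phi> \<Longrightarrow> bmeas \<phi>"
  using bounded_of_limits[of \<phi> 0 \<kappa>] bmeas_continuous unfolding front_def by metis

text \<open>The constant \<kappa> is a fixed point lying entirely in the contraction zone, so
  \<open>contraction_comparison\<close> applies with no further ordering assumption.\<close>

lemma front_le_kappa: assumes "front c \<phi>" shows "\<phi> z \<le> \<kappa>"
proof (rule contraction_comparison[where W=\<phi> and \<phi>="\<lambda>_. \<kappa>" and c=c])
  show "bmeas \<phi>" by (rule front_bmeas[OF assms])
  show "\<phi> z \<le> N c \<phi> z" for z using assms unfolding front_def by (metis order_refl)
qed (use delta in \<open>auto simp: N_const g_kappa bmeas_intros\<close>)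

lemma front_near_kappa: assumes "front c \<phi>" "0 < e" obtains Y where "\<And>z. Y \<le> z \<Longrightarrow> \<kappa> - e \<le> \<phi> z"
proof -
  have "eventually (\<lambda>z. \<kappa> - e < \<phi> z) at_top"
    using assms by (intro order_tendstoD(1)[of \<phi> \<kappa>]) (auto simp: front_def)
  then show thesis using that unfolding eventually_at_top_linorder by (meson less_imp_le)
qed

lemma front_near_0: assumes "front c \<phi>" "0 < e" obtains Y where "\<And>z. z \<le> Y \<Longrightarrow> \<phi> z \<le> e"
proof -
  have "eventually (\<lambda>z. \<phi> z < e) at_bot"
    using assms by (intro order_tendstoD(2)[of \<phi> 0]) (auto simp: front_def)
  then show thesis using that unfolding eventually_at_bot_linorder by (meson less_imp_le)
qed

lemma front_facts:
  assumes "front c \<phi>"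
  shows "0 < \<phi> z" "\<phi> z = N c \<phi> z" "continuous_on S \<phi>"
    "\<phi> z \<le> exp (disc c * \<bar>z - z'\<bar>) * \<phi> z'"
    "\<bar>\<phi> z - \<phi> z'\<bar> \<le> (exp (disc c * \<bar>z - z'\<bar>) - 1) * \<phi> z"
proof -
  show pos: "0 < \<phi> z" for z using assms unfolding front_def by blast
  show eq: "\<phi> z = N c \<phi> z" for z using assms unfolding front_def by blast
  show "continuous_on S \<phi>" using assms unfolding front_def by (blast intro: continuous_on_subset)
  show "\<phi> z \<le> exp (disc c * \<bar>z - z'\<bar>) * \<phi> z'"
    using N_harnack[OF front_bmeas[OF assms], of c z z'] pos eq by (metis less_imp_le)
  show "\<bar>\<phi> z - \<phi> z'\<bar> \<le> (exp (disc c * \<bar>z - z'\<bar>) - 1) * \<phi> z"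
    using N_lipschitz[OF front_bmeas[OF assms], of c z z'] pos eq by (metis less_imp_le)
qed

text \<open>Sliding: a subsolution that decays faster than the front lies below all its translates.\<close>
lemma fast_subsolution_zero:
  assumes W: "mono W" "\<And>z. 0 \<le> W z" "\<And>z. W z \<le> B * exp (l * z)" "bmeas W" "\<And>z. W z \<le> N c W z"
    and B: "0 < B" and l: "0 < l"
    and \<phi>: "front c \<phi>" and slow: "\<And>M. \<exists>Z. \<forall>z\<le>Z. M * exp (l * z) \<le> \<phi> z"
  shows "W z = 0"
proof -
  note F = front_facts[OF \<phi>]
  have W_shift: "bmeas (\<lambda>z. W (z - s))" "W (z - s) \<le> N c (\<lambda>z. W (z - s)) z" for s z
    using bmeas_shift[OF W(4), of "- s"] W(5)[of "z - s"] N_shift[of c W "- s" z] by simp_all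
  obtain Y where Y: "\<And>z. Y \<le> z \<Longrightarrow> \<kappa> - \<delta> \<le> \<phi> z" using front_near_kappa[OF \<phi> delta(1)] by blast
  define S where "S = {s. \<forall>z. W (z - s) \<le> \<phi> z}"
  \<comment> \<open>To the right of \<open>Y\<close> the front is in the contraction zone, so
    ordering on the left half-line already implies ordering everywhere.\<close>
  have near: "\<forall>z. W (z - s) \<le> \<phi> z" if "\<And>z. z \<le> Y \<Longrightarrow> W (z - s) \<le> \<phi> z" for s
  proof
    fix z
    show "W (z - s) \<le> \<phi> z"
    proof (rule contraction_comparison[where c=c, OF W_shift front_bmeas[OF \<phi>]])
      show "N c \<phi> z \<le> \<phi> z" for z by (rule eq_refl, rule F(2)[symmetric])
      show "\<kappa> - \<delta> \<le> \<phi> z" if "\<phi> z < W (z - s)" for z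
        using Y[of z] \<open>\<And>z. z \<le> Y \<Longrightarrow> W (z - s) \<le> \<phi> z\<close>[of z] that by linarith
    qed
  qed
  have S_up: "s' \<in> S" if "s \<in> S" "s \<le> s'" for s s'
    unfolding S_def
  proof (rule CollectI, rule allI)
    fix z
    have "W (z - s') \<le> W (z - s)" by (rule monoD[OF W(1)]) (use that in simp)
    also have "\<dots> \<le> \<phi> z" using that unfolding S_def by blast
    finally show "W (z - s') \<le> \<phi> z" .
  qed
  have S_ne: "\<exists>s. s \<in> S"
  proof -
    obtain Z where Z: "\<And>z. z \<le> Z \<Longrightarrow> 1 * exp (l * z) \<le> \<phi> z" using slow[of 1] by blast
    obtain \<mu> where \<mu>: "0 < \<mu>" "\<And>z. Z \<le> z \<Longrightarrow> z \<le> Y \<Longrightarrow> \<mu> \<le> \<phi> z"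
      using positive_min_on_interval[of \<phi> Z Y] F(1,3) by blast
    \<comment> \<open>Slow decay on the far left and positivity on a compact interval give
      \<open>m * exp (l * z) \<le> \<phi> z\<close> up to \<open>Y\<close>; a shift to the right
      reduces the constant \<open>B\<close> of \<open>W\<close> to \<open>m\<close>.\<close>
    define m where "m = min 1 (\<mu> * exp (- l * Y))"
    have m: "0 < m" "m \<le> 1" "m \<le> \<mu> * exp (- l * Y)" using \<mu> by (auto simp: m_def)
    have m_le: "m * exp (l * z) \<le> \<phi> z" if "z \<le> Y" for z
    proof (cases "z \<le> Z")
      case True
      have "m * exp (l * z) \<le> 1 * exp (l * z)" using m by (intro mult_right_mono) auto
      then show ?thesis using Z[OF True] by linarith
    next
      case False
      have "m * exp (l * z) \<le> \<mu> * exp (- l * Y) * exp (l * Y)"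
        using m that l \<mu> by (intro mult_mono) auto
      also have "\<dots> = \<mu>" by (simp add: mult.assoc flip: exp_add)
      finally show ?thesis using \<mu>(2)[of z] False that by simp
    qed
    define s where "s = ln (B / m) / l"
    have "B * exp (- (l * s)) = m" using l B m by (simp add: s_def exp_minus)
    have "W (z - s) \<le> \<phi> z" if "z \<le> Y" for z
    proof -
      have "W (z - s) \<le> B * exp (l * (z - s))" by (rule W)
      also have "\<dots> = B * exp (- (l * s)) * exp (l * z)" by (simp add: algebra_simps flip: exp_add)
      also have "\<dots> \<le> \<phi> z" unfolding \<open>B * exp (- (l * s)) = m\<close> using m_le[OF that] .
      finally show ?thesis .
    qed
    from near[OF this] show ?thesis unfolding S_def by blast
  qed
  have "\<not> bdd_below S"
  proof
    assume bdd: "bdd_below S"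
    define s0 where "s0 = Inf S"
    have "S \<noteq> {}" using S_ne by blast
    have above: "s \<in> S" if "s0 < s" for s
    proof -
      obtain s' where "s' \<in> S" "s' < s"
        using cInf_less_iff[OF \<open>S \<noteq> {}\<close> bdd, of s] \<open>s0 < s\<close> unfolding s0_def by blast
      then show ?thesis using S_up by auto
    qed
    have W_le: "W y \<le> \<phi> (y + s0)" for y
    proof (rule tendsto_lowerbound)
      have c1: "isCont (\<lambda>s. y + s) s0" by (intro continuous_intros)
      have "isCont \<phi> (y + s0)" using F(3)[of UNIV] by (simp add: continuous_on_eq_continuous_at)
      from isCont_o2[OF c1 this] have "isCont (\<lambda>s. \<phi> (y + s)) s0" .
      then show "((\<lambda>s. \<phi> (y + s)) \<longlongrightarrow> \<phi> (y + s0)) (at_right s0)" by (simp add: isCont_def filterlim_at_split)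
      have "W y \<le> \<phi> (y + s)" if "s0 < s" for s
      proof -
        have "W ((y + s) - s) \<le> \<phi> (y + s)" using above[OF that] unfolding S_def by blast
        then show ?thesis by simp
      qed
      then show "eventually (\<lambda>s. W y \<le> \<phi> (y + s)) (at_right s0)"
        by (auto simp: eventually_at_filter intro: always_eventually)
    qed simp
    define \<phi>0 where "\<phi>0 = (\<lambda>y. \<phi> (y + s0))"
    have \<phi>0: "bmeas \<phi>0" "\<And>z. \<phi>0 z = N c \<phi>0 z" "continuous_on UNIV \<phi>0" "\<And>z. 0 < \<phi>0 z" "\<And>z. W z \<le> \<phi>0 z"
    proof -
      show "bmeas \<phi>0" unfolding \<phi>0_def by (rule bmeas_shift[OF front_bmeas[OF \<phi>]])
      show "\<phi>0 z = N c \<phi>0 z" for z unfolding \<phi>0_def N_shift by (rule F(2))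
      show "continuous_on UNIV \<phi>0" unfolding \<phi>0_def by (rule continuous_on_compose2[OF F(3)[of UNIV]]) (auto intro!: continuous_intros)
    qed (use F(1) W_le in \<open>auto simp: \<phi>0_def\<close>)
    \<comment> \<open>Far left \<open>W\<close> is at most half of \<phi>0 and \<open>g\<close> has
      slope at least 1, so the images under \<open>g\<close> differ by a positive amount on an
      interval. The positive kernel spreads this strictness to every point.\<close>
    have strict: "N c W z < \<phi>0 z" for z
    proof -
      obtain d where d: "0 < d" "\<And>a b. - d \<le> a \<Longrightarrow> a \<le> b \<Longrightarrow> b \<le> d \<Longrightarrow> (G - (G - 1)) * (b - a) \<le> g b - g a"
        using g_near_0[of "G - 1"] G_gt_1 by auto
      obtain Z1 where Z1: "\<And>z. z \<le> Z1 \<Longrightarrow> 2 * B * exp (- l * s0) * exp (l * z) \<le> \<phi> z" using slow by blast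
      obtain Z2 where Z2: "\<And>z. z \<le> Z2 \<Longrightarrow> \<phi> z \<le> d" using front_near_0[OF \<phi> d(1)] by blast
      define q where "q = min Z1 Z2 - s0"
      obtain \<mu> where \<mu>: "0 < \<mu>" "\<And>x. q - 1 \<le> x \<Longrightarrow> x \<le> q \<Longrightarrow> \<mu> \<le> \<phi>0 x"
        using positive_min_on_interval[OF \<phi>0(3), of "q - 1" q] \<phi>0(4) by blast
      have "0 < res c (\<lambda>x. g (\<phi>0 x) - g (W x)) (z - c * h)"
      proof (rule res_pos[where m="\<mu> / 2" and p="q - 1" and q=q])
        show "bmeas (\<lambda>x. g (\<phi>0 x) - g (W x))" by (intro bmeas_intros(3) bmeas_g \<phi>0 W)
        show "0 \<le> g (\<phi>0 x) - g (W x)" for x using g_mono[OF \<phi>0(5)] by simp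
        fix x assume x: "q - 1 \<le> x" "x \<le> q"
        have "2 * B * exp (- l * s0) * exp (l * (x + s0)) \<le> \<phi>0 x"
          using x unfolding \<phi>0_def by (intro Z1) (simp add: q_def)
        moreover have "2 * B * exp (- l * s0) * exp (l * (x + s0)) = 2 * (B * exp (l * x))"
          by (simp add: algebra_simps flip: exp_add)
        ultimately have "2 * (B * exp (l * x)) \<le> \<phi>0 x" by (simp only:)
        then have "W x \<le> \<phi>0 x / 2" using W(3)[of x] by linarith
        moreover have "\<phi>0 x \<le> d" unfolding \<phi>0_def using x by (intro Z2) (simp add: q_def)
        ultimately have "\<phi>0 x - W x \<le> g (\<phi>0 x) - g (W x)"
          using d(2)[of "W x" "\<phi>0 x"] W(2)[of x] \<phi>0(5)[of x] d(1) by simp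
        then show "\<mu> / 2 \<le> g (\<phi>0 x) - g (W x)" using \<mu>(2)[OF x] \<open>W x \<le> \<phi>0 x / 2\<close> by simp
      qed (use \<mu>(1) in auto)
      also have "\<dots> = N c \<phi>0 z - N c W z"
        unfolding N_def by (rule res_diff) (intro bmeas_g \<phi>0 W)+
      finally show ?thesis using \<phi>0(2)[of z] by simp
    qed
    obtain Z where Z: "\<And>z. z \<le> Z \<Longrightarrow> B * exp (l * (1 - s0)) * exp (l * z) \<le> \<phi> z" using slow by blast
    have "continuous_on UNIV (\<lambda>z. \<phi>0 z - N c W z)"
      by (intro continuous_intros \<phi>0 N_continuous W)
    then obtain \<mu> where \<mu>: "0 < \<mu>" "\<And>x. Z - s0 \<le> x \<Longrightarrow> x \<le> Y - s0 + 1 \<Longrightarrow> \<mu> \<le> \<phi>0 x - N c W x"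
      using positive_min_on_interval[of "\<lambda>z. \<phi>0 z - N c W z" "Z - s0" "Y - s0 + 1"] strict by auto
    have "\<exists>\<epsilon>>0. \<epsilon> \<le> 1 \<and> 0 < \<mu> - (exp (disc c * \<epsilon>) - 1) * \<kappa>"
      by (intro exists_small_pos continuous_intros) (use \<mu> in auto)
    then obtain \<epsilon> where \<epsilon>: "0 < \<epsilon>" "\<epsilon> \<le> 1" "(exp (disc c * \<epsilon>) - 1) * \<kappa> < \<mu>" by auto
    \<comment> \<open>Sliding beyond the infimum: far left slow decay beats the exponential bound of
      \<open>W\<close>, on the compact middle the strict margin \<mu> beats the change of \<phi>
      under a shift by \<epsilon>, and on the right \<open>near\<close> takes over.\<close>
    have "\<forall>z. W (z - (s0 - \<epsilon>)) \<le> \<phi> z"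
    proof (rule near)
      fix z assume z: "z \<le> Y"
      define y where "y = z - (s0 - \<epsilon>)"
      have zy: "z = y + s0 - \<epsilon>" by (simp add: y_def)
      show "W (z - (s0 - \<epsilon>)) \<le> \<phi> z"
      proof (cases "z \<le> Z")
        case True
        have "W y \<le> B * exp (l * y)" by (rule W)
        also have "\<dots> \<le> B * exp (l * (1 - s0) + l * z)"
          using B l \<epsilon> by (intro mult_left_mono) (auto simp: zy algebra_simps)
        also have "\<dots> = B * exp (l * (1 - s0)) * exp (l * z)" by (simp add: exp_add)
        also have "\<dots> \<le> \<phi> z" by (rule Z[OF True])
        finally show ?thesis by (simp add: y_def)
      next
        case False
        then have "\<mu> \<le> \<phi>0 y - N c W y" using z \<epsilon> by (intro \<mu>(2)) (auto simp: y_def)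
        moreover have "\<bar>\<phi> (y + s0) - \<phi> z\<bar> \<le> (exp (disc c * \<epsilon>) - 1) * \<kappa>"
        proof -
          have "\<bar>\<phi> (y + s0) - \<phi> z\<bar> \<le> (exp (disc c * \<bar>(y + s0) - z\<bar>) - 1) * \<phi> (y + s0)" by (rule F(5))
          also have "\<bar>(y + s0) - z\<bar> = \<epsilon>" using \<epsilon> by (simp add: y_def)
          also have "(exp (disc c * \<epsilon>) - 1) * \<phi> (y + s0) \<le> (exp (disc c * \<epsilon>) - 1) * \<kappa>"
            using front_le_kappa[OF \<phi>] \<epsilon> disc_pos[of c] by (intro mult_left_mono) auto
          finally show ?thesis .
        qed
        ultimately have "W y \<le> \<phi> z" using W(5)[of y] \<epsilon>(3) unfolding \<phi>0_def by linarith
        then show ?thesis by (simp add: y_def)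
      qed
    qed
    then have "s0 - \<epsilon> \<in> S" by (simp add: S_def)
    then have "s0 \<le> s0 - \<epsilon>" unfolding s0_def using bdd by (intro cInf_lower)
    then show False using \<epsilon> by simp
  qed
  \<comment> \<open>With every shift admissible, a fixed value of \<open>W\<close> is compared with
    \<phi> arbitrarily far to the left, where \<phi> is small.\<close>
  then have all: "s \<in> S" for s using S_up unfolding bdd_below_def by (meson linorder_not_le less_imp_le)
  have "W z \<le> e" if "0 < e" for e
  proof -
    obtain Y where Y: "\<And>z. z \<le> Y \<Longrightarrow> \<phi> z \<le> e" using front_near_0[OF \<phi> \<open>0 < e\<close>] by blast
    have "W (Y - (Y - z)) \<le> \<phi> Y" using all[of "Y - z"] unfolding S_def by blast
    then show ?thesis using Y[of Y] by simp
  qed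
  then have "W z \<le> 0" by (rule field_le_epsilon[where y=0, simplified])
  then show ?thesis using W(2)[of z] by simp
qed

end

section \<open>Existence of monotone fronts\<close>

text \<open>Diagonal extraction along an enumeration of the rationals; equicontinuity of the
  profiles to which it is applied extends convergence to all reals.\<close>

lemma convergent_subsequence_on_rationals:
  fixes b :: "nat \<Rightarrow> real \<Rightarrow> real"
  assumes "\<And>k x. \<bar>b k x\<bar> \<le> B"
  obtains s :: "nat \<Rightarrow> nat" where "strict_mono s" "\<And>q. q \<in> \<rat> \<Longrightarrow> convergent (\<lambda>n. b (s n) q)"
proof -
  define q :: "nat \<Rightarrow> real" where "q = from_nat_into \<rat>"
  have q: "range q = \<rat>" unfolding q_def by (rule range_from_nat_into) (auto simp: countable_rat)
  define P where "P = (\<lambda>n (s :: nat \<Rightarrow> nat). convergent (\<lambda>i. b (s i) (q n)))"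
  interpret subseqs P
  proof
    fix n and s :: "nat \<Rightarrow> nat"
    have "bounded (range (\<lambda>i. b (s i) (q n)))" using assms by (intro boundedI[of _ B]) auto
    then obtain l r where "strict_mono r" "((\<lambda>i. b (s i) (q n)) \<circ> r) \<longlonglongrightarrow> l"
      using bounded_imp_convergent_subsequence by blast
    then show "\<exists>r'. strict_mono r' \<and> P n (s \<circ> r')" unfolding P_def by (auto simp: o_def convergent_def)
  qed
  have D: "P k (diagseq \<circ> ((+) (Suc k)))" for k
  proof (rule diagseq_holds)
    fix n and r s :: "nat \<Rightarrow> nat" assume "strict_mono r" "P n s"
    then show "P n (s \<circ> r)"
      unfolding P_def using convergent_subseq_convergent[of "\<lambda>i. b (s i) (q n)" r] by (simp add: o_def)
  qed
  have "convergent (\<lambda>i. b (diagseq (i + Suc k)) (q k))" for k using D[of k] by (simp only: P_def o_def add.commute[of "Suc k"])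
  then have conv: "convergent (\<lambda>i. b (diagseq i) (q k))" for k
    using convergent_ignore_initial_segment[of "\<lambda>i. b (diagseq i) (q k)" "Suc k"] by simp
  show thesis
  proof (rule that[OF subseq_diagseq])
    fix x :: real assume "x \<in> \<rat>"
    then obtain k where "x = q k" using q by blast
    then show "convergent (\<lambda>n. b (diagseq n) x)" using conv by simp
  qed
qed


lemma mono_shift_tendsto:
  fixes A :: "real \<Rightarrow> real"
  assumes "mono A" "\<And>x. \<bar>A x\<bar> \<le> B"
  shows "(\<lambda>n. A (x + real n)) \<longlonglongrightarrow> (SUP x. A x)" "(\<lambda>n. A (x - real n)) \<longlonglongrightarrow> (INF x. A x)"
    "(A \<longlongrightarrow> (SUP x. A x)) at_top" "(A \<longlongrightarrow> (INF x. A x)) at_bot"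
proof -
  have B: "A x \<le> B" "- B \<le> A x" for x using assms(2)[of x] by linarith+
  have bdd: "bdd_above (range A)" "bdd_below (range A)"
    by (rule bdd_aboveI[of _ B], use B in auto) (rule bdd_belowI[of _ "- B"], use B in auto)
  show top: "(A \<longlongrightarrow> (SUP x. A x)) at_top"
  proof (rule order_tendstoI)
    fix a assume "a < (SUP x. A x)"
    then obtain y where y: "a < A y" using less_cSUP_iff[OF _ bdd(1)] by auto
    then show "eventually (\<lambda>x. a < A x) at_top"
      by (intro eventually_mono[OF eventually_ge_at_top[of y]]) (auto intro: less_le_trans monoD[OF assms(1)])
  next
    fix a assume a: "(SUP x. A x) < a"
    have "A x < a" for x using cSUP_upper[OF UNIV_I bdd(1), of x] a by linarith
    then show "eventually (\<lambda>x. A x < a) at_top" by (intro always_eventually allI)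
  qed
  show bot: "(A \<longlongrightarrow> (INF x. A x)) at_bot"
  proof (rule order_tendstoI)
    fix a assume "(INF x. A x) < a"
    then obtain y where y: "A y < a" using cINF_less_iff[OF _ bdd(2)] by auto
    then show "eventually (\<lambda>x. A x < a) at_bot"
      by (intro eventually_mono[OF eventually_le_at_bot[of y]]) (auto intro: le_less_trans monoD[OF assms(1)])
  next
    fix a assume a: "a < (INF x. A x)"
    have "a < A x" for x using cINF_lower[OF bdd(2) UNIV_I, of x] a by linarith
    then show "eventually (\<lambda>x. a < A x) at_bot" by (intro always_eventually allI)
  qed
  have "LIM n sequentially. x + real n :> at_top"
    by (rule filterlim_tendsto_add_at_top[OF tendsto_const filterlim_real_sequentially])
  then show "(\<lambda>n. A (x + real n)) \<longlonglongrightarrow> (SUP x. A x)" by (rule filterlim_compose[OF top])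
  have "LIM n sequentially. - (- x + real n) :> at_bot"
    unfolding filterlim_uminus_at_bot minus_minus by (rule filterlim_tendsto_add_at_top[OF tendsto_const filterlim_real_sequentially])
  then show "(\<lambda>n. A (x - real n)) \<longlonglongrightarrow> (INF x. A x)" using filterlim_compose[OF bot] by simp
qed

context profile
begin

lemma N_limits:
  assumes "mono A" "\<And>x. \<bar>A x\<bar> \<le> B"
  shows "(\<lambda>n. N c A (z + real n)) \<longlonglongrightarrow> g (SUP x. A x)" "(\<lambda>n. N c A (z - real n)) \<longlonglongrightarrow> g (INF x. A x)"
proof -
  have bm: "bmeas A" by (rule bmeas_mono[OF assms])
  have "(\<lambda>n. N c (\<lambda>x. A (x + real n)) z) \<longlonglongrightarrow> N c (\<lambda>_. SUP x. A x) z"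
    by (rule N_tendsto[where B=B]) (use assms bm in \<open>auto intro!: mono_shift_tendsto bmeas_measurable[OF bmeas_shift]\<close>)
  then show "(\<lambda>n. N c A (z + real n)) \<longlonglongrightarrow> g (SUP x. A x)" by (simp add: N_shift N_const)
  have "(\<lambda>n. N c (\<lambda>x. A (x + - real n)) z) \<longlonglongrightarrow> N c (\<lambda>_. INF x. A x) z"
  proof (rule N_tendsto[where B=B])
    show "(\<lambda>x. A (x + - real n)) \<in> borel_measurable borel" for n by (rule bmeas_measurable[OF bmeas_shift[OF bm]])
    show "(\<lambda>n. A (x + - real n)) \<longlonglongrightarrow> (INF x. A x)" for x using mono_shift_tendsto(2)[OF assms] by simp
  qed (rule assms)
  then show "(\<lambda>n. N c A (z - real n)) \<longlonglongrightarrow> g (INF x. A x)"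
    using N_shift[of c A "- real n" z for n] by (simp add: N_const)
qed

lemma fixpoint_between: "0 \<le> l \<Longrightarrow> l \<le> \<kappa> \<Longrightarrow> g l \<le> l \<Longrightarrow> l = 0 \<or> l = \<kappa>"
  using g_above[of l] by fastforce

text \<open>Weinberger's recursion \<open>a \<mapsto> max a0 (N a)\<close> started from a low truncation of the supersolution:
  its limit is a fixed point up to \<open>\<epsilon>\<close> and reaches \<open>\<kappa>\<close> at \<open>+\<infinity>\<close>.\<close>
lemma almost_front:
  assumes \<Theta>: "mono \<Theta>" "\<And>z. 0 < \<Theta> z" "\<And>z. N c \<Theta> z \<le> \<Theta> z" "bmeas \<Theta>"
    and \<epsilon>: "0 < \<epsilon>" "\<epsilon> < \<kappa>"
  obtains A where "mono A" "\<And>z. 0 \<le> A z" "\<And>z. A z \<le> \<kappa>" "\<And>z. A z \<le> \<Theta> z"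
    "\<And>z. N c A z \<le> A z" "\<And>z. A z \<le> N c A z + \<epsilon>" "(\<lambda>n. N c A (real n)) \<longlonglongrightarrow> \<kappa>"
proof -
  define a0 where "a0 = (\<lambda>z. min (\<Theta> z) \<epsilon>)"
  define a where "a = (\<lambda>n. ((\<lambda>f z. max (a0 z) (N c f z)) ^^ n) a0)"
  have a_0: "a 0 = a0" and a_Suc: "\<And>n. a (Suc n) = (\<lambda>z. max (a0 z) (N c (a n) z))" by (auto simp: a_def)
  have a0: "mono a0" "\<And>z. 0 < a0 z" "\<And>z. a0 z \<le> \<epsilon>" "\<And>z. a0 z \<le> \<Theta> z"
    using \<Theta> \<epsilon> by (auto simp: a0_def mono_def min.coboundedI1 intro: min.mono)
  have inv: "mono (a n) \<and> (\<forall>z. 0 \<le> a n z \<and> a n z \<le> \<kappa> \<and> a n z \<le> \<Theta> z)" for n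
  proof (induction n)
    case 0
    have "a0 z \<le> \<kappa>" for z using a0(3)[of z] \<epsilon> by linarith
    then show ?case using a0(1) less_imp_le[OF a0(2)] a0(4) unfolding a_0 by blast
  next
    case (Suc n)
    have bm: "bmeas (a n)" using Suc by (intro bmeas_mono[of _ \<kappa>]) auto
    have m: "mono (N c (a n))" using Suc bm by (intro N_mono_fun) auto
    have "mono (\<lambda>z. max (a0 z) (N c (a n) z))"
      by (rule monoI, rule max.mono) (auto intro: monoD[OF a0(1)] monoD[OF m])
    moreover have "0 \<le> max (a0 z) (N c (a n) z)" for z using a0(2)[of z] by simp
    moreover have "max (a0 z) (N c (a n) z) \<le> \<kappa>" for z
      using a0(3)[of z] \<epsilon> N_le[OF bm, of \<kappa> c z] Suc by (auto simp: g_kappa)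
    moreover have "max (a0 z) (N c (a n) z) \<le> \<Theta> z" for z
      using a0(4)[of z] N_mono[OF bm \<Theta>(4), of c z] \<Theta>(3)[of z] Suc by auto
    ultimately show ?case unfolding a_Suc by blast
  qed
  have bm: "bmeas (a n)" for n using inv[of n] by (intro bmeas_mono[of _ \<kappa>]) auto
  have step: "a n z \<le> a (Suc n) z" for n z
  proof (induction n arbitrary: z)
    case 0
    show ?case by (simp add: a_Suc a_0)
  next
    case (Suc n)
    have "N c (a n) z \<le> N c (a (Suc n)) z" using Suc by (intro N_mono bm)
    then show ?case unfolding a_Suc[of n] a_Suc[of "Suc n"] by (intro max.mono) auto
  qed
  have inc: "incseq (\<lambda>n. a n z)" for z by (rule incseq_SucI) (rule step)
  have "\<exists>l. (\<lambda>n. a n z) \<longlonglongrightarrow> l" for z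
  proof -
    have "\<forall>n. a n z \<le> \<kappa>" using inv by blast
    then show ?thesis by (rule incseq_convergent[OF inc]) (rule exI)
  qed
  then obtain A where A: "\<And>z. (\<lambda>n. a n z) \<longlonglongrightarrow> A z" by metis
  have A_mono: "mono A"
  proof (rule monoI)
    fix x y :: real assume "x \<le> y"
    then have "\<forall>n\<ge>0. a n x \<le> a n y" using inv monoD by blast
    then show "A x \<le> A y" by (intro LIMSEQ_le[OF A A]) blast
  qed
  have A_bounds: "0 \<le> A z" "A z \<le> \<kappa>" "A z \<le> \<Theta> z" for z
    by (rule LIMSEQ_le_const[OF A], use inv in blast) (rule LIMSEQ_le_const2[OF A], use inv in blast)+
  have absA: "\<bar>A x\<bar> \<le> \<kappa>" for x using A_bounds[of x] by simp
  have N_lim: "(\<lambda>n. N c (a n) z) \<longlonglongrightarrow> N c A z" for z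
    by (rule N_tendsto[where B=\<kappa>, OF bmeas_measurable[OF bm] _ A]) (use inv in auto)
  have A_eq: "A z = max (a0 z) (N c A z)" for z
  proof (rule LIMSEQ_unique)
    show "(\<lambda>n. a (Suc n) z) \<longlonglongrightarrow> A z" using A[of z] by (rule LIMSEQ_Suc)
    show "(\<lambda>n. a (Suc n) z) \<longlonglongrightarrow> max (a0 z) (N c A z)" unfolding a_Suc by (intro tendsto_intros N_lim)
  qed
  have NA: "0 \<le> N c A z" for z using A_bounds by (intro N_nonneg)
  define l where "l = (SUP x. A x)"
  have Al: "(\<lambda>n. A (0 + real n)) \<longlonglongrightarrow> l" unfolding l_def by (rule mono_shift_tendsto[OF A_mono absA])
  have Nl: "(\<lambda>n. N c A (0 + real n)) \<longlonglongrightarrow> g l" unfolding l_def by (rule N_limits[OF A_mono absA])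
  \<comment> \<open>Only \<open>g l \<le> l\<close> is obtained in the limit, but between 0 and
    \<kappa> this leaves the two end points, and the truncation \<open>a0\<close> keeps
    \<open>l\<close> positive.\<close>
  have "l = \<kappa>"
  proof -
    have "g l \<le> l" by (rule LIMSEQ_le[OF Nl Al]) (use A_eq in \<open>auto intro!: exI[of _ 0] simp: max_def\<close>)
    moreover have "l \<le> \<kappa>" by (rule LIMSEQ_le_const2[OF Al]) (use A_bounds in blast)
    moreover have "a0 0 \<le> l"
    proof (rule LIMSEQ_le_const[OF Al], intro exI[of _ 0] allI impI)
      fix n
      have "a0 0 \<le> a0 (0 + real n)" by (rule monoD[OF a0(1)]) simp
      also have "\<dots> \<le> A (0 + real n)" using A_eq[of "0 + real n"] by simp
      finally show "a0 0 \<le> A (0 + real n)" .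
    qed
    ultimately show ?thesis using fixpoint_between[of l] a0(2)[of 0] by auto
  qed
  show thesis
  proof (rule that[OF A_mono A_bounds])
    show "N c A z \<le> A z" for z by (metis A_eq max.cobounded2)
    show "A z \<le> N c A z + \<epsilon>" for z using A_eq[of z] a0(3)[of z] NA[of z] \<epsilon> by (simp add: max_def)
    show "(\<lambda>n. N c A (real n)) \<longlonglongrightarrow> \<kappa>" using Nl \<open>l = \<kappa>\<close> by (simp add: g_kappa)
  qed
qed

text \<open>Almost fixed points with errors \<epsilon> tending to 0 are translated so that their
  images take the value \<open>\<kappa> / 2\<close> at 0; they do take it, since the supersolution
  falls below it and the limit at the right is \<kappa>. The limit of a subsequence is an exact
  monotone fixed point whose limits at both ends are fixed by \<open>g\<close>, and the value
  \<open>\<kappa> / 2\<close> separates them into 0 and \<kappa>.\<close>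

theorem front_from_supersolution:
  assumes \<Theta>: "mono \<Theta>" "\<And>z. 0 < \<Theta> z" "\<And>z. N c \<Theta> z \<le> \<Theta> z" "bmeas \<Theta>" and \<Theta>_bot: "\<And>e. 0 < e \<Longrightarrow> \<exists>z. \<Theta> z < e"
  shows "\<exists>V. front c V \<and> mono V"
proof -
  define \<epsilon> where "\<epsilon> = (\<lambda>k::nat. \<kappa> / (real k + 3))"
  have \<epsilon>: "0 < \<epsilon> k" "\<epsilon> k < \<kappa>" for k
  proof -
    show "0 < \<epsilon> k" using kappa_pos by (simp add: \<epsilon>_def)
    have "\<kappa> * 1 < \<kappa> * (real k + 3)" using kappa_pos by (intro mult_strict_left_mono) auto
    then show "\<epsilon> k < \<kappa>" by (simp add: \<epsilon>_def divide_less_eq)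
  qed
  have \<epsilon>_lim: "\<epsilon> \<longlonglongrightarrow> 0"
    unfolding \<epsilon>_def add.commute[of _ 3]
    by (intro tendsto_divide_0[OF tendsto_const] filterlim_at_top_imp_at_infinity
        filterlim_tendsto_add_at_top[OF tendsto_const filterlim_real_sequentially])
  have "\<exists>A. mono A \<and> (\<forall>z. 0 \<le> A z \<and> A z \<le> \<kappa> \<and> A z \<le> \<Theta> z \<and> N c A z \<le> A z \<and> A z \<le> N c A z + \<epsilon> k) \<and>
     (\<lambda>n. N c A (real n)) \<longlonglongrightarrow> \<kappa>" for k
    by (rule almost_front[OF \<Theta> \<epsilon>, of k]) blast
  then obtain A where A: "\<And>k. mono (A k)" "\<And>k z. 0 \<le> A k z" "\<And>k z. A k z \<le> \<kappa>" "\<And>k z. A k z \<le> \<Theta> z"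
    "\<And>k z. N c (A k) z \<le> A k z" "\<And>k z. A k z \<le> N c (A k) z + \<epsilon> k" "\<And>k. (\<lambda>n. N c (A k) (real n)) \<longlonglongrightarrow> \<kappa>"
    by metis
  have bmA: "bmeas (A k)" for k using A by (intro bmeas_mono[of _ \<kappa>]) auto
  have "\<exists>z. N c (A k) z = \<kappa> / 2" for k
  proof -
    obtain z1 where z1: "\<Theta> z1 < \<kappa> / 2" using \<Theta>_bot[of "\<kappa> / 2"] kappa_pos by auto
    have "eventually (\<lambda>n. \<kappa> / 2 < N c (A k) (real n)) sequentially"
      using A(7)[of k] kappa_pos by (intro order_tendstoD(1)) auto
    then obtain n where n: "\<kappa> / 2 < N c (A k) (real n)" by (auto simp: eventually_sequentially)
    have l: "N c (A k) z1 \<le> \<kappa> / 2" using A(4,5)[of k z1] z1 by linarith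
    have "z1 \<le> real n"
    proof (rule ccontr)
      assume "\<not> z1 \<le> real n"
      then have "N c (A k) (real n) \<le> N c (A k) z1" by (intro monoD[OF N_mono_fun[OF A(1) bmA]]) simp
      then show False using n l by simp
    qed
    then show ?thesis
      using IVT'[of "N c (A k)" z1 "\<kappa> / 2" "real n"] l n continuous_on_subset[OF N_continuous[OF bmA A(2)]]
      by (auto simp: less_imp_le)
  qed
  then obtain zk where zk: "\<And>k. N c (A k) (zk k) = \<kappa> / 2" by metis
  \<comment> \<open>The images under \<open>N c\<close> are used because they are equicontinuous,
    whereas \<open>A k\<close> inherits possible jumps of \<Theta>; the two differ by at most
    \<open>\<epsilon> k\<close>.\<close>
  define b where "b = (\<lambda>k z. N c (A k) (z + zk k))"
  have b_mono: "mono (b k)" for k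
    unfolding b_def by (rule monoI, rule monoD[OF N_mono_fun[OF A(1) bmA]]) simp
  have b_bounds: "0 \<le> b k z" "b k z \<le> \<kappa>" for k z
    using N_nonneg[of "A k" c "z + zk k"] A order_trans[OF A(5) A(3)] by (auto simp: b_def)
  have absb: "\<bar>b k z\<bar> \<le> \<kappa>" for k z using b_bounds[of k z] by simp
  have b_lip: "\<bar>b k z - b k z'\<bar> \<le> (exp (disc c * \<bar>z - z'\<bar>) - 1) * \<kappa>" for k z z'
  proof -
    have "\<bar>b k z - b k z'\<bar> \<le> (exp (disc c * \<bar>z - z'\<bar>) - 1) * b k z"
      using N_lipschitz[OF bmA A(2), of c k "z + zk k" "z' + zk k"] by (simp add: b_def)
    also have "\<dots> \<le> (exp (disc c * \<bar>z - z'\<bar>) - 1) * \<kappa>"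
      using b_bounds[of k z] disc_pos[of c] by (intro mult_left_mono) auto
    finally show ?thesis .
  qed
  obtain s where s: "strict_mono (s :: nat \<Rightarrow> nat)" "\<And>q. q \<in> \<rat> \<Longrightarrow> convergent (\<lambda>n. b (s n) q)"
    by (rule convergent_subsequence_on_rationals[of b \<kappa>, OF absb]) blast
  have "convergent (\<lambda>n. b (s n) x)" for x
    unfolding Cauchy_convergent_iff[symmetric]
  proof (rule CauchyI)
    fix e :: real assume e: "0 < e"
    have "\<exists>d>0. d \<le> 1 \<and> 0 < e / 3 - (exp (disc c * d) - 1) * \<kappa>"
      by (intro exists_small_pos continuous_intros) (use e in auto)
    then obtain d where d: "0 < d" "(exp (disc c * d) - 1) * \<kappa> < e / 3" by auto
    obtain q where q: "q \<in> \<rat>" "x < q" "q < x + d" using Rats_dense_in_real[of x "x + d"] d by auto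
    have close: "\<bar>b k x - b k q\<bar> < e / 3" for k
    proof -
      have "(exp (disc c * \<bar>x - q\<bar>) - 1) * \<kappa> \<le> (exp (disc c * d) - 1) * \<kappa>"
        using q disc_pos[of c] kappa_pos by (intro mult_right_mono) auto
      then show ?thesis using b_lip[of k x q] d by linarith
    qed
    have "Cauchy (\<lambda>n. b (s n) q)" using s(2)[OF q(1)] Cauchy_convergent_iff by blast
    from CauchyD[OF this, of "e / 3"] e obtain M where M: "\<forall>m\<ge>M. \<forall>n\<ge>M. norm (b (s m) q - b (s n) q) < e / 3" by auto
    have "norm (b (s m) x - b (s n) x) < e" if "M \<le> m" "M \<le> n" for m n
    proof -
      have "\<bar>b (s m) q - b (s n) q\<bar> < e / 3" using M that by simp
      then show ?thesis using close[of "s m"] close[of "s n"] unfolding real_norm_def by linarith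
    qed
    then show "\<exists>M. \<forall>m\<ge>M. \<forall>n\<ge>M. norm (b (s m) x - b (s n) x) < e" by blast
  qed
  then obtain V where V: "\<And>x. (\<lambda>n. b (s n) x) \<longlonglongrightarrow> V x" unfolding convergent_def by metis
  have V_mono: "mono V"
  proof (rule monoI)
    fix x y :: real assume "x \<le> y"
    then have "\<forall>n\<ge>0. b (s n) x \<le> b (s n) y" using b_mono monoD by blast
    then show "V x \<le> V y" by (intro LIMSEQ_le[OF V V]) blast
  qed
  have V_bounds: "0 \<le> V z" "V z \<le> \<kappa>" for z
    by (rule LIMSEQ_le_const[OF V], use b_bounds in blast) (rule LIMSEQ_le_const2[OF V], use b_bounds in blast)
  have absV: "\<bar>V x\<bar> \<le> \<kappa>" for x using V_bounds[of x] by simp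
  have bmV: "bmeas V" by (rule bmeas_mono[OF V_mono absV])
  have bmb: "bmeas (b k)" for k by (rule bmeas_mono[OF b_mono absb])
  have V0: "V 0 = \<kappa> / 2"
  proof (rule LIMSEQ_unique[OF V[of 0]])
    show "(\<lambda>n. b (s n) 0) \<longlonglongrightarrow> \<kappa> / 2" by (simp add: b_def zk)
  qed
  have V_fix: "V z = N c V z" for z
  proof -
    have "(\<lambda>n. N c (b (s n)) z) \<longlonglongrightarrow> N c V z"
      by (rule N_tendsto[where B=\<kappa>, OF bmeas_measurable[OF bmb] absb V])
    moreover have "(\<lambda>n. N c (b (s n)) z - b (s n) z) \<longlonglongrightarrow> 0"
    proof (rule Lim_null_comparison[OF always_eventually[OF allI]])
      show "(\<lambda>n. L * \<epsilon> (s n)) \<longlonglongrightarrow> 0"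
        using tendsto_mult_left[OF LIMSEQ_subseq_LIMSEQ[OF \<epsilon>_lim s(1)], of L] by (simp add: o_def)
      show "norm (N c (b (s n)) z - b (s n) z) \<le> L * \<epsilon> (s n)" for n
      proof -
        have "b (s n) z = N c (\<lambda>x. A (s n) (x + zk (s n))) z" by (simp add: b_def N_shift)
        moreover have "\<bar>N c (b (s n)) z - N c (\<lambda>x. A (s n) (x + zk (s n))) z\<bar> \<le> L * \<epsilon> (s n)"
        proof (rule N_close[OF bmb bmeas_shift[OF bmA]])
          fix x
          show "\<bar>b (s n) x - A (s n) (x + zk (s n))\<bar> \<le> \<epsilon> (s n)"
            using A(5)[of "s n" "x + zk (s n)"] A(6)[of "s n" "x + zk (s n)"] by (simp add: b_def)
        qed
        ultimately show ?thesis by simp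
      qed
    qed
    ultimately have "(\<lambda>n. N c (b (s n)) z - (N c (b (s n)) z - b (s n) z)) \<longlonglongrightarrow> N c V z - 0"
      by (rule tendsto_diff)
    then show ?thesis using LIMSEQ_unique[OF V[of z]] by simp
  qed
  have NV: "N c V = V" by (rule ext) (rule V_fix[symmetric])
  have fix_limits: "g (SUP x. V x) = (SUP x. V x)" "g (INF x. V x) = (INF x. V x)"
    by (rule LIMSEQ_unique[OF N_limits(1)[OF V_mono absV, of c 0, unfolded NV] mono_shift_tendsto(1)[OF V_mono absV]],
        rule LIMSEQ_unique[OF N_limits(2)[OF V_mono absV, of c 0, unfolded NV] mono_shift_tendsto(2)[OF V_mono absV]])
  have "(\<lambda>n. V (0 + real n)) \<longlonglongrightarrow> (SUP x. V x)" by (rule mono_shift_tendsto(1)[OF V_mono absV])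
  then have sup: "V 0 \<le> (SUP x. V x)" "(SUP x. V x) \<le> \<kappa>"
    by (rule LIMSEQ_le_const, intro exI[of _ 0] allI impI monoD[OF V_mono], simp)
       (rule LIMSEQ_le_const2[OF \<open>(\<lambda>n. V (0 + real n)) \<longlonglongrightarrow> _\<close>], use V_bounds in blast)
  have "(\<lambda>n. V (0 - real n)) \<longlonglongrightarrow> (INF x. V x)" by (rule mono_shift_tendsto(2)[OF V_mono absV])
  then have inf: "(INF x. V x) \<le> V 0" "0 \<le> (INF x. V x)"
    by (rule LIMSEQ_le_const2, intro exI[of _ 0] allI impI monoD[OF V_mono], simp)
       (rule LIMSEQ_le_const[OF \<open>(\<lambda>n. V (0 - real n)) \<longlonglongrightarrow> _\<close>], use V_bounds in blast)
  have "(SUP x. V x) = \<kappa>" using fixpoint_between[of "SUP x. V x"] sup V0 fix_limits kappa_pos by auto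
  then have top: "(V \<longlongrightarrow> \<kappa>) at_top" using mono_shift_tendsto(3)[OF V_mono absV] by simp
  have "(INF x. V x) = 0" using fixpoint_between[of "INF x. V x"] inf V0 fix_limits kappa_pos by auto
  then have bot: "(V \<longlongrightarrow> 0) at_bot" using mono_shift_tendsto(4)[OF V_mono absV] by simp
  have pos: "0 < V z" for z
  proof -
    have "V 0 \<le> exp (disc c * \<bar>0 - z\<bar>) * V z"
      using N_harnack[OF bmV V_bounds(1), of c 0 z] unfolding NV .
    then have "0 < exp (disc c * \<bar>0 - z\<bar>) * V z" using V0 kappa_pos by simp
    then show ?thesis by (simp add: zero_less_mult_iff)
  qed
  have "continuous_on UNIV V"
    using N_continuous[OF bmV V_bounds(1), of c] unfolding NV .
  then have "front c V" unfolding front_def using pos bot top V_fix by blast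
  then show ?thesis using V_mono by blast
qed

text \<open>The increasing function \<open>inf {\<phi> y. y \<ge> z}\<close> is a supersolution.\<close>
lemma monotone_front_exists:
  assumes \<phi>: "front c \<phi>" shows "\<exists>V. front c V \<and> mono V"
proof -
  note F = front_facts[OF \<phi>]
  define \<Theta> where "\<Theta> = (\<lambda>z. INF y\<in>{z..}. \<phi> y)"
  have bdd: "bdd_below (\<phi> ` S)" for S using F(1) by (intro bdd_belowI[of _ 0]) (auto intro: less_imp_le)
  have le: "\<Theta> z \<le> \<phi> y" if "z \<le> y" for z y unfolding \<Theta>_def by (rule cINF_lower[OF bdd]) (use that in simp)
  show ?thesis
  proof (rule front_from_supersolution)
    show m: "mono \<Theta>" unfolding \<Theta>_def by (intro monoI cINF_superset_mono bdd) auto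
    have nonneg: "0 \<le> \<Theta> z" for z unfolding \<Theta>_def using F(1) by (intro cINF_greatest) (auto intro: less_imp_le)
    have "\<bar>\<Theta> z\<bar> \<le> \<kappa>" for z using nonneg[of z] le[of z z] front_le_kappa[OF \<phi>, of z] by simp
    then show bm: "bmeas \<Theta>" by (rule bmeas_mono[OF m])
    show "0 < \<Theta> z" for z
    proof -
      obtain Y where Y: "\<And>z. Y \<le> z \<Longrightarrow> \<kappa> - \<delta> \<le> \<phi> z" using front_near_kappa[OF \<phi> delta(1)] by blast
      obtain \<mu> where \<mu>: "0 < \<mu>" "\<And>x. z \<le> x \<Longrightarrow> x \<le> Y \<Longrightarrow> \<mu> \<le> \<phi> x"
        using positive_min_on_interval[of \<phi> z Y] F(1,3) by blast
      have "min \<mu> (\<kappa> - \<delta>) \<le> \<Theta> z"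
        unfolding \<Theta>_def
      proof (rule cINF_greatest)
        fix x assume "x \<in> {z..}"
        then show "min \<mu> (\<kappa> - \<delta>) \<le> \<phi> x" using \<mu>(2)[of x] Y[of x] by (cases "x \<le> Y") auto
      qed simp
      then show ?thesis using \<mu> delta by (simp add: min_less_iff_disj)
    qed
    show "N c \<Theta> z \<le> \<Theta> z" for z
    proof -
      have "N c \<Theta> z \<le> \<phi> y" if "z \<le> y" for y
      proof -
        have "N c \<Theta> z \<le> N c (\<lambda>x. \<phi> (x + (y - z))) z"
          by (rule N_mono[OF bm bmeas_shift[OF front_bmeas[OF \<phi>]]], rule le) (use that in simp)
        also have "\<dots> = \<phi> y" using F(2)[of y] by (simp add: N_shift)
        finally show ?thesis .
      qed
      then have "N c \<Theta> z \<le> (INF y\<in>{z..}. \<phi> y)" by (intro cINF_greatest) auto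
      then show "N c \<Theta> z \<le> \<Theta> z" by (simp add: \<Theta>_def)
    qed
    show "\<exists>z. \<Theta> z < e" if "0 < e" for e
    proof -
      obtain Y where Y: "\<And>z. z \<le> Y \<Longrightarrow> \<phi> z \<le> e / 2" using front_near_0[OF \<phi>, of "e / 2"] \<open>0 < e\<close> by auto
      have "\<Theta> Y < e" using le[of Y Y] Y[of Y] that by simp
      then show ?thesis by blast
    qed
  qed
qed

end

section \<open>Derivative bounds and decay of fronts\<close>

lemma right_deriv_nonneg:
  fixes f :: "real \<Rightarrow> real"
  assumes "(f has_real_derivative D) (at t)" "\<And>s. t < s \<Longrightarrow> f t \<le> f s"
  shows "0 \<le> D"
proof (rule ccontr)
  assume "\<not> 0 \<le> D"
  then have "\<exists>d>0. \<forall>k>0. k < d \<longrightarrow> f (t + k) < f t" using DERIV_neg_dec_right[OF assms(1)] by simp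
  then obtain d where d: "d > 0" "\<And>k. 0 < k \<Longrightarrow> k < d \<Longrightarrow> f (t + k) < f t" by blast
  then have "f (t + d / 2) < f t" by (intro d(2)) auto
  moreover have "f t \<le> f (t + d / 2)" using d(1) by (intro assms(2)) auto
  ultimately show False by simp
qed

context profile
begin

lemma front_ode:
  assumes \<phi>: "front c \<phi>"
  obtains \<phi>' \<phi>'' where "\<And>z. (\<phi> has_real_derivative \<phi>' z) (at z)" "\<And>z. (\<phi>' has_real_derivative \<phi>'' z) (at z)"
    "\<And>z. c * \<phi>' z = \<phi>'' z - \<phi> z + g (\<phi> (z - c * h))"
proof -
  define f where "f = (\<lambda>x. g (\<phi> (x + - (c * h))))"
  have eq: "\<phi> = res c f"
  proof (rule ext)
    fix z
    have "\<phi> z = N c \<phi> z" by (rule front_facts(2)[OF \<phi>])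
    also have "\<dots> = res c f z" using res_shift[of c "\<lambda>x. g (\<phi> x)" "- (c * h)" z] by (simp only: f_def N_def add_uminus_conv_diff)
    finally show "\<phi> z = res c f z" .
  qed
  have cont: "continuous_on UNIV f"
    unfolding f_def by (intro continuous_on_g continuous_on_compose2[OF front_facts(3)[OF \<phi>, of UNIV]]) (auto intro!: continuous_intros)
  have bdd: "\<bar>f x\<bar> \<le> \<kappa>" for x
    using g_mono[OF front_le_kappa[OF \<phi>], of "x + - (c * h)"] g_nonneg[OF less_imp_le[OF front_facts(1)[OF \<phi>]], of "x + - (c * h)"]
    by (simp add: f_def g_kappa)
  obtain y' y'' where "\<And>z. (res c f has_real_derivative y' z) (at z)" "\<And>z. (y' has_real_derivative y'' z) (at z)"
    "\<And>z. y'' z = c * y' z + res c f z - f z" using res_ode[OF cont bdd] by blast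
  then show thesis unfolding eq[symmetric] by (intro that[of y' y'']) (auto simp: f_def)
qed

lemma ode_front:
  assumes d: "\<And>z. (\<phi> has_real_derivative \<phi>' z) (at z)" "\<And>z. (\<phi>' has_real_derivative \<phi>'' z) (at z)"
    and eq: "\<And>z. c * \<phi>' z = \<phi>'' z - \<phi> z + g (\<phi> (z - c * h))"
    and pos: "\<And>z. 0 < \<phi> z" and lims: "(\<phi> \<longlongrightarrow> 0) at_bot" "(\<phi> \<longlongrightarrow> \<kappa>) at_top"
  shows "front c \<phi>"
proof -
  have cont: "continuous_on S \<phi>" for S
    by (rule DERIV_continuous_on) (use d(1) has_field_derivative_at_within in blast)
  obtain M where M: "\<And>x. \<bar>\<phi> x\<bar> \<le> M" using bounded_of_limits[OF cont lims] by blast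
  define f where "f = (\<lambda>x. g (\<phi> (x + - (c * h))))"
  have contf: "continuous_on UNIV f"
    unfolding f_def by (intro continuous_on_g continuous_on_compose2[OF cont[of UNIV]]) (auto intro!: continuous_intros)
  have bdd: "\<bar>f x\<bar> \<le> L * M" for x
  proof -
    have "\<bar>f x - g 0\<bar> \<le> L * \<bar>\<phi> (x + - (c * h)) - 0\<bar>" unfolding f_def by (rule g_lip)
    also have "\<dots> \<le> L * M" using M L_ge_1 by (intro mult_left_mono) auto
    finally show ?thesis by (simp add: g_0)
  qed
  have "\<phi> z = N c \<phi> z" for z
  proof -
   have "\<phi> z = res c f z"
   proof (rule ode_imp_res[OF contf bdd d _ M])
    show "\<phi>'' z = c * \<phi>' z + \<phi> z - f z" for z using eq[of z] by (simp add: f_def)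
   qed
   also have "\<dots> = N c \<phi> z" using res_shift[of c "\<lambda>x. g (\<phi> x)" "- (c * h)" z] by (simp only: f_def N_def add_uminus_conv_diff)
   finally show ?thesis .
  qed
  then show ?thesis unfolding front_def using cont pos lims by blast
qed

text \<open>The increments \<open>V (z + t) - V z\<close> and the defect \<open>\<kappa> - V\<close>
  are resolvents of nonnegative functions, so they obey Harnack inequalities just as
  \<open>V\<close> does. Both sides agree at the base point, hence differentiating there gives the
  bounds on \<open>V'\<close>; positivity of \<open>V'\<close> spreads from one mean value point to
  all others.\<close>

lemma mono_front_facts:
  assumes V: "front c V" "mono V"
    and V': "\<And>z. (V has_real_derivative V' z) (at z)"
  shows "0 < V' z" "V' z \<le> disc c * V z" "V' z \<le> disc c * (\<kappa> - V z)" "V z < \<kappa>"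
proof -
  note F = front_facts[OF V(1)] and bm = front_bmeas[OF V(1)]
  have gap: "V (a + t) - V a \<le> exp (disc c * \<bar>a - z\<bar>) * (V (z + t) - V z)" if t: "0 \<le> t" for a z t
  proof -
    define k where "k = (\<lambda>x. g (V (x + t)) - g (V x))"
    have k: "V (y + t) - V y = res c k (y - c * h)" for y
    proof -
      have "res c k (y - c * h) = N c (\<lambda>x. V (x + t)) y - N c V y"
        unfolding k_def N_def by (rule res_diff[OF bmeas_g[OF bmeas_shift[OF bm]] bmeas_g[OF bm]])
      then show ?thesis by (simp only: N_shift F(2)[symmetric])
    qed
    have "bmeas k" unfolding k_def by (intro bmeas_intros(3) bmeas_g bmeas_shift[OF bm] bm)
    moreover have "0 \<le> k x" for x unfolding k_def using g_mono[OF monoD[OF V(2)], of x "x + t"] t by simp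
    ultimately show ?thesis unfolding k using res_harnack[of k c "a - c * h" "z - c * h"] by simp
  qed
  have defect: "\<kappa> - V a \<le> exp (disc c * \<bar>a - z\<bar>) * (\<kappa> - V z)" for a z
  proof -
    define k where "k = (\<lambda>x. g \<kappa> - g (V x))"
    have k: "\<kappa> - V y = res c k (y - c * h)" for y
    proof -
      have "res c k (y - c * h) = N c (\<lambda>_. \<kappa>) y - N c V y"
        unfolding k_def N_def by (rule res_diff[OF bmeas_intros(1) bmeas_g[OF bm]])
      then show ?thesis by (simp only: N_const g_kappa F(2)[symmetric])
    qed
    have "bmeas k" unfolding k_def by (intro bmeas_intros(3) bmeas_intros(1) bmeas_g bm)
    moreover have "0 \<le> k x" for x unfolding k_def using g_mono[OF front_le_kappa[OF V(1)]] by simp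
    ultimately show ?thesis unfolding k using res_harnack[of k c "a - c * h" "z - c * h"] by simp
  qed
  obtain Y where Y: "\<And>z. z \<le> Y \<Longrightarrow> V z \<le> \<kappa> / 2" using front_near_0[OF V(1), of "\<kappa> / 2"] kappa_pos by auto
  have "0 < \<kappa> - V Y" using Y[of Y] kappa_pos by simp
  also have "\<dots> \<le> exp (disc c * \<bar>Y - z\<bar>) * (\<kappa> - V z)" by (rule defect)
  finally show less: "V z < \<kappa>" by (simp add: zero_less_mult_iff)
  have E: "((\<lambda>t. exp (disc c * (t - z))) has_real_derivative disc c) (at z)" for z
    by (auto intro!: derivative_eq_intros)
  show "V' z \<le> disc c * V z"
  proof -
    have "((\<lambda>s. exp (disc c * (s - z)) * V z - V s) has_real_derivative (disc c * V z - V' z)) (at z)"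
      by (intro DERIV_diff V' DERIV_cmult_right E)
    then have "0 \<le> disc c * V z - V' z"
    proof (rule right_deriv_nonneg)
      fix s assume "z < s"
      then have "V s \<le> exp (disc c * (s - z)) * V z" using F(4)[of s z] by simp
      then show "exp (disc c * (z - z)) * V z - V z \<le> exp (disc c * (s - z)) * V z - V s" by simp
    qed
    then show ?thesis by simp
  qed
  show "V' z \<le> disc c * (\<kappa> - V z)"
  proof -
    have E2: "((\<lambda>t. exp (- disc c * (t - z))) has_real_derivative - disc c) (at z)"
      by (auto intro!: derivative_eq_intros)
    have "((\<lambda>s. (\<kappa> - V s) - exp (- disc c * (s - z)) * (\<kappa> - V z)) has_real_derivative (0 - V' z) - (- disc c * (\<kappa> - V z))) (at z)"
      by (intro DERIV_diff V' DERIV_cmult_right E2 DERIV_const)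
    then have "0 \<le> (0 - V' z) - (- disc c * (\<kappa> - V z))"
    proof (rule right_deriv_nonneg)
      fix s assume "z < s"
      then have "\<kappa> - V z \<le> exp (disc c * (s - z)) * (\<kappa> - V s)" using defect[of z s] by simp
      then have "exp (- disc c * (s - z)) * (\<kappa> - V z) \<le> exp (- disc c * (s - z)) * (exp (disc c * (s - z)) * (\<kappa> - V s))"
        by (intro mult_left_mono) auto
      also have "\<dots> = \<kappa> - V s" by (simp add: mult.assoc[symmetric] flip: exp_add)
      finally show "(\<kappa> - V z) - exp (- disc c * (z - z)) * (\<kappa> - V z) \<le> (\<kappa> - V s) - exp (- disc c * (s - z)) * (\<kappa> - V z)" by simp
    qed
    then show ?thesis by simp
  qed
  obtain Y2 where Y2: "\<And>z. Y2 \<le> z \<Longrightarrow> \<kappa> - \<kappa> / 4 \<le> V z" using front_near_kappa[OF V(1), of "\<kappa> / 4"] kappa_pos by auto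
  have "V Y < V Y2" using Y[of Y] Y2[of Y2] kappa_pos by simp
  then have "Y < Y2" using monoD[OF V(2), of Y2 Y] by (cases "Y < Y2") auto
  then obtain a where a: "V Y2 - V Y = (Y2 - Y) * V' a" using MVT2[of Y Y2 V V'] V' by blast
  have Va: "0 < V' a" using a \<open>V Y < V Y2\<close> \<open>Y < Y2\<close> by (metis diff_gt_0_iff_gt zero_less_mult_pos)
  show "0 < V' z"
  proof -
    let ?E = "exp (disc c * \<bar>a - z\<bar>)"
    have s1: "((\<lambda>t. V (a + t)) has_real_derivative V' a) (at 0)"
      using V'[of a] DERIV_shift[of V "V' a" 0 a] by (simp add: add.commute)
    have s2: "((\<lambda>t. V (z + t)) has_real_derivative V' z) (at 0)"
      using V'[of z] DERIV_shift[of V "V' z" 0 z] by (simp add: add.commute)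
    have "((\<lambda>t. ?E * (V (z + t) - V z) - (V (a + t) - V a)) has_real_derivative ?E * (V' z - 0) - (V' a - 0)) (at 0)"
      by (intro DERIV_diff DERIV_cmult s1 s2 DERIV_const)
    then have "0 \<le> ?E * (V' z - 0) - (V' a - 0)"
    proof (rule right_deriv_nonneg)
      fix s :: real assume "0 < s"
      then show "?E * (V (z + 0) - V z) - (V (a + 0) - V a) \<le> ?E * (V (z + s) - V z) - (V (a + s) - V a)"
        using gap[of s a z] by simp
    qed
    then have "0 < ?E * V' z" using Va by simp
    then show ?thesis by (simp add: zero_less_mult_iff)
  qed
qed

definition chi_negative :: "real \<Rightarrow> real \<Rightarrow> bool" where
  "chi_negative c l \<longleftrightarrow> G * exp (- l * c * h) < 1 + c * l - l\<^sup>2"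

lemma chi_negative_margin:
  assumes "chi_negative c l" shows "\<exists>e>0. \<forall>e'. 0 \<le> e' \<longrightarrow> e' \<le> e \<longrightarrow> (G + e') * exp (- l * c * h) < 1 + c * l - l\<^sup>2"
proof -
  have "\<exists>e>0. e \<le> 1 \<and> 0 < (1 + c * l - l\<^sup>2) - (G + e) * exp (- l * c * h)"
    by (intro exists_small_pos continuous_intros) (use assms in \<open>auto simp: chi_negative_def\<close>)
  then obtain e where e: "0 < e" "(G + e) * exp (- l * c * h) < 1 + c * l - l\<^sup>2" by auto
  have "(G + e') * exp (- l * c * h) \<le> (G + e) * exp (- l * c * h)" if "e' \<le> e" for e'
    using that by (intro mult_right_mono) auto
  then show ?thesis using e by (meson le_less_trans)
qed

text \<open>If \<open>\<phi>\<close> is below \<open>M exp (l2 z)\<close> along a sequence \<open>z \<rightarrow> -\<infinity>\<close>, then the strict supersolution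
  \<open>B exp (l3 z) + \<epsilon> exp (l1 z)\<close> dominates it on the intervals between that sequence and a fixed point.\<close>
lemma decay_dichotomy:
  assumes \<phi>: "front c \<phi>" and c: "0 \<le> c" and l: "0 < l1" "l1 < l2" "l2 \<le> l3"
    and chi: "chi_negative c l1" "chi_negative c l3"
    and not_slow: "\<not> (\<forall>M. \<exists>Z. \<forall>z\<le>Z. M * exp (l2 * z) \<le> \<phi> z)"
  shows "\<exists>B>0. \<forall>z. \<phi> z \<le> B * exp (l3 * z)"
proof -
  note F = front_facts[OF \<phi>]
  have ch: "0 \<le> c * h" using c h_nn by simp
  obtain M0 where M0: "\<And>Z. \<exists>z\<le>Z. \<phi> z < M0 * exp (l2 * z)" using not_slow by (meson linorder_not_le)
  define M where "M = \<bar>M0\<bar> + 1"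
  have M: "0 < M" "\<exists>z\<le>Z. \<phi> z < M * exp (l2 * z)" for Z
  proof -
    obtain z where z: "z \<le> Z" "\<phi> z < M0 * exp (l2 * z)" using M0 by blast
    have "M0 * exp (l2 * z) \<le> M * exp (l2 * z)" unfolding M_def by (intro mult_right_mono) auto
    then show "\<exists>z\<le>Z. \<phi> z < M * exp (l2 * z)" using z by (meson less_le_trans)
  qed (simp add: M_def)
  obtain e1 where e1: "0 < e1" "\<And>e'. 0 \<le> e' \<Longrightarrow> e' \<le> e1 \<Longrightarrow> (G + e') * exp (- l1 * c * h) < 1 + c * l1 - l1\<^sup>2"
    using chi_negative_margin[OF chi(1)] by blast
  obtain e3 where e3: "0 < e3" "\<And>e'. 0 \<le> e' \<Longrightarrow> e' \<le> e3 \<Longrightarrow> (G + e') * exp (- l3 * c * h) < 1 + c * l3 - l3\<^sup>2"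
    using chi_negative_margin[OF chi(2)] by blast
  define e where "e = min e1 e3"
  have e: "0 < e" "(G + e) * exp (- l1 * c * h) < 1 + c * l1 - l1\<^sup>2" "(G + e) * exp (- l3 * c * h) < 1 + c * l3 - l3\<^sup>2"
    using e1(1) e3(1) e1(2)[of e] e3(2)[of e] by (auto simp: e_def)
  obtain d where d: "0 < d" "\<And>a b. - d \<le> a \<Longrightarrow> a \<le> b \<Longrightarrow> b \<le> d \<Longrightarrow> g b - g a \<le> (G + e) * (b - a)"
    using g_near_0[OF e(1)] by blast
  obtain Zd where Zd: "\<And>z. z \<le> Zd \<Longrightarrow> \<phi> z \<le> d" using front_near_0[OF \<phi> d(1)] by blast
  obtain \<phi>' \<phi>'' where D: "\<And>z. (\<phi> has_real_derivative \<phi>' z) (at z)" "\<And>z. (\<phi>' has_real_derivative \<phi>'' z) (at z)"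
    "\<And>z. c * \<phi>' z = \<phi>'' z - \<phi> z + g (\<phi> (z - c * h))" using front_ode[OF \<phi>] by blast
  \<comment> \<open>The barrier thus exceeds \<kappa> at \<open>Zd\<close>, which excludes contact
    at the right end and makes the final bound trivial beyond it.\<close>
  define B where "B = (\<kappa> + 1) * exp (- l3 * Zd)"
  have B: "0 < B" using kappa_pos by (simp add: B_def)
  have BZ: "B * exp (l3 * Zd) = \<kappa> + 1" by (simp add: B_def mult.assoc flip: exp_add)
  have main: "\<phi> z \<le> B * exp (l3 * z) + \<epsilon> * exp (l1 * z)" if z: "z \<le> Zd" and \<epsilon>: "0 < \<epsilon>" for z \<epsilon>
  proof (rule ccontr)
    assume contr: "\<not> ?thesis"
    define S where "S = (\<lambda>z. B * exp (l3 * z) + \<epsilon> * exp (l1 * z))"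
    define S1 where "S1 = (\<lambda>z. B * (l3 * exp (l3 * z)) + \<epsilon> * (l1 * exp (l1 * z)))"
    define S2 where "S2 = (\<lambda>z. B * (l3 * l3 * exp (l3 * z)) + \<epsilon> * (l1 * l1 * exp (l1 * z)))"
    have Sp: "0 < S z" for z using B \<epsilon> by (simp add: S_def add_pos_pos)
    have dS: "(S has_real_derivative S1 z) (at z)" "(S1 has_real_derivative S2 z) (at z)" for z
      unfolding S_def S1_def S2_def by (auto intro!: derivative_eq_intros)
    \<comment> \<open>The delayed argument may fall to the left of \<open>zn\<close>. Harnack
      carries the bound at \<open>zn\<close> over the interval of length \<open>c * h\<close>;
      \<open>K\<close> collects its factor, \<open>M\<close>, and the change of
      \<open>exp (l1 * z)\<close> over that interval. As \<open>l1 < l2\<close>, the barrier wins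
      for \<open>zn\<close> far enough left.\<close>
    define K where "K = exp (disc c * (c * h)) * M * exp (l1 * (c * h))"
    have K: "0 < K" using M by (simp add: K_def)
    obtain zn where zn: "zn \<le> min z (ln (\<epsilon> / K) / (l2 - l1)) - 1" "\<phi> zn < M * exp (l2 * zn)" using M(2) by blast
    have left: "\<phi> y < S y" if y: "zn - c * h \<le> y" "y \<le> zn" for y
    proof -
      have "\<phi> y \<le> exp (disc c * \<bar>y - zn\<bar>) * \<phi> zn" by (rule F)
      also have "\<dots> \<le> exp (disc c * (c * h)) * (M * exp (l2 * zn))"
        using y zn disc_pos[of c] F(1)[of zn] by (intro mult_mono) auto
      also have "\<dots> = K * exp ((l2 - l1) * zn) * exp (l1 * (zn - c * h))"
        by (simp add: K_def algebra_simps flip: exp_add)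
      also have "\<dots> \<le> \<epsilon> * exp (l1 * (zn - c * h))"
      proof (rule mult_right_mono)
        have "zn \<le> ln (\<epsilon> / K) / (l2 - l1)" using zn by simp
        then have "(l2 - l1) * zn \<le> ln (\<epsilon> / K)" using l by (simp add: field_simps)
        then have "exp ((l2 - l1) * zn) \<le> exp (ln (\<epsilon> / K))" by (simp only: exp_le_cancel_iff)
        then show "K * exp ((l2 - l1) * zn) \<le> \<epsilon>" using K \<epsilon> by (simp add: field_simps)
      qed simp
      also have "\<dots> \<le> \<epsilon> * exp (l1 * y)" using \<epsilon> l y by (intro mult_left_mono) auto
      also have "\<dots> < S y" using B by (simp add: S_def)
      finally show ?thesis .
    qed
    have cq: "continuous_on {zn..Zd} (\<lambda>y. \<phi> y / S y)"
      using F(3) Sp less_irrefl unfolding S_def by (intro continuous_intros) (auto simp: less_imp_neq[symmetric])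
    obtain z0 where z0: "z0 \<in> {zn..Zd}" "\<And>y. y \<in> {zn..Zd} \<Longrightarrow> \<phi> y / S y \<le> \<phi> z0 / S z0"
    proof -
      have "{zn..Zd} \<noteq> {}" using zn z by simp
      from continuous_attains_sup[OF compact_Icc this cq] show thesis using that by blast
    qed
    \<comment> \<open>Scaling \<open>S\<close> by the maximal ratio makes it touch \<phi> from above
      at an interior point. Since \<open>S\<close> is a strict supersolution of the equation
      linearised with slope \<open>G + e\<close>, the second derivative test is contradicted
      there.\<close>
    define m where "m = \<phi> z0 / S z0"
    have "1 < \<phi> z / S z" using contr Sp[of z] by (simp add: S_def)
    moreover have "zn \<le> z" using zn(1) min.cobounded1[of z "ln (\<epsilon> / K) / (l2 - l1)"] by linarith
    ultimately have m: "1 < m" using z0(2)[of z] z by (simp add: m_def)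
    have \<phi>z0: "\<phi> z0 = m * S z0" using Sp[of z0] by (simp add: m_def)
    have le: "\<phi> y \<le> m * S y" if "zn - c * h \<le> y" "y \<le> Zd" for y
    proof (cases "zn \<le> y")
      case True
      then show ?thesis using z0(2)[of y] that Sp[of y] by (simp add: m_def[symmetric] pos_divide_le_eq)
    next
      case False
      then have "\<phi> y < S y" using that by (intro left) auto
      also have "S y < m * S y" using m Sp[of y] by simp
      finally show ?thesis by simp
    qed
    have "z0 \<noteq> zn" using left[of zn] \<phi>z0 m Sp[of zn] ch mult_strict_right_mono[OF m Sp[of zn]] by auto
    moreover have "z0 \<noteq> Zd"
    proof
      assume "z0 = Zd"
      then have "\<phi> Zd = m * S Zd" using \<phi>z0 by simp
      moreover have "1 * S Zd < m * S Zd" using m Sp[of Zd] by (intro mult_strict_right_mono) auto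
      moreover have "\<kappa> + 1 < S Zd" using \<epsilon> by (simp add: S_def BZ)
      ultimately show False using front_le_kappa[OF \<phi>, of Zd] by simp
    qed
    ultimately have z0_in: "zn < z0" "z0 < Zd" using z0(1) by auto
    have "0 < min (z0 - zn) (Zd - z0)" using z0_in by simp
    have "\<phi>' z0 = m * S1 z0" "\<phi>'' z0 \<le> m * S2 z0"
    proof -
      have 1: "((\<lambda>y. \<phi> y - m * S y) has_real_derivative \<phi>' y - m * S1 y) (at y)" for y
        by (intro DERIV_diff DERIV_cmult D dS)
      have 2: "((\<lambda>y. \<phi>' y - m * S1 y) has_real_derivative \<phi>'' z0 - m * S2 z0) (at z0)"
        by (intro DERIV_diff DERIV_cmult D dS)
      have 3: "\<phi> y - m * S y \<le> \<phi> z0 - m * S z0" if "\<bar>y - z0\<bar> < min (z0 - zn) (Zd - z0)" for y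
        using le[of y] that ch \<phi>z0 by auto
      note T = second_deriv_at_max[where f="\<lambda>y. \<phi> y - m * S y" and f'="\<lambda>y. \<phi>' y - m * S1 y" and a=z0 and D="\<phi>'' z0 - m * S2 z0",
          OF \<open>0 < min (z0 - zn) (Zd - z0)\<close> 1 2 3]
      show "\<phi>' z0 = m * S1 z0" "\<phi>'' z0 \<le> m * S2 z0" using T by auto
    qed
    moreover have "g (\<phi> (z0 - c * h)) \<le> (G + e) * (m * S (z0 - c * h))"
    proof -
      have "g (\<phi> (z0 - c * h)) - g 0 \<le> (G + e) * (\<phi> (z0 - c * h) - 0)"
        using F(1)[of "z0 - c * h"] Zd[of "z0 - c * h"] z0_in ch d(1) by (intro d(2)) auto
      also have "\<dots> \<le> (G + e) * (m * S (z0 - c * h))"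
        using le[of "z0 - c * h"] z0_in ch G_gt_1 e by (intro mult_left_mono) auto
      finally show ?thesis by (simp add: g_0)
    qed
    ultimately have "0 \<le> m * S2 z0 - c * (m * S1 z0) - m * S z0 + (G + e) * (m * S (z0 - c * h))"
      using D(3)[of z0] \<phi>z0 by simp
    also have "\<dots> = m * (B * exp (l3 * z0) * ((G + e) * exp (- l3 * c * h) - (1 + c * l3 - l3\<^sup>2))
        + \<epsilon> * exp (l1 * z0) * ((G + e) * exp (- l1 * c * h) - (1 + c * l1 - l1\<^sup>2)))"
      unfolding S_def S1_def S2_def right_diff_distrib[of _ z0 "c * h"] exp_diff
      by (simp add: exp_minus power2_eq_square field_simps)
    also have "\<dots> < 0"
    proof -
      have "B * exp (l3 * z0) * ((G + e) * exp (- l3 * c * h) - (1 + c * l3 - l3\<^sup>2)) < 0"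
        using B e by (intro mult_pos_neg) auto
      moreover have "\<epsilon> * exp (l1 * z0) * ((G + e) * exp (- l1 * c * h) - (1 + c * l1 - l1\<^sup>2)) < 0"
        using \<epsilon> e by (intro mult_pos_neg) auto
      ultimately show ?thesis using m by (intro mult_pos_neg) auto
    qed
    finally show False by simp
  qed
  \<comment> \<open>\<open>B\<close> does not depend on \<epsilon>, so the slowly decaying summand
    can be sent to zero.\<close>
  have near: "\<phi> z \<le> B * exp (l3 * z)" if "z \<le> Zd" for z
  proof (rule field_le_epsilon)
    fix e' :: real assume "0 < e'"
    then show "\<phi> z \<le> B * exp (l3 * z) + e'"
      using main[OF that, of "e' * exp (- l1 * z)"] by (simp add: mult.assoc flip: exp_add)
  qed
  have "\<phi> z \<le> B * exp (l3 * z)" for z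
  proof (cases "z \<le> Zd")
    case False
    have "\<kappa> + 1 \<le> B * exp (l3 * z)"
      unfolding BZ[symmetric] using False l B by (intro mult_left_mono) auto
    then show ?thesis using front_le_kappa[OF \<phi>, of z] by simp
  qed (rule near)
  then show ?thesis using B by blast
qed

end

section \<open>A slowly decaying monotone front is not the slowest\<close>

text \<open>Both roots increase with the speed. For speeds in \<open>{0..c}\<close> the kernel is
  therefore dominated by the exponential with \<open>root1 c\<close> on the right and the one with
  \<open>root2 0\<close> on the left, an integrable majorant common to all of them.\<close>

lemma green_perturb:
  assumes c: "cj \<longlonglongrightarrow> c" "\<And>j. 0 \<le> cj j" "\<And>j. cj j \<le> c"
  shows "(\<lambda>j. green (cj j) y) \<longlonglongrightarrow> green c y"
    and "green (cj j) y \<le> disc c * green c y + disc 0 * green 0 y"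
proof -
  have d0: "disc x \<noteq> 0" for x using disc_pos[of x] by simp
  have "(\<lambda>j. disc (cj j)) \<longlonglongrightarrow> disc c" unfolding disc_def by (intro tendsto_intros c)
  then show "(\<lambda>j. green (cj j) y) \<longlonglongrightarrow> green c y"
    unfolding green_def root1_def root2_def by (intro tendsto_intros c) (auto simp: d0)
  have disc1: "1 \<le> disc x" for x unfolding disc_def by (rule real_le_rsqrt) simp
  have inv: "exp a / disc (cj j) \<le> exp a" for a using disc1[of "cj j"] by (simp add: pos_divide_le_eq disc_pos)
  show "green (cj j) y \<le> disc c * green c y + disc 0 * green 0 y"
  proof (cases "0 \<le> y")
    case True
    have mono: "root1 (cj j) \<le> root1 c"
    proof -
      have r: "root1 x = - 1 / root2 x" for x using roots(2,4)[of x] by (simp add: field_simps)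
      have "disc (cj j) \<le> disc c" unfolding disc_def using c(2,3)[of j] by (simp add: power_mono)
      then have "root2 (cj j) \<le> root2 c" using c(3)[of j] by (simp add: root2_def)
      then show ?thesis unfolding r using roots(2)[of "cj j"] by (simp add: frac_le)
    qed
    have "green (cj j) y \<le> exp (root1 (cj j) * y)" using True inv by (simp add: green_cases)
    also have "\<dots> \<le> exp (root1 c * y)" using mult_right_mono[OF mono True] by simp
    also have "\<dots> = disc c * green c y" using True by (simp add: green_cases d0)
    finally show ?thesis using green_pos[of 0 y] disc_pos[of 0] by (smt (verit) mult_pos_pos)
  next
    case False
    have mono: "root2 0 \<le> root2 (cj j)"
    proof -
      have "disc 0 \<le> disc (cj j)" unfolding disc_def by (rule real_sqrt_le_mono) simp
      then show ?thesis using c(2)[of j] by (simp add: root2_def)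
    qed
    have "green (cj j) y \<le> exp (root2 (cj j) * y)" using False inv by (simp add: green_cases)
    also have "\<dots> \<le> exp (root2 0 * y)" using mult_right_mono_neg[OF mono, of y] False by simp
    also have "\<dots> = disc 0 * green 0 y" using False by (simp add: green_cases d0)
    finally show ?thesis using green_pos[of c y] disc_pos[of c] by (smt (verit) mult_pos_pos)
  qed
qed

context profile
begin

text \<open>Dominated convergence treats the varying kernel at the fixed argument
  \<open>z - c * h\<close>; the varying delay shift is then added by the uniform continuity estimate
  \<open>res_lipschitz\<close>.\<close>

lemma N_perturb:
  assumes c: "cj \<longlonglongrightarrow> c" "\<And>j. 0 \<le> cj j" "\<And>j. cj j \<le> c"
    and \<psi>: "\<And>j. \<psi> j \<in> borel_measurable borel" "\<And>j x. 0 \<le> \<psi> j x" "\<And>j x. \<psi> j x \<le> B" "\<And>x. (\<lambda>j. \<psi> j x) \<longlonglongrightarrow> \<omega> x"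
  shows "(\<lambda>j. N (cj j) (\<psi> j) z) \<longlonglongrightarrow> N c \<omega> z"
proof -
  have [measurable]: "\<And>j. \<psi> j \<in> borel_measurable borel" by (rule \<psi>)
  have [measurable]: "\<omega> \<in> borel_measurable borel"
    using borel_measurable_LIMSEQ_real[of borel \<psi> \<omega>] \<psi>(1,4) by blast
  have gB: "0 \<le> g (\<psi> j x)" "g (\<psi> j x) \<le> g B" for j x using g_mono[OF \<psi>(3)] g_nonneg[OF \<psi>(2)] by auto
  then have gB0: "0 \<le> g B" by (meson order_trans)
  have "0 \<le> B" using \<psi>(2,3) order_trans by blast
  then have bm: "bmeas (\<psi> j)" for j unfolding bmeas_def using \<psi>(1,2,3) by (auto simp: abs_le_iff intro!: exI[of _ B])
  define D where "D = (\<lambda>y. disc c * green c y + disc 0 * green 0 y)"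
  have lim: "(\<lambda>j. res (cj j) (\<lambda>x. g (\<psi> j x)) (z - c * h)) \<longlonglongrightarrow> N c \<omega> z"
    unfolding res_def N_def
  proof (rule integral_dominated_convergence[where w="\<lambda>y. g B * D y"])
    show "(\<lambda>y. green c y * g (\<omega> (z - c * h - y))) \<in> borel_measurable lborel" by measurable
    show "(\<lambda>y. green (cj j) y * g (\<psi> j (z - c * h - y))) \<in> borel_measurable lborel" for j by measurable
    have "(\<lambda>j. green (cj j) y * g (\<psi> j x)) \<longlonglongrightarrow> green c y * g (\<omega> x)" for y x
      by (intro tendsto_mult green_perturb(1)[OF c] isCont_tendsto_compose[OF isCont_g] \<psi>(4))
    then show "AE y in lborel. (\<lambda>j. green (cj j) y * g (\<psi> j (z - c * h - y))) \<longlonglongrightarrow> green c y * g (\<omega> (z - c * h - y))"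
      by (intro AE_I2)
    have "norm (green (cj j) y * g (\<psi> j x)) \<le> g B * D y" for j y x
    proof -
      have "green (cj j) y * g (\<psi> j x) \<le> D y * g B"
        using green_perturb(2)[OF c, of j y] gB[of j x] green_pos[of "cj j" y] unfolding D_def by (intro mult_mono) auto
      then show ?thesis using gB(1)[of j x] green_pos[of "cj j" y] by (simp add: mult.commute abs_mult)
    qed
    then show "AE y in lborel. norm (green (cj j) y * g (\<psi> j (z - c * h - y))) \<le> g B * D y" for j by (intro AE_I2)
    show "integrable lborel (\<lambda>y. g B * D y)" unfolding D_def using green_integrable(1) by auto
  qed
  have err: "\<bar>N (cj j) (\<psi> j) z - res (cj j) (\<lambda>x. g (\<psi> j x)) (z - c * h)\<bar> \<le> (exp (disc (cj j) * \<bar>(z - cj j * h) - (z - c * h)\<bar>) - 1) * g B" for j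
  proof -
    let ?E = "exp (disc (cj j) * \<bar>(z - cj j * h) - (z - c * h)\<bar>) - 1"
    have "\<bar>N (cj j) (\<psi> j) z - res (cj j) (\<lambda>x. g (\<psi> j x)) (z - c * h)\<bar> \<le> ?E * N (cj j) (\<psi> j) z"
      unfolding N_def by (rule res_lipschitz[OF bmeas_g[OF bm] gB(1)])
    also have "\<dots> \<le> ?E * g B" using N_le[OF bm \<psi>(3)] disc_pos[of "cj j"] by (intro mult_left_mono) auto
    finally show ?thesis .
  qed
  have "(\<lambda>j. disc (cj j)) \<longlonglongrightarrow> disc c" unfolding disc_def by (intro tendsto_intros c)
  then have "(\<lambda>j. (exp (disc (cj j) * \<bar>(z - cj j * h) - (z - c * h)\<bar>) - 1) * g B)
      \<longlonglongrightarrow> (exp (disc c * \<bar>(z - c * h) - (z - c * h)\<bar>) - 1) * g B"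
    by (intro tendsto_intros c)
  then have "(\<lambda>j. (exp (disc (cj j) * \<bar>(z - cj j * h) - (z - c * h)\<bar>) - 1) * g B) \<longlonglongrightarrow> 0" by simp
  then have "(\<lambda>j. N (cj j) (\<psi> j) z - res (cj j) (\<lambda>x. g (\<psi> j x)) (z - c * h)) \<longlonglongrightarrow> 0"
    by (rule Lim_null_comparison[rotated]) (use err in auto)
  from tendsto_add[OF this lim] show ?thesis by simp
qed

lemma g_above_kappa: "0 \<le> q \<Longrightarrow> g (\<kappa> + q) \<le> \<kappa> + \<rho> * q"
  using g_near_kappa[of \<kappa> "\<kappa> + q"] delta by (simp add: g_kappa)

text \<open>The linear bound on \<open>g\<close> holds for small values only, but to the right of
  \<open>y0\<close> the exponential exceeds \<open>\<kappa> + 1\<close> and dominates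
  \<open>g (F y)\<close> anyway. The resulting factor is at most 1 precisely when the characteristic
  inequality with slope \<open>G + e\<close> holds.\<close>

lemma N_exp_step:
  assumes F: "mono F" "bmeas F" "\<And>x. 0 \<le> F x" "\<And>x. F x \<le> \<kappa> + 1" "\<And>x. F x \<le> B * exp (l * x)" "F y0 \<le> d"
    and d: "\<And>a b. - d \<le> a \<Longrightarrow> a \<le> b \<Longrightarrow> b \<le> d \<Longrightarrow> g b - g a \<le> (G + e) * (b - a)" "0 < d"
    and B: "B * exp (l * y0) = \<kappa> + 1" "0 < B" and l: "0 < l" and e: "0 < e" and den: "0 < 1 + c * l - l\<^sup>2"
  shows "N c F z \<le> (G + e) * exp (- l * c * h) / (1 + c * l - l\<^sup>2) * (B * exp (l * z))"
proof -
  have "g (F y) \<le> ((G + e) * B) * exp (l * y)" for y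
  proof (cases "y \<le> y0")
    case True
    have "F y \<le> d" using monoD[OF F(1) True] F(6) by simp
    then have "g (F y) \<le> (G + e) * F y" using d(1)[of 0 "F y"] d(2) F(3)[of y] by (simp add: g_0)
    also have "\<dots> \<le> (G + e) * (B * exp (l * y))" using F(5)[of y] G_gt_1 e by (intro mult_left_mono) auto
    finally show ?thesis by simp
  next
    case False
    have "g (F y) \<le> g (\<kappa> + 1)" by (rule g_mono[OF F(4)])
    also have "\<dots> \<le> \<kappa> + 1" using g_above_kappa[of 1] rho by simp
    also have "\<dots> \<le> B * exp (l * y)" unfolding B(1)[symmetric] using False l B by (intro mult_left_mono) auto
    also have "\<dots> \<le> (G + e) * (B * exp (l * y))" using mult_right_mono[of 1 "G + e" "B * exp (l * y)"] G_gt_1 e B(2) by simp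
    finally show ?thesis by simp
  qed
  then have "N c F z \<le> ((G + e) * B) * exp (l * (z - c * h)) / (1 + c * l - l\<^sup>2)"
    unfolding N_def by (intro res_le_exp bmeas_g F den)
  also have "exp (l * (z - c * h)) = exp (- l * c * h) * exp (l * z)" by (simp add: algebra_simps flip: exp_add)
  also have "((G + e) * B) * (exp (- l * c * h) * exp (l * z)) / (1 + c * l - l\<^sup>2)
      = (G + e) * exp (- l * c * h) / (1 + c * l - l\<^sup>2) * (B * exp (l * z))" by (simp only: times_divide_eq_left times_divide_eq_right mult.assoc mult.left_commute)
  finally show ?thesis .
qed

text \<open>To the right of \<open>Zd\<close> the slope \<rho> contracts the added constant. The
  uncontrolled part on the left is seen from \<open>z\<close> only through an exponential moment of
  the kernel, which for large \<open>z\<close> costs at most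
  \<open>(1 - \<rho>) / 2\<close>.\<close>

lemma N_add_const_near_kappa:
  assumes V: "front c V"
  obtains \<rho>2 Z1 where "0 < \<rho>2" "\<rho>2 < 1" "\<And>q z. 0 \<le> q \<Longrightarrow> Z1 \<le> z \<Longrightarrow> N c (\<lambda>x. V x + q) z \<le> V z + \<rho>2 * q"
proof -
  note bm = front_bmeas[OF V]
  obtain Zd where Zd: "\<And>z. Zd \<le> z \<Longrightarrow> \<kappa> - \<delta> \<le> V z" using front_near_kappa[OF V delta(1)] by blast
  have "\<exists>a>0. a \<le> 1 \<and> 0 < 1 + c * (- a) - (- a)\<^sup>2"
    by (intro exists_small_pos continuous_intros) auto
  then obtain a where a: "0 < a" "0 < 1 + c * (- a) - (- a)\<^sup>2" by blast
  define K where "K = L * exp (a * Zd) / (1 + c * (- a) - (- a)\<^sup>2)"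
  have K: "0 < K" unfolding K_def using a L_ge_1 by (intro divide_pos_pos) auto
  define Z1 where "Z1 = c * h + ln (2 * K / (1 - \<rho>)) / a"
  have small: "K * exp (- a * (z - c * h)) \<le> (1 - \<rho>) / 2" if "Z1 \<le> z" for z
  proof -
    have "ln (2 * K / (1 - \<rho>)) / a \<le> z - c * h" using that by (simp add: Z1_def)
    then have "ln (2 * K / (1 - \<rho>)) \<le> a * (z - c * h)" using a by (simp add: pos_divide_le_eq mult.commute)
    then have "exp (ln (2 * K / (1 - \<rho>))) \<le> exp (a * (z - c * h))" by (simp only: exp_le_cancel_iff)
    then have "2 * K / (1 - \<rho>) \<le> exp (a * (z - c * h))" using K rho by simp
    then have "2 * K \<le> exp (a * (z - c * h)) * (1 - \<rho>)" using rho by (simp add: pos_divide_le_eq)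
    then have "K / exp (a * (z - c * h)) \<le> (1 - \<rho>) / 2" unfolding pos_divide_le_eq[OF exp_gt_zero] by (simp add: mult.commute)
    moreover have "exp (- a * (z - c * h)) = 1 / exp (a * (z - c * h))" unfolding mult_minus_left exp_minus by (simp add: inverse_eq_divide)
    ultimately show ?thesis by simp
  qed
  have "N c (\<lambda>x. V x + q) z \<le> V z + (1 + \<rho>) / 2 * q" if q: "0 \<le> q" and z: "Z1 \<le> z" for q z
  proof -
    have bmq: "bmeas (\<lambda>x. V x + q)" by (intro bmeas_intros(2) bm bmeas_intros(1))
    have "N c (\<lambda>x. V x + q) z - N c V z = res c (\<lambda>x. g (V x + q) - g (V x)) (z - c * h)"
      unfolding N_def by (rule res_diff[symmetric]) (intro bmeas_g bm bmq)+
    also have "\<dots> \<le> (\<rho> * q) * exp (0 * (z - c * h)) / (1 + c * 0 - 0\<^sup>2) + (L * q * exp (a * Zd)) * exp ((- a) * (z - c * h)) / (1 + c * (- a) - (- a)\<^sup>2)"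
    proof (rule res_le_exp2)
      show "bmeas (\<lambda>x. g (V x + q) - g (V x))" by (intro bmeas_intros(3) bmeas_g bm bmq)
      fix x
      have pos: "0 \<le> (L * q * exp (a * Zd)) * exp (- a * x)" using L_ge_1 q by simp
      show "g (V x + q) - g (V x) \<le> (\<rho> * q) * exp (0 * x) + (L * q * exp (a * Zd)) * exp (- a * x)"
      proof (cases "Zd \<le> x")
        case True
        then show ?thesis using g_near_kappa[OF Zd, of x "V x + q"] q pos by simp
      next
        case False
        have "g (V x + q) - g (V x) \<le> L * q * 1" using g_diff_le[of "V x + q" "V x"] q by simp
        also have "\<dots> \<le> L * q * exp (a * (Zd - x))" using False a L_ge_1 q by (intro mult_left_mono) auto
        also have "\<dots> = (L * q * exp (a * Zd)) * exp (- a * x)" by (simp add: algebra_simps flip: exp_add)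
        also have "\<dots> \<le> (\<rho> * q) * exp (0 * x) + (L * q * exp (a * Zd)) * exp (- a * x)" using rho q by simp
        finally show ?thesis .
      qed
    qed (use a in auto)
    also have "\<dots> = \<rho> * q + q * (K * exp (- a * (z - c * h)))" by (simp add: K_def)
    also have "\<dots> \<le> \<rho> * q + q * ((1 - \<rho>) / 2)" using small[OF z] q by (intro add_left_mono mult_left_mono) auto
    finally have "N c (\<lambda>x. V x + q) z \<le> N c V z + (1 + \<rho>) / 2 * q" by (simp add: field_simps)
    then show ?thesis using front_facts(2)[OF V, of z] by simp
  qed
  then show thesis using rho by (intro that[of "(1 + \<rho>) / 2" Z1]) auto
qed

text \<open>The iterates remain trapped under translates of \<open>V\<close> with shrinking additive
  errors and under a fast exponential. Their upper limit is thus a rapidly decaying subsolution,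
  which \<open>fast_subsolution_zero\<close> annihilates because \<open>V\<close> decays slowly.
  Hence some iterate fits below the starting function with room to spare, and this survives a
  slightly smaller speed.\<close>

lemma slower_front_exists:
  assumes V: "front c V" "mono V" and c: "0 < c" and l: "0 < l" "chi_negative c l"
    and slow: "\<And>M. \<exists>Z. \<forall>z\<le>Z. M * exp (l * z) \<le> V z"
  shows "\<exists>c'<c. \<exists>\<psi>. front c' \<psi>"
proof -
  note bm = front_bmeas[OF V(1)] and Vk = front_le_kappa[OF V(1)] and Vp = front_facts(1)[OF V(1)]
  obtain e where e: "0 < e" "(G + e) * exp (- l * c * h) < 1 + c * l - l\<^sup>2"
    using chi_negative_margin[OF l(2)] by (meson less_imp_le order_refl)
  obtain d where d: "0 < d" "\<And>a b. - d \<le> a \<Longrightarrow> a \<le> b \<Longrightarrow> b \<le> d \<Longrightarrow> g b - g a \<le> (G + e) * (b - a)"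
    using g_near_0[OF e(1)] by blast
  obtain Y0 where Y0: "\<And>z. z \<le> Y0 \<Longrightarrow> V z \<le> d / 3" using front_near_0[OF V(1), of "d / 3"] d by auto
  \<comment> \<open>The translations used for the iterates never exceed 1 in total, so at
    \<open>y0\<close> the shifted front is still at most \<open>d / 3\<close>.\<close>
  define y0 where "y0 = Y0 - 1"
  define B where "B = (\<kappa> + 1) * exp (- l * y0)"
  have B: "0 < B" "B * exp (l * y0) = \<kappa> + 1" using kappa_pos by (simp_all add: B_def mult.assoc flip: exp_add)
  obtain Z0 where Z0: "\<And>z. z \<le> Z0 \<Longrightarrow> B * exp (l * z) \<le> V z" using slow[of B] by blast
  obtain \<rho>2 Z1 where \<rho>2: "0 < \<rho>2" "\<rho>2 < 1" and Z1: "\<And>q z. 0 \<le> q \<Longrightarrow> Z1 \<le> z \<Longrightarrow> N c (\<lambda>x. V x + q) z \<le> V z + \<rho>2 * q"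
    using N_add_const_near_kappa[OF V(1)] by blast
  obtain V' V'' where D: "\<And>z. (V has_real_derivative V' z) (at z)" "\<And>z. (V' has_real_derivative V'' z) (at z)"
    "\<And>z. c * V' z = V'' z - V z + g (V (z - c * h))" using that by (rule front_ode[OF V(1)])
  have "continuous_on UNIV V'"
    by (rule DERIV_continuous_on) (use D(2) has_field_derivative_at_within in blast)
  then obtain m where m: "0 < m" "\<And>x. Z0 \<le> x \<Longrightarrow> x \<le> Z1 + 1 \<Longrightarrow> m \<le> V' x"
    using positive_min_on_interval[of V' Z0 "Z1 + 1"] mono_front_facts(1)[OF V D(1)] by blast
  have grow: "V w + m * t \<le> V (w + t)" if "Z0 \<le> w" "w \<le> Z1" "0 \<le> t" "t \<le> 1" for w t
  proof (cases "t = 0")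
    case False
    then have "w < w + t" using that by simp
    then obtain x where x: "w < x" "x < w + t" "V (w + t) - V w = (w + t - w) * V' x" using MVT2[of w "w + t" V V'] D(1) by blast
    then have le: "t * m \<le> t * V' x" using that by (intro mult_left_mono m) auto
    have "V (w + t) - V w = t * V' x" using x(3) by simp
    with le show ?thesis unfolding mult.commute[of m t] by linarith
  qed simp
  \<comment> \<open>The last bound balances the middle range: when the error shrinks from
    \<open>r * q\<close> to \<open>\<rho>2 * r * q\<close>, the extra translation
    \<open>(1 - \<rho>2) * r\<close> raises \<open>V\<close> by at least
    \<open>m * (1 - \<rho>2) * r\<close>, which covers the Lipschitz error
    \<open>L * r * q\<close>.\<close>
  define q where "q = min 1 (min (d / 3) ((1 - \<rho>2) * m / L))"
  have q: "0 < q" "q \<le> 1" "q \<le> d / 3" "L * q \<le> m * (1 - \<rho>2)"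
  proof -
    show "0 < q" using d m \<rho>2 L_ge_1 by (simp add: q_def)
    have "q \<le> (1 - \<rho>2) * m / L" by (simp add: q_def)
    then show "L * q \<le> m * (1 - \<rho>2)" using L_ge_1 by (simp add: field_simps)
    show "q \<le> 1" "q \<le> d / 3" unfolding q_def by linarith+
  qed
  define \<Theta> where "\<Theta> = (\<lambda>z. min (V z + q) (B * exp (l * z)))"
  have \<Theta>: "mono \<Theta>" "0 < \<Theta> z" "\<Theta> z \<le> \<kappa> + q" "\<Theta> z \<le> B * exp (l * z)" "\<Theta> z \<le> V z + q" for z
  proof -
    show "mono \<Theta>"
    proof (rule monoI)
      fix x y :: real assume xy: "x \<le> y"
      have "B * exp (l * x) \<le> B * exp (l * y)" using xy l B by (intro mult_left_mono) auto
      then show "\<Theta> x \<le> \<Theta> y" using monoD[OF V(2) xy] by (auto simp: \<Theta>_def min_def)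
    qed
    show "0 < \<Theta> z" using Vp[of z] q B by (simp add: \<Theta>_def)
    show "\<Theta> z \<le> \<kappa> + q" using Vk[of z] by (simp add: \<Theta>_def min_le_iff_disj)
  qed (auto simp: \<Theta>_def)
  define F where "F = (\<lambda>a n. (N a ^^ n) \<Theta>)"
  have F_0: "F a 0 = \<Theta>" and F_Suc: "F a (Suc n) = N a (F a n)" for a n by (simp_all add: F_def)
  have F: "mono (F a n) \<and> bmeas (F a n) \<and> (\<forall>x. 0 < F a n x) \<and> (\<forall>x. F a n x \<le> \<kappa> + q) \<and> (0 < n \<longrightarrow> (\<forall>x. F a n x \<le> \<kappa> + \<rho> * q))" for a n
  proof (induction n)
    case 0
    have "\<bar>\<Theta> x\<bar> \<le> \<kappa> + q" for x using \<Theta>(2,3)[of x] by simp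
    then have "bmeas \<Theta>" by (rule bmeas_mono[OF \<Theta>(1)])
    then show ?case unfolding F_0 using \<Theta>(1-3) by simp
  next
    case (Suc n)
    then have I: "mono (F a n)" "bmeas (F a n)" "\<And>x. 0 < F a n x" "\<And>x. F a n x \<le> \<kappa> + q" by auto
    have "N a (F a n) x \<le> \<kappa> + \<rho> * q" for x
      using N_le[OF I(2,4), of a x] g_above_kappa[of q] q by simp
    moreover have "\<rho> * q \<le> q" using rho q by (simp add: mult_le_cancel_right1)
    moreover have "0 < N a (F a n) x" for x
      unfolding N_def
    proof (rule res_pos[where p=0 and q=1])
      have "0 < \<kappa> / 2 \<and> True" using kappa_pos by simp
      show "0 < g (F a n 0)" using I(3)[of 0] g_above[of "min (F a n 0) (\<kappa> / 2)"] g_mono[of "min (F a n 0) (\<kappa> / 2)" "F a n 0"] kappa_pos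
        by (auto simp: min_less_iff_disj)
      show "g (F a n 0) \<le> g (F a n x)" if "0 \<le> x" for x by (rule g_mono[OF monoD[OF I(1) that]])
      show "0 \<le> g (F a n x)" for x using g_nonneg[OF less_imp_le[OF I(3)]] .
    qed (use bmeas_g[OF I(2)] in auto)
    moreover from \<open>\<rho> * q \<le> q\<close> \<open>\<And>x. N a (F a n) x \<le> \<kappa> + \<rho> * q\<close> have "N a (F a n) x \<le> \<kappa> + q" for x
      by (meson add_left_mono order_trans)
    moreover note N_mono_fun[OF I(1,2)] bmeas_N[OF I(2) less_imp_le[OF I(3)]]
    ultimately show ?case unfolding F_Suc by blast
  qed
  have F_mono: "F a n x \<le> F a n y" if "x \<le> y" for a n x y using F[of a n] that by (auto dest: monoD)
  have F_pos: "0 < F a n x" and F_le: "F a n x \<le> \<kappa> + q" and F_bm: "bmeas (F a n)" for a n x using F by blast+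
  have F1: "F a n x \<le> \<kappa> + 1" for a n x using F_le[of a n x] q by simp
  have exp_step: "F a (Suc n) z \<le> B * exp (l * z)"
    if "\<And>x. F a n x \<le> B * exp (l * x)" "F a n y0 \<le> d" "(G + e) * exp (- l * a * h) < 1 + a * l - l\<^sup>2" for a n z
  proof -
    have pos: "0 < (G + e) * exp (- l * a * h)" using G_gt_1 e by simp
    then have den: "0 < 1 + a * l - l\<^sup>2" using \<open>(G + e) * exp (- l * a * h) < 1 + a * l - l\<^sup>2\<close> by linarith
    have "F a (Suc n) z \<le> (G + e) * exp (- l * a * h) / (1 + a * l - l\<^sup>2) * (B * exp (l * z))"
      unfolding F_Suc using F[of a n] F1 that d B l e den F_pos[of a n] by (intro N_exp_step) (auto intro: less_imp_le)
    also have "\<dots> \<le> 1 * (B * exp (l * z))"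
    proof (rule mult_right_mono)
      show "(G + e) * exp (- l * a * h) / (1 + a * l - l\<^sup>2) \<le> 1" unfolding divide_le_eq_1 using den \<open>(G + e) * exp (- l * a * h) < 1 + a * l - l\<^sup>2\<close> by linarith
    qed (use B in simp)
    finally show ?thesis by simp
  qed
  \<comment> \<open>Three zones: far left the exponential bound lies below \<open>V\<close>, near
    \<kappa> the operator contracts the additive error by \<rho>2, and in between the additional
    translation absorbs it.\<close>
  have inv: "(\<forall>z. F c n z \<le> V (z + (1 - \<rho>2 ^ n)) + \<rho>2 ^ n * q) \<and> (\<forall>z. F c n z \<le> B * exp (l * z))" for n
  proof (induction n)
    case 0
    then show ?case unfolding F_0 using \<Theta>(4,5) by simp
  next
    case (Suc n)
    define r where "r = \<rho>2 ^ n"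
    have r: "0 < r" "r \<le> 1" "\<rho>2 ^ Suc n = \<rho>2 * r" using \<rho>2 by (auto simp: r_def power_le_one)
    have \<rho>r: "0 \<le> \<rho>2 * r" "\<rho>2 * r \<le> r" using \<rho>2 r by (auto simp: mult_le_cancel_right1)
    have IH: "F c n z \<le> V (z + (1 - r)) + r * q" "F c n z \<le> B * exp (l * z)" for z using Suc by (auto simp: r_def)
    have rq: "0 \<le> r * q" "r * q \<le> q" using r q by (auto simp: mult_le_cancel_right1)
    have "F c n y0 \<le> d"
      using IH(1)[of y0] Y0[of "y0 + (1 - r)"] rq q(3) r d(1) by (simp add: y0_def)
    then have E: "F c (Suc n) z \<le> B * exp (l * z)" for z using exp_step[OF IH(2) _ e(2)] by blast
    have "F c (Suc n) z \<le> V (z + (1 - \<rho>2 * r)) + \<rho>2 * r * q" for z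
    proof (cases "z \<le> Z0")
      case True
      have "0 \<le> \<rho>2 * r * q" using \<rho>r q by simp
      have "\<rho>2 * r \<le> 1" using \<rho>r(2) r(2) by linarith
      then have "V z \<le> V (z + (1 - \<rho>2 * r))" by (intro monoD[OF V(2)]) linarith
      moreover note \<open>0 \<le> \<rho>2 * r * q\<close>
      ultimately show ?thesis using E[of z] Z0[OF True] by linarith
    next
      case False
      define w where "w = z + (1 - r)"
      have w: "Z0 \<le> w" "w + (r - \<rho>2 * r) = z + (1 - \<rho>2 * r)" using False r by (auto simp: w_def)
      have bmr: "bmeas (\<lambda>x. V x + r * q)" by (intro bmeas_intros(2) bm bmeas_intros(1))
      have "F c (Suc n) z \<le> N c (\<lambda>x. V (x + (1 - r)) + r * q) z"
        unfolding F_Suc by (rule N_mono[OF F_bm bmeas_shift[OF bmr] IH(1)])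
      also have "\<dots> = N c (\<lambda>x. V x + r * q) w" unfolding w_def by (rule N_shift)
      finally have Fw: "F c (Suc n) z \<le> N c (\<lambda>x. V x + r * q) w" .
      show ?thesis
      proof (cases "Z1 \<le> w")
        case True
        have "F c (Suc n) z \<le> V w + \<rho>2 * (r * q)" using Fw Z1[OF rq(1) True] by linarith
        moreover have "V w \<le> V (z + (1 - \<rho>2 * r))" unfolding w(2)[symmetric] using \<rho>r by (intro monoD[OF V(2)]) simp
        ultimately show ?thesis by (simp add: mult.assoc)
      next
        case False
        have "\<bar>N c (\<lambda>x. V x + r * q) w - N c V w\<bar> \<le> L * (r * q)"
          using rq by (intro N_close bmr bm) simp
        then have "F c (Suc n) z \<le> V w + L * (r * q)" using Fw front_facts(2)[OF V(1), of w] by linarith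
        also have "\<dots> \<le> V w + m * (r - \<rho>2 * r)" using mult_left_mono[OF q(4), of r] r by (simp add: algebra_simps)
        also have "\<dots> \<le> V (w + (r - \<rho>2 * r))" using False w \<rho>r r by (intro grow) auto
        finally have "F c (Suc n) z \<le> V (z + (1 - \<rho>2 * r))" by (simp only: w(2))
        moreover have "0 \<le> \<rho>2 * r * q" using \<rho>r q by simp
        ultimately show ?thesis by linarith
      qed
    qed
    then show ?case unfolding r(3) using E by blast
  qed
  \<comment> \<open>Monotonicity of the iterates in \<open>n\<close> is not known, so the tail
    suprema are used: they decrease in \<open>n\<close>, and monotonicity of the operator gives
    \<open>P (Suc n) \<le> N c (P n)\<close>, which makes their limit a subsolution.\<close>
  define P where "P = (\<lambda>n z. SUP k. F c (n + k) z)"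
  have bdd: "bdd_above (range (\<lambda>k. F c (n + k) z))" for n z using F_le by (intro bdd_aboveI2)
  have FP: "F c (n + k) z \<le> P n z" for n k z unfolding P_def by (rule cSUP_upper[OF _ bdd]) simp
  have P_least: "P n z \<le> b" if "\<And>k. F c (n + k) z \<le> b" for n z b unfolding P_def using that by (intro cSUP_least) auto
  have P: "mono (P n)" "0 \<le> P n z" "P n z \<le> \<kappa> + q" "P n z \<le> B * exp (l * z)" for n z
  proof -
    show "mono (P n)"
    proof (rule monoI, rule P_least)
      fix x y :: real and k assume "x \<le> y"
      then show "F c (n + k) x \<le> P n y" using F_mono FP order_trans by blast
    qed
    show "0 \<le> P n z" using F_pos[of c "n + 0" z] FP[of n 0 z] by linarith
    show "P n z \<le> \<kappa> + q" "P n z \<le> B * exp (l * z)" using F_le inv by (auto intro!: P_least)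
  qed
  have bmP: "bmeas (P n)" for n
  proof (rule bmeas_mono[OF P(1)])
    show "\<bar>P n x\<bar> \<le> \<kappa> + q" for x using P(2,3)[of n x] by simp
  qed
  have P_Suc: "P (Suc n) z \<le> N c (P n) z" for n z
  proof (rule P_least)
    fix k
    have "F c (Suc (n + k)) z \<le> N c (P n) z" unfolding F_Suc by (rule N_mono[OF F_bm bmP FP])
    then show "F c (Suc n + k) z \<le> N c (P n) z" by simp
  qed
  have P_dec: "decseq (\<lambda>n. P n z)" for z
  proof (rule decseq_SucI, rule P_least)
    show "F c (Suc n + k) z \<le> P n z" for n k using FP[of n "Suc k" z] by simp
  qed
  define W where "W = (\<lambda>z. INF n. P n z)"
  have W: "(\<lambda>n. P n z) \<longlonglongrightarrow> W z" for z
    unfolding W_def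
  proof (rule LIMSEQ_decseq_INF[OF _ P_dec])
    show "bdd_below (range (\<lambda>n. P n z))" by (rule bdd_belowI2[where m=0]) (rule P(2))
  qed
  have W_bounds: "0 \<le> W z" "W z \<le> \<kappa> + q" "W z \<le> B * exp (l * z)" for z
    using LIMSEQ_le_const[OF W, of 0 z] LIMSEQ_le_const2[OF W, of z "\<kappa> + q"] LIMSEQ_le_const2[OF W, of z "B * exp (l * z)"] P by auto
  have W_mono: "mono W"
  proof (rule monoI)
    fix x y :: real assume xy: "x \<le> y"
    show "W x \<le> W y" by (rule LIMSEQ_le[OF W W]) (use monoD[OF P(1) xy] in blast)
  qed
  have W0: "W z = 0" for z
  proof (rule fast_subsolution_zero[OF W_mono W_bounds(1,3) _ _ B(1) l(1) V(1) slow])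
    show "bmeas W"
    proof (rule bmeas_mono[OF W_mono])
      show "\<bar>W x\<bar> \<le> \<kappa> + q" for x using W_bounds(1,2)[of x] by simp
    qed
    show "W z \<le> N c W z" for z
    proof (rule LIMSEQ_le)
      show "(\<lambda>n. P (Suc n) z) \<longlonglongrightarrow> W z" using LIMSEQ_Suc[OF W] .
      show "(\<lambda>n. N c (P n) z) \<longlonglongrightarrow> N c W z"
      proof (rule N_tendsto[OF _ _ W])
        show "P n \<in> borel_measurable borel" for n by (rule bmeas_measurable[OF bmP])
        show "\<bar>P n x\<bar> \<le> \<kappa> + q" for n x using P(2,3)[of n x] by simp
      qed
    qed (use P_Suc in blast)
  qed
  obtain Z2 where Z2: "\<And>z. Z2 \<le> z \<Longrightarrow> \<kappa> - (1 - \<rho>) * q \<le> V z" using front_near_kappa[OF V(1), of "(1 - \<rho>) * q"] rho q by auto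
  define Z3 where "Z3 = max Z2 y0"
  \<comment> \<open>For every speed, all iterates but the zeroth are at most
    \<open>\<kappa> + \<rho> * q\<close>; beyond \<open>Z3\<close> the starting function is at least
    that large.\<close>
  have right: "\<kappa> + \<rho> * q \<le> \<Theta> z" if "Z3 \<le> z" for z
  proof -
    have "\<rho> * q \<le> q" using rho q by (simp add: mult_le_cancel_right1)
    then have "\<kappa> + \<rho> * q \<le> B * exp (l * y0)" unfolding B(2) using q(2) by linarith
    also have "\<dots> \<le> B * exp (l * z)" using that l B by (intro mult_left_mono) (auto simp: Z3_def)
    finally have "\<kappa> + \<rho> * q \<le> B * exp (l * z)" .
    moreover have "\<kappa> + \<rho> * q \<le> V z + q" using Z2[of z] that by (simp add: Z3_def algebra_simps)
    ultimately show ?thesis by (simp add: \<Theta>_def)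
  qed
  have left: "\<Theta> z = B * exp (l * z)" if "z \<le> Z0" for z using Z0[OF that] q by (simp add: \<Theta>_def)
  have "eventually (\<lambda>n. P n Z3 < \<Theta> Z0) sequentially"
    using order_tendstoD(2)[OF W[of Z3], of "\<Theta> Z0"] W0 \<Theta>(2) by simp
  then obtain n0 where "P n0 Z3 < \<Theta> Z0" using eventually_happens' sequentially_bot by blast
  \<comment> \<open>The successor guarantees \<open>M > 0\<close>, so that the improved bound
    \<open>\<kappa> + \<rho> * q\<close> is available for the last iterate.\<close>
  define M where "M = Suc n0"
  have FM: "F c M Z3 < \<Theta> Z0" using FP[of n0 1 Z3] \<open>P n0 Z3 < \<Theta> Z0\<close> by (simp add: M_def)
  define cj where "cj = (\<lambda>j. c - c / (real j + 1))"
  have cj: "cj \<longlonglongrightarrow> c" "0 \<le> cj j" "cj j \<le> c" "cj j < c" for j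
  proof -
    have "(\<lambda>j. c - c * inverse (real (Suc j))) \<longlonglongrightarrow> c - c * 0" by (intro tendsto_intros LIMSEQ_inverse_real_of_nat)
    moreover have "cj = (\<lambda>j. c - c * inverse (real (Suc j)))" by (simp add: cj_def divide_inverse add.commute)
    ultimately show "cj \<longlonglongrightarrow> c" by simp
    show "0 \<le> cj j" "cj j \<le> c" "cj j < c" using c by (auto simp: cj_def field_simps)
  qed
  have conv: "(\<lambda>j. F (cj j) n z) \<longlonglongrightarrow> F c n z" for n z
  proof (induction n arbitrary: z)
    case (Suc n)
    show ?case unfolding F_Suc
      by (rule N_perturb[OF cj(1-3) bmeas_measurable[OF F_bm] less_imp_le[OF F_pos] F_le Suc])
  qed (simp add: F_0)
  \<comment> \<open>The finitely many strict conditions carried over to a smaller speed: room in the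
    middle range, smallness at \<open>y0\<close> of the iterates before \<open>M\<close>, and the
    characteristic inequality. Together the last two reproduce the exponential bound.\<close>
  have "eventually (\<lambda>j. F (cj j) M Z3 < \<Theta> Z0) sequentially" by (rule order_tendstoD(2)[OF conv FM])
  moreover have "eventually (\<lambda>j. \<forall>n\<in>{..<M}. F (cj j) n y0 < d) sequentially"
  proof (intro eventually_ball_finite ballI order_tendstoD(2)[OF conv])
    fix n
    have "0 \<le> \<rho>2 ^ n" "\<rho>2 ^ n \<le> 1" using \<rho>2 by (auto simp: power_le_one)
    have "V (y0 + (1 - \<rho>2 ^ n)) \<le> d / 3" by (rule Y0) (use \<open>0 \<le> \<rho>2 ^ n\<close> in \<open>simp add: y0_def\<close>)
    moreover have "\<rho>2 ^ n * q \<le> q" using \<open>\<rho>2 ^ n \<le> 1\<close> q(1) by (simp add: mult_le_cancel_right1)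
    moreover have "F c n y0 \<le> V (y0 + (1 - \<rho>2 ^ n)) + \<rho>2 ^ n * q" using inv[of n] by blast
    ultimately show "F c n y0 < d" using q(3) d(1) by linarith
  qed simp
  moreover have "eventually (\<lambda>j. (G + e) * exp (- l * cj j * h) - (1 + cj j * l - l\<^sup>2) < 0) sequentially"
  proof (rule order_tendstoD(2))
    show "(\<lambda>j. (G + e) * exp (- l * cj j * h) - (1 + cj j * l - l\<^sup>2)) \<longlonglongrightarrow> (G + e) * exp (- l * c * h) - (1 + c * l - l\<^sup>2)"
      by (intro tendsto_intros cj)
  qed (use e in simp)
  ultimately have "eventually (\<lambda>j. F (cj j) M Z3 < \<Theta> Z0 \<and> (\<forall>n\<in>{..<M}. F (cj j) n y0 < d) \<and>
      (G + e) * exp (- l * cj j * h) - (1 + cj j * l - l\<^sup>2) < 0) sequentially" by eventually_elim simp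
  then obtain j where j: "F (cj j) M Z3 < \<Theta> Z0" "\<And>n. n < M \<Longrightarrow> F (cj j) n y0 < d"
      "(G + e) * exp (- l * cj j * h) < 1 + cj j * l - l\<^sup>2" using eventually_happens' sequentially_bot by force
  define a where "a = cj j"
  have exp_bound: "F a n z \<le> B * exp (l * z)" if "n \<le> M" for n z
    using that
  proof (induction n arbitrary: z)
    case (Suc n)
    then show ?case using j by (intro exp_step) (auto simp: a_def intro: less_imp_le)
  qed (simp add: F_0 \<Theta>)
  have closing: "F a M z \<le> \<Theta> z" for z
  proof -
    consider "z \<le> Z0" | "Z3 \<le> z" | "Z0 \<le> z" "z \<le> Z3" by linarith
    then show ?thesis
    proof cases
      case 1 then show ?thesis using exp_bound[of M z] left by simp
    next
      case 2 then show ?thesis using F[of a M] right[of z] by (auto simp: M_def intro: order_trans)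
    next
      case 3 then show ?thesis using F_mono[of z Z3 a M] j(1) monoD[OF \<Theta>(1), of Z0 z] by (simp add: a_def)
    qed
  qed
  \<comment> \<open>The operator sends each iterate to the next and the last one lies below the
    zeroth, so the cycle closes and the minimum is mapped below itself.\<close>
  define \<Omega> where "\<Omega> = (\<lambda>z. Min ((\<lambda>n. F a n z) ` {..<M}))"
  have \<Omega>_le: "\<Omega> z \<le> F a n z" if "n < M" for n z unfolding \<Omega>_def using that by (intro Min_le) auto
  have \<Omega>_ge: "b \<le> \<Omega> z" if "\<And>n. n < M \<Longrightarrow> b \<le> F a n z" for b z unfolding \<Omega>_def using that by (subst Min_ge_iff) (auto simp: M_def)
  have \<Omega>_pos: "0 < \<Omega> z" for z unfolding \<Omega>_def using F_pos by (subst Min_gr_iff) (auto simp: M_def)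
  have \<Omega>_mono: "mono \<Omega>"
    by (intro monoI \<Omega>_ge) (meson F_mono \<Omega>_le order_trans)
  have \<Omega>_\<Theta>: "\<Omega> z \<le> \<Theta> z" for z using \<Omega>_le[of 0 z] by (simp add: F_0 M_def)
  have \<Omega>_bm: "bmeas \<Omega>"
  proof (rule bmeas_mono[OF \<Omega>_mono])
    show "\<bar>\<Omega> x\<bar> \<le> \<kappa> + q" for x using \<Omega>_pos[of x] \<Omega>_\<Theta>[of x] \<Theta>(3)[of x] by simp
  qed
  have step: "N a \<Omega> z \<le> F a (Suc n) z" if "n < M" for n z
    unfolding F_Suc by (rule N_mono[OF \<Omega>_bm F_bm \<Omega>_le[OF that]])
  have "N a \<Omega> z \<le> \<Omega> z" for z
  proof (rule \<Omega>_ge)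
    fix n assume "n < M"
    show "N a \<Omega> z \<le> F a n z"
    proof (cases n)
      case 0
      then show ?thesis using step[of n0 z] closing[of z] by (simp add: F_0 M_def)
    next
      case (Suc n')
      then show ?thesis using step[of n' z] \<open>n < M\<close> by simp
    qed
  qed
  moreover have "\<exists>z. \<Omega> z < b" if "0 < b" for b
  proof -
    have "B * exp (l * (ln (b / (2 * B)) / l)) = b / 2" using that B l by simp
    then show ?thesis using \<Omega>_\<Theta>[of "ln (b / (2 * B)) / l"] \<Theta>(4)[of "ln (b / (2 * B)) / l"] that
      by (intro exI[of _ "ln (b / (2 * B)) / l"]) linarith
  qed
  ultimately have "\<exists>\<psi>. front a \<psi> \<and> mono \<psi>"
    using front_from_supersolution[of \<Omega> a, OF \<Omega>_mono \<Omega>_pos _ \<Omega>_bm] by blast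
  then show ?thesis using cj(4)[of j] by (auto simp: a_def)
qed

end

section \<open>Zeros of the characteristic function\<close>

text \<open>The exponential lies above its tangent and the polynomial part is expanded exactly, so
  the full square survives. This gives uniform convexity without second derivatives.\<close>

lemma chi_tangent:
  assumes "0 \<le> deriv g 0"
  shows "chi g h l c + (2 * l - c - deriv g 0 * (c * h) * exp (- l * c * h)) * (z - l) + (z - l)\<^sup>2 \<le> chi g h z c"
proof -
  define t where "t = c * h"
  define E where "E = exp (- l * t)"
  have "1 + (- ((z - l) * t)) \<le> exp (- ((z - l) * t))" by (rule exp_ge_add_one_self)
  then have "E * (1 - (z - l) * t) \<le> E * exp (- ((z - l) * t))" by (intro mult_left_mono) (auto simp: E_def)
  also have "\<dots> = exp (- z * t)" by (simp add: E_def algebra_simps flip: exp_add)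
  finally have "deriv g 0 * (E * (1 - (z - l) * t)) \<le> deriv g 0 * exp (- z * t)" using assms by (intro mult_left_mono) auto
  moreover have "chi g h z c = z\<^sup>2 - c * z - 1 + deriv g 0 * exp (- z * t)" "chi g h l c = l\<^sup>2 - c * l - 1 + deriv g 0 * E"
    by (simp_all add: chi_def t_def E_def mult.assoc)
  moreover have "exp (- l * c * h) = E" by (simp add: E_def t_def mult.assoc)
  ultimately show ?thesis by (simp add: t_def[symmetric] power2_eq_square algebra_simps)
qed

lemma chi_deriv: "((\<lambda>y. chi g h y c) has_real_derivative (2 * z - c - deriv g 0 * (c * h) * exp (- z * c * h))) (at z)"
  unfolding chi_def by (auto intro!: derivative_eq_intros simp: algebra_simps)

lemma chi_strict_antimono:
  assumes "0 \<le> deriv g 0" "0 \<le> h" "0 < z" "c1 < c2" shows "chi g h z c2 < chi g h z c1"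
proof -
  have "z * c1 * h \<le> z * c2 * h" using assms by (intro mult_right_mono mult_left_mono) auto
  then have "deriv g 0 * exp (- z * c2 * h) \<le> deriv g 0 * exp (- z * c1 * h)" using assms by (intro mult_left_mono) auto
  moreover have "c1 * z < c2 * z" using assms by simp
  ultimately show ?thesis by (simp add: chi_def)
qed

text \<open>With \<open>w = z c\<close> the two equations of a double zero reduce to \<open>w + 2 = G exp (- w h) (2 + w h)\<close>.\<close>
lemma double_zero_exists:
  assumes G: "1 < deriv g 0" and h: "0 \<le> h"
  shows "\<exists>c. \<exists>z>0. chi g h z c = 0 \<and> deriv (\<lambda>y. chi g h y c) z = 0"
proof -
  define G where "G = deriv g 0"
  define p where "p = (\<lambda>w. w + 2 - G * exp (- w * h) * (2 + w * h))"
  have "p 0 \<le> 0" using assms by (simp add: p_def G_def)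
  \<comment> \<open>With \<open>t = 3 * G * h\<close> one has
    \<open>exp (- t) * (2 + t) \<le> 3\<close>, whence \<open>p (3 * G) \<ge> 2\<close>;
    \<open>p\<close> thus changes sign on \<open>{0..3 * G}\<close>.\<close>
  moreover have "0 \<le> p (3 * G)"
  proof -
    have t: "exp (- (3 * G) * h) * (3 * G * h) \<le> 1"
    proof -
      have "3 * G * h \<le> exp (3 * G * h)" using exp_ge_add_one_self[of "3 * G * h"] by linarith
      then show ?thesis by (simp add: exp_minus divide_simps)
    qed
    have "exp (- (3 * G) * h) * 2 \<le> 1 * 2" using G h by (intro mult_right_mono) (auto simp: G_def)
    with t have "exp (- (3 * G) * h) * (2 + 3 * G * h) \<le> 3" unfolding distrib_left by linarith
    then have "G * (exp (- (3 * G) * h) * (2 + 3 * G * h)) \<le> G * 3" using G by (intro mult_left_mono) (auto simp: G_def)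
    then show ?thesis by (simp add: p_def mult.assoc)
  qed
  moreover have "0 \<le> 3 * G" using G by (simp add: G_def)
  moreover have "continuous_on {0..3 * G} p" unfolding p_def by (intro continuous_intros)
  ultimately obtain w where w: "0 \<le> w" "p w = 0" using IVT'[of p 0 0 "3 * G"] by blast
  define X where "X = G * exp (- w * h)"
  have X: "0 < X" "w + 2 = X * (2 + w * h)" using w G by (auto simp: X_def p_def G_def)
  have "w \<noteq> 0" using w G by (auto simp: p_def G_def)
  then have w0: "0 < w" using w by simp
  \<comment> \<open>Multiplying the derivative condition by \<open>z\<close> and inserting
    \<open>c * z = w\<close> determines \<open>z\<^sup>2\<close>; the equation
    \<open>p w = 0\<close> then makes the value vanish too.\<close>
  define z where "z = sqrt ((w + X * (w * h)) / 2)"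
  have arg: "0 < (w + X * (w * h)) / 2" using w0 X h by (auto intro!: add_pos_nonneg)
  have z: "0 < z" "z\<^sup>2 = (w + X * (w * h)) / 2" using arg by (auto simp: z_def)
  define c where "c = w / z"
  have cz: "c * z = w" using z by (simp add: c_def)
  have e: "G * exp (- z * c * h) = X" by (simp add: X_def mult.commute flip: cz)
  have "chi g h z c = z\<^sup>2 - w - 1 + X" unfolding chi_def G_def[symmetric] e cz by simp
  also have "\<dots> = 0" unfolding z(2) using X(2) by (simp add: field_simps)
  finally have 1: "chi g h z c = 0" .
  have "(2 * z - c - G * (c * h) * exp (- z * c * h)) * z = 2 * z\<^sup>2 - c * z - (G * exp (- z * c * h)) * ((c * z) * h)"
    by (simp add: power2_eq_square algebra_simps)
  also have "\<dots> = 0" unfolding e cz z(2) by (simp add: field_simps)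
  finally have "2 * z - c - G * (c * h) * exp (- z * c * h) = 0" using z by simp
  then have "deriv (\<lambda>y. chi g h y c) z = 0" using DERIV_imp_deriv[OF chi_deriv[of g h c z]] by (simp add: G_def)
  with 1 z show ?thesis by blast
qed

text \<open>Uniqueness justifies the definite description. At a double zero the tangent vanishes, so
  \<open>chi\<close> is nonnegative for that speed, while at any zero belonging to a smaller speed
  it would be strictly negative by monotonicity in \<open>c\<close>.\<close>

lemma c_sharp_double_zero:
  assumes G: "1 < deriv g 0" and h: "0 \<le> h"
  shows "\<exists>z>0. chi g h z (c_sharp g h) = 0"
proof -
  let ?P = "\<lambda>c. \<exists>z>0. chi g h z c = 0 \<and> deriv (\<lambda>y. chi g h y c) z = 0"
  have no_lt: "\<not> c1 < c2" if P1: "?P c1" and P2: "?P c2" for c1 c2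
  proof
    assume "c1 < c2"
    obtain z1 where z1: "0 < z1" "chi g h z1 c1 = 0" using P1 by blast
    obtain z2 where z2: "0 < z2" "chi g h z2 c2 = 0" "deriv (\<lambda>y. chi g h y c2) z2 = 0" using P2 by blast
    have D0: "2 * z2 - c2 - deriv g 0 * (c2 * h) * exp (- z2 * c2 * h) = 0"
      using DERIV_imp_deriv[OF chi_deriv[of g h c2 z2]] z2(3) by simp
    have G0: "0 \<le> deriv g 0" using G by simp
    have "0 \<le> chi g h z1 c2"
      using chi_tangent[OF G0, of h z2 c2 z1, unfolded D0 z2(2)] zero_le_power2[of "z1 - z2"] by linarith
    then show False using chi_strict_antimono[of g h z1 c1 c2] G h z1 \<open>c1 < c2\<close> by simp
  qed
  have "\<exists>!c. ?P c"
  proof (rule ex_ex1I[OF double_zero_exists[OF G h]])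
    fix c1 c2 assume p: "?P c1" "?P c2"
    show "c1 = c2" using no_lt[OF p] no_lt[OF p(2) p(1)] by simp
  qed
  then have "?P (c_sharp g h)" unfolding c_sharp_def by (rule theI')
  then show ?thesis by blast
qed

text \<open>At the double zero of \<open>c_sharp g h\<close> the function is negative for the larger
  speed, which yields zeros. Infimum and supremum then provide zeros on both sides of
  \<open>l\<close>, and since the tangent at \<open>l\<close> does not descend towards at least one
  of them, convexity forces a negative value. A nonpositive speed would make \<open>chi\<close>
  positive at every positive argument.\<close>

lemma chi_between_zeros:
  assumes G: "1 < deriv g 0" and h: "0 \<le> h" and c: "c_sharp g h < c"
    and l: "lambda1 g h c < l" "l < lambda2 g h c"
  shows "0 < c" "0 < l" "chi g h l c < 0"
proof -
  define S where "S = {z. z > 0 \<and> chi g h z c = 0}"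
  have cont: "continuous_on X (\<lambda>z. chi g h z c)" for X unfolding chi_def by (intro continuous_intros)
  obtain z0 where z0: "0 < z0" "chi g h z0 (c_sharp g h) = 0" using c_sharp_double_zero[OF G h] by blast
  have neg: "chi g h z0 c < 0" using chi_strict_antimono[of g h z0 "c_sharp g h" c] G h z0 c by simp
  have at0: "chi g h 0 c = deriv g 0 - 1" by (simp add: chi_def)
  obtain z1 where z1: "0 \<le> z1" "z1 \<le> z0" "chi g h z1 c = 0"
    using IVT2'[of "\<lambda>z. chi g h z c" z0 0 0] neg at0 G z0 cont by auto
  have "z1 \<noteq> 0" using z1 at0 G by auto
  then have "z1 \<in> S" using z1 by (simp add: S_def)
  then have S: "S \<noteq> {}" by blast
  have ub: "z \<le> \<bar>c\<bar> + 1" if "z \<in> S" for z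
  proof (rule ccontr)
    assume "\<not> ?thesis"
    then have gt: "\<bar>c\<bar> + 1 < z" "1 < z" by auto
    have "0 < deriv g 0 * exp (- z * c * h)" using G by simp
    then have "z\<^sup>2 < c * z + 1" using that by (simp add: S_def chi_def)
    moreover have "c * z \<le> \<bar>c\<bar> * z" using gt by (intro mult_right_mono) auto
    moreover have "\<bar>c\<bar> * z + z \<le> z\<^sup>2"
    proof -
      have "(\<bar>c\<bar> + 1) * z \<le> z * z" using gt by (intro mult_right_mono) auto
      then show ?thesis by (simp only: power2_eq_square distrib_right mult_1)
    qed
    ultimately show False using gt(2) by linarith
  qed
  have bdd: "bdd_above S" "bdd_below S" using ub by (auto simp: S_def intro!: bdd_aboveI[of _ "\<bar>c\<bar> + 1"] bdd_belowI[of _ 0])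
  obtain a where a: "a \<in> S" "a < l" using l(1) cInf_less_iff[OF S bdd(2)] unfolding lambda1_def S_def by blast
  obtain b where b: "b \<in> S" "l < b" using l(2) less_cSup_iff[OF S bdd(1)] unfolding lambda2_def S_def by blast
  show "0 < l" using a by (simp add: S_def)
  show "0 < c"
  proof (rule ccontr)
    assume "\<not> 0 < c"
    then have nc: "c * a \<le> 0" "a * c * h \<le> 0" using a h by (auto simp: S_def mult_nonpos_nonneg mult_nonneg_nonpos)
    then have "1 * 1 \<le> deriv g 0 * exp (- a * c * h)" using G by (intro mult_mono) auto
    moreover have "0 < a\<^sup>2" using a by (simp add: S_def)
    moreover have "a\<^sup>2 - c * a - 1 + deriv g 0 * exp (- a * c * h) = 0" using a by (simp add: S_def chi_def)
    ultimately show False using nc(1) by linarith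
  qed
  define D where "D = 2 * l - c - deriv g 0 * (c * h) * exp (- l * c * h)"
  have ta: "chi g h l c + D * (a - l) + (a - l)\<^sup>2 \<le> 0" using chi_tangent[of g h l c a] G a by (simp add: D_def S_def)
  have tb: "chi g h l c + D * (b - l) + (b - l)\<^sup>2 \<le> 0" using chi_tangent[of g h l c b] G b by (simp add: D_def S_def)
  have "0 < (a - l)\<^sup>2" "0 < (b - l)\<^sup>2" using a b by auto
  moreover have "0 \<le> D * (a - l) \<or> 0 \<le> D * (b - l)"
    using a b by (cases "0 \<le> D") (auto simp: mult_nonpos_nonpos)
  ultimately show "chi g h l c < 0" using ta tb by linarith
qed

section \<open>From hypothesis (H) to the abstract nonlinearity\<close>

lemma increment_near_C1:
  fixes g :: "real \<Rightarrow> real"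
  assumes r: "0 < r" and d: "\<And>x. x \<in> {p - r<..<p + r} \<Longrightarrow> g differentiable at x"
    and c: "continuous_on {p - r<..<p + r} (deriv g)" and e: "0 < e"
  obtains d where "0 < d" "\<And>a b. p - d \<le> a \<Longrightarrow> a \<le> b \<Longrightarrow> b \<le> p + d \<Longrightarrow>
      (deriv g p - e) * (b - a) \<le> g b - g a \<and> g b - g a \<le> (deriv g p + e) * (b - a)"
proof -
  have "isCont (deriv g) p" using c r continuous_on_eq_continuous_at[of "{p - r<..<p + r}" "deriv g"] by auto
  then obtain s where s: "0 < s" "\<And>x. \<bar>x - p\<bar> < s \<Longrightarrow> \<bar>deriv g x - deriv g p\<bar> < e"
    using e unfolding continuous_at_eps_delta dist_real_def by metis
  define d where "d = min r s / 2"
  have d0: "0 < d" "d < r" "d < s" using r s by (auto simp: d_def)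
  show thesis
  proof (rule that[OF d0(1)])
    fix a b assume ab: "p - d \<le> a" "a \<le> b" "b \<le> p + d"
    show "(deriv g p - e) * (b - a) \<le> g b - g a \<and> g b - g a \<le> (deriv g p + e) * (b - a)"
    proof (cases "a = b")
      case False
      then have "a < b" using ab by simp
      moreover have "(g has_real_derivative deriv g x) (at x)" if "a \<le> x" "x \<le> b" for x
      proof -
        have "g differentiable at x" using that ab d0 by (intro d) auto
        then show ?thesis by (simp add: DERIV_deriv_iff_real_differentiable)
      qed
      ultimately obtain x where x: "a < x" "x < b" "g b - g a = (b - a) * deriv g x" using MVT2[of a b g "deriv g"] by blast
      have "\<bar>deriv g x - deriv g p\<bar> < e" using x ab d0 by (intro s) auto
      then have "(b - a) * (deriv g p - e) \<le> (b - a) * deriv g x" "(b - a) * deriv g x \<le> (b - a) * (deriv g p + e)"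
        using ab by (auto intro!: mult_left_mono)
      then show ?thesis using x(3) by (simp add: mult.commute)
    qed simp
  qed
qed

text \<open>Global properties are pieced together from the interval and the two linear extensions;
  monotonicity above \<kappa> shows that the slope there is nonnegative. That \<open>g\<close> lies
  above the identity between the equilibria follows from slope above 1 at 0 and the absence of
  further fixed points.\<close>

lemma monostable_of_hyp_H:
  assumes H: "hyp_H g \<kappa>" and mono: "mono_on {0..} g"
  shows "\<exists>L \<rho> \<delta>. monostable g \<kappa> (deriv g 0) L \<rho> \<delta>"
proof -
  define G where "G = deriv g 0"
  define K where "K = deriv g \<kappa>"
  have \<kappa>: "0 < \<kappa>" and fp: "{x. x \<ge> 0 \<and> g x = x} = {0, \<kappa>}" using H unfolding hyp_H_def by blast+
  obtain r Lg where R: "\<forall>x \<in> {-r<..<r}. g differentiable at x" "0 < r" "continuous_on {-r<..<r} (deriv g)"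
    "\<forall>x \<in> {\<kappa>-r<..<\<kappa>+r}. g differentiable at x" "continuous_on {\<kappa>-r<..<\<kappa>+r} (deriv g)"
    "deriv g 0 > 1" "deriv g \<kappa> < 1" "\<forall>u\<in>{0..\<kappa>}. \<forall>v\<in>{0..\<kappa>}. \<bar>g u - g v\<bar> \<le> Lg * \<bar>u - v\<bar>"
    "\<forall>x\<le>0. g x = deriv g 0 * x" "\<forall>x\<ge>\<kappa>. g x = \<kappa> + deriv g \<kappa> * (x - \<kappa>)"
    using H unfolding hyp_H_def by (elim conjE exE) (rule that; assumption)
  have r: "0 < r" "\<And>x. x \<in> {-r<..<r} \<Longrightarrow> g differentiable at x" "continuous_on {-r<..<r} (deriv g)"
    "\<And>x. x \<in> {\<kappa>-r<..<\<kappa>+r} \<Longrightarrow> g differentiable at x" "continuous_on {\<kappa>-r<..<\<kappa>+r} (deriv g)"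
    "1 < G" "K < 1" "\<forall>u\<in>{0..\<kappa>}. \<forall>v\<in>{0..\<kappa>}. \<bar>g u - g v\<bar> \<le> Lg * \<bar>u - v\<bar>"
    "\<And>x. x \<le> 0 \<Longrightarrow> g x = G * x" "\<And>x. \<kappa> \<le> x \<Longrightarrow> g x = \<kappa> + K * (x - \<kappa>)"
    unfolding G_def K_def by (fact R(2) R(3) R(5) R(6) R(7) R(8) R(1)[rule_format] R(4)[rule_format] R(9)[rule_format] R(10)[rule_format])+
  have Lg: "u \<in> {0..\<kappa>} \<Longrightarrow> v \<in> {0..\<kappa>} \<Longrightarrow> \<bar>g u - g v\<bar> \<le> Lg * \<bar>u - v\<bar>" for u v using r(8) by blast
  have g0: "g 0 = 0" and g\<kappa>: "g \<kappa> = \<kappa>" and fixp: "\<And>x. 0 \<le> x \<Longrightarrow> g x = x \<Longrightarrow> x = 0 \<or> x = \<kappa>" using fp \<kappa> by auto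
  have mono0: "g x \<le> g y" if "0 \<le> x" "x \<le> y" for x y using mono_onD[OF mono] that by auto
  have K: "0 \<le> K" using mono0[of \<kappa> "\<kappa> + 1"] r(10)[of "\<kappa> + 1"] \<kappa> g\<kappa> by simp
  have g_mono: "g x \<le> g y" if "x \<le> y" for x y
  proof -
    consider "0 \<le> x" | "y \<le> 0" | "x < 0" "0 < y" by linarith
    then show ?thesis
    proof cases
      case 3
      have "G * x \<le> 0" using 3 r(6) by (simp add: mult_nonneg_nonpos)
      then show ?thesis using 3 mono0[of 0 y] g0 r(9)[of x] by simp
    qed (use that mono0 r(6,9) in \<open>auto intro!: mult_left_mono\<close>)
  qed
  define L where "L = max (max Lg G) K"
  have lip: "g y - g x \<le> L * (y - x)" if "x \<le> y" for x y
  proof -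
    \<comment> \<open>A point is the sum of its projection to the interval and its two overshoots,
      on each of which \<open>g\<close> is linear. All three parts increase with \<open>x\<close>,
      so the Lipschitz bounds add up without loss.\<close>
    define cl where "cl = (\<lambda>x. max 0 (min \<kappa> x))"
    have dec: "g x = g (cl x) + G * min x 0 + K * max (x - \<kappa>) 0" for x
      using r(9)[of x] r(10)[of x] \<kappa> g0 g\<kappa> by (auto simp: cl_def max_def min_def)
    have clx: "cl x \<in> {0..\<kappa>}" "x = cl x + min x 0 + max (x - \<kappa>) 0" for x using \<kappa> by (auto simp: cl_def max_def min_def)
    have le: "cl x \<le> cl y" using that by (auto simp: cl_def)
    have "g (cl y) - g (cl x) \<le> Lg * (cl y - cl x)" using Lg[OF clx(1) clx(1), of y x] le by simp
    also have "\<dots> \<le> L * (cl y - cl x)" using le by (intro mult_right_mono) (auto simp: L_def)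
    finally have 1: "g (cl y) - g (cl x) \<le> L * (cl y - cl x)" .
    have 2: "G * (min y 0 - min x 0) \<le> L * (min y 0 - min x 0)" using that by (intro mult_right_mono) (auto simp: L_def)
    have 3: "K * (max (y - \<kappa>) 0 - max (x - \<kappa>) 0) \<le> L * (max (y - \<kappa>) 0 - max (x - \<kappa>) 0)"
      using that by (intro mult_right_mono) (auto simp: L_def)
    have "g y - g x = (g (cl y) - g (cl x)) + G * (min y 0 - min x 0) + K * (max (y - \<kappa>) 0 - max (x - \<kappa>) 0)"
      unfolding dec[of y] dec[of x] by (simp add: algebra_simps)
    also have "\<dots> \<le> L * (cl y - cl x) + L * (min y 0 - min x 0) + L * (max (y - \<kappa>) 0 - max (x - \<kappa>) 0)"
      using 1 2 3 by linarith
    also have "\<dots> = L * ((cl y + min y 0 + max (y - \<kappa>) 0) - (cl x + min x 0 + max (x - \<kappa>) 0))" by (simp add: algebra_simps)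
    also have "\<dots> = L * (y - x)" by (simp only: clx(2)[symmetric])
    finally show ?thesis .
  qed
  have g_lip: "\<bar>g x - g y\<bar> \<le> L * \<bar>x - y\<bar>" for x y
  proof (cases "x \<le> y")
    case True then show ?thesis using lip[OF True] g_mono[OF True] by simp
  next
    case False then show ?thesis using lip[of y x] g_mono[of y x] by simp
  qed
  have near0: "\<exists>d>0. \<forall>a b. - d \<le> a \<and> a \<le> b \<and> b \<le> d \<longrightarrow> (G - e) * (b - a) \<le> g b - g a \<and> g b - g a \<le> (G + e) * (b - a)"
    if e: "0 < e" for e
  proof -
    have D: "\<And>x. x \<in> {0 - r<..<0 + r} \<Longrightarrow> g differentiable at x" "continuous_on {0 - r<..<0 + r} (deriv g)" using r by auto
    obtain d where d: "0 < d" "\<And>a b. 0 - d \<le> a \<Longrightarrow> a \<le> b \<Longrightarrow> b \<le> 0 + d \<Longrightarrow>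
      (deriv g 0 - e) * (b - a) \<le> g b - g a \<and> g b - g a \<le> (deriv g 0 + e) * (b - a)"
      using increment_near_C1[OF r(1) D e] by blast
    show ?thesis by (rule exI[of _ d]) (use d in \<open>simp add: G_def\<close>)
  qed
  \<comment> \<open>Halfway between the slope at \<kappa> and 1, leaving \<open>(1 - K) / 2\<close>
    for the variation of the derivative to the left of \<kappa>.\<close>
  define \<rho> where "\<rho> = (1 + K) / 2"
  obtain d where d: "0 < d" "\<And>a b. \<kappa> - d \<le> a \<Longrightarrow> a \<le> b \<Longrightarrow> b \<le> \<kappa> + d \<Longrightarrow>
      (deriv g \<kappa> - (1 - K) / 2) * (b - a) \<le> g b - g a \<and> g b - g a \<le> (deriv g \<kappa> + (1 - K) / 2) * (b - a)"
    using increment_near_C1[OF r(1,4,5), of "(1 - K) / 2"] r(7) by auto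
  define \<delta> where "\<delta> = min d (\<kappa> / 2)"
  have \<rho>: "deriv g \<kappa> + (1 - K) / 2 = \<rho>" "0 \<le> \<rho>" "\<rho> < 1" "K \<le> \<rho>" using K r(7) by (auto simp: \<rho>_def K_def field_simps)
  have near\<kappa>_left: "g b - g a \<le> \<rho> * (b - a)" if "\<kappa> - \<delta> \<le> a" "a \<le> b" "b \<le> \<kappa>" for a b
    using d(2)[of a b] that d(1) by (simp add: \<rho>(1) \<delta>_def)
  have near\<kappa>_right: "g b - g a \<le> \<rho> * (b - a)" if "\<kappa> \<le> a" "a \<le> b" for a b
  proof -
    have "K * (b - a) \<le> \<rho> * (b - a)" using \<rho> that by (intro mult_right_mono) auto
    then show ?thesis using r(10)[of a] r(10)[of b] that by (simp add: algebra_simps)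
  qed
  have near\<kappa>: "g b - g a \<le> \<rho> * (b - a)" if "\<kappa> - \<delta> \<le> a" "a \<le> b" for a b
  proof -
    consider "b \<le> \<kappa>" | "\<kappa> \<le> a" | "a \<le> \<kappa>" "\<kappa> \<le> b" by linarith
    then show ?thesis
    proof cases
      case 3
      have "g b - g \<kappa> \<le> \<rho> * (b - \<kappa>)" "g \<kappa> - g a \<le> \<rho> * (\<kappa> - a)" using 3 that near\<kappa>_left near\<kappa>_right by auto
      then show ?thesis by (simp add: algebra_simps)
    qed (use that near\<kappa>_left near\<kappa>_right in auto)
  qed
  have g_above: "x < g x" if x: "0 < x" "x < \<kappa>" for x
  proof (rule ccontr)
    assume "\<not> x < g x"
    then have le: "g x - x \<le> 0" by simp
    obtain s where s: "0 < s" "\<And>a b. - s \<le> a \<and> a \<le> b \<and> b \<le> s \<Longrightarrow> (G - (G - 1)) * (b - a) \<le> g b - g a"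
      using near0[of "G - 1"] r(6) by auto
    define y where "y = min s x"
    have y: "0 < y" "y \<le> x" "y \<le> s" using s x by (auto simp: y_def)
    have "0 \<le> g y - y" using s(2)[of 0 y] y s(1) g0 by simp
    moreover have "continuous_on {y..x} (\<lambda>x. g x - x)"
    proof -
      have "L-lipschitz_on {y..x} g" using g_lip r(6) by (intro lipschitz_onI) (auto simp: dist_real_def L_def)
      then show ?thesis by (intro continuous_intros) (rule lipschitz_on_continuous_on)
    qed
    ultimately obtain w where w: "y \<le> w" "w \<le> x" "g w - w = 0" using IVT2'[of "\<lambda>x. g x - x" x 0 y] le y by blast
    then show False using fixp[of w] y x by auto
  qed
  have "monostable g \<kappa> G L \<rho> \<delta>"
    by unfold_locales (use \<kappa> g_mono g_lip g0 g\<kappa> g_above r(6) near0 \<rho> near\<kappa> d(1) in \<open>auto simp: \<delta>_def\<close>)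
  then show ?thesis unfolding G_def by blast
qed

section \<open>Decay of the minimal front and convergence\<close>

lemma exp_le_logistic:
  assumes "0 \<le> l" "z \<le> 0" shows "exp (l * z) \<le> 2 * logistic l z"
proof -
  have "logistic l z \<le> 1 / 2" using logistic_mono[OF assms] by (simp add: logistic_def)
  then have "exp (l * z) * (1 / 2) \<le> exp (l * z) * (1 - logistic l z)" by (intro mult_left_mono) auto
  then show ?thesis using logistic_eq[of l z] by simp
qed

lemma fast_exp_le_logistic:
  assumes l: "0 \<le> l" "l < l3" and K: "0 < K" "0 < \<nu>"
  shows "\<exists>Z\<le>0. \<forall>z\<le>Z. K * exp (l3 * z) \<le> \<nu> * logistic l z"
proof -
  define Z where "Z = min 0 (ln (\<nu> / (2 * K)) / (l3 - l))"
  have "K * exp (l3 * z) \<le> \<nu> * logistic l z" if z: "z \<le> Z" for z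
  proof -
    have z0: "z \<le> 0" and zl: "z \<le> ln (\<nu> / (2 * K)) / (l3 - l)" using z unfolding Z_def by linarith+
    have "z * (l3 - l) \<le> ln (\<nu> / (2 * K))" using zl l by (simp add: pos_le_divide_eq)
    then have "exp (z * (l3 - l)) \<le> exp (ln (\<nu> / (2 * K)))" by (simp only: exp_le_cancel_iff)
    also have "\<dots> = \<nu> / (2 * K)" using K by simp
    finally have "K * exp (z * (l3 - l)) \<le> K * (\<nu> / (2 * K))" using K by (intro mult_left_mono) auto
    also have "\<dots> = \<nu> / 2" using K by simp
    finally have a: "K * exp (z * (l3 - l)) \<le> \<nu> / 2" .
    have "K * exp (l3 * z) = (K * exp (z * (l3 - l))) * exp (l * z)" by (simp add: algebra_simps flip: exp_add)
    also have "\<dots> \<le> (\<nu> / 2) * (2 * logistic l z)" using a K exp_le_logistic[OF l(1) z0] by (intro mult_mono) auto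
    finally show ?thesis by simp
  qed
  moreover have "Z \<le> 0" by (simp add: Z_def)
  ultimately show ?thesis by blast
qed

context profile
begin

text \<open>Slow decay of the monotone front would produce a slower one, against minimality. Slow
  decay of \<phi> is then impossible as well, since the rapidly decaying \<open>V\<close> would be a
  subsolution that sliding under \<phi> reduces to zero. The dichotomy turns both negations into
  exponential bounds.\<close>

lemma minimal_front_decay:
  assumes \<phi>: "front c \<phi>" and minimal: "\<forall>c' \<psi>. front c' \<psi> \<longrightarrow> c \<le> c'" and c: "0 < c" and l: "0 < l1" "l1 < l3"
    and neg: "chi_negative c l1" "chi_negative c l3"
  obtains V B D where "front c V" "mono V" "0 < B" "\<And>z. V z \<le> B * exp (l3 * z)" "0 < D" "\<And>z. \<phi> z \<le> D * exp (l3 * z)"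
proof -
  obtain V where V: "front c V" "mono V" using monotone_front_exists[OF \<phi>] by blast
  have l3: "0 < l3" and c0: "0 \<le> c" using l c by auto
  have nV: "\<not> (\<forall>M. \<exists>Z. \<forall>z\<le>Z. M * exp (l3 * z) \<le> V z)"
  proof
    assume s: "\<forall>M. \<exists>Z. \<forall>z\<le>Z. M * exp (l3 * z) \<le> V z"
    obtain c' \<psi> where "c' < c" "front c' \<psi>" using slower_front_exists[OF V c l3 neg(2) s[rule_format]] by blast
    then show False using minimal by (meson not_less)
  qed
  obtain B where B: "0 < B" "\<And>z. V z \<le> B * exp (l3 * z)"
    using decay_dichotomy[OF V(1) c0 l order_refl neg nV] by blast
  have n\<phi>: "\<not> (\<forall>M. \<exists>Z. \<forall>z\<le>Z. M * exp (l3 * z) \<le> \<phi> z)"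
  proof
    assume s: "\<forall>M. \<exists>Z. \<forall>z\<le>Z. M * exp (l3 * z) \<le> \<phi> z"
    have "V 0 = 0"
    proof (rule fast_subsolution_zero[OF V(2) less_imp_le[OF front_facts(1)[OF V(1)]] B(2) front_bmeas[OF V(1)] _ B(1) l3 \<phi> s[rule_format]])
      show "V z \<le> N c V z" for z by (rule eq_refl[OF front_facts(2)[OF V(1)]])
    qed
    then show False using front_facts(1)[OF V(1), of 0] by simp
  qed
  obtain D where D: "0 < D" "\<And>z. \<phi> z \<le> D * exp (l3 * z)"
    using decay_dichotomy[OF \<phi> c0 l order_refl neg n\<phi>] by blast
  show thesis by (rule that[OF V B D])
qed

text \<open>An exponent strictly above that of the weight is what makes the front negligible on the
  left, together with \<open>V' \<le> disc c * V\<close>. On the right \<open>V'\<close> is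
  controlled by the defect \<open>\<kappa> - V\<close>.\<close>

lemma fast_front_of_decay:
  assumes V: "front c V" "mono V" and B: "0 < B" "\<And>z. V z \<le> B * exp (l3 * z)" and c: "0 < c" and l: "0 < l" "l < l3"
    and neg: "chi_negative c l"
  shows "\<exists>V' V''. fast_front g \<kappa> G L \<rho> \<delta> h c l V V' V''"
proof -
  obtain V' V'' where D: "\<And>z. (V has_real_derivative V' z) (at z)" "\<And>z. (V' has_real_derivative V'' z) (at z)"
    "\<And>z. c * V' z = V'' z - V z + g (V (z - c * h))" using that by (rule front_ode[OF V(1)])
  note MF = mono_front_facts[OF V D(1)]
  have l0: "0 \<le> l" using l by simp
  have dp: "0 < disc c" by (rule disc_pos)
  have V'_small: "\<exists>Z. \<forall>z. Z \<le> \<bar>z\<bar> \<longrightarrow> V' z \<le> \<nu> * logistic l z" if \<nu>: "0 < \<nu>" for \<nu>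
  proof -
    have KB: "0 < disc c * B" using dp B by simp
    obtain Z1 where Z1: "Z1 \<le> 0" "\<And>z. z \<le> Z1 \<Longrightarrow> disc c * B * exp (l3 * z) \<le> \<nu> * logistic l z"
      using fast_exp_le_logistic[OF l0 l(2) KB \<nu>] by blast
    have ep: "0 < \<nu> / (2 * disc c)" using \<nu> dp by simp
    obtain Y where Y: "\<And>z. Y \<le> z \<Longrightarrow> \<kappa> - \<nu> / (2 * disc c) \<le> V z" using front_near_kappa[OF V(1) ep] by blast
    have "V' z \<le> \<nu> * logistic l z" if z: "max (1 - Z1) Y \<le> \<bar>z\<bar>" for z
    proof (cases "0 \<le> z")
      case True
      then have "\<kappa> - V z \<le> \<nu> / (2 * disc c)" using Y[of z] z by simp
      then have "disc c * (\<kappa> - V z) \<le> disc c * (\<nu> / (2 * disc c))" using dp by (intro mult_left_mono) auto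
      also have "\<dots> = \<nu> * (1 / 2)" using dp by simp
      also have "\<dots> \<le> \<nu> * logistic l z" using logistic_ge_half[OF l0 True] \<nu> by (intro mult_left_mono) auto
      finally show ?thesis using MF(3)[of z] by linarith
    next
      case False
      then have "z \<le> Z1" using z by simp
      have "V' z \<le> disc c * V z" by (rule MF)
      also have "\<dots> \<le> disc c * (B * exp (l3 * z))" using dp B(2) by (intro mult_left_mono) auto
      also have "\<dots> \<le> \<nu> * logistic l z" using Z1(2)[OF \<open>z \<le> Z1\<close>] by (simp add: mult.assoc)
      finally show ?thesis .
    qed
    then show ?thesis by blast
  qed
  have V_small: "\<exists>Z. \<forall>z\<le>Z. V z \<le> \<nu> * logistic l z" if \<nu>: "0 < \<nu>" for \<nu>
    using fast_exp_le_logistic[OF l0 l(2) B(1) \<nu>] B(2) by (meson order_trans)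
  have lims: "(V \<longlongrightarrow> 0) at_bot" "(V \<longlongrightarrow> \<kappa>) at_top" using V(1) by (auto simp: front_def)
  have "fast_front g \<kappa> G L \<rho> \<delta> h c l V V' V''"
    by (intro fast_front.intro fast_front_axioms.intro monostable_axioms h_nn c l(1) neg[unfolded chi_negative_def] D MF(1,4)
        front_facts(1)[OF V(1)] lims V'_small V_small)
  then show ?thesis by blast
qed

text \<open>Uniqueness of bounded solutions identifies the differential with the integral
  formulation, so minimality of the speed among wavefronts becomes minimality among fixed
  points.\<close>

lemma wavefront_iff_front: "is_wavefront g h \<kappa> c \<phi> \<longleftrightarrow> front c \<phi>"
proof
  assume w: "is_wavefront g h \<kappa> c \<phi>"
  then obtain d2 where d2: "\<And>z. (deriv \<phi> has_real_derivative d2 z) (at z)" "\<And>z. c * deriv \<phi> z = d2 z - \<phi> z + g (\<phi> (z - c * h))"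
    unfolding is_wavefront_def by metis
  have d1: "(\<phi> has_real_derivative deriv \<phi> z) (at z)" for z
    using w unfolding is_wavefront_def DERIV_deriv_iff_real_differentiable by blast
  show "front c \<phi>" using w by (intro ode_front[OF d1 d2]) (auto simp: is_wavefront_def)
next
  assume f: "front c \<phi>"
  obtain \<phi>' \<phi>'' where D: "\<And>z. (\<phi> has_real_derivative \<phi>' z) (at z)" "\<And>z. (\<phi>' has_real_derivative \<phi>'' z) (at z)"
    "\<And>z. c * \<phi>' z = \<phi>'' z - \<phi> z + g (\<phi> (z - c * h))" using that by (rule front_ode[OF f])
  have dd: "deriv \<phi> = \<phi>'" using D(1) DERIV_imp_deriv by blast
  have "\<phi> differentiable at z" for z using D(1) real_differentiable_def by blast
  moreover have "\<exists>d2. (\<phi>' has_real_derivative d2) (at z) \<and> c * \<phi>' z = d2 - \<phi> z + g (\<phi> (z - c * h))" for z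
    using D(2)[of z] D(3)[of z] by blast
  ultimately show "is_wavefront g h \<kappa> c \<phi>" using f unfolding is_wavefront_def front_def dd by blast
qed

text \<open>Lets the stability theorem be applied to the front itself, which will identify it with a
  translate of the monotone one.\<close>

lemma front_solution:
  assumes f: "front c \<phi>" shows "\<exists>ut ux uxx. solution g \<kappa> G L \<rho> \<delta> h \<kappa> (\<lambda>t x. \<phi> (x + c * t)) ut ux uxx"
proof -
  obtain \<phi>' \<phi>'' where D: "\<And>z. (\<phi> has_real_derivative \<phi>' z) (at z)" "\<And>z. (\<phi>' has_real_derivative \<phi>'' z) (at z)"
    "\<And>z. c * \<phi>' z = \<phi>'' z - \<phi> z + g (\<phi> (z - c * h))" using that by (rule front_ode[OF f])
  have "solution g \<kappa> G L \<rho> \<delta> h \<kappa> (\<lambda>t x. \<phi> (x + c * t)) (\<lambda>t x. c * \<phi>' (x + c * t)) (\<lambda>t x. \<phi>' (x + c * t)) (\<lambda>t x. \<phi>'' (x + c * t))"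
  proof (intro solution.intro solution_axioms.intro monostable_axioms h_nn)
    have "continuous_on ({- h..} \<times> UNIV) (\<lambda>p. \<phi> (snd p + c * fst p))"
      by (rule continuous_on_compose2[OF front_facts(3)[OF f, of UNIV]]) (auto intro!: continuous_intros)
    then show "continuous_on ({- h..} \<times> UNIV) (\<lambda>(t, x). \<phi> (x + c * t))" by (simp add: case_prod_beta)
    fix t x
    show "\<bar>\<phi> (x + c * t)\<bar> \<le> \<kappa>" "0 \<le> \<phi> (x + c * t) \<and> \<phi> (x + c * t) \<le> \<kappa>"
      using front_facts(1)[OF f, of "x + c * t"] front_le_kappa[OF f, of "x + c * t"] by auto
    have inner: "((\<lambda>\<tau>. x + c * \<tau>) has_real_derivative c) (at t)" by (auto intro!: derivative_eq_intros)
    show "((\<lambda>\<tau>. \<phi> (x + c * \<tau>)) has_real_derivative c * \<phi>' (x + c * t)) (at t)"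
      using DERIV_chain2[OF D(1) inner] by (simp only: mult.commute[of c "\<phi>' (x + c * t)"])
    show "((\<lambda>x. \<phi> (x + c * t)) has_real_derivative \<phi>' (x + c * t)) (at x)"
      using D(1)[of "x + c * t"] by (simp add: DERIV_shift)
    show "((\<lambda>x. \<phi>' (x + c * t)) has_real_derivative \<phi>'' (x + c * t)) (at x)"
      using D(2)[of "x + c * t"] by (simp add: DERIV_shift)
    show "c * \<phi>' (x + c * t) = \<phi>'' (x + c * t) - \<phi> (x + c * t) + g (\<phi> (x + c * (t - h)))"
      using D(3)[of "x + c * t"] by (simp add: algebra_simps)
  qed
  then show ?thesis by blast
qed

end

context solution
begin

text \<open>Invariance of the equation under reflection in \<open>x\<close> reduces the right
  half-line to the left one.\<close>

lemma reflected_solution: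
  "solution g \<kappa> G L \<rho> \<delta> h M (\<lambda>t x. u t (- x)) (\<lambda>t x. ut t (- x)) (\<lambda>t x. - ux t (- x)) (\<lambda>t x. uxx t (- x))"
proof (intro solution.intro solution_axioms.intro monostable_axioms h_nonneg)
  have "continuous_on ({- h..} \<times> UNIV) (\<lambda>p. (\<lambda>(t, x). u t x) (fst p, - snd p))"
    by (rule continuous_on_compose2[OF u_cont]) (auto intro!: continuous_intros)
  then show "continuous_on ({- h..} \<times> UNIV) (\<lambda>(t, x). u t (- x))" by (simp add: case_prod_beta)
  fix t x
  have neg: "((\<lambda>x::real. - x) has_real_derivative - 1) (at x)" by (auto intro!: derivative_eq_intros)
  show "\<bar>u t (- x)\<bar> \<le> M" if "- h \<le> t" using u_bdd[OF that] .
  show "0 \<le> u t (- x) \<and> u t (- x) \<le> \<kappa>" if "- h \<le> t" "t \<le> 0" using u_init[OF that] .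
  show "((\<lambda>\<tau>. u \<tau> (- x)) has_real_derivative ut t (- x)) (at t)" if "0 < t" using u_t[OF that] .
  show "((\<lambda>x. u t (- x)) has_real_derivative - ux t (- x)) (at x)" if "0 < t"
    using DERIV_chain2[OF u_x[OF that, of "- x"] neg] by simp
  show "((\<lambda>x. - ux t (- x)) has_real_derivative uxx t (- x)) (at x)" if "0 < t"
    using DERIV_minus[OF DERIV_chain2[OF u_xx[OF that, of "- x"] neg]] by simp
  show "ut t (- x) = uxx t (- x) - u t (- x) + g (u (t - h) (- x))" if "0 < t" by (rule u_eq[OF that])
qed

end

lemma solution_of_is_solution:
  assumes "monostable g \<kappa> G L \<rho> \<delta>" and h: "0 \<le> h" and sol: "is_solution g h w0 u"
    and w0: "\<forall>s\<in>{-h..0}. \<forall>x. 0 \<le> w0 s x \<and> w0 s x \<le> \<kappa>"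
  shows "\<exists>M ut ux uxx. solution g \<kappa> G L \<rho> \<delta> h M u ut ux uxx"
proof -
  have init: "\<forall>s\<in>{-h..0}. \<forall>x. u s x = w0 s x" and cont: "continuous_on ({-h..} \<times> UNIV) (\<lambda>(t, x). u t x)"
    and bdd: "\<exists>M. \<forall>t\<ge>-h. \<forall>x. \<bar>u t x\<bar> \<le> M" and dx: "\<forall>t>0. \<forall>x. (\<lambda>y. u t y) differentiable at x"
    and ex: "\<forall>t>0. \<forall>x. \<exists>ut uxx. ((\<lambda>\<tau>. u \<tau> x) has_real_derivative ut) (at t) \<and>
        ((\<lambda>y. deriv (\<lambda>z. u t z) y) has_real_derivative uxx) (at x) \<and> ut = uxx - u t x + g (u (t - h) x)"
    using sol unfolding is_solution_def by - (elim conjE, assumption)+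
  obtain M where M: "\<And>t x. - h \<le> t \<Longrightarrow> \<bar>u t x\<bar> \<le> M" using bdd by blast
  define ut where "ut = (\<lambda>t x. deriv (\<lambda>\<tau>. u \<tau> x) t)"
  define ux where "ux = (\<lambda>t x. deriv (u t) x)"
  define uxx where "uxx = (\<lambda>t x. deriv (ux t) x)"
  have D: "((\<lambda>\<tau>. u \<tau> x) has_real_derivative ut t x) (at t) \<and> (ux t has_real_derivative uxx t x) (at x) \<and>
      ut t x = uxx t x - u t x + g (u (t - h) x)" if t: "0 < t" for t x
  proof -
    obtain a b where ab: "((\<lambda>\<tau>. u \<tau> x) has_real_derivative a) (at t)" "((\<lambda>y. deriv (\<lambda>z. u t z) y) has_real_derivative b) (at x)"
      "a = b - u t x + g (u (t - h) x)" using ex t by blast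
    have "ut t x = a" unfolding ut_def by (rule DERIV_imp_deriv[OF ab(1)])
    moreover have "uxx t x = b" unfolding uxx_def ux_def by (rule DERIV_imp_deriv[OF ab(2)])
    ultimately show ?thesis using ab by (simp add: ux_def)
  qed
  have Dx: "(u t has_real_derivative ux t x) (at x)" if "0 < t" for t x
    using dx that unfolding ux_def DERIV_deriv_iff_real_differentiable by blast
  have I: "0 \<le> u t x \<and> u t x \<le> \<kappa>" if "- h \<le> t" "t \<le> 0" for t x using init w0 that by simp
  have "solution g \<kappa> G L \<rho> \<delta> h M u ut ux uxx"
    by (intro solution.intro solution_axioms.intro assms(1) h cont M I Dx) (use D in blast)+
  then show ?thesis by blast
qed

text \<open>Both sides of \<open>l\<close> are required: the decay argument works with a slower
  auxiliary exponential and must deliver an exponent strictly above that of the weight.\<close>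

lemma chi_negative_neighbourhood:
  assumes "chi g h l c < 0" "0 < l"
  obtains l1 l3 where "0 < l1" "l1 < l" "l < l3" "chi g h l1 c < 0" "chi g h l3 c < 0"
proof -
  have "isCont (\<lambda>z. chi g h z c) l" unfolding chi_def by (intro continuous_intros)
  then obtain r where r: "0 < r" "\<And>z. \<bar>z - l\<bar> < r \<Longrightarrow> \<bar>chi g h z c - chi g h l c\<bar> < - chi g h l c"
    using assms(1) unfolding continuous_at_eps_delta dist_real_def by (metis neg_0_less_iff_less)
  define s where "s = min r l / 2"
  have s: "0 < s" "s < r" "s < l" using r assms by (auto simp: s_def)
  show thesis by (rule that[of "l - s" "l + s"]) (use s r(2)[of "l - s"] r(2)[of "l + s"] in auto)
qed

theorem theorem3:
  fixes g :: "real \<Rightarrow> real" and \<kappa> h cs \<mu> A la :: real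
    and \<phi> :: "real \<Rightarrow> real" and w0 u :: "real \<Rightarrow> real \<Rightarrow> real"
  assumes H: "hyp_H g \<kappa>"
    and mono: "mono_on {0..} g"
    and h: "h \<ge> 0"
    and front: "is_wavefront g h \<kappa> cs \<phi>"
    and minimal: "\<forall>c \<psi>. is_wavefront g h \<kappa> c \<psi> \<longrightarrow> cs \<le> c"
    and pushed: "cs > c_sharp g h"
    and mu: "\<mu> > lambda1 g h cs"
    and A: "A > 0"
    and lam: "lambda1 g h cs < la" "la < lambda2 g h cs" "la < \<mu>"
    and w0_adm: "admissible_initial h w0"
    and nz1: "\<exists>s\<in>{-h..0}. \<exists>x. w0 s x \<noteq> 0"
    and nz2: "\<exists>s\<in>{-h..0}. \<exists>x. w0 s (-x) \<noteq> 0"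
    and IC1: "\<forall>s\<in>{-h..0}. \<forall>x. 0 \<le> w0 s x \<and> w0 s x \<le> \<kappa>"
    and IC1': "\<forall>s\<in>{-h..0}. \<forall>x. 0 \<le> w0 s (-x) \<and> w0 s (-x) \<le> \<kappa>"
    and IC2: "\<forall>s\<in>{-h..0}. \<forall>x. w0 s x \<le> A * exp (\<mu> * x)"
    and IC2': "\<forall>s\<in>{-h..0}. \<forall>x. w0 s (-x) \<le> A * exp (\<mu> * x)"
    and sol: "is_solution g h w0 u"
  shows "\<exists>s1 s2.
     (\<forall>\<epsilon>>0. \<exists>T. \<forall>t\<ge>T. \<forall>x\<le>0.
        \<bar>u t x - \<phi> (x + cs * t + s1)\<bar> / eta la (x + cs * t) \<le> \<epsilon>) \<and>
     (\<forall>\<epsilon>>0. \<exists>T. \<forall>t\<ge>T. \<forall>x\<ge>0.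
        \<bar>u t x - \<phi> (- x + cs * t + s2)\<bar> / eta la (- x + cs * t) \<le> \<epsilon>)"
proof -
  obtain L \<rho> \<delta> where ms: "monostable g \<kappa> (deriv g 0) L \<rho> \<delta>" using monostable_of_hyp_H[OF H mono] by blast
  interpret profile g \<kappa> "deriv g 0" L \<rho> \<delta> h by (intro profile.intro profile_axioms.intro ms h)
  have \<phi>: "front cs \<phi>" using front by (simp add: wavefront_iff_front)
  have min: "\<forall>c \<psi>. front c \<psi> \<longrightarrow> cs \<le> c" using minimal by (simp only: wavefront_iff_front)
  note chi = chi_between_zeros[OF G_gt_1 h pushed lam(1,2)]
  have chi_neg: "chi_negative cs l" if "chi g h l cs < 0" for l using that by (simp add: chi_negative_def chi_def)
  obtain l1 l3 where l: "0 < l1" "l1 < la" "la < l3" "chi g h l1 cs < 0" "chi g h l3 cs < 0"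
    using chi_negative_neighbourhood[OF chi(3,2)] by blast
  have l13: "l1 < l3" using l by simp
  obtain V B D where V: "front cs V" "mono V" "0 < B" "\<And>z. V z \<le> B * exp (l3 * z)" "0 < D" "\<And>z. \<phi> z \<le> D * exp (l3 * z)"
    using minimal_front_decay[OF \<phi> min chi(1) l(1) l13 chi_neg[OF l(4)] chi_neg[OF l(5)]] by blast
  obtain V' V'' where ff: "fast_front g \<kappa> (deriv g 0) L \<rho> \<delta> h cs la V V' V''"
    using fast_front_of_decay[OF V(1-4) chi(1,2) l(3) chi_neg[OF chi(3)]] by blast
  have conv: "\<exists>s. \<forall>\<epsilon>>0. \<exists>T. \<forall>t\<ge>T. \<forall>x\<le>0. \<bar>v t x - V (x + cs * t + s)\<bar> \<le> \<epsilon> * logistic la (x + cs * t)"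
    if sv: "solution g \<kappa> (deriv g 0) L \<rho> \<delta> h M v vt vx vxx" and nz: "\<exists>s\<in>{-h..0}. \<exists>x. v s x \<noteq> 0"
      and decay: "\<And>t x. - h \<le> t \<Longrightarrow> t \<le> 0 \<Longrightarrow> v t x \<le> C * exp (m * x)" and C: "0 < C" and m: "la < m"
    for M v vt vx vxx C m
  proof -
    \<comment> \<open>The larger exponent \<open>m\<close> is weakened to \<open>la\<close> for
      \<open>x \<le> 0\<close>; for \<open>x > 0\<close> the bound by \<kappa> takes its
      place.\<close>
    have "v t x \<le> max C \<kappa> * exp (la * x)" if t: "- h \<le> t" "t \<le> 0" for t x
    proof (cases "x \<le> 0")
      case True
      have "m * x \<le> la * x" using m True by (intro mult_right_mono_neg) auto
      then have "C * exp (m * x) \<le> max C \<kappa> * exp (la * x)" using C by (intro mult_mono) auto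
      then show ?thesis using decay[OF t, of x] by linarith
    next
      case False
      have "v t x \<le> \<kappa> * 1" using solution.u_init[OF sv t, of x] by simp
      also have "\<dots> \<le> max C \<kappa> * exp (la * x)" using False chi(2) kappa_pos by (intro mult_mono) auto
      finally show ?thesis .
    qed
    then have "front_stability g \<kappa> (deriv g 0) L \<rho> \<delta> h M v vt vx vxx cs la V V' V'' (max C \<kappa>)"
      by (intro front_stability.intro front_stability_axioms.intro sv ff nz)
    then show ?thesis by (rule front_stability.convergence_to_front)
  qed
  obtain pt px pxx where sp: "solution g \<kappa> (deriv g 0) L \<rho> \<delta> h \<kappa> (\<lambda>t x. \<phi> (x + cs * t)) pt px pxx"
    using front_solution[OF \<phi>] by blast
  have l3: "0 < l3" using l by simp
  \<comment> \<open>The given front need not be known to be monotone; its decay with exponent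
    \<open>l3\<close> above \<open>la\<close> makes it admissible as a solution converging to
    \<open>V\<close>.\<close>
  have "\<exists>s. \<forall>\<epsilon>>0. \<exists>T. \<forall>t\<ge>T. \<forall>x\<le>0. \<bar>\<phi> (x + cs * t) - V (x + cs * t + s)\<bar> \<le> \<epsilon> * logistic la (x + cs * t)"
  proof (rule conv[OF sp _ _ V(5) l(3)])
    show "\<exists>s\<in>{-h..0}. \<exists>x. \<phi> (x + cs * s) \<noteq> 0"
      using h front_facts(1)[OF \<phi>] by (intro bexI[of _ 0] exI[of _ 0]) (auto simp: less_le)
    fix t x :: real assume t: "- h \<le> t" "t \<le> 0"
    have "cs * t \<le> 0" using chi(1) t by (simp add: mult_nonneg_nonpos)
    then have "l3 * (x + cs * t) \<le> l3 * x" using l3 by (intro mult_left_mono) auto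
    then have "D * exp (l3 * (x + cs * t)) \<le> D * exp (l3 * x)" using V(5) by (intro mult_left_mono) auto
    then show "\<phi> (x + cs * t) \<le> D * exp (l3 * x)" using V(6)[of "x + cs * t"] by linarith
  qed
  then obtain s0 where s0: "\<And>\<epsilon>. 0 < \<epsilon> \<Longrightarrow> \<exists>T. \<forall>t\<ge>T. \<forall>x\<le>0. \<bar>\<phi> (x + cs * t) - V (x + cs * t + s0)\<bar> \<le> \<epsilon> * logistic la (x + cs * t)"
    by blast
  have V_eq: "V y = \<phi> (y - s0)" for y
  proof -
    \<comment> \<open>At a fixed wave coordinate the difference does not depend on time, and the
      corresponding \<open>x\<close> becomes nonpositive for late times, so convergence means
      equality.\<close>
    have "\<bar>\<phi> (y - s0) - V y\<bar> \<le> 0 + \<epsilon>" if \<epsilon>: "0 < \<epsilon>" for \<epsilon>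
    proof -
      obtain T where T: "\<And>t x. T \<le> t \<Longrightarrow> x \<le> 0 \<Longrightarrow> \<bar>\<phi> (x + cs * t) - V (x + cs * t + s0)\<bar> \<le> \<epsilon> * logistic la (x + cs * t)"
        using s0[OF \<epsilon>] by blast
      define t where "t = max T ((y - s0) / cs)"
      have "(y - s0) / cs \<le> t" "T \<le> t" by (auto simp: t_def)
      then have "(y - s0) - cs * t \<le> 0" using chi(1) by (simp add: pos_divide_le_eq mult.commute)
      from T[OF \<open>T \<le> t\<close> this] have "\<bar>\<phi> (y - s0) - V y\<bar> \<le> \<epsilon> * logistic la (y - s0)" by simp
      also have "\<dots> \<le> \<epsilon> * 1" using \<epsilon> logistic_less_1[of la "y - s0"] by (intro mult_left_mono) auto
      finally show ?thesis by simp
    qed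
    then have "\<bar>\<phi> (y - s0) - V y\<bar> \<le> 0" by (rule field_le_epsilon)
    then show ?thesis by simp
  qed
  \<comment> \<open>The logistic weight lies below \<eta>, so an error of \<epsilon> times the
    weight is at most \<epsilon> after division.\<close>
  have eta: "0 < eta la z" "logistic la z \<le> eta la z" for z
    using logistic_le_exp[of la z] logistic_less_1[of la z] by (auto simp: eta_def)
  have close: "\<exists>s. \<forall>\<epsilon>>0. \<exists>T. \<forall>t\<ge>T. \<forall>x\<le>0. \<bar>v t x - \<phi> (x + cs * t + s)\<bar> / eta la (x + cs * t) \<le> \<epsilon>"
    if near: "\<exists>s. \<forall>\<epsilon>>0. \<exists>T. \<forall>t\<ge>T. \<forall>x\<le>0. \<bar>v t x - V (x + cs * t + s)\<bar> \<le> \<epsilon> * logistic la (x + cs * t)" for v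
  proof -
    obtain s where s: "\<forall>\<epsilon>>0. \<exists>T. \<forall>t\<ge>T. \<forall>x\<le>0. \<bar>v t x - V (x + cs * t + s)\<bar> \<le> \<epsilon> * logistic la (x + cs * t)"
      using near by blast
    have "\<bar>v t x - \<phi> (x + cs * t + (s - s0))\<bar> / eta la (x + cs * t) \<le> \<epsilon>"
      if "0 < \<epsilon>" "\<bar>v t x - V (x + cs * t + s)\<bar> \<le> \<epsilon> * logistic la (x + cs * t)" for \<epsilon> t x
    proof -
      have "\<epsilon> * logistic la (x + cs * t) \<le> \<epsilon> * eta la (x + cs * t)" using that eta by (intro mult_left_mono) auto
      then have "\<bar>v t x - \<phi> (x + cs * t + s - s0)\<bar> \<le> \<epsilon> * eta la (x + cs * t)" using that(2) unfolding V_eq by linarith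
      then show ?thesis using eta(1)[of "x + cs * t"] by (simp add: pos_divide_le_eq add_diff_eq)
    qed
    then show ?thesis using s by (intro exI[of _ "s - s0"]) meson
  qed
  obtain M ut ux uxx where su: "solution g \<kappa> (deriv g 0) L \<rho> \<delta> h M u ut ux uxx"
    using solution_of_is_solution[OF ms h sol IC1] by blast
  have init: "u t x = w0 t x" if "- h \<le> t" "t \<le> 0" for t x using sol that unfolding is_solution_def by simp
  have "\<exists>s\<in>{-h..0}. \<exists>x. u s x \<noteq> 0" using nz1 init by fastforce
  moreover have "u t x \<le> A * exp (\<mu> * x)" if "- h \<le> t" "t \<le> 0" for t x using IC2 init that by simp
  ultimately obtain s1 where s1: "\<forall>\<epsilon>>0. \<exists>T. \<forall>t\<ge>T. \<forall>x\<le>0. \<bar>u t x - \<phi> (x + cs * t + s1)\<bar> / eta la (x + cs * t) \<le> \<epsilon>"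
    using close[OF conv[OF su _ _ A lam(3)]] by blast
  have "\<exists>s\<in>{-h..0}. \<exists>x. u s (- x) \<noteq> 0" using nz2 init by fastforce
  moreover have "u t (- x) \<le> A * exp (\<mu> * x)" if "- h \<le> t" "t \<le> 0" for t x using IC2' init that by simp
  ultimately obtain s2 where s2: "\<forall>\<epsilon>>0. \<exists>T. \<forall>t\<ge>T. \<forall>x\<le>0. \<bar>u t (- x) - \<phi> (x + cs * t + s2)\<bar> / eta la (x + cs * t) \<le> \<epsilon>"
    using close[OF conv[OF solution.reflected_solution[OF su] _ _ A lam(3)]] by blast
  have "\<exists>T. \<forall>t\<ge>T. \<forall>x\<ge>0. \<bar>u t x - \<phi> (- x + cs * t + s2)\<bar> / eta la (- x + cs * t) \<le> \<epsilon>" if \<epsilon>: "0 < \<epsilon>" for \<epsilon>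
  proof -
    obtain T where T: "\<And>t x. T \<le> t \<Longrightarrow> x \<le> 0 \<Longrightarrow> \<bar>u t (- x) - \<phi> (x + cs * t + s2)\<bar> / eta la (x + cs * t) \<le> \<epsilon>"
      using s2 \<epsilon> by blast
    show ?thesis
    proof (intro exI[of _ T] allI impI)
      fix t x :: real assume "T \<le> t" "0 \<le> x"
      then show "\<bar>u t x - \<phi> (- x + cs * t + s2)\<bar> / eta la (- x + cs * t) \<le> \<epsilon>" using T[of t "- x"] by simp
    qed
  qed
  with s1 show ?thesis by blast
qed

end
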